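(* Let $\Lambda$ be an $\mathbb{R}^d$-valued Lévy basis on $S\times\mathbb{R}^m$ with characteristic quadruplet $(\gamma,\Sigma,\nu,\pi)$, $f:S\times\mathbb{R}^m\to M_{n\times d}(\mathbb{R})$ measurable and $\Lambda$-integrable, and let $X=(X_u)_{u\in\mathbb{Z}^m}$ be the mixed moving average field $X_u=\int_S\int_{\mathbb{R}^m}f(z,u-s)\,\Lambda(dz,ds)$. Suppose $E[X_0]=0$ and $E[\|X_0\|^{2+\delta}]<\infty$ for some $\delta>0$, and that the $\eta$-coefficients of $X$ satisfy $\eta_X(h)=\mathcal{O}(h^{-\beta})$ with $\beta>m\max\left(2,1+\frac1\delta\right)$. Let $(D_N)_{N\in\mathbb{N}}$ be finite subsets of $\mathbb{Z}^m$ with $|D_N|\to\infty$ and $|\partial D_N|/|D_N|\to0$. Then $$\Xi=\sum_{u\in\mathbb{Z}^m}Cov(X_0,X_u)=\sum_{u\in\mathbb{Z}^m}E[X_0X_u']$$ is finite, positive semidefinite and $$\frac{1}{|D_N|^{1/2}}\sum_{u\in D_N}X_u\xrightarrow[N\to\infty]{d}N(0,\Xi).$$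
   Context: $S$ is a non-empty Polish space, $\pi$ a probability measure on it, $\lambda$ Lebesgue measure on $\mathbb{R}^m$; a prime denotes transposition. An $\mathbb{R}^d$-valued Lévy basis with characteristic quadruplet $(\gamma,\Sigma,\nu,\pi)$ is a family $\Lambda=\{\Lambda(B)\}$ of $\mathbb{R}^d$-valued random variables indexed by the bounded Borel sets $B\subset S\times\mathbb{R}^m$, with independent values on disjoint sets, almost surely $\sigma$-additive, and with $E[e^{i\langle u,\Lambda(B)\rangle}]=e^{\Phi(u)(\pi\times\lambda)(B)}$, where $\Phi(u)=i\langle\gamma,u\rangle-\frac12\langle u,\Sigma u\rangle+\int_{\mathbb{R}^d}(e^{i\langle u,x\rangle}-1-i\langle u,x\rangle\mathbb{1}_{[0,1]}(\|x\|))\nu(dx)$, $\gamma\in\mathbb{R}^d$, $\Sigma$ symmetric positive semidefinite, $\nu$ a Lévy measure. Stochastic integrals and $\Lambda$-integrability are in the sense of Rajput and Rosiński (1989). $\eta$-coefficients of an $\mathbb{R}^n$-valued field $X=(X_u)_{u\in\mathbb{Z}^m}$: let $\mathcal{G}_u$ be the bounded functions $F:(\mathbb{R}^n)^u\to\mathbb{R}$ that are Lipschitz with respect to $\sum_{i=1}^u\|x_i-y_i\|$, with Lipschitz constant $Lip(F)$. Then $\eta_X(h)=\sup_{u,v\in\mathbb{N}}\eta_{u,v}(h)$, where $\eta_{u,v}(h)$ is the supremum of $$\frac{|Cov(F(X_\Gamma),G(X_{\tilde\Gamma}))|}{u\|G\|_\infty Lip(F)+v\|F\|_\infty Lip(G)}$$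 over $F\in\mathcal{G}_u$, $G\in\mathcal{G}_v$ (non-zero denominator) and $\Gamma,\tilde\Gamma\subset\mathbb{Z}^m$ with $|\Gamma|=u$, $|\tilde\Gamma|=v$, $dist(\Gamma,\tilde\Gamma)=\inf_{i\in\Gamma,j\in\tilde\Gamma}\|i-j\|_\infty\ge h$; $X_\Gamma=(X_{i_1},\dots,X_{i_u})$ for $\Gamma=(i_1,\dots,i_u)$. $\partial D=\{i\in D:\exists j\in\mathbb{Z}^m\setminus D,\ \|i-j\|_\infty=1\}$. *)

theory Defs
  imports "HOL-Probability.Probability"
begin

definition pos_semidef :: "real ^ 'k ^ 'k \<Rightarrow> bool" where
  "pos_semidef A \<longleftrightarrow> transpose A = A \<and> (\<forall>x. 0 \<le> x \<bullet> (A *v x))"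

definition outer :: "real ^ 'k \<Rightarrow> real ^ 'l \<Rightarrow> real ^ 'l ^ 'k" where
  "outer x y = (\<chi> i j. x $ i * y $ j)"

definition of_int_vec :: "int ^ 'm \<Rightarrow> real ^ 'm" where
  "of_int_vec u = (\<chi> i. real_of_int (u $ i))"

definition norm_inf :: "int ^ 'm::finite \<Rightarrow> nat" where
  "norm_inf u = Max (range (\<lambda>i. nat \<bar>u $ i\<bar>))"

text \<open>Since \<^const>\<open>Inf\<close> of the empty set of naturals is \<open>0\<close>, this is used for nonempty sets only.\<close>

definition lattice_dist :: "(int ^ 'm::finite) set \<Rightarrow> (int ^ 'm) set \<Rightarrow> nat" where
  "lattice_dist A B = (INF (i, j) \<in> A \<times> B. norm_inf (i - j))"

definition lattice_boundary :: "(int ^ 'm::finite) set \<Rightarrow> (int ^ 'm) set" where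
  "lattice_boundary D = {i \<in> D. \<exists>j. j \<notin> D \<and> norm_inf (i - j) = 1}"

definition cov :: "'w measure \<Rightarrow> ('w \<Rightarrow> real) \<Rightarrow> ('w \<Rightarrow> real) \<Rightarrow> real" where
  "cov M Y Z = (LINT w|M. (Y w - (LINT w'|M. Y w')) * (Z w - (LINT w'|M. Z w')))"

definition cov_matrix ::
    "'w measure \<Rightarrow> ('w \<Rightarrow> real ^ 'k) \<Rightarrow> ('w \<Rightarrow> real ^ 'l) \<Rightarrow> real ^ 'l ^ 'k" where
  "cov_matrix M Y Z = (\<chi> i j. cov M (\<lambda>w. Y w $ i) (\<lambda>w. Z w $ j))"

definition tendsto_in_prob ::
    "'w measure \<Rightarrow> (nat \<Rightarrow> 'w \<Rightarrow> 'a::euclidean_space) \<Rightarrow> ('w \<Rightarrow> 'a) \<Rightarrow> bool" where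
  "tendsto_in_prob M Y Z \<longleftrightarrow>
     (\<forall>\<epsilon>>0. (\<lambda>k. measure M {w \<in> space M. dist (Y k w) (Z w) > \<epsilon>}) \<longlonglongrightarrow> 0)"

text \<open>The library's \<^const>\<open>weak_conv_m\<close> is restricted to measures on the real line.\<close>

definition weak_conv_euclidean ::
    "(nat \<Rightarrow> 'a::euclidean_space measure) \<Rightarrow> 'a measure \<Rightarrow> bool" where
  "weak_conv_euclidean \<mu> \<mu>' \<longleftrightarrow>
     (\<forall>g :: 'a \<Rightarrow> real. continuous_on UNIV g \<longrightarrow> bounded (range g) \<longrightarrow>
        (\<lambda>N. LINT x|\<mu> N. g x) \<longlonglongrightarrow> (LINT x|\<mu>'. g x))"

text \<open>Defined through the characteristic function, so that degenerate covariance matrices are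
  included.\<close>

definition normal_law :: "real ^ 'k \<Rightarrow> real ^ 'k ^ 'k \<Rightarrow> (real ^ 'k) measure \<Rightarrow> bool" where
  "normal_law a C \<mu> \<longleftrightarrow> prob_space \<mu> \<and> sets \<mu> = sets borel \<and>
     (\<forall>t. (CLINT x|\<mu>. iexp (t \<bullet> x)) =
          exp (\<i> * complex_of_real (t \<bullet> a) - complex_of_real (t \<bullet> (C *v t)) / 2))"

definition levy_measure :: "('a::euclidean_space) measure \<Rightarrow> bool" where
  "levy_measure \<nu> \<longleftrightarrow> sets \<nu> = sets borel \<and> emeasure \<nu> {0} = 0 \<and>
     (\<integral>\<^sup>+ x. ennreal (min 1 ((norm x)\<^sup>2)) \<partial>\<nu>) < \<infinity>"

definition levy_exponent ::
    "real ^ 'd \<Rightarrow> real ^ 'd ^ 'd \<Rightarrow> (real ^ 'd) measure \<Rightarrow> real ^ 'd \<Rightarrow> complex" where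
  "levy_exponent \<gamma> C \<nu> u =
     \<i> * complex_of_real (\<gamma> \<bullet> u) - complex_of_real (u \<bullet> (C *v u)) / 2
     + (CLINT x|\<nu>. iexp (u \<bullet> x) - 1
          - \<i> * complex_of_real (u \<bullet> x) * indicator {0..1} (norm x))"

text \<open>Boundedness refers to the complete metric that comes with the type class of the Polish
  space \<open>'s\<close> (any complete metric inducing the topology is allowed).\<close>

definition bounded_borel :: "('s::polish_space \<times> (real ^ 'm)) set set" where
  "bounded_borel = {B \<in> sets borel. bounded B}"

definition levy_basis ::
    "'w measure \<Rightarrow> (('s::polish_space \<times> (real ^ 'm)) set \<Rightarrow> 'w \<Rightarrow> real ^ 'd)
     \<Rightarrow> real ^ 'd \<Rightarrow> real ^ 'd ^ 'd \<Rightarrow> (real ^ 'd) measure \<Rightarrow> 's measure \<Rightarrow> bool" where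
  "levy_basis M \<Lambda> \<gamma> C \<nu> \<pi> \<longleftrightarrow>
     prob_space M \<and> prob_space \<pi> \<and> sets \<pi> = sets borel \<and> pos_semidef C \<and> levy_measure \<nu> \<and>
     (\<forall>B\<in>bounded_borel. \<Lambda> B \<in> borel_measurable M) \<and>
     (\<forall>(k::nat) B. (\<forall>i<k. B i \<in> bounded_borel) \<and> disjoint_family_on B {..<k} \<longrightarrow>
        prob_space.indep_vars M (\<lambda>_. borel) (\<lambda>i. \<Lambda> (B i)) {..<k}) \<and>
     (\<forall>B :: nat \<Rightarrow> _. range B \<subseteq> bounded_borel \<and> disjoint_family B \<and> (\<Union>i. B i) \<in> bounded_borel \<longrightarrow>
        (AE w in M. (\<lambda>i. \<Lambda> (B i) w) sums \<Lambda> (\<Union>i. B i) w)) \<and>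
     (\<forall>B\<in>bounded_borel. \<forall>u.
        (CLINT w|M. iexp (u \<bullet> \<Lambda> B w)) =
        exp (levy_exponent \<gamma> C \<nu> u * complex_of_real (measure (\<pi> \<Otimes>\<^sub>M lborel) B)))"

definition basis_simple ::
    "('s::polish_space \<times> (real ^ 'm) \<Rightarrow> real ^ 'd ^ 'n) \<Rightarrow> bool" where
  "basis_simple g \<longleftrightarrow> finite (range g) \<and> (\<forall>c. c \<noteq> 0 \<longrightarrow> g -` {c} \<in> bounded_borel)"

text \<open>The integral of a simple function over a Borel set \<open>A\<close>, written with the canonical
  representation of \<open>g\<close> as the sum of \<open>c * 1(g = c)\<close> over its nonzero values \<open>c\<close>.\<close>

definition simple_basis_integral ::
    "(('s::polish_space \<times> (real ^ 'm)) set \<Rightarrow> 'w \<Rightarrow> real ^ 'd)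
     \<Rightarrow> ('s \<times> (real ^ 'm)) set \<Rightarrow> ('s \<times> (real ^ 'm) \<Rightarrow> real ^ 'd ^ 'n) \<Rightarrow> 'w \<Rightarrow> real ^ 'n" where
  "simple_basis_integral \<Lambda> A g w = (\<Sum>c\<in>range g - {0}. c *v \<Lambda> (A \<inter> g -` {c}) w)"

text \<open>In the sense of Rajput and Rosinski (1989), \<open>Y\<close> is a version of the integral of \<open>f\<close> over
  the whole space: there are simple functions
  \<open>g k\<close> converging to \<open>f\<close> almost everywhere whose integrals over every Borel set converge in
  probability, and \<open>Y\<close> is the limit for the whole space. Almost everywhere refers to
  \<open>\<pi> \<times> lborel\<close>: the control measure of Rajput and Rosinski is a constant multiple of it, and if
  the constant is zero then \<open>\<Lambda> = 0\<close> almost surely and both versions agree.\<close>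

definition has_basis_integral ::
    "'w measure \<Rightarrow> (('s::polish_space \<times> (real ^ 'm)) set \<Rightarrow> 'w \<Rightarrow> real ^ 'd) \<Rightarrow> 's measure
     \<Rightarrow> ('s \<times> (real ^ 'm) \<Rightarrow> real ^ 'd ^ 'n) \<Rightarrow> ('w \<Rightarrow> real ^ 'n) \<Rightarrow> bool" where
  "has_basis_integral M \<Lambda> \<pi> f Y \<longleftrightarrow>
     f \<in> borel_measurable borel \<and> Y \<in> borel_measurable M \<and>
     (\<exists>g. (\<forall>k. basis_simple (g k)) \<and>
          (AE z in \<pi> \<Otimes>\<^sub>M lborel. (\<lambda>k. g k z) \<longlonglongrightarrow> f z) \<and>
          (\<forall>A\<in>sets borel. \<exists>Z\<in>borel_measurable M.
             tendsto_in_prob M (\<lambda>k. simple_basis_integral \<Lambda> A (g k)) Z) \<and>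
          tendsto_in_prob M (\<lambda>k. simple_basis_integral \<Lambda> UNIV (g k)) Y)"

definition basis_integrable ::
    "'w measure \<Rightarrow> (('s::polish_space \<times> (real ^ 'm)) set \<Rightarrow> 'w \<Rightarrow> real ^ 'd) \<Rightarrow> 's measure
     \<Rightarrow> ('s \<times> (real ^ 'm) \<Rightarrow> real ^ 'd ^ 'n) \<Rightarrow> bool" where
  "basis_integrable M \<Lambda> \<pi> f \<longleftrightarrow> (\<exists>Y. has_basis_integral M \<Lambda> \<pi> f Y)"

definition mma_field ::
    "'w measure \<Rightarrow> (('s::polish_space \<times> (real ^ 'm)) set \<Rightarrow> 'w \<Rightarrow> real ^ 'd) \<Rightarrow> 's measure
     \<Rightarrow> ('s \<times> (real ^ 'm) \<Rightarrow> real ^ 'd ^ 'n) \<Rightarrow> (int ^ 'm \<Rightarrow> 'w \<Rightarrow> real ^ 'n) \<Rightarrow> bool" where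
  "mma_field M \<Lambda> \<pi> f X \<longleftrightarrow>
     (\<forall>u. has_basis_integral M \<Lambda> \<pi> (\<lambda>(z, s). f (z, of_int_vec u - s)) (X u))"

text \<open>Functions on the \<open>u\<close>-fold power of the space of vectors are functions on lists, of which
  only the values on lists of length \<open>u\<close> matter.\<close>

definition tuples :: "nat \<Rightarrow> (real ^ 'n) list set" where
  "tuples u = {x. length x = u}"

definition tuple_dist :: "(real ^ 'n) list \<Rightarrow> (real ^ 'n) list \<Rightarrow> real" where
  "tuple_dist x y = (\<Sum>i<length x. norm (x ! i - y ! i))"

definition Lip_const :: "nat \<Rightarrow> ((real ^ 'n) list \<Rightarrow> real) \<Rightarrow> real" where
  "Lip_const u F = Inf {L. 0 \<le> L \<and>
     (\<forall>x\<in>tuples u. \<forall>y\<in>tuples u. \<bar>F x - F y\<bar> \<le> L * tuple_dist x y)}"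

definition sup_norm :: "nat \<Rightarrow> ((real ^ 'n) list \<Rightarrow> real) \<Rightarrow> real" where
  "sup_norm u F = (SUP x\<in>tuples u. \<bar>F x\<bar>)"

definition bounded_Lipschitz :: "nat \<Rightarrow> ((real ^ 'n) list \<Rightarrow> real) set" where
  "bounded_Lipschitz u = {F. bounded (F ` tuples u) \<and>
     (\<exists>L\<ge>0. \<forall>x\<in>tuples u. \<forall>y\<in>tuples u. \<bar>F x - F y\<bar> \<le> L * tuple_dist x y)}"

text \<open>Finite index sets are given by duplicate-free enumerations \<open>I\<close>, \<open>J\<close>. The suprema are taken
  in the extended nonnegative reals, as they may be infinite.\<close>

definition eta_uv ::
    "'w measure \<Rightarrow> (int ^ 'm::finite \<Rightarrow> 'w \<Rightarrow> real ^ 'n) \<Rightarrow> nat \<Rightarrow> nat \<Rightarrow> nat \<Rightarrow> ennreal" where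
  "eta_uv M X u v h =
     Sup {ennreal (\<bar>cov M (\<lambda>w. F (map (\<lambda>i. X i w) I)) (\<lambda>w. G (map (\<lambda>j. X j w) J))\<bar>
            / (real u * sup_norm v G * Lip_const u F + real v * sup_norm u F * Lip_const v G))
          | F G I J.
            F \<in> bounded_Lipschitz u \<and> G \<in> bounded_Lipschitz v \<and>
            real u * sup_norm v G * Lip_const u F + real v * sup_norm u F * Lip_const v G \<noteq> 0 \<and>
            distinct I \<and> length I = u \<and> distinct J \<and> length J = v \<and>
            lattice_dist (set I) (set J) \<ge> h}"

definition eta_coeff ::
    "'w measure \<Rightarrow> (int ^ 'm::finite \<Rightarrow> 'w \<Rightarrow> real ^ 'n) \<Rightarrow> nat \<Rightarrow> ennreal" where
  "eta_coeff M X h = (SUP (u, v) \<in> {1..} \<times> {1..}. eta_uv M X u v h)"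

end

theory Submission
  imports Defs "HOL-Real_Asymp.Real_Asymp"
begin

text \<open>The proof has three parts: the moving average is stationary, a stationary weakly dependent real
  field obeys a central limit theorem, and the vector statement follows by testing against directions.

  Stationarity. An integral against a Levy basis is a limit in probability of integrals of simple
  functions. The law of the integral of a simple function depends only on the measures of its level
  sets, so it does not change under translations, and the translates of simple functions that
  approximate the kernel at the origin converge almost everywhere to the kernel at any other site.
  What has to be shown is that the integral does not depend on the approximating sequence. If the
  integrals of a sequence converge over every Borel set, they are uniformly absolutely continuous
  (\<open>vitali_hahn_saks\<close>); hence almost everywhere convergence of the integrands to zero forces the
  integrals to zero (\<open>ky_fan_integral_of_null_sequence\<close>). This gives \<open>mma_field_stationary\<close>.

  Real fields. The eta-coefficients bound the covariance of bounded Lipschitz functionals of the field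
  over two separated finite sets, at the cost of a factor linear in the number of sites
  (\<open>weakly_dependent_of_eta\<close>). For a bounded field Stein's method gives the characteristic function
  of the normalised sum over \<open>D\<close> up to an error (\<open>stein_identity_approx\<close>, \<open>char_normsum_approx\<close>): with
  \<open>n\<close> sites, dependence range \<open>q\<close> and dependence \<open>\<kappa> q\<close> of order \<open>q\<^sup>-\<^sup>\<beta>\<close> the error is of the order of
  \<open>q\<^sup>m / sqrt n + n * \<kappa> q\<close> and a tail of the covariances. Some power \<open>q\<close> of \<open>n\<close> makes all of it vanish
  exactly if \<open>\<beta> > 2 m\<close>. An unbounded field is truncated at a level \<open>T\<close>. Balancing the truncated
  part against the tails, the covariances at distance \<open>h\<close> are at most of order \<open>h\<close> to the power
  \<open>- \<beta> \<delta> / (1 + \<delta>)\<close>, which is summable over the lattice exactly if \<open>\<beta> > m (1 + 1 / \<delta>)\<close>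
  (\<open>cov_lipschitz_le\<close>). The same estimate, interpolated with the smallness of the tails, shows that the
  truncation error of the normalised sum tends to zero as \<open>T\<close> grows, uniformly in \<open>D\<close>
  (\<open>mean_truncated_cov_le\<close>). The variance of the normalised sum is a mean over \<open>u \<in> D\<close> of sums of
  covariances over \<open>D - u\<close>, and the condition on the boundaries makes these means converge to the sum
  over the whole lattice (\<open>mean_of_difference_sums_tendsto\<close>). Together this is \<open>char_clt\<close>.

  Vector fields. Applied to \<open>a \<bullet> X u\<close> for every direction \<open>a\<close>, this is convergence of the
  characteristic functions of the normalised sums to that of a normal law, which exists by
  \<open>normal_law_exists\<close>; weak convergence follows from Levy's continuity theorem in the form
  \<open>char_convergence.weak_convergence\<close>.\<close>

section \<open>Lattice geometry\<close>

lemma norm_inf_le_iff: "norm_inf (u :: int ^ 'm::finite) \<le> k \<longleftrightarrow> (\<forall>i. nat \<bar>u $ i\<bar> \<le> k)"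
  unfolding norm_inf_def by (subst Max_le_iff) auto

lemma component_le_norm_inf: "nat \<bar>(u :: int ^ 'm::finite) $ i\<bar> \<le> norm_inf u"
  using norm_inf_le_iff[of u "norm_inf u"] by simp

lemma norm_inf_0 [simp]: "norm_inf (0 :: int ^ 'm::finite) = 0"
  using norm_inf_le_iff[of "0 :: int ^ 'm" 0] by simp

lemma norm_inf_minus [simp]: "norm_inf (- u) = norm_inf (u :: int ^ 'm::finite)"
  by (simp add: norm_inf_def)

lemma norm_inf_minus_commute: "norm_inf (u - v) = norm_inf (v - u :: int ^ 'm::finite)"
  using norm_inf_minus[of "u - v"] by simp

definition ball_card_bound :: "'m::finite itself \<Rightarrow> nat \<Rightarrow> nat" where
  "ball_card_bound _ q = (2 * q + 1) ^ CARD('m)"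

lemma card_norm_inf_ball:
  "finite {h :: int ^ 'm::finite. norm_inf h \<le> q}"
  "card {h :: int ^ 'm::finite. norm_inf h \<le> q} \<le> ball_card_bound TYPE('m) q"
proof -
  let ?P = "PiE (UNIV :: 'm set) (\<lambda>_. {- int q..int q})"
  have sub: "{h :: int ^ 'm. norm_inf h \<le> q} \<subseteq> vec_lambda ` ?P"
  proof
    fix h :: "int ^ 'm" assume "h \<in> {h. norm_inf h \<le> q}"
    hence "nat \<bar>h $ i\<bar> \<le> q" for i by (simp add: norm_inf_le_iff)
    hence "vec_nth h \<in> ?P" by (auto simp: abs_le_iff nat_le_iff) (metis abs_le_iff minus_le_iff)
    thus "h \<in> vec_lambda ` ?P" by (metis image_eqI vec_nth_inverse)
  qed
  have fin: "finite ?P" by (intro finite_PiE) auto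
  thus "finite {h :: int ^ 'm. norm_inf h \<le> q}" using sub by (meson finite_imageI finite_subset)
  have "card {h :: int ^ 'm. norm_inf h \<le> q} \<le> card ?P"
    using sub fin by (meson card_image_le card_mono finite_imageI order_trans)
  also have "\<dots> = ball_card_bound TYPE('m) q"
    by (simp add: card_PiE ball_card_bound_def nat_add_distrib nat_mult_distrib)
  finally show "card {h :: int ^ 'm. norm_inf h \<le> q} \<le> ball_card_bound TYPE('m) q" .
qed

lemma summable_one_plus_abs_powr:
  fixes a :: real
  assumes "a > 1"
  shows "(\<lambda>k::int. (1 + real_of_int \<bar>k\<bar>) powr - a) summable_on UNIV"
proof -
  have "summable (\<lambda>n. norm ((1 + real n) powr - a))"
  proof -
    have "summable (\<lambda>n. real n powr - a)"
      using assms by (simp add: summable_real_powr_iff)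
    hence "summable (\<lambda>n. real (Suc n) powr - a)" by (subst summable_Suc_iff)
    thus ?thesis by (simp add: add.commute)
  qed
  hence nat: "(\<lambda>n. (1 + real n) powr - a) summable_on UNIV"
    by (rule norm_summable_imp_summable_on)
  have pos: "(\<lambda>k::int. (1 + real_of_int \<bar>k\<bar>) powr - a) summable_on range int"
    using nat by (subst summable_on_reindex) (auto simp: o_def inj_on_def)
  have neg: "(\<lambda>k::int. (1 + real_of_int \<bar>k\<bar>) powr - a) summable_on range (\<lambda>n. - int n)"
    using nat by (subst summable_on_reindex) (auto simp: o_def inj_on_def)
  have U: "(UNIV :: int set) = range int \<union> range (\<lambda>n. - int n)"
    by (auto simp: image_def) (metis int_cases2 )
  show ?thesis unfolding U
    using pos neg by (rule summable_on_union)
qed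

text \<open>The weight is dominated by the product of the one-dimensional weights
  \<open>(1 + \<bar>h\<^sub>i\<bar>) powr (- g / m)\<close>, each of which is summable over the integers.\<close>

lemma summable_lattice_weight:
  fixes g :: real
  assumes "g > real CARD('m::finite)"
  shows "(\<lambda>h :: int ^ 'm. (1 + real (norm_inf h)) powr - g) summable_on UNIV"
proof -
  define a where "a = g / real CARD('m)"
  have a: "a > 1" using assms by (simp add: a_def)
  define w where "w k = (1 + real_of_int \<bar>k\<bar>) powr - a" for k :: int
  define W where "W = infsum w UNIV"
  have sw: "w summable_on UNIV" unfolding w_def by (rule summable_one_plus_abs_powr[OF a])
  have w0: "w k \<ge> 0" for k by (simp add: w_def)
  have W: "sum w A \<le> W" if "finite A" for A
    unfolding W_def by (rule finite_sum_le_infsum[OF sw that]) (auto simp: w0)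
  have le: "(1 + real (norm_inf h)) powr - g \<le> (\<Prod>i\<in>UNIV. w (h $ i))" for h :: "int ^ 'm"
  proof -
    have "(1 + real (norm_inf h)) powr - g = (\<Prod>i\<in>(UNIV::'m set). (1 + real (norm_inf h)) powr - a)"
      by (simp add: a_def powr_power)
    also have "\<dots> \<le> (\<Prod>i\<in>UNIV. w (h $ i))"
    proof (rule prod_mono, safe)
      fix i
      have "real_of_int \<bar>h $ i\<bar> \<le> real (norm_inf h)"
        using component_le_norm_inf[of h i] by linarith
      thus "(1 + real (norm_inf h)) powr - a \<le> w (h $ i)"
        unfolding w_def using a by (intro powr_mono2') auto
    qed auto
    finally show ?thesis .
  qed
  show ?thesis
  proof (rule nonneg_bounded_partial_sums_imp_summable_on)
    show "\<forall>\<^sub>F F in finite_subsets_at_top UNIV. (\<Sum>h\<in>F. (1 + real (norm_inf (h :: int ^ 'm))) powr - g) \<le> W ^ CARD('m)"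
    proof (rule eventually_finite_subsets_at_top_weakI)
      fix F :: "(int ^ 'm) set" assume F: "finite F"
      define B where "B = (\<Union>h\<in>F. range (vec_nth h))"
      have B: "finite B" using F by (auto simp: B_def)
      have "(\<Sum>h\<in>F. (1 + real (norm_inf h)) powr - g) \<le> (\<Sum>h\<in>F. \<Prod>i\<in>UNIV. w (h $ i))"
        by (rule sum_mono) (rule le)
      also have "\<dots> = (\<Sum>p\<in>vec_nth ` F. \<Prod>i\<in>UNIV. w (p i))"
        by (subst sum.reindex) (auto simp: inj_on_def vec_nth_inject)
      also have "\<dots> \<le> (\<Sum>p\<in>PiE (UNIV :: 'm set) (\<lambda>_. B). \<Prod>i\<in>UNIV. w (p i))"
        proof (rule sum_mono2)
          show "finite (PiE (UNIV :: 'm set) (\<lambda>_. B))" using B by (intro finite_PiE) auto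
        qed (auto simp: B_def intro!: prod_nonneg w0)
      also have "\<dots> = (\<Prod>i\<in>(UNIV :: 'm set). sum w B)"
        using B by (subst prod_sum_PiE) auto
      also have "\<dots> \<le> W ^ CARD('m)" 
        by (simp) (intro power_mono W B sum_nonneg w0)
      finally show "(\<Sum>h\<in>F. (1 + real (norm_inf (h :: int ^ 'm))) powr - g) \<le> W ^ CARD('m)" .
    qed
  qed auto
qed

text \<open>A double sum over \<open>D \<times> D\<close> of a function of the difference counts each difference at most
  once per point of \<open>D\<close>.\<close>

lemma sum_sum_differences_le:
  fixes b :: "int ^ 'm::finite \<Rightarrow> real"
  assumes "finite D" "b summable_on UNIV" "\<And>h. b h \<ge> 0" "finite E"
  shows "(\<Sum>u\<in>D. \<Sum>v\<in>E. b (v - u)) \<le> real (card D) * infsum b UNIV"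
proof -
  have "(\<Sum>v\<in>E. b (v - u)) \<le> infsum b UNIV" for u
  proof -
    have "(\<Sum>v\<in>E. b (v - u)) = sum b ((\<lambda>v. v - u) ` E)"
      by (subst sum.reindex) (auto simp: inj_on_def)
    also have "\<dots> \<le> infsum b UNIV"
      using assms by (intro finite_sum_le_infsum) auto
    finally show ?thesis .
  qed
  hence "(\<Sum>u\<in>D. \<Sum>v\<in>E. b (v - u)) \<le> (\<Sum>u\<in>D. infsum b UNIV)" by (intro sum_mono)
  thus ?thesis by simp
qed

text \<open>Moving from \<open>u\<close> to \<open>u + h\<close> by unit steps, a walk that leaves \<open>D\<close> passes a boundary point of
  \<open>D\<close>; the length of the walk depends on \<open>h\<close> only.\<close>

lemma card_leaving_le:
  fixes h :: "int ^ 'm::finite"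
  shows "\<exists>c::nat. \<forall>D. finite D \<longrightarrow> card {u \<in> D. u + h \<notin> D} \<le> c * card (lattice_boundary D)"
proof -
  define P where "P h \<longleftrightarrow> (\<exists>c::nat. \<forall>D. finite D \<longrightarrow>
    card {u \<in> D. u + h \<notin> D} \<le> c * card (lattice_boundary D))" for h :: "int ^ 'm"
  have fb: "finite (lattice_boundary D)" if "finite D" for D :: "(int ^ 'm) set"
    using that by (auto simp: lattice_boundary_def)
  have step: "P (h + e)" if "P h" and e1: "norm_inf e = 1" for h e
  proof -
    obtain c where c: "card {u \<in> D. u + h \<notin> D} \<le> c * card (lattice_boundary D)" if "finite D" for D
      using \<open>P h\<close> by (auto simp: P_def)
    have "card {u \<in> D. u + (h + e) \<notin> D} \<le> (c + 1) * card (lattice_boundary D)" if D: "finite D" for D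
    proof -
      have "{u \<in> D. u + (h + e) \<notin> D} \<subseteq> {u \<in> D. u + h \<notin> D} \<union> (\<lambda>v. v - h) ` lattice_boundary D"
      proof (rule subsetI)
        fix u assume u: "u \<in> {u \<in> D. u + (h + e) \<notin> D}"
        show "u \<in> {u \<in> D. u + h \<notin> D} \<union> (\<lambda>v. v - h) ` lattice_boundary D"
        proof (cases "u + h \<in> D")
          case True
          have "norm_inf (u + h - (u + (h + e))) = 1" using e1 norm_inf_minus[of e] by simp
          hence "u + h \<in> lattice_boundary D" using True u by (auto simp: lattice_boundary_def)
          hence "(u + h) - h \<in> (\<lambda>v. v - h) ` lattice_boundary D" by (rule imageI)
          thus ?thesis by simp
        qed (use u in auto)
      qed
      hence "card {u \<in> D. u + (h + e) \<notin> D}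
          \<le> card ({u \<in> D. u + h \<notin> D} \<union> (\<lambda>v. v - h) ` lattice_boundary D)"
        using D fb by (intro card_mono) auto
      also have "\<dots> \<le> card {u \<in> D. u + h \<notin> D} + card ((\<lambda>v. v - h) ` lattice_boundary D)"
        by (rule card_Un_le)
      also have "\<dots> \<le> c * card (lattice_boundary D) + card (lattice_boundary D)"
        using D fb by (intro add_mono c card_image_le) auto
      finally show ?thesis by simp
    qed
    thus ?thesis unfolding P_def by blast
  qed
  have unit: "norm_inf (axis i (s::int) :: int ^ 'm) = 1" if "\<bar>s\<bar> = 1" for i s
  proof (rule antisym)
    show "norm_inf (axis i s :: int ^ 'm) \<le> 1"
      using that by (auto simp: norm_inf_le_iff axis_def)
    show "1 \<le> norm_inf (axis i s :: int ^ 'm)"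
      using component_le_norm_inf[of "axis i s :: int ^ 'm" i] that by (simp add: axis_def)
  qed
  have line: "P (g + axis i k)" if "P g" for g i k
  proof (induction k rule: int_induct[where k = 0])
    case base
    have "g + axis i 0 = g" by (simp add: axis_def vec_eq_iff)
    with that show ?case by metis
  next
    case (step1 k)
    have "g + axis i k + axis i 1 = g + axis i (k + 1)" by (simp add: axis_def vec_eq_iff)
    with step[OF step1(2) unit[of 1 i]] show ?case by simp
  next
    case (step2 k)
    have "g + axis i k + axis i (- 1) = g + axis i (k - 1)" by (simp add: axis_def vec_eq_iff)
    with step[OF step2(2) unit[of "-1" i]] show ?case by simp
  qed
  have "P (\<Sum>i\<in>A. axis i (h $ i))" if "finite A" for A
    using that
  proof (induction A rule: finite_induct)
    case empty
    have "P 0" unfolding P_def by (intro exI[of _ 0]) auto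
    thus ?case by simp
  next
    case (insert x A)
    thus ?case using line[OF insert.IH, of x "h $ x"] by (simp add: add.commute)
  qed
  from this[of UNIV] have "P (\<Sum>i\<in>UNIV. axis i (h $ i))" by simp
  also have "(\<Sum>i\<in>UNIV. axis i (h $ i)) = h"
    by (simp add: vec_eq_iff axis_def if_distrib cong: if_cong)
  finally show ?thesis unfolding P_def .
qed


section \<open>Covariance inequalities\<close>

lemma cmod_iexp_diff_le: "cmod (iexp x - iexp y) \<le> \<bar>x - y\<bar>"
proof -
  let ?z = "x - y"
  have "\<i> * complex_of_real x = \<i> * complex_of_real y + \<i> * complex_of_real ?z"
    by (simp add: algebra_simps)
  hence "iexp x = iexp y * iexp ?z" by (simp only: exp_add)
  hence "iexp x - iexp y = iexp y * (iexp ?z - (\<Sum>k\<le>0. (\<i> * ?z) ^ k / fact k))"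
    by (simp add: right_diff_distrib)
  hence "cmod (iexp x - iexp y) = cmod (iexp ?z - (\<Sum>k\<le>0. (\<i> * ?z) ^ k / fact k))"
    by (simp add: norm_mult)
  also have "\<dots> \<le> \<bar>?z\<bar> ^ Suc 0 / fact (Suc 0)" by (rule iexp_approx1)
  finally show ?thesis by simp
qed

lemma (in prob_space) cov_eq:
  assumes "integrable M Y" "integrable M Z" "integrable M (\<lambda>w. Y w * Z w)"
  shows "cov M Y Z = (LINT w|M. Y w * Z w) - (LINT w|M. Y w) * (LINT w|M. Z w)"
proof -
  define a b where "a = (LINT w|M. Y w)" and "b = (LINT w|M. Z w)"
  have "cov M Y Z = (LINT w|M. Y w * Z w - b * Y w - a * Z w + a * b)"
    unfolding cov_def a_def[symmetric] b_def[symmetric] by (simp add: algebra_simps)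
  also have "\<dots> = (LINT w|M. Y w * Z w) - b * a - a * b + a * b"
    using assms by (simp add: a_def b_def prob_space)
  finally show ?thesis by (simp add: a_def b_def)
qed

lemma cov_commute: "cov M Y Z = cov M Z Y"
  by (simp add: cov_def mult.commute)

lemma (in prob_space) integrable_prod_of_squares:
  fixes Y Z :: "'a \<Rightarrow> real"
  assumes [measurable]: "Y \<in> borel_measurable M" "Z \<in> borel_measurable M"
    and "integrable M (\<lambda>w. (Y w)\<^sup>2)" "integrable M (\<lambda>w. (Z w)\<^sup>2)"
  shows "integrable M (\<lambda>w. Y w * Z w)"
proof (rule Bochner_Integration.integrable_bound)
  show "integrable M (\<lambda>w. (Y w)\<^sup>2 + (Z w)\<^sup>2)" using assms by simp
  show "AE w in M. norm (Y w * Z w) \<le> norm ((Y w)\<^sup>2 + (Z w)\<^sup>2)"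
  proof (rule AE_I2)
    fix w
    have "2 * (\<bar>Y w\<bar> * \<bar>Z w\<bar>) \<le> (Y w)\<^sup>2 + (Z w)\<^sup>2"
      using sum_squares_bound[of "\<bar>Y w\<bar>" "\<bar>Z w\<bar>"] by simp
    moreover have "0 \<le> \<bar>Y w\<bar> * \<bar>Z w\<bar>" by simp
    ultimately show "norm (Y w * Z w) \<le> norm ((Y w)\<^sup>2 + (Z w)\<^sup>2)"
      unfolding real_norm_def abs_mult by linarith
  qed
qed simp

lemma (in prob_space) expectation_abs_le_sqrt:
  fixes Y :: "'a \<Rightarrow> real"
  assumes [measurable]: "Y \<in> borel_measurable M" and "integrable M (\<lambda>w. (Y w)\<^sup>2)"
  shows "(LINT w|M. \<bar>Y w\<bar>) \<le> sqrt (LINT w|M. (Y w)\<^sup>2)"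
proof -
  have i: "integrable M Y"
    using square_integrable_imp_integrable[OF assms] .
  have "0 \<le> variance (\<lambda>w. \<bar>Y w\<bar>)" by (rule variance_positive)
  also have "\<dots> = (LINT w|M. (Y w)\<^sup>2) - (LINT w|M. \<bar>Y w\<bar>)\<^sup>2"
    using i assms by (subst variance_eq) auto
  finally show ?thesis by (intro real_le_rsqrt) simp
qed

section \<open>Weak dependence for functionals of a field\<close>

definition lipschitz_in :: "'i set \<Rightarrow> real \<Rightarrow> (('i \<Rightarrow> 'a::real_normed_vector) \<Rightarrow> real) \<Rightarrow> bool" where
  "lipschitz_in I L F \<longleftrightarrow> L \<ge> 0 \<and> (\<forall>x y. \<bar>F x - F y\<bar> \<le> L * (\<Sum>i\<in>I. norm (x i - y i)))"

text \<open>Functionals of whole configurations replace functions of tuples, so that an enumeration of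
  the index set never has to be chosen.\<close>

definition weakly_dependent ::
    "'w measure \<Rightarrow> (int ^ 'm::finite \<Rightarrow> 'w \<Rightarrow> 'a::real_normed_vector) \<Rightarrow> (nat \<Rightarrow> real) \<Rightarrow> bool" where
  "weakly_dependent M X \<kappa> \<longleftrightarrow>
    (\<forall>I J F G BF BG LF LG h. finite I \<longrightarrow> finite J \<longrightarrow> I \<noteq> {} \<longrightarrow> J \<noteq> {} \<longrightarrow>
      (\<forall>x. \<bar>F x\<bar> \<le> BF) \<longrightarrow> (\<forall>x. \<bar>G x\<bar> \<le> BG) \<longrightarrow> lipschitz_in I LF F \<longrightarrow> lipschitz_in J LG G \<longrightarrow>
      (\<lambda>w. F (\<lambda>i. X i w)) \<in> borel_measurable M \<longrightarrow> (\<lambda>w. G (\<lambda>i. X i w)) \<in> borel_measurable M \<longrightarrow>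
      (\<forall>i\<in>I. \<forall>j\<in>J. h \<le> norm_inf (i - j)) \<longrightarrow>
      \<bar>cov M (\<lambda>w. F (\<lambda>i. X i w)) (\<lambda>w. G (\<lambda>i. X i w))\<bar>
        \<le> \<kappa> h * (real (card I) * BG * LF + real (card J) * BF * LG))"

lemma weakly_dependentD:
  assumes "weakly_dependent M X \<kappa>"
    and "finite I" "finite J" "I \<noteq> {}" "J \<noteq> {}"
    and "\<And>x. \<bar>F x\<bar> \<le> BF" "\<And>x. \<bar>G x\<bar> \<le> BG" "lipschitz_in I LF F" "lipschitz_in J LG G"
    and "(\<lambda>w. F (\<lambda>i. X i w)) \<in> borel_measurable M" "(\<lambda>w. G (\<lambda>i. X i w)) \<in> borel_measurable M"
    and "\<And>i j. i \<in> I \<Longrightarrow> j \<in> J \<Longrightarrow> h \<le> norm_inf (i - j)"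
  shows "\<bar>cov M (\<lambda>w. F (\<lambda>i. X i w)) (\<lambda>w. G (\<lambda>i. X i w))\<bar>
        \<le> \<kappa> h * (real (card I) * BG * LF + real (card J) * BF * LG)"
  by (rule assms(1)[unfolded weakly_dependent_def, rule_format]) (use assms in simp_all)

lemma weakly_dependent_compose:
  assumes wd: "weakly_dependent M X \<kappa>" and c: "c \<ge> 0"
    and lip: "\<And>i x y. norm (\<phi> i x - \<phi> i y) \<le> c * norm (x - y)"
  shows "weakly_dependent M (\<lambda>i w. \<phi> i (X i w)) (\<lambda>h. c * \<kappa> h)"
  unfolding weakly_dependent_def
proof (intro allI impI)
  fix I J F G BF BG LF LG h
  assume h: "finite I" "finite J" "I \<noteq> {}" "J \<noteq> {}" "\<forall>x. \<bar>F x\<bar> \<le> BF" "\<forall>x. \<bar>G x\<bar> \<le> BG"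
     "lipschitz_in I LF F" "lipschitz_in J LG G"
     "(\<lambda>w. F (\<lambda>i. \<phi> i (X i w))) \<in> borel_measurable M" "(\<lambda>w. G (\<lambda>i. \<phi> i (X i w))) \<in> borel_measurable M"
     "\<forall>i\<in>I. \<forall>j\<in>J. h \<le> norm_inf (i - j)"
  have l: "lipschitz_in I' (c * L) (\<lambda>x. H (\<lambda>i. \<phi> i (x i)))" if "lipschitz_in I' L H" for I' L H
    unfolding lipschitz_in_def
  proof (intro conjI allI)
    show "0 \<le> c * L" using that c by (simp add: lipschitz_in_def)
    fix x y
    have "\<bar>H (\<lambda>i. \<phi> i (x i)) - H (\<lambda>i. \<phi> i (y i))\<bar> \<le> L * (\<Sum>i\<in>I'. norm (\<phi> i (x i) - \<phi> i (y i)))"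
      using that by (simp add: lipschitz_in_def)
    also have "\<dots> \<le> L * (\<Sum>i\<in>I'. c * norm (x i - y i))"
      using that by (intro mult_left_mono sum_mono lip) (simp add: lipschitz_in_def)
    finally show "\<bar>H (\<lambda>i. \<phi> i (x i)) - H (\<lambda>i. \<phi> i (y i))\<bar> \<le> c * L * (\<Sum>i\<in>I'. norm (x i - y i))"
      by (simp add: sum_distrib_left mult_ac)
  qed
  have "\<bar>cov M (\<lambda>w. F (\<lambda>i. \<phi> i (X i w))) (\<lambda>w. G (\<lambda>i. \<phi> i (X i w)))\<bar>
    \<le> \<kappa> h * (real (card I) * BG * (c * LF) + real (card J) * BF * (c * LG))"
    by (rule weakly_dependentD[OF wd, where F = "\<lambda>x. F (\<lambda>i. \<phi> i (x i))" and G = "\<lambda>x. G (\<lambda>i. \<phi> i (x i))"])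
      (use h in \<open>auto intro: l\<close>)
  thus "\<bar>cov M (\<lambda>w. F (\<lambda>i. \<phi> i (X i w))) (\<lambda>w. G (\<lambda>i. \<phi> i (X i w)))\<bar>
    \<le> c * \<kappa> h * (real (card I) * BG * LF + real (card J) * BF * LG)"
    by (simp add: algebra_simps)
qed

text \<open>Subtracting the value at the zero configuration does not change the covariance and leaves a
  variable that the Lipschitz constant and the first absolute moments control. No decay is gained, so
  the bound serves for small distances.\<close>

lemma (in prob_space) abs_cov_le_bounded_lipschitz:
  fixes X :: "'i \<Rightarrow> 'a \<Rightarrow> 'b::{banach, second_countable_topology}"
  assumes [measurable]: "\<And>i. X i \<in> borel_measurable M"
    and X1: "\<And>i. integrable M (X i)" "\<And>i. (LINT w|M. norm (X i w)) \<le> m1"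
    and FB: "\<And>x. \<bar>F x\<bar> \<le> BF" and GB: "\<And>x. \<bar>G x\<bar> \<le> BG" and L: "lipschitz_in I LF F"
    and Fm[measurable]: "(\<lambda>w. F (\<lambda>i. X i w)) \<in> borel_measurable M"
    and Gm[measurable]: "(\<lambda>w. G (\<lambda>i. X i w)) \<in> borel_measurable M"
  shows "\<bar>cov M (\<lambda>w. F (\<lambda>i. X i w)) (\<lambda>w. G (\<lambda>i. X i w))\<bar> \<le> 2 * m1 * (real (card I) * BG * LF)"
proof -
  let ?F = "\<lambda>w. F (\<lambda>i. X i w)" and ?G = "\<lambda>w. G (\<lambda>i. X i w)"
  define F0 where "F0 w = ?F w - F (\<lambda>i. 0)" for w
  have iF: "integrable M ?F" by (rule integrable_const_bound[of _ BF]) (auto simp: FB)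
  have iG: "integrable M ?G" by (rule integrable_const_bound[of _ BG]) (auto simp: GB)
  have iFG: "integrable M (\<lambda>w. ?F w * ?G w)"
    by (rule integrable_const_bound[of _ "BF * BG"])
      (auto simp: abs_mult intro!: mult_mono FB GB intro: order_trans[OF abs_ge_zero FB])
  have BG0: "BG \<ge> 0" using GB[of undefined] by linarith
  have iF0: "integrable M F0" unfolding F0_def using iF by simp
  have iF0G: "integrable M (\<lambda>w. F0 w * ?G w)"
    unfolding F0_def using iFG iG by (simp add: left_diff_distrib)
  have bF0: "(LINT w|M. \<bar>F0 w\<bar>) \<le> LF * (real (card I) * m1)"
  proof -
    have "(LINT w|M. \<bar>F0 w\<bar>) \<le> (LINT w|M. LF * (\<Sum>i\<in>I. norm (X i w)))"
    proof (rule integral_mono)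
      show "\<bar>F0 w\<bar> \<le> LF * (\<Sum>i\<in>I. norm (X i w))" for w
        using L[unfolded lipschitz_in_def, THEN conjunct2, rule_format, of "\<lambda>i. X i w" "\<lambda>i. 0"]
        by (simp add: F0_def)
    qed (use iF0 X1 in \<open>auto intro!: integrable_mult_right Bochner_Integration.integrable_sum integrable_norm\<close>)
    also have "\<dots> = LF * (\<Sum>i\<in>I. LINT w|M. norm (X i w))" using X1 by simp
    also have "\<dots> \<le> LF * (\<Sum>i\<in>I. m1)"
      using L by (intro mult_left_mono sum_mono X1) (simp add: lipschitz_in_def)
    finally show ?thesis by simp
  qed
  have "cov M ?F ?G = cov M F0 ?G"
    unfolding cov_def F0_def using iF by (simp add: prob_space)
  also have "\<dots> = (LINT w|M. F0 w * ?G w) - (LINT w|M. F0 w) * (LINT w|M. ?G w)"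
    using iF0 iG iF0G by (rule cov_eq)
  also have "\<bar>\<dots>\<bar> \<le> \<bar>LINT w|M. F0 w * ?G w\<bar> + \<bar>LINT w|M. F0 w\<bar> * \<bar>LINT w|M. ?G w\<bar>"
    by (simp add: abs_mult[symmetric] abs_triangle_ineq4)
  also have "\<dots> \<le> BG * (LF * (real (card I) * m1)) + (LF * (real (card I) * m1)) * BG"
  proof (rule add_mono)
    have "\<bar>LINT w|M. F0 w * ?G w\<bar> \<le> (LINT w|M. \<bar>F0 w * ?G w\<bar>)" by (rule integral_abs_bound)
    also have "\<dots> \<le> (LINT w|M. BG * \<bar>F0 w\<bar>)"
    proof (rule integral_mono)
      show "\<bar>F0 w * ?G w\<bar> \<le> BG * \<bar>F0 w\<bar>" for w
        using mult_right_mono[OF GB, of "\<bar>F0 w\<bar>" "\<lambda>i. X i w"] by (simp add: abs_mult mult.commute)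
    qed (use iF0 iF0G in \<open>auto intro!: integrable_abs integrable_mult_right\<close>)
    also have "\<dots> \<le> BG * (LF * (real (card I) * m1))" using bF0 BG0 by (simp add: mult_left_mono)
    finally show "\<bar>LINT w|M. F0 w * ?G w\<bar> \<le> BG * (LF * (real (card I) * m1))" .
    have "\<bar>LINT w|M. F0 w\<bar> \<le> (LINT w|M. \<bar>F0 w\<bar>)" by (rule integral_abs_bound)
    hence 1: "\<bar>LINT w|M. F0 w\<bar> \<le> LF * (real (card I) * m1)" using bF0 by linarith
    have "\<bar>LINT w|M. ?G w\<bar> \<le> (LINT w|M. \<bar>?G w\<bar>)" by (rule integral_abs_bound)
    also have "\<dots> \<le> (LINT w|M. BG)" using iG by (intro integral_mono) (auto simp: GB)
    finally have 2: "\<bar>LINT w|M. ?G w\<bar> \<le> BG" by (simp add: prob_space)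
    show "\<bar>LINT w|M. F0 w\<bar> * \<bar>LINT w|M. ?G w\<bar> \<le> (LF * (real (card I) * m1)) * BG"
      by (rule mult_mono[OF 1 2]) (use 1 in auto)
  qed
  finally show ?thesis by (simp add: algebra_simps)
qed

section \<open>From eta-coefficients to functionals of the field\<close>

lemma Lip_const_properties:
  fixes F :: "(real ^ 'n::finite) list \<Rightarrow> real"
  assumes L: "\<And>x y. x \<in> tuples u \<Longrightarrow> y \<in> tuples u \<Longrightarrow> \<bar>F x - F y\<bar> \<le> L * tuple_dist x y" "L \<ge> 0"
  shows "0 \<le> Lip_const u F" "Lip_const u F \<le> L"
    "\<And>x y. x \<in> tuples u \<Longrightarrow> y \<in> tuples u \<Longrightarrow> \<bar>F x - F y\<bar> \<le> Lip_const u F * tuple_dist x y"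
proof -
  let ?S = "{L. 0 \<le> L \<and> (\<forall>x\<in>tuples u. \<forall>y\<in>tuples u. \<bar>F x - F y\<bar> \<le> L * tuple_dist x y)}"
  have ne: "L \<in> ?S" using L by auto
  have bd: "bdd_below ?S" by (rule bdd_belowI[of _ 0]) auto
  show "Lip_const u F \<le> L" unfolding Lip_const_def by (rule cInf_lower[OF ne bd])
  show "0 \<le> Lip_const u F" unfolding Lip_const_def using ne by (intro cInf_greatest) auto
  fix x y :: "(real ^ 'n) list" assume xy: "x \<in> tuples u" "y \<in> tuples u"
  have d: "tuple_dist x y \<ge> 0" by (auto simp: tuple_dist_def intro!: sum_nonneg)
  show "\<bar>F x - F y\<bar> \<le> Lip_const u F * tuple_dist x y"
  proof (cases "tuple_dist x y = 0")
    case True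
    with L(1)[OF xy] show ?thesis by simp
  next
    case False
    hence d: "tuple_dist x y > 0" using d by simp
    have "\<bar>F x - F y\<bar> / tuple_dist x y \<le> Lip_const u F"
      unfolding Lip_const_def using ne d xy by (intro cInf_greatest) (auto simp: field_simps)
    thus ?thesis using d by (simp add: field_simps)
  qed
qed

lemma sup_norm_properties:
  fixes F :: "(real ^ 'n::finite) list \<Rightarrow> real"
  assumes "\<And>x. x \<in> tuples u \<Longrightarrow> \<bar>F x\<bar> \<le> B"
  shows "sup_norm u F \<le> B" "\<And>x. x \<in> tuples u \<Longrightarrow> \<bar>F x\<bar> \<le> sup_norm u F" "0 \<le> sup_norm u F"
proof -
  have ne: "replicate u 0 \<in> tuples u" by (simp add: tuples_def)
  hence "tuples u \<noteq> {}" by blast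
  thus "sup_norm u F \<le> B" unfolding sup_norm_def using assms by (intro cSUP_least) auto
  have bd: "bdd_above ((\<lambda>x. \<bar>F x\<bar>) ` tuples u)" using assms by (intro bdd_aboveI2) auto
  show s: "\<bar>F x\<bar> \<le> sup_norm u F" if "x \<in> tuples u" for x
    unfolding sup_norm_def by (rule cSUP_upper[OF that bd])
  show "0 \<le> sup_norm u F" using s[OF ne] by linarith
qed

text \<open>The supremum defining the eta-coefficient leaves out zero denominators. If the denominator is
  zero, one of the functionals is constant on tuples and the covariance vanishes.\<close>

lemma (in prob_space) cov_le_eta_coeff:
  fixes X :: "int ^ 'm::finite \<Rightarrow> 'a \<Rightarrow> real ^ 'n::finite"
  assumes fin: "finite I" "finite J" and ne: "I \<noteq> {}" "J \<noteq> {}"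
    and FB: "\<And>x. \<bar>F x\<bar> \<le> BF" and GB: "\<And>x. \<bar>G x\<bar> \<le> BG"
    and LF: "lipschitz_in I LF F" and LG: "lipschitz_in J LG G"
    and dist: "\<And>i j. i \<in> I \<Longrightarrow> j \<in> J \<Longrightarrow> h \<le> norm_inf (i - j)"
    and eta: "eta_coeff M X h \<le> ennreal e" and e: "e \<ge> 0"
  shows "\<bar>cov M (\<lambda>w. F (\<lambda>i. X i w)) (\<lambda>w. G (\<lambda>i. X i w))\<bar>
        \<le> e * (real (card I) * BG * LF + real (card J) * BF * LG)"
proof -
  obtain xs where xs: "set xs = I" "distinct xs" using finite_distinct_list[OF fin(1)] by auto
  obtain ys where ys: "set ys = J" "distinct ys" using finite_distinct_list[OF fin(2)] by auto
  \<comment> \<open>The configuration with the entries of the tuple \<open>l\<close> at the sites that \<open>zs\<close> enumerates and zero elsewhere.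
    A functional that is Lipschitz in these sites only sees the entries.\<close>
  define conf where "conf zs l i = (if i \<in> set zs then l ! (THE k. k < length zs \<and> zs ! k = i) else 0)"
    for zs :: "(int ^ 'm) list" and l :: "(real ^ 'n) list" and i
  have conf_nth: "conf zs l (zs ! k) = l ! k" if "distinct zs" "k < length zs" for zs l k
  proof -
    have "(THE j. j < length zs \<and> zs ! j = zs ! k) = k"
      by (rule the_equality) (use that in \<open>auto simp: nth_eq_iff_index_eq\<close>)
    thus ?thesis using that by (simp add: conf_def)
  qed
  have conf_lip: "\<bar>H (conf zs x) - H (conf zs y)\<bar> \<le> L * tuple_dist x y"
    if "distinct zs" "lipschitz_in (set zs) L H" "length x = length zs" "length y = length zs"
    for H :: "(int ^ 'm \<Rightarrow> real ^ 'n) \<Rightarrow> real" and zs L x y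
  proof -
    have "\<bar>H (conf zs x) - H (conf zs y)\<bar> \<le> L * (\<Sum>i\<in>set zs. norm (conf zs x i - conf zs y i))"
      using that(2) by (simp add: lipschitz_in_def)
    also have "(\<Sum>i\<in>set zs. norm (conf zs x i - conf zs y i))
        = (\<Sum>k<length zs. norm (conf zs x (zs ! k) - conf zs y (zs ! k)))"
      using that(1) by (intro sum.reindex_bij_betw[symmetric] bij_betw_nth) auto
    also have "\<dots> = tuple_dist x y"
      unfolding tuple_dist_def that(3) by (intro sum.cong) (auto simp: conf_nth that(1))
    finally show ?thesis .
  qed
  have conf_eq: "H (conf zs (map (\<lambda>i. x i) zs)) = H x" if "distinct zs" "lipschitz_in (set zs) L H"
    for H :: "(int ^ 'm \<Rightarrow> real ^ 'n) \<Rightarrow> real" and zs L x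
  proof -
    have "\<bar>H (conf zs (map (\<lambda>i. x i) zs)) - H x\<bar>
        \<le> L * (\<Sum>i\<in>set zs. norm (conf zs (map (\<lambda>i. x i) zs) i - x i))"
      using that(2) by (simp add: lipschitz_in_def)
    also have "(\<Sum>i\<in>set zs. norm (conf zs (map (\<lambda>i. x i) zs) i - x i)) = 0"
      by (intro sum.neutral ballI) (auto simp: in_set_conv_nth conf_nth that(1))
    finally show ?thesis by simp
  qed
  define u v where "u = card I" and "v = card J"
  have lu: "length xs = u" and lv: "length ys = v"
    using xs ys distinct_card u_def v_def by metis+
  have uv: "u \<ge> 1" "v \<ge> 1" using fin ne by (simp_all add: u_def v_def Suc_le_eq card_gt_0_iff)
  define F' where "F' l = F (conf xs l)" for l
  define G' where "G' l = G (conf ys l)" for l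
  have F'L: "\<bar>F' x - F' y\<bar> \<le> LF * tuple_dist x y" if "x \<in> tuples u" "y \<in> tuples u" for x y
    unfolding F'_def using that LF xs lu by (intro conf_lip) (auto simp: tuples_def)
  have G'L: "\<bar>G' x - G' y\<bar> \<le> LG * tuple_dist x y" if "x \<in> tuples v" "y \<in> tuples v" for x y
    unfolding G'_def using that LG ys lv by (intro conf_lip) (auto simp: tuples_def)
  have LF0: "LF \<ge> 0" and LG0: "LG \<ge> 0" using LF LG by (auto simp: lipschitz_in_def)
  have FL: "0 \<le> Lip_const u F'" "Lip_const u F' \<le> LF"
      "\<And>x y. x \<in> tuples u \<Longrightarrow> y \<in> tuples u \<Longrightarrow> \<bar>F' x - F' y\<bar> \<le> Lip_const u F' * tuple_dist x y"
    using Lip_const_properties[of u F' LF] F'L LF0 by blast+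
  have GL: "0 \<le> Lip_const v G'" "Lip_const v G' \<le> LG"
    using Lip_const_properties[of v G' LG] G'L LG0 by blast+
  have FS: "sup_norm u F' \<le> BF" "\<And>x. x \<in> tuples u \<Longrightarrow> \<bar>F' x\<bar> \<le> sup_norm u F'" "0 \<le> sup_norm u F'"
    using sup_norm_properties[of u F' BF] FB by (auto simp: F'_def)
  have GS: "sup_norm v G' \<le> BG" "\<And>x. x \<in> tuples v \<Longrightarrow> \<bar>G' x\<bar> \<le> sup_norm v G'" "0 \<le> sup_norm v G'"
    using sup_norm_properties[of v G' BG] GB by (auto simp: G'_def)
  have Feq: "(\<lambda>w. F (\<lambda>i. X i w)) = (\<lambda>w. F' (map (\<lambda>i. X i w) xs))"
    unfolding F'_def using conf_eq[OF xs(2), of LF F] LF xs by simp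
  have Geq: "(\<lambda>w. G (\<lambda>i. X i w)) = (\<lambda>w. G' (map (\<lambda>i. X i w) ys))"
    unfolding G'_def using conf_eq[OF ys(2), of LG G] LG ys by simp
  have Ftup: "map (\<lambda>i. X i w) xs \<in> tuples u" "map (\<lambda>i. X i w) ys \<in> tuples v" for w
    using lu lv by (auto simp: tuples_def)
  define d where "d = real u * sup_norm v G' * Lip_const u F' + real v * sup_norm u F' * Lip_const v G'"
  define c where "c = \<bar>cov M (\<lambda>w. F' (map (\<lambda>i. X i w) xs)) (\<lambda>w. G' (map (\<lambda>i. X i w) ys))\<bar>"
  have t0: "0 \<le> real u * sup_norm v G' * Lip_const u F'" "0 \<le> real v * sup_norm u F' * Lip_const v G'"
    using FS(3) GS(3) FL(1) GL(1) by auto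
  have B0: "0 \<le> BF" "0 \<le> BG" using FS(1,3) GS(1,3) by linarith+
  have d_le: "d \<le> real u * BG * LF + real v * BF * LG"
    unfolding d_def using FL(1,2) GL(1,2) FS(1,3) GS(1,3) LF0 LG0 B0
    by (intro add_mono mult_mono mult_left_mono mult_nonneg_nonneg) auto
  have const_cov: "cov M Y Z = 0" if "\<And>w. Y w = k" for Y Z :: "'a \<Rightarrow> real" and k
  proof -
    have "Y = (\<lambda>_. k)" using that by auto
    thus ?thesis unfolding cov_def by (simp add: prob_space)
  qed
  have "c \<le> e * d"
  proof (cases "d = 0")
    case True
    hence z: "real u * sup_norm v G' * Lip_const u F' = 0" 
      using t0 unfolding d_def by linarith
    from z uv consider "sup_norm v G' = 0" | "Lip_const u F' = 0" by auto
    hence "c = 0"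
    proof cases
      case 1
      hence "G' (map (\<lambda>i. X i w) ys) = 0" for w using GS(2)[OF Ftup(2)] by simp
      thus ?thesis unfolding c_def by (subst cov_commute) (simp add: const_cov)
    next
      case 2
      hence "F' (map (\<lambda>i. X i w) xs) = F' (replicate u 0)" for w
        using FL(3)[OF Ftup(1), of "replicate u 0" w] by (simp add: tuples_def)
      thus ?thesis unfolding c_def using const_cov by simp
    qed
    thus ?thesis using True by simp
  next
    case False
    have mem: "ennreal (c / d) \<le> eta_uv M X u v h"
      unfolding eta_uv_def
    proof (rule Sup_upper, rule CollectI, intro exI conjI)
      show "ennreal (c / d) = ennreal (\<bar>cov M (\<lambda>w. F' (map (\<lambda>i. X i w) xs)) (\<lambda>w. G' (map (\<lambda>j. X j w) ys))\<bar>
            / (real u * sup_norm v G' * Lip_const u F' + real v * sup_norm u F' * Lip_const v G'))"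
        by (simp add: c_def d_def)
      show "F' \<in> bounded_Lipschitz u" unfolding bounded_Lipschitz_def bounded_iff
        using F'L LF0 FS(2) by auto
      show "G' \<in> bounded_Lipschitz v" unfolding bounded_Lipschitz_def bounded_iff
        using G'L LG0 GS(2) by auto
      show "real u * sup_norm v G' * Lip_const u F' + real v * sup_norm u F' * Lip_const v G' \<noteq> 0"
        using False by (simp add: d_def)
      show "h \<le> lattice_dist (set xs) (set ys)"
        unfolding lattice_dist_def xs ys using ne dist by (intro cINF_greatest) auto
    qed (use xs ys lu lv in auto)
    also have "\<dots> \<le> eta_coeff M X h"
      unfolding eta_coeff_def
      using uv by (intro SUP_upper2[of "(u, v)"]) auto
    finally have "ennreal (c / d) \<le> ennreal e" using eta by (rule order_trans)
    hence "c / d \<le> e" using e by (simp add: ennreal_le_iff)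
    moreover have "d > 0" using False t0 unfolding d_def by linarith
    ultimately show ?thesis by (simp add: field_simps)
  qed
  also have "\<dots> \<le> e * (real u * BG * LF + real v * BF * LG)" using d_le e by (rule mult_left_mono)
  finally show ?thesis unfolding Feq Geq c_def u_def v_def .
qed

text \<open>At distances where the hypothesis on the eta-coefficients is silent, the first absolute
  moment gives an inequality of the same form, so one constant serves for all distances.\<close>

lemma (in prob_space) weakly_dependent_of_eta:
  fixes X :: "int ^ 'm::finite \<Rightarrow> 'a \<Rightarrow> real ^ 'n::finite"
  assumes meas: "\<And>i. X i \<in> borel_measurable M"
    and X1: "\<And>i. integrable M (X i)" "\<And>i. (LINT w|M. norm (X i w)) \<le> m1"
    and eta: "\<forall>\<^sub>F h in sequentially. eta_coeff M X h \<le> ennreal (K * real h powr (- \<beta>))"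
    and \<beta>: "\<beta> > 0"
  shows "\<exists>K'\<ge>0. weakly_dependent M X (\<lambda>h. K' * (1 + real h) powr (- \<beta>))"
proof -
  obtain h0 where h0: "\<And>h. h \<ge> h0 \<Longrightarrow> eta_coeff M X h \<le> ennreal (K * real h powr (- \<beta>))"
    using eta by (auto simp: eventually_sequentially)
  define h1 where "h1 = max h0 1"
  have "0 \<le> (LINT w|M. norm (X 0 w))" by (rule Bochner_Integration.integral_nonneg) simp
  hence m1: "m1 \<ge> 0" using X1(2)[of 0] by linarith
  \<comment> \<open>The first entry is for \<open>h \<ge> h1\<close>, where \<open>1 + h \<le> 2 * h\<close>, the second one for the smaller distances.\<close>
  define K' where "K' = max (\<bar>K\<bar> * 2 powr \<beta>) (2 * m1 * (1 + real h1) powr \<beta>)"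
  have K': "K' \<ge> 0" unfolding K'_def by (rule max.coboundedI1) simp
  have "weakly_dependent M X (\<lambda>h. K' * (1 + real h) powr (- \<beta>))"
    unfolding weakly_dependent_def
  proof (intro allI impI)
    fix I J :: "(int ^ 'm) set" and F G :: "(int ^ 'm \<Rightarrow> real ^ 'n) \<Rightarrow> real" and BF BG LF LG h
    assume h: "finite I" "finite J" "I \<noteq> {}" "J \<noteq> {}" "\<forall>x. \<bar>F x\<bar> \<le> BF" "\<forall>x. \<bar>G x\<bar> \<le> BG"
     "lipschitz_in I LF F" "lipschitz_in J LG G"
     "(\<lambda>w. F (\<lambda>i. X i w)) \<in> borel_measurable M" "(\<lambda>w. G (\<lambda>i. X i w)) \<in> borel_measurable M"
     "\<forall>i\<in>I. \<forall>j\<in>J. h \<le> norm_inf (i - j)"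
    let ?c = "\<bar>cov M (\<lambda>w. F (\<lambda>i. X i w)) (\<lambda>w. G (\<lambda>i. X i w))\<bar>"
    let ?r = "real (card I) * BG * LF + real (card J) * BF * LG"
    have B0: "BF \<ge> 0" "BG \<ge> 0" "LF \<ge> 0" "LG \<ge> 0"
      using h(5)[rule_format, of undefined] h(6)[rule_format, of undefined] h(7,8)
      by (auto simp: lipschitz_in_def)
    hence r0: "?r \<ge> 0" by simp
    show "?c \<le> K' * (1 + real h) powr (- \<beta>) * ?r"
    proof (cases "h \<ge> h1")
      case True
      have hp: "real h \<ge> 1" using True by (auto simp: h1_def)
      have "eta_coeff M X h \<le> ennreal (K * real h powr (- \<beta>))" using True by (intro h0) (simp add: h1_def)
      also have "\<dots> \<le> ennreal (K' * (1 + real h) powr (- \<beta>))"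
      proof (rule ennreal_leI)
        have "K * real h powr (- \<beta>) \<le> \<bar>K\<bar> * real h powr (- \<beta>)" by (intro mult_right_mono) auto
        also have "real h powr (- \<beta>) \<le> ((1 + real h) / 2) powr (- \<beta>)"
          using hp \<beta> by (intro powr_mono2') auto
        also have "\<dots> = 2 powr \<beta> * (1 + real h) powr (- \<beta>)"
          by (simp add: powr_divide powr_minus_divide)
        also have "\<bar>K\<bar> * (2 powr \<beta> * (1 + real h) powr (- \<beta>)) \<le> K' * (1 + real h) powr (- \<beta>)"
          unfolding mult.assoc[symmetric] by (intro mult_right_mono) (auto simp: K'_def)
        finally show "K * real h powr - \<beta> \<le> K' * (1 + real h) powr - \<beta>" by (simp add: mult_left_mono)
      qed
      finally show ?thesis using h K'
        by (intro cov_le_eta_coeff[where F = F and G = G and I = I and J = J]) auto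
    next
      case False
      have "?c \<le> 2 * m1 * (real (card I) * BG * LF)"
        using meas X1 h by (intro abs_cov_le_bounded_lipschitz) auto
      also have "\<dots> \<le> 2 * m1 * ?r" using m1 B0 by (intro mult_left_mono) auto
      also have "\<dots> \<le> K' * (1 + real h) powr (- \<beta>) * ?r"
      proof (rule mult_right_mono[OF _ r0])
        have "2 * m1 = 2 * m1 * (1 + real h1) powr \<beta> * (1 + real h1) powr (- \<beta>)"
          by (simp add: powr_minus field_simps)
        also have "\<dots> \<le> K' * (1 + real h) powr (- \<beta>)"
          using False \<beta> m1 K' by (intro mult_mono powr_mono2') (auto simp: K'_def)
        finally show "2 * m1 \<le> K' * (1 + real h) powr (- \<beta>)" .
      qed
      finally show ?thesis .
    qed
  qed
  thus ?thesis using K' by blast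
qed


section \<open>Stein's method for bounded fields\<close>

definition clip :: "real \<Rightarrow> real \<Rightarrow> real" where
  "clip T x = max (- T) (min T x)"

lemma clip_le: "T \<ge> 0 \<Longrightarrow> \<bar>clip T x\<bar> \<le> T"
  by (auto simp: clip_def)

lemma clip_eq: "\<bar>x\<bar> \<le> T \<Longrightarrow> clip T x = x"
  by (auto simp: clip_def)

lemma clip_lipschitz: "\<bar>clip T x - clip T y\<bar> \<le> \<bar>x - y\<bar>"
  by (auto simp: clip_def)

lemma clip_0 [simp]: "T \<ge> 0 \<Longrightarrow> clip T 0 = 0"
  by (auto simp: clip_def)

lemma norm_square_le: "\<bar>x :: real\<bar> \<le> c \<Longrightarrow> norm (x\<^sup>2) \<le> c\<^sup>2"
  using power_mono[of "\<bar>x\<bar>" c 2] by simp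

lemma clip_measurable [measurable]: "clip T \<in> borel_measurable borel"
  unfolding clip_def by measurable

lemma (in prob_space) has_vector_derivative_char_bounded:
  fixes S :: "'a \<Rightarrow> real"
  assumes [measurable]: "S \<in> borel_measurable M" and C: "\<And>w. \<bar>S w\<bar> \<le> C"
  shows "((\<lambda>t. CLINT w|M. iexp (t * S w)) has_vector_derivative
           \<i> * (CLINT w|M. S w * iexp (t * S w))) (at t within A)"
proof -
  have C0: "C \<ge> 0" using C[of undefined] by linarith
  have i1: "integrable M (\<lambda>w. iexp (s * S w))" for s
    by (rule integrable_const_bound[of _ 1]) auto
  have i2: "integrable M (\<lambda>w. S w * iexp (s * S w))" for s
    by (rule integrable_const_bound[of _ C]) (auto simp: norm_mult C)
  define D where "D = \<i> * (CLINT w|M. S w * iexp (t * S w))"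
  have bnd: "cmod ((CLINT w|M. iexp (s * S w)) - (CLINT w|M. iexp (t * S w)) - (s - t) *\<^sub>R D)
      \<le> (s - t)\<^sup>2 * C\<^sup>2 / 2" for s
  proof -
    define z where "z w = S w * iexp (t * S w)" for w
    define y where "y w = (s - t) *\<^sub>R (\<i> * z w)" for w
    define g where "g w = iexp (s * S w) - iexp (t * S w) - y w" for w
    have iz: "integrable M z" unfolding z_def by (rule i2)
    have iy: "integrable M y" unfolding y_def using iz by simp
    have ig: "integrable M g" unfolding g_def using i1[of s] i1[of t] iy by simp
    have g_le: "cmod (g w) \<le> (s - t)\<^sup>2 * C\<^sup>2 / 2" for w
    proof -
      let ?x = "(s - t) * S w"
      have e: "iexp (s * S w) = iexp (t * S w) * iexp ?x"
      proof -
        have "\<i> * complex_of_real (s * S w) = \<i> * complex_of_real (t * S w) + \<i> * complex_of_real ?x"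
          by (simp add: algebra_simps)
        thus ?thesis by (simp only: exp_add)
      qed
      have "g w = iexp (t * S w) * (iexp ?x - (\<Sum>k\<le>1. (\<i> * ?x) ^ k / fact k))"
        unfolding g_def e y_def z_def by (simp add: scaleR_conv_of_real algebra_simps)
      hence "cmod (g w) = cmod (iexp ?x - (\<Sum>k\<le>1. (\<i> * ?x) ^ k / fact k))"
        by (simp add: norm_mult)
      also have "\<dots> \<le> \<bar>?x\<bar> ^ Suc 1 / fact (Suc 1)" by (rule iexp_approx1)
      also have "\<dots> = (s - t)\<^sup>2 * (S w)\<^sup>2 / 2" by (simp add: power2_eq_square abs_mult mult_ac flip: power2_abs)
      also have "\<dots> \<le> (s - t)\<^sup>2 * C\<^sup>2 / 2"
        using norm_square_le[OF C[of w]] by (intro divide_right_mono mult_left_mono) auto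
      finally show ?thesis .
    qed
    have "(CLINT w|M. iexp (s * S w)) - (CLINT w|M. iexp (t * S w)) - (s - t) *\<^sub>R D = (CLINT w|M. g w)"
      unfolding D_def g_def y_def z_def using i1 i2 by simp
    also have "cmod \<dots> \<le> (LINT w|M. cmod (g w))" by (rule integral_norm_bound)
    also have "\<dots> \<le> (LINT w|M. (s - t)\<^sup>2 * C\<^sup>2 / 2)"
      using ig g_le by (intro integral_mono) auto
    finally show ?thesis by (simp add: prob_space)
  qed
  have "((\<lambda>t. CLINT w|M. iexp (t * S w)) has_derivative (\<lambda>h. h *\<^sub>R D)) (at t within A)"
  proof (rule has_derivativeI_sandwich[where e = 1 and H = "\<lambda>s. \<bar>s - t\<bar> * C\<^sup>2 / 2"])
    show "bounded_linear (\<lambda>h. h *\<^sub>R D)" by (rule bounded_linear_scaleR_left)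
    show "((\<lambda>s. \<bar>s - t\<bar> * C\<^sup>2 / 2) \<longlongrightarrow> 0) (at t within A)" by (auto intro!: tendsto_eq_intros)
    fix s assume "s \<noteq> t"
    thus "norm ((CLINT w|M. iexp (s * S w)) - (CLINT w|M. iexp (t * S w)) - (s - t) *\<^sub>R D) / norm (s - t)
       \<le> \<bar>s - t\<bar> * C\<^sup>2 / 2"
      using bnd[of s] by (simp add: field_simps power2_eq_square)
  qed simp
  thus ?thesis unfolding has_vector_derivative_def D_def .
qed

text \<open>Stein's identity \<open>E S e\<^sup>i\<^sup>t\<^sup>S = i t v E e\<^sup>i\<^sup>t\<^sup>S\<close> characterises the normal law with variance \<open>v\<close>.
  An approximate identity gives an approximate differential equation for the characteristic
  function; multiplying by \<open>exp (v t\<^sup>2 / 2)\<close> and using the mean value inequality solves it. The case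
  \<open>v = 0\<close> is included.\<close>

lemma (in prob_space) char_close_to_gaussian_of_stein:
  fixes S :: "'a \<Rightarrow> real" and C v \<epsilon> t :: real
  assumes [measurable]: "S \<in> borel_measurable M" and C: "\<And>w. \<bar>S w\<bar> \<le> C" and v: "v \<ge> 0" and \<epsilon>: "\<epsilon> \<ge> 0"
    and stein: "\<And>t. cmod ((CLINT w|M. S w * iexp (t * S w)) - \<i> * t * v * (CLINT w|M. iexp (t * S w)))
       \<le> (1 + t\<^sup>2) * \<epsilon>"
  shows "cmod ((CLINT w|M. iexp (t * S w)) - exp (- (v * t\<^sup>2 / 2))) \<le> \<bar>t\<bar> * (1 + t\<^sup>2) * \<epsilon>"
proof -
  define \<phi> where "\<phi> t = (CLINT w|M. iexp (t * S w))" for t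
  define r where "r t = (CLINT w|M. S w * iexp (t * S w)) - \<i> * t * v * \<phi> t" for t
  define E where "E t = exp (v * t\<^sup>2 / 2)" for t :: real
  define \<psi> where "\<psi> t = \<phi> t * complex_of_real (E t)" for t
  define \<psi>' where "\<psi>' s = \<i> * r s * E s" for s
  have d: "(\<psi> has_vector_derivative \<psi>' s) (at s within A)" for s A
  proof -
    have dE: "(E has_real_derivative v * s * E s) (at s within A)"
      unfolding E_def by (auto intro!: derivative_eq_intros)
    have "((\<lambda>t. complex_of_real (E t)) has_vector_derivative complex_of_real (v * s * E s)) (at s within A)"
      using dE by (intro has_vector_derivative_of_real) (simp add: has_real_derivative_iff_has_vector_derivative)
    with has_vector_derivative_char_bounded[OF assms(1) C, of s A]
    have "(\<psi> has_vector_derivative \<phi> s * complex_of_real (v * s * E s)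
       + (\<i> * (CLINT w|M. S w * iexp (s * S w))) * complex_of_real (E s)) (at s within A)"
      unfolding \<psi>_def \<phi>_def by (intro has_vector_derivative_mult)
    moreover have "\<phi> s * complex_of_real (v * s * E s)
       + (\<i> * (CLINT w|M. S w * iexp (s * S w))) * complex_of_real (E s) = \<psi>' s"
      unfolding \<psi>'_def r_def by (simp add: algebra_simps)
    ultimately show ?thesis by simp
  qed
  have "norm (\<psi> t - \<psi> 0) \<le> (1 + t\<^sup>2) * \<epsilon> * E t * norm (t - 0)"
  proof (rule differentiable_bound[where S = "{- \<bar>t\<bar> .. \<bar>t\<bar>}" and f' = "\<lambda>s h. h *\<^sub>R \<psi>' s"])
    show "(\<psi> has_derivative (\<lambda>h. h *\<^sub>R \<psi>' s)) (at s within {- \<bar>t\<bar> .. \<bar>t\<bar>})" for s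
      using d unfolding has_vector_derivative_def .
    fix s assume s: "s \<in> {- \<bar>t\<bar> .. \<bar>t\<bar>}"
    have st: "s\<^sup>2 \<le> t\<^sup>2" using s by (intro abs_le_square_iff[THEN iffD1]) auto
    have "norm (\<psi>' s) = cmod (r s) * E s" by (simp add: \<psi>'_def norm_mult E_def)
    also have "\<dots> \<le> ((1 + s\<^sup>2) * \<epsilon>) * E s"
      using stein[of s] by (intro mult_right_mono) (auto simp: r_def \<phi>_def E_def)
    also have "\<dots> \<le> ((1 + t\<^sup>2) * \<epsilon>) * E t"
      using st v \<epsilon> by (intro mult_mono) (auto simp: E_def intro!: mult_left_mono divide_right_mono)
    finally show "onorm (\<lambda>h. h *\<^sub>R \<psi>' s) \<le> (1 + t\<^sup>2) * \<epsilon> * E t"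
      by (intro onorm_le) (simp add: mult.commute mult_left_mono)
  qed auto
  moreover have "\<psi> 0 = 1" by (simp add: \<psi>_def \<phi>_def E_def prob_space)
  ultimately have b: "cmod (\<psi> t - 1) \<le> \<bar>t\<bar> * (1 + t\<^sup>2) * \<epsilon> * E t" by (simp add: mult_ac)
  have Ei: "exp (- (v * t\<^sup>2 / 2)) * E t = 1" by (simp add: E_def exp_minus)
  have "\<phi> t - exp (- (v * t\<^sup>2 / 2)) = (\<psi> t - 1) * complex_of_real (exp (- (v * t\<^sup>2 / 2)))"
  proof -
    have "complex_of_real (E t) * complex_of_real (exp (- (v * t\<^sup>2 / 2))) = 1"
      unfolding of_real_mult[symmetric] using Ei by (simp add: mult.commute)
    thus ?thesis by (simp add: \<psi>_def left_diff_distrib mult.assoc)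
  qed
  hence "cmod (\<phi> t - exp (- (v * t\<^sup>2 / 2))) = cmod (\<psi> t - 1) * exp (- (v * t\<^sup>2 / 2))"
    by (simp add: norm_mult)
  also have "\<dots> \<le> \<bar>t\<bar> * (1 + t\<^sup>2) * \<epsilon> * E t * exp (- (v * t\<^sup>2 / 2))"
    using b by (intro mult_right_mono) auto
  also have "\<dots> = \<bar>t\<bar> * (1 + t\<^sup>2) * \<epsilon>" using Ei by (simp add: mult.assoc mult.commute[of "E t"])
  finally show ?thesis by (simp add: \<phi>_def)
qed

lemma (in prob_space) variance_sum_eq:
  fixes A :: "'i \<Rightarrow> 'a \<Rightarrow> real"
  assumes [measurable]: "\<And>e. A e \<in> borel_measurable M" and sq: "\<And>e. e \<in> E \<Longrightarrow> integrable M (\<lambda>w. (A e w)\<^sup>2)"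
  shows "integrable M (\<lambda>w. ((\<Sum>e\<in>E. A e w) - (LINT w|M. (\<Sum>e\<in>E. A e w)))\<^sup>2)"
    and "(LINT w|M. ((\<Sum>e\<in>E. A e w) - (LINT w|M. (\<Sum>e\<in>E. A e w)))\<^sup>2) = (\<Sum>e\<in>E. \<Sum>e'\<in>E. cov M (A e) (A e'))"
proof -
  define A0 where "A0 e w = A e w - (LINT w|M. A e w)" for e w
  have m[measurable]: "A0 e \<in> borel_measurable M" for e unfolding A0_def by measurable
  have i: "integrable M (A e)" if "e \<in> E" for e
    using square_integrable_imp_integrable[OF _ sq[OF that]] by simp
  have sq0: "integrable M (\<lambda>w. (A0 e w)\<^sup>2)" if "e \<in> E" for e
  proof -
    have "integrable M (\<lambda>w. (A e w)\<^sup>2 - 2 * (LINT w|M. A e w) * A e w + (LINT w|M. A e w)\<^sup>2)"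
      using i[OF that] sq[OF that] by simp
    thus ?thesis unfolding A0_def by (simp add: power2_diff algebra_simps)
  qed
  have ip: "integrable M (\<lambda>w. A0 e w * A0 e' w)" if "e \<in> E" "e' \<in> E" for e e'
    using that by (intro integrable_prod_of_squares sq0) auto
  have eq: "((\<Sum>e\<in>E. A e w) - (LINT w|M. (\<Sum>e\<in>E. A e w)))\<^sup>2 = (\<Sum>e\<in>E. \<Sum>e'\<in>E. A0 e w * A0 e' w)" for w
  proof -
    have "(\<Sum>e\<in>E. A e w) - (LINT w|M. (\<Sum>e\<in>E. A e w)) = (\<Sum>e\<in>E. A0 e w)"
      using i by (simp add: A0_def sum_subtractf)
    thus ?thesis by (simp add: power2_eq_square sum_product)
  qed
  show "integrable M (\<lambda>w. ((\<Sum>e\<in>E. A e w) - (LINT w|M. (\<Sum>e\<in>E. A e w)))\<^sup>2)"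
    unfolding eq using ip by (intro Bochner_Integration.integrable_sum) auto
  show "(LINT w|M. ((\<Sum>e\<in>E. A e w) - (LINT w|M. (\<Sum>e\<in>E. A e w)))\<^sup>2) = (\<Sum>e\<in>E. \<Sum>e'\<in>E. cov M (A e) (A e'))"
    unfolding eq using ip by (simp add: cov_def A0_def Bochner_Integration.integral_sum)
qed

lemma lipschitz_product_clip:
  assumes "B \<ge> 0"
  shows "\<bar>clip B a * clip B b - clip B c * clip B d\<bar> \<le> B * (\<bar>a - c\<bar> + \<bar>b - d\<bar>)"
proof -
  have "clip B a * clip B b - clip B c * clip B d = (clip B a - clip B c) * clip B b + clip B c * (clip B b - clip B d)"
    by (simp add: algebra_simps)
  also have "\<bar>\<dots>\<bar> \<le> \<bar>clip B a - clip B c\<bar> * \<bar>clip B b\<bar> + \<bar>clip B c\<bar> * \<bar>clip B b - clip B d\<bar>"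
    by (simp add: abs_mult[symmetric] abs_triangle_ineq)
  also have "\<dots> \<le> \<bar>a - c\<bar> * B + B * \<bar>b - d\<bar>"
    using assms by (intro add_mono mult_mono clip_le clip_lipschitz) auto
  finally show ?thesis by (simp add: algebra_simps)
qed

text \<open>The condition \<open>\<beta> > m\<close> makes the covariances summable over the lattice, on which the error bound
  for the normal approximation rests. The stronger \<open>\<beta> > 2 m\<close> enters with the choice of a range for
  which the error vanishes.\<close>

locale bounded_weakly_dependent_field = prob_space M for M :: "'a measure" +
  fixes Y :: "int ^ 'm::finite \<Rightarrow> 'a \<Rightarrow> real" and B K \<beta> :: real
  assumes Y_measurable [measurable]: "\<And>i. Y i \<in> borel_measurable M"
    and Y_bound: "\<And>i w. \<bar>Y i w\<bar> \<le> B"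
    and Y_mean: "\<And>i. (LINT w|M. Y i w) = 0"
    and K_nonneg: "K \<ge> 0" and \<beta>_gt: "\<beta> > real CARD('m)"
    and wd: "weakly_dependent M Y (\<lambda>h. K * (1 + real h) powr (- \<beta>))"
begin

abbreviation "\<kappa> h \<equiv> K * (1 + real h) powr (- \<beta>)"

definition k :: "int ^ 'm \<Rightarrow> real" where "k h = \<kappa> (norm_inf h)"

lemma k_nonneg: "k h \<ge> 0" using K_nonneg by (simp add: k_def)

lemma k_minus: "k (u - v) = k (v - u)" by (simp add: k_def norm_inf_minus_commute)

lemma k_summable: "k summable_on UNIV"
  unfolding k_def by (intro summable_on_cmult_right summable_lattice_weight \<beta>_gt)

lemma k_sum_nonneg: "infsum k UNIV \<ge> 0" by (intro infsum_nonneg k_nonneg)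

lemma B_nonneg: "B \<ge> 0" using Y_bound[of undefined undefined] by linarith

lemma clip_Y [simp]: "clip B (Y i w) = Y i w" by (rule clip_eq) (rule Y_bound)

lemma abs_Y_mult_le: "\<bar>c\<bar> \<le> 1 \<Longrightarrow> \<bar>Y i w\<bar> * \<bar>c\<bar> \<le> B"
  using mult_mono[OF Y_bound[of i w], of "\<bar>c\<bar>" 1] B_nonneg by simp

lemma integrable_Y: "integrable M (Y i)"
  by (rule integrable_const_bound[of _ B]) (auto simp: Y_bound)

lemma abs_YY_le: "\<bar>Y i w * Y j w\<bar> \<le> B * B"
  unfolding abs_mult by (intro mult_mono Y_bound B_nonneg abs_ge_zero)

lemma integrable_YY: "integrable M (\<lambda>w. Y i w * Y j w)"
  by (rule integrable_const_bound[of _ "B * B"]) (simp_all add: abs_YY_le)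

lemma integral_YY_le: "\<bar>LINT w|M. Y u w * Y v w\<bar> \<le> 2 * B * k (u - v)"
proof -
  have "\<bar>cov M (\<lambda>w. clip B (Y u w)) (\<lambda>w. clip B (Y v w))\<bar>
     \<le> \<kappa> (norm_inf (u - v)) * (real (card {u}) * B * 1 + real (card {v}) * B * 1)"
    by (rule weakly_dependentD[OF wd, where F = "\<lambda>x. clip B (x u)" and G = "\<lambda>x. clip B (x v)"])
       (auto simp: lipschitz_in_def clip_le B_nonneg clip_lipschitz)
  thus ?thesis by (simp add: cov_def Y_mean k_def mult_ac)
qed

text \<open>The distance of the pairs is one of the four mutual distances, so the bound may be written
  as a sum over these. In this form it can be summed one pair at a time.\<close>

lemma cov_YY_le:
  "\<bar>cov M (\<lambda>w. Y u w * Y u' w) (\<lambda>w. Y v w * Y v' w)\<bar>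
     \<le> 8 * B ^ 3 * (k (u - v) + k (u - v') + k (u' - v) + k (u' - v'))"
proof -
  define h where "h = min (min (norm_inf (u - v)) (norm_inf (u - v'))) (min (norm_inf (u' - v)) (norm_inf (u' - v')))"
  have lip: "lipschitz_in {a, b} (2 * B) (\<lambda>x. clip B (x a) * clip B (x b))" for a b :: "int ^ 'm"
    unfolding lipschitz_in_def
  proof (intro conjI allI)
    fix x y :: "int ^ 'm \<Rightarrow> real"
    have "\<bar>clip B (x a) * clip B (x b) - clip B (y a) * clip B (y b)\<bar> \<le> B * (\<bar>x a - y a\<bar> + \<bar>x b - y b\<bar>)"
      by (rule lipschitz_product_clip[OF B_nonneg])
    also have "\<dots> \<le> B * (2 * (\<Sum>i\<in>{a, b}. norm (x i - y i)))"
      using B_nonneg by (intro mult_left_mono) (cases "a = b", auto)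
    finally show "\<bar>clip B (x a) * clip B (x b) - clip B (y a) * clip B (y b)\<bar>
       \<le> 2 * B * (\<Sum>i\<in>{a, b}. norm (x i - y i))" by simp
  qed (simp add: B_nonneg)
  have bd: "\<bar>clip B a * clip B b\<bar> \<le> B * B" for a b
    unfolding abs_mult by (intro mult_mono clip_le B_nonneg) auto
  have c2: "real (card {a, b}) \<le> 2" for a b :: "int ^ 'm" by (simp add: card_insert_if)
  have "\<bar>cov M (\<lambda>w. clip B (Y u w) * clip B (Y u' w)) (\<lambda>w. clip B (Y v w) * clip B (Y v' w))\<bar>
     \<le> \<kappa> h * (real (card {u, u'}) * (B * B) * (2 * B) + real (card {v, v'}) * (B * B) * (2 * B))"
    by (rule weakly_dependentD[OF wd, where F = "\<lambda>x. clip B (x u) * clip B (x u')" and G = "\<lambda>x. clip B (x v) * clip B (x v')"])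
       (auto simp: bd lip h_def)
  also have "\<dots> \<le> \<kappa> h * (2 * (B * B) * (2 * B) + 2 * (B * B) * (2 * B))"
    using B_nonneg K_nonneg by (intro mult_left_mono add_mono mult_right_mono c2) auto
  also have "\<dots> = 8 * B ^ 3 * \<kappa> h" by (simp add: power3_eq_cube)
  also have "\<dots> \<le> 8 * B ^ 3 * (k (u - v) + k (u - v') + k (u' - v) + k (u' - v'))"
  proof (intro mult_left_mono)
    have "\<kappa> h = k (u - v) \<or> \<kappa> h = k (u - v') \<or> \<kappa> h = k (u' - v) \<or> \<kappa> h = k (u' - v')"
      by (auto simp: h_def k_def min_def)
    thus "\<kappa> h \<le> k (u - v) + k (u - v') + k (u' - v) + k (u' - v')"
      using k_nonneg[of "u - v"] k_nonneg[of "u - v'"] k_nonneg[of "u' - v"] k_nonneg[of "u' - v'"] by linarith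
  qed (simp add: B_nonneg)
  finally show ?thesis by simp
qed

text \<open>The exponential depends on all sites of \<open>J\<close>, and the covariance inequality charges for each of
  them. This linear factor is the reason why \<open>n * \<kappa> q\<close>, and not just \<open>\<kappa> q\<close>, has to vanish in the
  end.\<close>

lemma integral_Y_iexp_le:
  assumes J: "finite J" "\<And>j. j \<in> J \<Longrightarrow> q \<le> norm_inf (u - j)"
  shows "cmod (CLINT w|M. Y u w * iexp (s * (\<Sum>j\<in>J. Y j w))) \<le> 2 * \<kappa> q * (1 + real (card J) * B * \<bar>s\<bar>)"
proof (cases "J = {}")
  case True
  thus ?thesis using K_nonneg by (simp add: Y_mean del: of_real_sum)
next
  case ne: False
  have main: "\<bar>LINT w|M. Y u w * g (s * (\<Sum>j\<in>J. Y j w))\<bar> \<le> \<kappa> q * (1 + real (card J) * B * \<bar>s\<bar>)"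
    if g: "\<And>x. \<bar>g x\<bar> \<le> 1" "\<And>x y. \<bar>g x - g y\<bar> \<le> \<bar>x - y\<bar>" and [measurable]: "g \<in> borel_measurable borel"
    for g :: "real \<Rightarrow> real"
  proof -
    have "\<bar>cov M (\<lambda>w. clip B (Y u w)) (\<lambda>w. g (s * (\<Sum>j\<in>J. Y j w)))\<bar>
       \<le> \<kappa> q * (real (card {u}) * 1 * 1 + real (card J) * B * \<bar>s\<bar>)"
    proof (rule weakly_dependentD[OF wd, where F = "\<lambda>x. clip B (x u)" and G = "\<lambda>x. g (s * (\<Sum>j\<in>J. x j))"])
      show "lipschitz_in J \<bar>s\<bar> (\<lambda>x. g (s * (\<Sum>j\<in>J. x j)))" unfolding lipschitz_in_def
      proof (intro conjI allI)
        fix x y :: "int ^ 'm \<Rightarrow> real"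
        have "\<bar>g (s * (\<Sum>j\<in>J. x j)) - g (s * (\<Sum>j\<in>J. y j))\<bar> \<le> \<bar>s * (\<Sum>j\<in>J. x j) - s * (\<Sum>j\<in>J. y j)\<bar>"
          by (rule g)
        also have "\<dots> = \<bar>s\<bar> * \<bar>\<Sum>j\<in>J. x j - y j\<bar>" by (simp add: right_diff_distrib[symmetric] sum_subtractf abs_mult)
        also have "\<dots> \<le> \<bar>s\<bar> * (\<Sum>j\<in>J. \<bar>x j - y j\<bar>)" by (intro mult_left_mono sum_abs) auto
        finally show "\<bar>g (s * (\<Sum>j\<in>J. x j)) - g (s * (\<Sum>j\<in>J. y j))\<bar> \<le> \<bar>s\<bar> * (\<Sum>j\<in>J. norm (x j - y j))" by simp
      qed simp
    qed (use J ne g in \<open>auto simp: lipschitz_in_def clip_le B_nonneg clip_lipschitz\<close>)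
    moreover have "cov M (\<lambda>w. clip B (Y u w)) (\<lambda>w. g (s * (\<Sum>j\<in>J. Y j w))) = (LINT w|M. Y u w * g (s * (\<Sum>j\<in>J. Y j w)))"
    proof -
      have ig: "integrable M (\<lambda>w. g (s * (\<Sum>j\<in>J. Y j w)))"
        by (rule integrable_const_bound[of _ 1]) (auto simp: g)
      have iyg: "integrable M (\<lambda>w. Y u w * g (s * (\<Sum>j\<in>J. Y j w)))"
        by (rule integrable_const_bound[of _ B]) (auto simp: abs_mult intro!: abs_Y_mult_le g)
      show ?thesis using cov_eq[OF integrable_Y ig iyg] by (simp add: Y_mean)
    qed
    ultimately show ?thesis by simp
  qed
  have ss: "\<bar>sin x - sin y\<bar> \<le> \<bar>x - y\<bar>" "\<bar>cos x - cos y\<bar> \<le> \<bar>x - y\<bar>" for x y :: real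
  proof -
    have *: "\<bar>sin a * b\<bar> \<le> \<bar>a\<bar>" if "\<bar>b\<bar> \<le> 1" for a b :: real
      unfolding abs_mult using mult_mono[OF abs_sin_x_le_abs_x that, of a] by simp
    show "\<bar>sin x - sin y\<bar> \<le> \<bar>x - y\<bar>"
      using *[of "cos ((x + y) / 2)" "(x - y) / 2"] by (simp add: sin_diff_sin abs_mult)
    show "\<bar>cos x - cos y\<bar> \<le> \<bar>x - y\<bar>"
      using *[of "sin ((x + y) / 2)" "(y - x) / 2"] by (simp add: cos_diff_cos abs_mult mult_ac)
  qed
  let ?s = "\<lambda>w. s * (\<Sum>j\<in>J. Y j w)"
  have ic: "integrable M (\<lambda>w. Y u w * cos (?s w))" "integrable M (\<lambda>w. Y u w * sin (?s w))"
    by (rule integrable_const_bound[of _ B], auto simp: abs_mult intro!: abs_Y_mult_le)+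
  have "(CLINT w|M. Y u w * iexp (?s w)) = (CLINT w|M. complex_of_real (Y u w * cos (?s w)) + \<i> * complex_of_real (Y u w * sin (?s w)))"
    by (intro Bochner_Integration.integral_cong refl)
      (auto simp: complex_eq_iff Re_exp Im_exp simp del: of_real_sum of_real_mult)
  also have "\<dots> = complex_of_real (LINT w|M. Y u w * cos (?s w)) + \<i> * complex_of_real (LINT w|M. Y u w * sin (?s w))"
    using ic by (subst Bochner_Integration.integral_add) (auto simp del: of_real_sum of_real_mult)
  also have "cmod \<dots> \<le> \<bar>LINT w|M. Y u w * cos (?s w)\<bar> + \<bar>LINT w|M. Y u w * sin (?s w)\<bar>"
    by (rule norm_triangle_le) (simp add: norm_mult)
  also have "\<dots> \<le> \<kappa> q * (1 + real (card J) * B * \<bar>s\<bar>) + \<kappa> q * (1 + real (card J) * B * \<bar>s\<bar>)"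
    by (intro add_mono main ss) auto
  finally show ?thesis by (simp add: algebra_simps)
qed


text \<open>For a finite index set \<open>D\<close> and a range \<open>q\<close>, the pairs of sites closer than \<open>q\<close> carry the
  variance, while a site and the sites at distance at least \<open>q\<close> from it are almost independent.\<close>

definition near :: "(int ^ 'm) set \<Rightarrow> nat \<Rightarrow> int ^ 'm \<Rightarrow> (int ^ 'm) set" where
  "near D q u = {v \<in> D. norm_inf (u - v) < q}"

definition ballc :: "nat \<Rightarrow> real" where "ballc q = real (ball_card_bound TYPE('m) q)"

definition normsum :: "(int ^ 'm) set \<Rightarrow> 'a \<Rightarrow> real" where
  "normsum D w = (\<Sum>u\<in>D. Y u w) / sqrt (real (card D))"

definition normvar :: "(int ^ 'm) set \<Rightarrow> real" where
  "normvar D = (\<Sum>u\<in>D. \<Sum>v\<in>D. LINT w|M. Y u w * Y v w) / real (card D)"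

definition tail :: "nat \<Rightarrow> real" where
  "tail q = infsum (\<lambda>h. if norm_inf h < q then 0 else k h) UNIV"

text \<open>The first term collects the quadratic remainder of the exponential and the fluctuation of the
  products of near pairs, the second one the dependence across distance \<open>q\<close>, the last one the part of
  the variance that pairs beyond distance \<open>q\<close> carry.\<close>

definition rate :: "nat \<Rightarrow> nat \<Rightarrow> real" where
  "rate n q = (B\<^sup>2 * infsum k UNIV + sqrt (32 * B ^ 3 * infsum k UNIV)) * (ballc q / sqrt (real n))
     + 2 * (1 + B) * (real n * \<kappa> q) + 2 * B * tail q"

lemma card_near_le:
  assumes "finite D"
  shows "real (card (near D q u)) \<le> ballc q"
proof -
  have "near D q u \<subseteq> (\<lambda>h. u - h) ` {h. norm_inf h \<le> q}"
  proof
    fix v assume "v \<in> near D q u"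
    hence "u - v \<in> {h. norm_inf h \<le> q}" by (auto simp: near_def)
    hence "u - (u - v) \<in> (\<lambda>h. u - h) ` {h. norm_inf h \<le> q}" by (rule imageI)
    thus "v \<in> (\<lambda>h. u - h) ` {h. norm_inf h \<le> q}" by simp
  qed
  hence "card (near D q u) \<le> card ((\<lambda>h. u - h) ` {h :: int ^ 'm. norm_inf h \<le> q})"
    by (intro card_mono finite_imageI card_norm_inf_ball)
  also have "\<dots> \<le> card {h :: int ^ 'm. norm_inf h \<le> q}" by (intro card_image_le card_norm_inf_ball)
  also have "\<dots> \<le> ball_card_bound TYPE('m) q" by (rule card_norm_inf_ball)
  finally show ?thesis by (simp add: ballc_def)
qed

lemma sum_near_le:
  fixes f :: "int ^ 'm \<Rightarrow> real"
  assumes D: "finite D" and f: "\<And>u. f u \<ge> 0"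
  shows "(\<Sum>e\<in>Sigma D (near D q). f (fst e)) \<le> ballc q * (\<Sum>u\<in>D. f u)"
    and "(\<Sum>e\<in>Sigma D (near D q). f (snd e)) \<le> ballc q * (\<Sum>u\<in>D. f u)"
proof -
  have fn: "finite (near D q u)" for u using D by (simp add: near_def)
  show 1: "(\<Sum>e\<in>Sigma D (near D q). f (fst e)) \<le> ballc q * (\<Sum>u\<in>D. f u)"
  proof -
    have "(\<Sum>e\<in>Sigma D (near D q). f (fst e)) = (\<Sum>u\<in>D. real (card (near D q u)) * f u)"
      using D fn by (subst sum.Sigma[symmetric, of D "near D q" "\<lambda>u v. f u", simplified case_prod_unfold]) auto
    also have "\<dots> \<le> (\<Sum>u\<in>D. ballc q * f u)"
      by (intro sum_mono mult_right_mono card_near_le D f)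
    finally show ?thesis by (simp add: sum_distrib_left)
  qed
  have "(\<Sum>e\<in>Sigma D (near D q). f (snd e)) = (\<Sum>e\<in>Sigma D (near D q). f (fst e))"
    by (rule sum.reindex_bij_witness[of _ prod.swap prod.swap])
       (auto simp: near_def norm_inf_minus_commute)
  with 1 show "(\<Sum>e\<in>Sigma D (near D q). f (snd e)) \<le> ballc q * (\<Sum>u\<in>D. f u)" by simp
qed

lemma ballc_nonneg: "ballc q \<ge> 0" by (simp add: ballc_def)

lemma sum_k_le:
  assumes "finite D" "finite E"
  shows "(\<Sum>u\<in>D. \<Sum>v\<in>E. k (u - v)) \<le> real (card D) * infsum k UNIV"
  using sum_sum_differences_le[OF assms(1) k_summable k_nonneg assms(2)] by (simp add: k_minus)

text \<open>Summed over all pairs of near pairs, each of the four terms of the covariance bound leaves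
  one free near neighbour in either pair, hence the square of the ball size.\<close>

lemma variance_near_products_le:
  fixes q :: nat
  assumes D: "finite D"
  defines "E \<equiv> Sigma D (near D q)"
  defines "W \<equiv> \<lambda>w. \<Sum>e\<in>E. Y (fst e) w * Y (snd e) w"
  shows "(LINT w|M. (W w - (LINT w|M. W w))\<^sup>2) \<le> 32 * B ^ 3 * infsum k UNIV * (real (card D) * (ballc q)\<^sup>2)"
proof -
  have sq: "integrable M (\<lambda>w. (Y (fst e) w * Y (snd e) w)\<^sup>2)" for e
    by (rule integrable_const_bound[of _ "(B * B)\<^sup>2"])
       (auto intro!: AE_I2 norm_square_le abs_YY_le simp del: real_norm_def)
  have 1: "(\<Sum>e\<in>E. \<Sum>e'\<in>E. k (p e - r e')) \<le> (ballc q)\<^sup>2 * (real (card D) * infsum k UNIV)"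
    if p: "p = fst \<or> p = snd" and r: "r = fst \<or> r = snd" for p r :: "(int ^ 'm) \<times> (int ^ 'm) \<Rightarrow> int ^ 'm"
  proof -
    have "(\<Sum>e'\<in>E. k (x - r e')) \<le> ballc q * (\<Sum>v\<in>D. k (x - v))" for x
      using sum_near_le[OF D, of "\<lambda>v. k (x - v)" q] k_nonneg r unfolding E_def by auto
    hence "(\<Sum>e\<in>E. \<Sum>e'\<in>E. k (p e - r e')) \<le> (\<Sum>e\<in>E. ballc q * (\<Sum>v\<in>D. k (p e - v)))"
      by (intro sum_mono)
    also have "\<dots> = ballc q * (\<Sum>e\<in>E. \<Sum>v\<in>D. k (p e - v))" by (simp add: sum_distrib_left)
    also have "\<dots> \<le> ballc q * (ballc q * (\<Sum>u\<in>D. \<Sum>v\<in>D. k (u - v)))"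
    proof (rule mult_left_mono[OF _ ballc_nonneg])
      show "(\<Sum>e\<in>E. \<Sum>v\<in>D. k (p e - v)) \<le> ballc q * (\<Sum>u\<in>D. \<Sum>v\<in>D. k (u - v))"
        using sum_near_le[OF D, of "\<lambda>u. \<Sum>v\<in>D. k (u - v)" q] k_nonneg p
        unfolding E_def by (auto simp: sum_nonneg)
    qed
    also have "\<dots> \<le> ballc q * (ballc q * (real (card D) * infsum k UNIV))"
      by (intro mult_left_mono sum_k_le D ballc_nonneg)
    finally show ?thesis by (simp add: power2_eq_square mult_ac)
  qed
  have "(LINT w|M. (W w - (LINT w|M. W w))\<^sup>2)
     = (\<Sum>e\<in>E. \<Sum>e'\<in>E. cov M (\<lambda>w. Y (fst e) w * Y (snd e) w) (\<lambda>w. Y (fst e') w * Y (snd e') w))"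
    unfolding W_def by (rule variance_sum_eq) (auto intro: sq)
  also have "\<dots> \<le> (\<Sum>e\<in>E. \<Sum>e'\<in>E. 8 * B ^ 3 * (k (fst e - fst e') + k (fst e - snd e') + k (snd e - fst e') + k (snd e - snd e')))"
    by (intro sum_mono order_trans[OF abs_ge_self cov_YY_le])
  also have "\<dots> = 8 * B ^ 3 * ((\<Sum>e\<in>E. \<Sum>e'\<in>E. k (fst e - fst e')) + (\<Sum>e\<in>E. \<Sum>e'\<in>E. k (fst e - snd e'))
      + (\<Sum>e\<in>E. \<Sum>e'\<in>E. k (snd e - fst e')) + (\<Sum>e\<in>E. \<Sum>e'\<in>E. k (snd e - snd e')))"
    by (simp add: sum.distrib sum_distrib_left[symmetric])
  also have "\<dots> \<le> 8 * B ^ 3 * ((ballc q)\<^sup>2 * (real (card D) * infsum k UNIV) + (ballc q)\<^sup>2 * (real (card D) * infsum k UNIV)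
      + (ballc q)\<^sup>2 * (real (card D) * infsum k UNIV) + (ballc q)\<^sup>2 * (real (card D) * infsum k UNIV))"
    by (intro mult_left_mono add_mono 1) (auto simp: B_nonneg)
  finally show ?thesis by (simp add: algebra_simps)
qed

lemma tail_nonneg: "tail q \<ge> 0"
  unfolding tail_def by (intro infsum_nonneg) (auto simp: k_nonneg)

lemma tail_summable: "(\<lambda>h. if norm_inf h < q then 0 else k h) summable_on UNIV"
  by (rule summable_on_comparison_test[OF k_summable]) (auto simp: k_nonneg)

lemma normvar_near_le:
  fixes q :: nat
  assumes D: "finite D" "D \<noteq> {}"
  defines "E \<equiv> Sigma D (near D q)"
  shows "\<bar>(LINT w|M. (\<Sum>e\<in>E. Y (fst e) w * Y (snd e) w)) / real (card D) - normvar D\<bar> \<le> 2 * B * tail q"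
proof -
  have n: "real (card D) > 0" using D by (simp add: card_gt_0_iff)
  have fn: "finite (near D q u)" "near D q u \<subseteq> D" for u using D by (auto simp: near_def)
  have "(LINT w|M. (\<Sum>e\<in>E. Y (fst e) w * Y (snd e) w)) = (\<Sum>e\<in>E. LINT w|M. Y (fst e) w * Y (snd e) w)"
    by (intro Bochner_Integration.integral_sum integrable_YY)
  also have "\<dots> = (\<Sum>u\<in>D. \<Sum>v\<in>near D q u. LINT w|M. Y u w * Y v w)"
    unfolding E_def using D fn
    by (subst sum.Sigma[of D "near D q" "\<lambda>u v. LINT w|M. Y u w * Y v w"]) (auto simp: case_prod_unfold)
  finally have e: "(LINT w|M. (\<Sum>e\<in>E. Y (fst e) w * Y (snd e) w)) = (\<Sum>u\<in>D. \<Sum>v\<in>near D q u. LINT w|M. Y u w * Y v w)" .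
  have "\<bar>(\<Sum>u\<in>D. \<Sum>v\<in>near D q u. LINT w|M. Y u w * Y v w) - (\<Sum>u\<in>D. \<Sum>v\<in>D. LINT w|M. Y u w * Y v w)\<bar>
     = \<bar>\<Sum>u\<in>D. \<Sum>v\<in>D - near D q u. LINT w|M. Y u w * Y v w\<bar>"
    using D fn by (simp add: sum_diff sum_subtractf)
  also have "\<dots> \<le> (\<Sum>u\<in>D. \<Sum>v\<in>D - near D q u. \<bar>LINT w|M. Y u w * Y v w\<bar>)"
    by (rule order_trans[OF sum_abs], rule sum_mono, rule sum_abs)
  also have "\<dots> \<le> (\<Sum>u\<in>D. \<Sum>v\<in>D - near D q u. 2 * B * k (u - v))"
    by (intro sum_mono integral_YY_le)
  also have "\<dots> = (\<Sum>u\<in>D. \<Sum>v\<in>D. 2 * B * (if norm_inf (v - u) < q then 0 else k (v - u)))"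
  proof (rule sum.cong[OF refl])
    fix u
    have "(\<Sum>v\<in>D. 2 * B * (if norm_inf (v - u) < q then 0 else k (v - u)))
        = (\<Sum>v\<in>D - near D q u. 2 * B * (if norm_inf (v - u) < q then 0 else k (v - u)))"
      using D by (intro sum.mono_neutral_right) (auto simp: near_def norm_inf_minus_commute)
    also have "\<dots> = (\<Sum>v\<in>D - near D q u. 2 * B * k (u - v))"
      by (intro sum.cong) (auto simp: near_def norm_inf_minus_commute k_minus)
    finally show "(\<Sum>v\<in>D - near D q u. 2 * B * k (u - v)) = (\<Sum>v\<in>D. 2 * B * (if norm_inf (v - u) < q then 0 else k (v - u)))" by simp
  qed
  also have "\<dots> = 2 * B * (\<Sum>u\<in>D. \<Sum>v\<in>D. (if norm_inf (v - u) < q then 0 else k (v - u)))"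
    by (simp add: sum_distrib_left)
  also have "\<dots> \<le> 2 * B * (real (card D) * tail q)"
    unfolding tail_def using D B_nonneg k_nonneg tail_summable
    by (intro mult_left_mono sum_sum_differences_le[of D "\<lambda>h. if norm_inf h < q then 0 else k h"]) auto
  finally have "\<bar>(\<Sum>u\<in>D. \<Sum>v\<in>near D q u. LINT w|M. Y u w * Y v w) - (\<Sum>u\<in>D. \<Sum>v\<in>D. LINT w|M. Y u w * Y v w)\<bar> / real (card D)
     \<le> 2 * B * tail q"
    using n by (simp add: divide_le_eq mult_ac)
  moreover have "(LINT w|M. (\<Sum>e\<in>E. Y (fst e) w * Y (snd e) w)) / real (card D) - normvar D
     = ((\<Sum>u\<in>D. \<Sum>v\<in>near D q u. LINT w|M. Y u w * Y v w) - (\<Sum>u\<in>D. \<Sum>v\<in>D. LINT w|M. Y u w * Y v w)) / real (card D)"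
    unfolding e normvar_def by (simp add: diff_divide_distrib)
  ultimately show ?thesis using n by (simp add: abs_divide)
qed

text \<open>Stein's identity up to an error. With \<open>S\<close> the normalised sum and \<open>L u\<close> the part of it
  near \<open>u\<close>, the exponential is expanded around \<open>S - L u\<close>: the remainder is quadratic in \<open>L u\<close>, the
  term with \<open>S - L u\<close> is small by weak dependence, and the linear term reproduces the variance.\<close>

lemma stein_identity_approx:
  assumes D: "finite D" "D \<noteq> {}"
  shows "cmod ((CLINT w|M. normsum D w * iexp (t * normsum D w)) - \<i> * t * normvar D * (CLINT w|M. iexp (t * normsum D w)))
       \<le> (1 + t\<^sup>2) * rate (card D) q"
proof -
  define n where "n = real (card D)"
  have n: "n > 0" using D by (simp add: n_def card_gt_0_iff)
  have n1: "n \<ge> 1" using D unfolding n_def by (simp add: Suc_le_eq card_gt_0_iff)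
  define c where "c = 1 / sqrt n"
  have c: "c > 0" "c * c * n = 1" using n by (simp_all add: c_def)
  define E where "E = Sigma D (near D q)"
  define Sk where "Sk = infsum k UNIV"
  have Sk: "Sk \<ge> 0" using k_sum_nonneg by (simp add: Sk_def)
  define bl where "bl = ballc q"
  have bl: "bl \<ge> 0" using ballc_nonneg by (simp add: bl_def)
  have fn: "finite (near D q u)" "near D q u \<subseteq> D" for u using D by (auto simp: near_def)
  define S where "S w = normsum D w" for w
  have S_eq: "S w = c * (\<Sum>u\<in>D. Y u w)" for w by (simp add: S_def normsum_def c_def n_def)
  have [measurable]: "S \<in> borel_measurable M" unfolding S_eq[abs_def] by measurable
  define L where "L u w = c * (\<Sum>v\<in>near D q u. Y v w)" for u w
  have [measurable]: "L u \<in> borel_measurable M" for u unfolding L_def by measurable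
  define W where "W w = c * c * (\<Sum>e\<in>E. Y (fst e) w * Y (snd e) w)" for w
  have [measurable]: "W \<in> borel_measurable M" unfolding W_def by measurable
  have W_eq: "W w = c * (\<Sum>u\<in>D. Y u w * L u w)" for w
    unfolding W_def L_def E_def using D fn
    by (subst sum.Sigma[symmetric, of D "near D q" "\<lambda>u v. Y u w * Y v w", simplified case_prod_unfold])
       (auto simp: sum_distrib_left mult_ac)
  define v where "v = normvar D"
  define e where "e w = iexp (t * S w)" for w
  have [measurable]: "e \<in> borel_measurable M" unfolding e_def by measurable
  have e1: "cmod (e w) = 1" for w by (simp add: e_def)
  define R where "R u w = e w - iexp (t * (S w - L u w)) - \<i> * t * L u w * e w" for u w
  have R_bound: "cmod (R u w) \<le> t\<^sup>2 / 2 * (L u w)\<^sup>2" for u w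
  proof -
    let ?x = "- (t * L u w)"
    have "iexp (t * (S w - L u w)) = e w * iexp ?x"
    proof -
      have "\<i> * complex_of_real (t * (S w - L u w)) = \<i> * complex_of_real (t * S w) + \<i> * complex_of_real ?x"
        by (simp add: algebra_simps)
      thus ?thesis by (simp only: exp_add e_def)
    qed
    hence "R u w = - e w * (iexp ?x - (\<Sum>k\<le>1. (\<i> * ?x) ^ k / fact k))"
      by (simp add: R_def algebra_simps)
    hence "cmod (R u w) = cmod (iexp ?x - (\<Sum>k\<le>1. (\<i> * ?x) ^ k / fact k))" by (simp add: norm_mult e1)
    also have "\<dots> \<le> \<bar>?x\<bar> ^ Suc 1 / fact (Suc 1)" by (rule iexp_approx1)
    also have "\<dots> = t\<^sup>2 / 2 * (L u w)\<^sup>2" by (simp add: power2_eq_square abs_mult[symmetric])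
    finally show ?thesis .
  qed
  have sum_bound: "\<bar>\<Sum>u\<in>A. Y u w\<bar> \<le> real (card A) * B" for A w
    using order_trans[OF sum_abs sum_mono[of A "\<lambda>u. \<bar>Y u w\<bar>" "\<lambda>_. B"]] by (simp add: Y_bound)
  have S_bound: "\<bar>S w\<bar> \<le> c * (n * B)" for w
    unfolding S_eq abs_mult n_def using c sum_bound by (simp add: mult_left_mono)
  have L_bound: "\<bar>L u w\<bar> \<le> c * (real (card (near D q u)) * B)" for u w
    unfolding L_def abs_mult using c sum_bound by (simp add: mult_left_mono)
  have W_bound: "\<bar>W w\<bar> \<le> c * c * (real (card E) * (B * B))" for w
  proof -
    have "\<bar>\<Sum>e\<in>E. Y (fst e) w * Y (snd e) w\<bar> \<le> (\<Sum>e\<in>E. B * B)"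
      by (rule order_trans[OF sum_abs], rule sum_mono, rule abs_YY_le)
    thus ?thesis unfolding W_def abs_mult using c by (simp add: mult_left_mono)
  qed
  have iW: "integrable M W" by (rule integrable_const_bound) (use W_bound in auto)
  have iWe: "integrable M (\<lambda>w. (W w - v) * e w)"
    by (rule integrable_const_bound[of _ "c * c * (real (card E) * (B * B)) + \<bar>v\<bar>"])
       (auto simp: norm_mult e1 simp flip: of_real_diff intro!: AE_I2 order_trans[OF abs_triangle_ineq4] add_mono W_bound)
  have ie: "integrable M e" by (rule integrable_const_bound[of _ 1]) (auto simp: e1)
  have iYR: "integrable M (\<lambda>w. Y u w * R u w)" for u
  proof (rule Bochner_Integration.integrable_bound)
    show "integrable M (\<lambda>w. B * (t\<^sup>2 / 2 * (L u w)\<^sup>2))"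
      by (rule integrable_const_bound[of _ "B * (t\<^sup>2 / 2 * (c * (real (card (near D q u)) * B))\<^sup>2)"])
         (auto simp: B_nonneg abs_mult intro!: AE_I2 mult_left_mono norm_square_le[unfolded real_norm_def abs_power2] L_bound)
    show "AE w in M. norm (Y u w * R u w) \<le> norm (B * (t\<^sup>2 / 2 * (L u w)\<^sup>2))"
      using mult_mono[OF Y_bound R_bound B_nonneg] by (auto simp: norm_mult abs_mult B_nonneg)
  qed (unfold R_def, measurable)
  have iYs: "integrable M (\<lambda>w. Y u w * iexp (t * (S w - L u w)))" for u
    by (rule integrable_const_bound[of _ B]) (auto simp: norm_mult Y_bound)
  have decomp: "S w * e w - \<i> * t * v * e w = c * (\<Sum>u\<in>D. Y u w * R u w) + c * (\<Sum>u\<in>D. Y u w * iexp (t * (S w - L u w)))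
      + \<i> * t * ((W w - v) * e w)" for w
  proof -
    have "S w * e w = c * (\<Sum>u\<in>D. Y u w * e w)" by (simp add: S_eq sum_distrib_right mult.assoc)
    also have "\<dots> = c * (\<Sum>u\<in>D. Y u w * R u w + Y u w * iexp (t * (S w - L u w)) + \<i> * t * e w * (Y u w * L u w))"
      by (intro arg_cong[where f = "\<lambda>x. complex_of_real c * x"] sum.cong refl) (simp add: R_def algebra_simps)
    also have "\<dots> = c * (\<Sum>u\<in>D. Y u w * R u w) + c * (\<Sum>u\<in>D. Y u w * iexp (t * (S w - L u w))) + \<i> * t * e w * W w"
      by (simp add: W_eq sum.distrib sum_distrib_left algebra_simps)
    finally show ?thesis by (simp add: algebra_simps)
  qed
  have EL2: "(LINT w|M. (L u w)\<^sup>2) \<le> 2 * B * bl * Sk / n" for u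
  proof -
    have "(L u w)\<^sup>2 = c * c * (\<Sum>a\<in>near D q u. \<Sum>b\<in>near D q u. Y a w * Y b w)" for w
      by (simp add: L_def power2_eq_square sum_product mult_ac)
    hence "(LINT w|M. (L u w)\<^sup>2) = c * c * (\<Sum>a\<in>near D q u. \<Sum>b\<in>near D q u. LINT w|M. Y a w * Y b w)"
      using integrable_YY by (simp add: Bochner_Integration.integral_sum)
    also have "\<dots> \<le> c * c * (\<Sum>a\<in>near D q u. \<Sum>b\<in>near D q u. 2 * B * k (a - b))"
      using c by (intro mult_left_mono sum_mono order_trans[OF abs_ge_self integral_YY_le]) auto
    also have "\<dots> = c * c * (2 * B * (\<Sum>a\<in>near D q u. \<Sum>b\<in>near D q u. k (a - b)))"
      by (simp add: sum_distrib_left)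
    also have "\<dots> \<le> c * c * (2 * B * (bl * Sk))"
      using c B_nonneg Sk card_near_le[OF D(1)] fn unfolding Sk_def bl_def
      by (intro mult_left_mono order_trans[OF sum_k_le] mult_right_mono) auto
    also have "\<dots> = 2 * B * bl * Sk / n" using n by (simp add: c_def)
    finally show ?thesis .
  qed
  have T1: "cmod (CLINT w|M. Y u w * R u w) \<le> B * (t\<^sup>2 / 2 * (2 * B * bl * Sk / n))" for u
  proof -
    have iL2: "integrable M (\<lambda>w. (L u w)\<^sup>2)"
      by (rule integrable_const_bound[of _ "(c * (real (card (near D q u)) * B))\<^sup>2"])
         (auto intro!: AE_I2 norm_square_le L_bound simp del: real_norm_def)
    have "cmod (CLINT w|M. Y u w * R u w) \<le> (LINT w|M. cmod (Y u w * R u w))" by (rule integral_norm_bound)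
    also have "\<dots> \<le> (LINT w|M. B * (t\<^sup>2 / 2 * (L u w)\<^sup>2))"
    proof (rule integral_mono)
      show "integrable M (\<lambda>w. cmod (Y u w * R u w))" using iYR by (rule integrable_norm)
      show "integrable M (\<lambda>w. B * (t\<^sup>2 / 2 * (L u w)\<^sup>2))" using iL2 by simp
      show "cmod (Y u w * R u w) \<le> B * (t\<^sup>2 / 2 * (L u w)\<^sup>2)" for w
        unfolding norm_mult using mult_mono[OF Y_bound R_bound B_nonneg] by simp
    qed
    also have "\<dots> = B * (t\<^sup>2 / 2 * (LINT w|M. (L u w)\<^sup>2))" by simp
    also have "\<dots> \<le> B * (t\<^sup>2 / 2 * (2 * B * bl * Sk / n))"
      using EL2 B_nonneg by (intro mult_left_mono) auto
    finally show ?thesis .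
  qed
  have T2: "cmod (CLINT w|M. Y u w * iexp (t * (S w - L u w))) \<le> 2 * \<kappa> q * (1 + n * B * (\<bar>t\<bar> * c))" for u
  proof -
    have "t * (S w - L u w) = (t * c) * (\<Sum>j\<in>D - near D q u. Y j w)" for w
      using D fn by (simp add: S_eq L_def sum_diff algebra_simps)
    hence "cmod (CLINT w|M. Y u w * iexp (t * (S w - L u w))) = cmod (CLINT w|M. Y u w * iexp ((t * c) * (\<Sum>j\<in>D - near D q u. Y j w)))"
      by (simp only:)
    also have "\<dots> \<le> 2 * \<kappa> q * (1 + real (card (D - near D q u)) * B * \<bar>t * c\<bar>)"
      using D by (intro integral_Y_iexp_le) (auto simp: near_def)
    also have "\<dots> \<le> 2 * \<kappa> q * (1 + n * B * (\<bar>t\<bar> * c))"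
      using D c B_nonneg K_nonneg unfolding n_def abs_mult
      by (intro mult_left_mono add_left_mono mult_mono) (auto intro: card_mono)
    finally show ?thesis .
  qed
  have T3: "cmod (CLINT w|M. (W w - v) * e w) \<le> sqrt (32 * B ^ 3 * Sk) * (bl * c) + 2 * B * tail q"
  proof -
    define W0 where "W0 w = (\<Sum>e\<in>E. Y (fst e) w * Y (snd e) w)" for w
    have [measurable]: "W0 \<in> borel_measurable M" unfolding W0_def by measurable
    have WW0: "W w = c * c * W0 w" for w by (simp add: W_def W0_def)
    have EW: "(LINT w|M. W w) = (LINT w|M. W0 w) / n" unfolding WW0 using n by (simp add: c_def)
    have iabs: "integrable M (\<lambda>w. \<bar>W w - (LINT w|M. W w)\<bar>)" using iW by simp
    have sq: "integrable M (\<lambda>w. (W w - (LINT w|M. W w))\<^sup>2)"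
      by (rule integrable_const_bound[of _ "(c * c * (real (card E) * (B * B)) + \<bar>LINT w|M. W w\<bar>)\<^sup>2"])
         (auto intro!: AE_I2 norm_square_le order_trans[OF abs_triangle_ineq4] add_mono W_bound simp del: real_norm_def)
    have "(LINT w|M. (W w - (LINT w|M. W w))\<^sup>2) = (c * c)\<^sup>2 * (LINT w|M. (W0 w - (LINT w|M. W0 w))\<^sup>2)"
    proof -
      have "(W w - (LINT w|M. W w))\<^sup>2 = (c * c)\<^sup>2 * (W0 w - (LINT w|M. W0 w))\<^sup>2" for w
        unfolding WW0 by (simp add: power_mult_distrib[symmetric] right_diff_distrib)
      thus ?thesis by simp
    qed
    also have "\<dots> \<le> (c * c)\<^sup>2 * (32 * B ^ 3 * Sk * (n * bl\<^sup>2))"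
      using variance_near_products_le[OF D(1), of q] unfolding W0_def E_def Sk_def n_def bl_def
      by (intro mult_left_mono) auto
    also have "\<dots> = 32 * B ^ 3 * Sk * (bl * c)\<^sup>2"
      using c(2) by (simp add: power2_eq_square mult_ac)
    finally have var: "(LINT w|M. (W w - (LINT w|M. W w))\<^sup>2) \<le> 32 * B ^ 3 * Sk * (bl * c)\<^sup>2" .
    have "cmod (CLINT w|M. (W w - v) * e w) \<le> (LINT w|M. cmod ((W w - v) * e w))" by (rule integral_norm_bound)
    also have "\<dots> \<le> (LINT w|M. \<bar>W w - (LINT w|M. W w)\<bar> + \<bar>(LINT w|M. W w) - v\<bar>)"
    proof (rule integral_mono)
      show "integrable M (\<lambda>w. cmod ((W w - v) * e w))" using iWe by (rule integrable_norm)
      show "integrable M (\<lambda>w. \<bar>W w - (LINT w|M. W w)\<bar> + \<bar>(LINT w|M. W w) - v\<bar>)" using iabs by simp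
      show "cmod ((W w - v) * e w) \<le> \<bar>W w - (LINT w|M. W w)\<bar> + \<bar>(LINT w|M. W w) - v\<bar>" for w
        unfolding norm_mult e1 by (simp flip: of_real_diff)
    qed
    also have "\<dots> = (LINT w|M. \<bar>W w - (LINT w|M. W w)\<bar>) + \<bar>(LINT w|M. W w) - v\<bar>"
      using iabs by (simp add: prob_space)
    also have "\<dots> \<le> sqrt (LINT w|M. (W w - (LINT w|M. W w))\<^sup>2) + 2 * B * tail q"
    proof (rule add_mono)
      show "(LINT w|M. \<bar>W w - (LINT w|M. W w)\<bar>) \<le> sqrt (LINT w|M. (W w - (LINT w|M. W w))\<^sup>2)"
        by (rule expectation_abs_le_sqrt[OF _ sq]) simp
      show "\<bar>(LINT w|M. W w) - v\<bar> \<le> 2 * B * tail q"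
        using normvar_near_le[OF D, of q] unfolding EW v_def W0_def E_def n_def by simp
    qed
    also have "sqrt (LINT w|M. (W w - (LINT w|M. W w))\<^sup>2) \<le> sqrt (32 * B ^ 3 * Sk * (bl * c)\<^sup>2)"
      using var by simp
    also have "\<dots> = sqrt (32 * B ^ 3 * Sk) * (bl * c)"
      using bl c by (simp add: real_sqrt_mult)
    finally show ?thesis by simp
  qed
  have "(CLINT w|M. S w * e w) - \<i> * t * v * (CLINT w|M. e w) = (CLINT w|M. S w * e w - \<i> * t * v * e w)"
  proof -
    have "integrable M (\<lambda>w. S w * e w)"
      by (rule integrable_const_bound[of _ "c * (n * B)"])
         (auto simp: norm_mult e1 S_bound)
    thus ?thesis using ie by (simp add: Bochner_Integration.integral_diff)
  qed
  also have "\<dots> = c * (\<Sum>u\<in>D. CLINT w|M. Y u w * R u w) + c * (\<Sum>u\<in>D. CLINT w|M. Y u w * iexp (t * (S w - L u w)))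
      + \<i> * t * (CLINT w|M. (W w - v) * e w)"
    unfolding decomp using iYR iYs iWe
    by (simp add: Bochner_Integration.integral_sum Bochner_Integration.integral_add
        Bochner_Integration.integrable_sum Bochner_Integration.integrable_add del: of_real_diff)
  also have "cmod \<dots> \<le> c * (\<Sum>u\<in>D. cmod (CLINT w|M. Y u w * R u w)) + c * (\<Sum>u\<in>D. cmod (CLINT w|M. Y u w * iexp (t * (S w - L u w))))
      + \<bar>t\<bar> * cmod (CLINT w|M. (W w - v) * e w)"
    using c by (intro norm_triangle_le add_mono) (auto simp: norm_mult intro!: mult_left_mono norm_sum)
  also have "\<dots> \<le> c * (\<Sum>u\<in>D. B * (t\<^sup>2 / 2 * (2 * B * bl * Sk / n))) + c * (\<Sum>u\<in>D. 2 * \<kappa> q * (1 + n * B * (\<bar>t\<bar> * c)))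
      + \<bar>t\<bar> * (sqrt (32 * B ^ 3 * Sk) * (bl * c) + 2 * B * tail q)"
    using c by (intro add_mono mult_left_mono sum_mono T1 T2 T3) auto
  also have "\<dots> = t\<^sup>2 * (B\<^sup>2 * Sk * (bl * c)) + 2 * \<kappa> q * (c * n + n * B * \<bar>t\<bar>)
      + \<bar>t\<bar> * (sqrt (32 * B ^ 3 * Sk) * (bl * c) + 2 * B * tail q)"
  proof -
    have "c * (\<Sum>u\<in>D. 2 * \<kappa> q * (1 + n * B * (\<bar>t\<bar> * c))) = 2 * \<kappa> q * (c * n + (c * c * n) * n * B * \<bar>t\<bar>)"
      by (simp add: n_def algebra_simps)
    moreover have "c * (\<Sum>u\<in>D. B * (t\<^sup>2 / 2 * (2 * B * bl * Sk / n))) = t\<^sup>2 * (B\<^sup>2 * Sk * (bl * c))"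
      using n by (simp add: n_def[symmetric] power2_eq_square)
    ultimately show ?thesis using c(2) by simp
  qed
  also have "\<dots> \<le> (1 + t\<^sup>2) * (B\<^sup>2 * Sk * (bl * c)) + (1 + t\<^sup>2) * (2 * \<kappa> q * (n + n * B))
      + (1 + t\<^sup>2) * (sqrt (32 * B ^ 3 * Sk) * (bl * c) + 2 * B * tail q)"
  proof -
    have t: "\<bar>t\<bar> \<le> 1 + t\<^sup>2"
    proof -
      have "0 \<le> (\<bar>t\<bar> - 1)\<^sup>2" by simp
      hence "2 * \<bar>t\<bar> \<le> 1 + t\<^sup>2" by (simp add: power2_diff)
      thus ?thesis by simp
    qed
    have cn: "c * n \<le> n" using n1 n by (simp add: c_def divide_le_eq)
    have "c * n + n * B * \<bar>t\<bar> \<le> (1 + t\<^sup>2) * (n + n * B)"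
    proof -
      have "c * n \<le> (1 + t\<^sup>2) * n" using cn n by (smt (verit) mult_le_cancel_right1 zero_le_power2)
      moreover have "n * B * \<bar>t\<bar> \<le> n * B * (1 + t\<^sup>2)" using t n B_nonneg by (intro mult_left_mono) auto
      ultimately show ?thesis by (simp add: algebra_simps)
    qed
    hence 2: "2 * \<kappa> q * (c * n + n * B * \<bar>t\<bar>) \<le> (1 + t\<^sup>2) * (2 * \<kappa> q * (n + n * B))"
      using mult_left_mono[of "c * n + n * B * \<bar>t\<bar>" "(1 + t\<^sup>2) * (n + n * B)" "2 * \<kappa> q"] K_nonneg
      by (simp add: mult_ac)
    have "0 \<le> sqrt (32 * B ^ 3 * Sk) * (bl * c) + 2 * B * tail q"
      using bl c Sk B_nonneg tail_nonneg by auto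
    with 2 t show ?thesis using bl c Sk B_nonneg by (intro add_mono mult_right_mono) auto
  qed
  also have "\<dots> = (1 + t\<^sup>2) * rate (card D) q"
    unfolding rate_def Sk_def[symmetric] bl_def[symmetric] n_def[symmetric] c_def by (simp add: algebra_simps)
  finally show ?thesis unfolding S_def e_def v_def .
qed

lemma normvar_eq: "normvar D = (LINT w|M. (normsum D w)\<^sup>2)"
proof -
  have "(normsum D w)\<^sup>2 = (\<Sum>u\<in>D. \<Sum>v\<in>D. Y u w * Y v w) / real (card D)" for w
    by (simp add: normsum_def power_divide power2_eq_square sum_product)
  thus ?thesis using integrable_YY by (simp add: normvar_def Bochner_Integration.integral_sum)
qed

lemma rate_nonneg: "rate n q \<ge> 0"
  unfolding rate_def using B_nonneg ballc_nonneg K_nonneg tail_nonneg k_sum_nonneg by auto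

theorem char_normsum_approx:
  assumes D: "finite D" "D \<noteq> {}"
  shows "cmod ((CLINT w|M. iexp (t * normsum D w)) - exp (- (normvar D * t\<^sup>2 / 2))) \<le> \<bar>t\<bar> * (1 + t\<^sup>2) * rate (card D) q"
proof (rule char_close_to_gaussian_of_stein[where C = "real (card D) * B / sqrt (real (card D))"])
  show "normsum D \<in> borel_measurable M" unfolding normsum_def by measurable
  show "\<bar>normsum D w\<bar> \<le> real (card D) * B / sqrt (real (card D))" for w
    unfolding normsum_def abs_divide
    using order_trans[OF sum_abs sum_mono[of D "\<lambda>u. \<bar>Y u w\<bar>" "\<lambda>_. B"]] by (auto simp: Y_bound intro!: divide_right_mono)
  show "0 \<le> normvar D" unfolding normvar_eq by (rule Bochner_Integration.integral_nonneg) simp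
qed (use stein_identity_approx[OF D] rate_nonneg in auto)

end


section \<open>Lattice sums along growing sets\<close>

text \<open>For fixed \<open>u \<in> D\<close> the inner sum misses the differences \<open>h\<close> with \<open>u + h \<notin> D\<close>. For each \<open>h\<close> of a
  finite set only a boundary-sized set of points \<open>u\<close> is affected, and the other \<open>h\<close> contribute
  little to the sum.\<close>

lemma mean_of_difference_sums_tendsto:
  fixes c :: "int ^ 'm::finite \<Rightarrow> real"
  assumes c: "(\<lambda>h. \<bar>c h\<bar>) summable_on UNIV"
    and D: "\<And>N. finite (D N)" "filterlim (\<lambda>N. card (D N)) at_top sequentially"
    and bd: "(\<lambda>N. real (card (lattice_boundary (D N))) / real (card (D N))) \<longlonglongrightarrow> 0"
  shows "(\<lambda>N. (\<Sum>u\<in>D N. \<Sum>v\<in>D N. c (v - u)) / real (card (D N))) \<longlonglongrightarrow> infsum c UNIV"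
proof (rule LIMSEQ_I)
  fix r :: real assume r: "r > 0"
  define S where "S = infsum c UNIV"
  have cs: "c summable_on UNIV" by (rule abs_summable_summable) (use c in simp)
  have csA: "c summable_on A" "(\<lambda>h. \<bar>c h\<bar>) summable_on A" for A
    by (rule summable_on_subset_banach[OF cs subset_UNIV], rule summable_on_subset_banach[OF c subset_UNIV])
  obtain F where F: "finite F" "infsum (\<lambda>h. \<bar>c h\<bar>) (- F) < r / 2"
  proof -
    have "((\<lambda>h. \<bar>c h\<bar>) has_sum infsum (\<lambda>h. \<bar>c h\<bar>) UNIV) UNIV" using c by (rule has_sum_infsum)
    hence "\<forall>\<^sub>F F in finite_subsets_at_top UNIV. dist (\<Sum>h\<in>F. \<bar>c h\<bar>) (infsum (\<lambda>h. \<bar>c h\<bar>) UNIV) < r / 2"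
      unfolding has_sum_def using r by (intro tendstoD) auto
    then obtain F where F: "finite F" "dist (\<Sum>h\<in>F. \<bar>c h\<bar>) (infsum (\<lambda>h. \<bar>c h\<bar>) UNIV) < r / 2"
      unfolding eventually_finite_subsets_at_top by auto
    have "infsum (\<lambda>h. \<bar>c h\<bar>) (UNIV - F) = infsum (\<lambda>h. \<bar>c h\<bar>) UNIV - (\<Sum>h\<in>F. \<bar>c h\<bar>)"
      using infsum_Diff[OF c csA(2)[of F]] F(1) by simp
    hence "infsum (\<lambda>h. \<bar>c h\<bar>) (- F) < r / 2"
      using F(2) unfolding dist_real_def Compl_eq_Diff_UNIV by linarith
    thus ?thesis by (rule that[OF F(1)])
  qed
  have "\<forall>h :: int ^ 'm. \<exists>c::nat. \<forall>D. finite D \<longrightarrow> card {u \<in> D. u + h \<notin> D} \<le> c * card (lattice_boundary D)"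
    by (rule allI) (rule card_leaving_le)
  from choice[OF this] obtain k where
    k: "\<And>h D. finite D \<Longrightarrow> card {u \<in> D. u + h \<notin> D} \<le> k h * card (lattice_boundary (D :: (int ^ 'm) set))"
    by blast
  define b where "b N = real (card (lattice_boundary (D N))) / real (card (D N))" for N
  have "(\<lambda>N. (\<Sum>h\<in>F. \<bar>c h\<bar> * real (k h)) * b N) \<longlonglongrightarrow> (\<Sum>h\<in>F. \<bar>c h\<bar> * real (k h)) * 0"
    unfolding b_def by (intro tendsto_intros bd)
  hence "\<forall>\<^sub>F N in sequentially. norm ((\<Sum>h\<in>F. \<bar>c h\<bar> * real (k h)) * b N) < r / 2"
    using r by (intro order_tendstoD[OF tendsto_norm_zero]) auto
  moreover have "\<forall>\<^sub>F N in sequentially. card (D N) \<ge> 1"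
    using D(2) by (auto simp: filterlim_at_top)
  ultimately have "\<forall>\<^sub>F N in sequentially. norm ((\<Sum>u\<in>D N. \<Sum>v\<in>D N. c (v - u)) / real (card (D N)) - S) < r"
  proof eventually_elim
    case (elim N)
    let ?D = "D N" and ?n = "real (card (D N))"
    have n: "?n > 0" using elim(2) by simp
    have pt: "\<bar>S - (\<Sum>v\<in>?D. c (v - u))\<bar> \<le> (\<Sum>h\<in>F. if u + h \<in> ?D then 0 else \<bar>c h\<bar>) + r / 2" for u
    proof -
      define A where "A = (\<lambda>v. v - u) ` ?D"
      have A: "finite A" "h \<in> A \<longleftrightarrow> u + h \<in> ?D" for h
        using D by (auto simp: A_def image_iff intro!: bexI[of _ "u + h"])
      have "(\<Sum>v\<in>?D. c (v - u)) = sum c A"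
        unfolding A_def by (subst sum.reindex) (auto simp: inj_on_def)
      hence "S - (\<Sum>v\<in>?D. c (v - u)) = infsum c (UNIV - A)"
        using infsum_Diff[OF cs csA(1)[of A]] A(1) by (simp add: S_def)
      hence "\<bar>S - (\<Sum>v\<in>?D. c (v - u))\<bar> \<le> infsum (\<lambda>h. \<bar>c h\<bar>) (UNIV - A)"
        using norm_infsum_bound[of c "UNIV - A"] csA(2) by simp
      also have "\<dots> \<le> infsum (\<lambda>h. \<bar>c h\<bar>) ((F - A) \<union> - F)"
        by (rule infsum_mono2) (auto intro: csA)
      also have "\<dots> = infsum (\<lambda>h. \<bar>c h\<bar>) (F - A) + infsum (\<lambda>h. \<bar>c h\<bar>) (- F)"
        by (rule infsum_Un_disjoint) (auto intro: csA)
      also have "infsum (\<lambda>h. \<bar>c h\<bar>) (F - A) = (\<Sum>h\<in>F - A. \<bar>c h\<bar>)" using F by simp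
      also have "\<dots> = (\<Sum>h\<in>F. if u + h \<in> ?D then 0 else \<bar>c h\<bar>)"
        using F A(2) by (intro sum.mono_neutral_cong_left) auto
      finally show ?thesis using F(2) by linarith
    qed
    have "(\<Sum>u\<in>?D. \<Sum>h\<in>F. if u + h \<in> ?D then 0 else \<bar>c h\<bar>) = (\<Sum>h\<in>F. \<bar>c h\<bar> * real (card {u \<in> ?D. u + h \<notin> ?D}))"
    proof (subst sum.swap, rule sum.cong[OF refl])
      fix h
      have "(\<Sum>u\<in>?D. if u + h \<in> ?D then 0 else \<bar>c h\<bar>) = (\<Sum>u\<in>{u \<in> ?D. u + h \<notin> ?D}. \<bar>c h\<bar>)"
        using D by (intro sum.mono_neutral_cong_right) auto
      thus "(\<Sum>u\<in>?D. if u + h \<in> ?D then 0 else \<bar>c h\<bar>) = \<bar>c h\<bar> * real (card {u \<in> ?D. u + h \<notin> ?D})"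
        by simp
    qed
    also have "\<dots> \<le> (\<Sum>h\<in>F. \<bar>c h\<bar> * real (k h * card (lattice_boundary ?D)))"
      using D k by (intro sum_mono mult_left_mono) (auto simp del: of_nat_mult)
    also have "\<dots> = (\<Sum>h\<in>F. \<bar>c h\<bar> * real (k h)) * b N * ?n"
    proof -
      have "b N * ?n = real (card (lattice_boundary ?D))" using n by (simp add: b_def)
      thus ?thesis by (simp add: mult.assoc) (simp add: sum_distrib_right mult.assoc)
    qed
    finally have swap: "(\<Sum>u\<in>?D. \<Sum>h\<in>F. if u + h \<in> ?D then 0 else \<bar>c h\<bar>) \<le> (\<Sum>h\<in>F. \<bar>c h\<bar> * real (k h)) * b N * ?n" .
    have "(\<Sum>u\<in>?D. \<Sum>v\<in>?D. c (v - u)) / ?n - S = - (\<Sum>u\<in>?D. S - (\<Sum>v\<in>?D. c (v - u))) / ?n"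
      using n by (simp add: sum_subtractf field_simps)
    hence "\<bar>(\<Sum>u\<in>?D. \<Sum>v\<in>?D. c (v - u)) / ?n - S\<bar> = \<bar>\<Sum>u\<in>?D. S - (\<Sum>v\<in>?D. c (v - u))\<bar> / ?n"
      using n by (simp add: abs_divide)
    also have "\<dots> \<le> (\<Sum>u\<in>?D. (\<Sum>h\<in>F. if u + h \<in> ?D then 0 else \<bar>c h\<bar>) + r / 2) / ?n"
      using n by (intro divide_right_mono order_trans[OF sum_abs] sum_mono pt) auto
    also have "\<dots> \<le> ((\<Sum>h\<in>F. \<bar>c h\<bar> * real (k h)) * b N * ?n + ?n * (r / 2)) / ?n"
      using n swap by (intro divide_right_mono) (auto simp: sum.distrib)
    also have "\<dots> = (\<Sum>h\<in>F. \<bar>c h\<bar> * real (k h)) * b N + r / 2"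
      using n by (simp add: field_simps)
    also have "\<dots> < r" using elim(1) by simp
    finally show ?case by simp
  qed
  thus "\<exists>no. \<forall>N\<ge>no. norm ((\<Sum>u\<in>D N. \<Sum>v\<in>D N. c (v - u)) / real (card (D N)) - infsum c UNIV) < r"
    unfolding S_def by (simp add: eventually_sequentially)
qed

section \<open>The central limit theorem for bounded fields\<close>

context bounded_weakly_dependent_field
begin

lemma tail_tendsto_0: "tail \<longlonglongrightarrow> 0"
proof -
  define Bq where "Bq q = {h :: int ^ 'm. norm_inf h < q}" for q
  have fB: "finite (Bq q)" for q
    by (rule finite_subset[OF _ card_norm_inf_ball(1)[of q]]) (auto simp: Bq_def)
  have eq: "tail q = infsum k UNIV - sum k (Bq q)" for q
  proof -
    have "tail q = infsum k (UNIV - Bq q)"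
      unfolding tail_def by (intro infsum_cong_neutral) (auto simp: Bq_def)
    thus ?thesis using infsum_Diff[OF k_summable, of "Bq q"] fB by simp
  qed
  have "filterlim Bq (finite_subsets_at_top UNIV) sequentially"
    unfolding filterlim_finite_subsets_at_top
  proof (intro allI impI)
    fix A :: "(int ^ 'm) set" assume A: "finite A \<and> A \<subseteq> UNIV"
    define q0 where "q0 = Suc (Max (insert 0 (norm_inf ` A)))"
    have "norm_inf h < q0" if "h \<in> A" for h
      using that A unfolding q0_def by (simp add: less_Suc_eq_le)
    hence "A \<subseteq> Bq q" if "q \<ge> q0" for q using that by (force simp: Bq_def)
    thus "\<forall>\<^sub>F q in sequentially. finite (Bq q) \<and> A \<subseteq> Bq q \<and> Bq q \<subseteq> UNIV"
      using fB by (intro eventually_sequentiallyI[of q0]) auto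
  qed
  hence "(\<lambda>q. sum k (Bq q)) \<longlonglongrightarrow> infsum k UNIV"
    using has_sum_infsum[OF k_summable] unfolding has_sum_def by (rule filterlim_compose[rotated])
  hence "(\<lambda>q. infsum k UNIV - sum k (Bq q)) \<longlonglongrightarrow> infsum k UNIV - infsum k UNIV" by (intro tendsto_intros)
  thus ?thesis unfolding eq[abs_def] by simp
qed

text \<open>The range \<open>q = n powr \<theta>\<close> must satisfy \<open>q\<^sup>m \<ll> n\<^bsup>1/2\<^esup>\<close> and \<open>q\<^sup>\<beta> \<gg> n\<close>. Both are possible for
  \<open>1 / \<beta> < \<theta> < 1 / (2 m)\<close>, which is where \<open>\<beta> > 2 m\<close> is used.\<close>

lemma rate_tendsto_0:
  assumes \<beta>2: "\<beta> > 2 * real CARD('m)"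
  shows "\<exists>q. (\<lambda>n. rate n (q n)) \<longlonglongrightarrow> 0"
proof -
  define m where "m = real CARD('m)"
  have m: "m > 0" by (simp add: m_def)
  have "1 / \<beta> < 1 / (2 * m)" using \<beta>2 m by (simp add: m_def field_simps)
  then obtain \<theta> where \<theta>: "1 / \<beta> < \<theta>" "\<theta> < 1 / (2 * m)" using dense by blast
  have \<beta>0: "\<beta> > 0" using \<beta>2 m by (simp add: m_def)
  have \<theta>0: "\<theta> > 0" using \<theta>(1) \<beta>0 by (smt (verit) divide_pos_pos)
  define q where "q n = nat \<lfloor>real n powr \<theta>\<rfloor>" for n
  have q_le: "real (q n) \<le> real n powr \<theta>" for n by (simp add: q_def)
  have q_ge: "real n powr \<theta> \<le> 1 + real (q n)" for n unfolding q_def by linarith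
  have 1: "(\<lambda>n. ballc (q n) / sqrt (real n)) \<longlonglongrightarrow> 0"
  proof (rule tendsto_sandwich[where f = "\<lambda>_. 0" and h = "\<lambda>n. 3 powr m * real n powr (\<theta> * m - 1 / 2)"])
    show "\<forall>\<^sub>F n in sequentially. ballc (q n) / sqrt (real n) \<le> 3 powr m * real n powr (\<theta> * m - 1 / 2)"
    proof (rule eventually_sequentiallyI[of 1])
      fix n :: nat assume n: "n \<ge> 1"
      have r: "real n powr \<theta> \<ge> 1" using n \<theta>0 by (intro ge_one_powr_ge_zero) auto
      have "ballc (q n) = (2 * real (q n) + 1) powr m"
        unfolding ballc_def ball_card_bound_def m_def by (subst powr_realpow) (auto simp: add_pos_nonneg add.commute)
      also have "\<dots> \<le> (3 * real n powr \<theta>) powr m"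
        using q_le[of n] r m by (intro powr_mono2) auto
      also have "\<dots> = 3 powr m * real n powr (\<theta> * m)" by (simp add: powr_mult powr_powr)
      finally have "ballc (q n) / sqrt (real n) \<le> 3 powr m * real n powr (\<theta> * m) / sqrt (real n)"
        by (intro divide_right_mono) auto
      also have "\<dots> = 3 powr m * real n powr (\<theta> * m - 1 / 2)"
        using n by (simp add: powr_diff powr_half_sqrt)
      finally show "ballc (q n) / sqrt (real n) \<le> 3 powr m * real n powr (\<theta> * m - 1 / 2)" .
    qed
    have "\<theta> * m - 1 / 2 < 0" using \<theta>(2) m by (simp add: field_simps)
    hence "((\<lambda>n. real n powr (\<theta> * m - 1 / 2)) \<longlongrightarrow> 0) sequentially"
      by (intro tendsto_neg_powr filterlim_real_sequentially) auto
    thus "(\<lambda>n. 3 powr m * real n powr (\<theta> * m - 1 / 2)) \<longlonglongrightarrow> 0" by (rule tendsto_mult_right_zero)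
  qed (auto simp: ballc_def)
  have 2: "(\<lambda>n. real n * \<kappa> (q n)) \<longlonglongrightarrow> 0"
  proof (rule tendsto_sandwich[where f = "\<lambda>_. 0" and h = "\<lambda>n. K * real n powr (1 - \<theta> * \<beta>)"])
    show "\<forall>\<^sub>F n in sequentially. real n * \<kappa> (q n) \<le> K * real n powr (1 - \<theta> * \<beta>)"
    proof (rule eventually_sequentiallyI[of 1])
      fix n :: nat assume n: "n \<ge> 1"
      have "(1 + real (q n)) powr - \<beta> \<le> (real n powr \<theta>) powr - \<beta>"
        using q_ge[of n] n \<beta>0 by (intro powr_mono2') auto
      also have "\<dots> = real n powr (- (\<theta> * \<beta>))" by (simp add: powr_powr)
      finally have "K * (real n * (1 + real (q n)) powr - \<beta>) \<le> K * (real n * real n powr (- (\<theta> * \<beta>)))"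
        using K_nonneg by (intro mult_left_mono) auto
      also have "real n * real n powr (- (\<theta> * \<beta>)) = real n powr (1 - \<theta> * \<beta>)"
        using n by (simp add: powr_diff powr_minus_divide)
      finally show "real n * \<kappa> (q n) \<le> K * real n powr (1 - \<theta> * \<beta>)" by (simp add: mult_ac)
    qed
    have "1 - \<theta> * \<beta> < 0" using \<theta>(1) \<beta>0 by (simp add: field_simps)
    hence "((\<lambda>n. real n powr (1 - \<theta> * \<beta>)) \<longlongrightarrow> 0) sequentially"
      by (intro tendsto_neg_powr filterlim_real_sequentially) auto
    thus "(\<lambda>n. K * real n powr (1 - \<theta> * \<beta>)) \<longlonglongrightarrow> 0" by (rule tendsto_mult_right_zero)
  qed (auto simp: K_nonneg)
  have "filterlim (\<lambda>n. real n powr \<theta>) at_top sequentially"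
    using \<theta>0 by real_asymp
  hence "filterlim q at_top sequentially"
    unfolding q_def by (intro filterlim_compose[OF filterlim_nat_sequentially] filterlim_compose[OF filterlim_floor_sequentially])
  hence 3: "(\<lambda>n. tail (q n)) \<longlonglongrightarrow> 0" by (rule filterlim_compose[OF tail_tendsto_0])
  have "(\<lambda>n. rate n (q n)) \<longlonglongrightarrow> (B\<^sup>2 * infsum k UNIV + sqrt (32 * B ^ 3 * infsum k UNIV)) * 0 + 2 * (1 + B) * 0 + 2 * B * 0"
    unfolding rate_def by (intro tendsto_intros 1 2 3)
  thus ?thesis by auto
qed

lemma char_normsum_tendsto:
  assumes \<beta>2: "\<beta> > 2 * real CARD('m)"
    and D: "\<And>N. finite (D N)" "filterlim (\<lambda>N. card (D N)) at_top sequentially"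
  shows "(\<lambda>N. (CLINT w|M. iexp (normsum (D N) w)) - exp (- (normvar (D N) / 2))) \<longlonglongrightarrow> 0"
proof -
  obtain q where q: "(\<lambda>n. rate n (q n)) \<longlonglongrightarrow> 0" using rate_tendsto_0[OF \<beta>2] by blast
  have r: "(\<lambda>N. 2 * rate (card (D N)) (q (card (D N)))) \<longlonglongrightarrow> 2 * 0"
    by (intro tendsto_intros filterlim_compose[OF q D(2)])
  have "\<forall>\<^sub>F N in sequentially. card (D N) \<ge> 1" using D(2) by (auto simp: filterlim_at_top)
  hence "\<forall>\<^sub>F N in sequentially. norm ((CLINT w|M. iexp (normsum (D N) w)) - exp (- (normvar (D N) / 2)))
     \<le> 2 * rate (card (D N)) (q (card (D N)))"
  proof eventually_elim
    case (elim N)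
    hence "D N \<noteq> {}" by auto
    from char_normsum_approx[OF D(1) this, of 1] show ?case by simp
  qed
  thus ?thesis by (rule Lim_null_comparison) (use r in simp)
qed

end


section \<open>Truncation and the central limit theorem for real fields\<close>

text \<open>The field need not be stationary: at different sites it may be a different linear functional of a
  stationary vector field.\<close>

locale moment_field = prob_space M for M :: "'a measure" +
  fixes Z :: "int ^ 'm::finite \<Rightarrow> 'a \<Rightarrow> real" and K \<beta> \<delta> m2 :: real
  assumes Z_measurable [measurable]: "\<And>i. Z i \<in> borel_measurable M"
    and Z_mean: "\<And>i. (LINT w|M. Z i w) = 0"
    and \<delta>_pos: "\<delta> > 0"
    and Z_moment: "\<And>i. integrable M (\<lambda>w. \<bar>Z i w\<bar> powr (2 + \<delta>))"
    and Z_moment_le: "\<And>i. (LINT w|M. \<bar>Z i w\<bar> powr (2 + \<delta>)) \<le> m2"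
    and K_nonneg: "K \<ge> 0" and \<beta>_gt: "\<beta> > real CARD('m) * max 2 (1 + 1 / \<delta>)"
    and wd: "weakly_dependent M Z (\<lambda>h. K * (1 + real h) powr (- \<beta>))"
begin

text \<open>The exponent \<open>g\<close> is the rate at which covariances decay; the part \<open>\<beta> > m * (1 + 1 / \<delta>)\<close>
  of the assumption says that \<open>g > m\<close>. The constant \<open>m3\<close> is that of the contribution of the tails, \<open>C\<close> that of the
  covariance bound itself.\<close>

definition g :: real where "g = \<beta> * \<delta> / (1 + \<delta>)"
definition m3 :: real where "m3 = m2 * (3 + m2)"
definition C :: real where "C = 2 * K + 2 * m3"

lemma \<beta>_gt2: "\<beta> > 2 * real CARD('m)"
proof -
  have "2 * real CARD('m) \<le> real CARD('m) * max 2 (1 + 1 / \<delta>)"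
    by (simp add: mult.commute[of 2] mult_left_mono)
  thus ?thesis using \<beta>_gt by linarith
qed

lemma \<beta>_pos: "\<beta> > 0" using \<beta>_gt2 by (smt (verit) of_nat_0_le_iff)

lemma g_gt: "g > real CARD('m)"
proof -
  have "real CARD('m) * (1 + 1 / \<delta>) \<le> real CARD('m) * max 2 (1 + 1 / \<delta>)" by (intro mult_left_mono) auto
  hence "real CARD('m) * (1 + 1 / \<delta>) < \<beta>" using \<beta>_gt by linarith
  thus ?thesis using \<delta>_pos by (simp add: g_def field_simps)
qed

lemma m2_nonneg: "m2 \<ge> 0"
proof -
  have "0 \<le> (LINT w|M. \<bar>Z 0 w\<bar> powr (2 + \<delta>))" by (rule Bochner_Integration.integral_nonneg) simp
  thus ?thesis using Z_moment_le[of 0] by linarith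
qed

lemma m3_nonneg: "m3 \<ge> 0" using m2_nonneg by (simp add: m3_def)

lemma C_nonneg: "C \<ge> 0" using m3_nonneg K_nonneg by (simp add: C_def)

lemma powr_tail_le:
  assumes "T \<ge> 1" "T \<le> (x::real)" "0 \<le> p" "p \<le> 2"
  shows "x powr p \<le> T powr (- \<delta>) * x powr (2 + \<delta>)"
proof -
  have "1 \<le> (x / T) powr \<delta>" using assms \<delta>_pos by (intro ge_one_powr_ge_zero) auto
  also have "(x / T) powr \<delta> = T powr (- \<delta>) * x powr \<delta>"
    using assms by (simp add: powr_divide powr_minus_divide)
  finally have 1: "1 \<le> T powr (- \<delta>) * x powr \<delta>" .
  have "x powr p \<le> x powr 2" using assms by (intro powr_mono) auto
  also have "\<dots> \<le> (T powr (- \<delta>) * x powr \<delta>) * x powr 2" using 1 by (simp add: mult_le_cancel_right1)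
  finally show ?thesis by (simp add: powr_add mult_ac)
qed

lemma powr_le_one_plus:
  assumes "0 \<le> (x::real)" "0 < p" "p \<le> 2"
  shows "x powr p \<le> 1 + x powr (2 + \<delta>)"
proof (cases "x \<le> 1")
  case True
  hence "x powr p \<le> 1" using assms by (intro powr_le1) auto
  thus ?thesis by (simp add: add_increasing2)
next
  case False
  hence "x powr p \<le> 1 powr (- \<delta>) * x powr (2 + \<delta>)" using assms by (intro powr_tail_le) auto
  thus ?thesis unfolding powr_one_eq_one by linarith
qed

lemma Z_sq: "integrable M (\<lambda>w. (Z u w)\<^sup>2)"
proof (rule Bochner_Integration.integrable_bound)
  show "integrable M (\<lambda>w. 1 + \<bar>Z u w\<bar> powr (2 + \<delta>))" using Z_moment by simp
  show "AE w in M. norm ((Z u w)\<^sup>2) \<le> norm (1 + \<bar>Z u w\<bar> powr (2 + \<delta>))"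
  proof (rule AE_I2)
    fix w
    have "(Z u w)\<^sup>2 = \<bar>Z u w\<bar> powr 2" by (cases "Z u w = 0") auto
    thus "norm ((Z u w)\<^sup>2) \<le> norm (1 + \<bar>Z u w\<bar> powr (2 + \<delta>))"
      using powr_le_one_plus[of "\<bar>Z u w\<bar>" 2] by simp
  qed
qed simp

lemma dominated_sq:
  assumes [measurable]: "A \<in> borel_measurable M" and "\<And>w. \<bar>A w\<bar> \<le> \<bar>Z u w\<bar>"
  shows "integrable M (\<lambda>w. (A w)\<^sup>2)" "integrable M A"
proof -
  show sq: "integrable M (\<lambda>w. (A w)\<^sup>2)"
    by (rule Bochner_Integration.integrable_bound[OF Z_sq[of u]])
      (use norm_square_le[OF assms(2)] in \<open>auto simp: abs_le_square_iff[symmetric] assms(2)\<close>)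
  show "integrable M A" by (rule square_integrable_imp_integrable[OF _ sq]) simp
qed

lemma expectation_abs_le:
  assumes [measurable]: "A \<in> borel_measurable M" and A: "\<And>w. \<bar>A w\<bar> \<le> \<bar>Z u w\<bar>"
  shows "(LINT w|M. \<bar>A w\<bar>) \<le> 1 + m2"
proof -
  have "(LINT w|M. \<bar>A w\<bar>) \<le> (LINT w|M. 1 + \<bar>Z u w\<bar> powr (2 + \<delta>))"
  proof (rule integral_mono)
    show "\<bar>A w\<bar> \<le> 1 + \<bar>Z u w\<bar> powr (2 + \<delta>)" for w
      using powr_le_one_plus[of "\<bar>Z u w\<bar>" 1] A[of w] by simp
  qed (use dominated_sq(2)[OF assms] Z_moment in auto)
  also have "\<dots> \<le> 1 + m2" using Z_moment Z_moment_le[of u] by (simp add: prob_space)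
  finally show ?thesis .
qed

text \<open>If \<open>\<bar>Z u\<bar> \<le> \<bar>Z v\<bar>\<close> the product is at most the square of the larger one, which is above \<open>T\<close> as
  well; this replaces Hoelder's inequality.\<close>

lemma tail_cov_le:
  assumes T: "T \<ge> 1" and [measurable]: "A \<in> borel_measurable M" "B \<in> borel_measurable M"
    and A: "\<And>w. \<bar>A w\<bar> \<le> \<bar>Z u w\<bar>" "\<And>w. \<bar>Z u w\<bar> \<le> T \<Longrightarrow> A w = 0" and B: "\<And>w. \<bar>B w\<bar> \<le> \<bar>Z v w\<bar>"
  shows "\<bar>cov M A B\<bar> \<le> m3 * T powr (- \<delta>)"
proof -
  note iA = dominated_sq[OF assms(2) A(1)] and iB = dominated_sq[OF assms(3) B]
  have iAB: "integrable M (\<lambda>w. A w * B w)" using iA iB by (intro integrable_prod_of_squares) auto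
  have EA: "(LINT w|M. \<bar>A w\<bar>) \<le> T powr (- \<delta>) * m2"
  proof -
    have "(LINT w|M. \<bar>A w\<bar>) \<le> (LINT w|M. T powr (- \<delta>) * \<bar>Z u w\<bar> powr (2 + \<delta>))"
    proof (rule integral_mono)
      fix w show "\<bar>A w\<bar> \<le> T powr (- \<delta>) * \<bar>Z u w\<bar> powr (2 + \<delta>)"
      proof (cases "\<bar>Z u w\<bar> \<le> T")
        case False
        thus ?thesis using powr_tail_le[of T "\<bar>Z u w\<bar>" 1] T A(1)[of w] by simp
      qed (simp add: A(2))
    qed (use iA Z_moment in auto)
    also have "\<dots> \<le> T powr (- \<delta>) * m2" using Z_moment_le[of u] by (simp add: mult_left_mono)
    finally show ?thesis .
  qed
  have EAB: "(LINT w|M. \<bar>A w * B w\<bar>) \<le> T powr (- \<delta>) * (m2 + m2)"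
  proof -
    have "(LINT w|M. \<bar>A w * B w\<bar>) \<le> (LINT w|M. T powr (- \<delta>) * (\<bar>Z u w\<bar> powr (2 + \<delta>) + \<bar>Z v w\<bar> powr (2 + \<delta>)))"
    proof (rule integral_mono)
      fix w show "\<bar>A w * B w\<bar> \<le> T powr (- \<delta>) * (\<bar>Z u w\<bar> powr (2 + \<delta>) + \<bar>Z v w\<bar> powr (2 + \<delta>))"
      proof (cases "\<bar>Z u w\<bar> \<le> T")
        case False
        define z where "z = max \<bar>Z u w\<bar> \<bar>Z v w\<bar>"
        have z: "T \<le> z" using False by (simp add: z_def)
        have "\<bar>A w * B w\<bar> \<le> z * z"
          unfolding abs_mult using A(1)[of w] B[of w] by (intro mult_mono) (auto simp: z_def)
        also have "\<dots> = z powr 2" using z T by (simp add: power2_eq_square)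
        also have "\<dots> \<le> T powr (- \<delta>) * z powr (2 + \<delta>)" using z T by (intro powr_tail_le) auto
        also have "z powr (2 + \<delta>) \<le> \<bar>Z u w\<bar> powr (2 + \<delta>) + \<bar>Z v w\<bar> powr (2 + \<delta>)"
          by (simp add: z_def max_def)
        finally show ?thesis by (simp add: mult_left_mono)
      qed (simp add: A(2))
    qed (use iAB Z_moment in auto)
    also have "\<dots> \<le> T powr (- \<delta>) * (m2 + m2)"
      using Z_moment_le[of u] Z_moment_le[of v] Z_moment by (simp add: mult_left_mono add_mono)
    finally show ?thesis .
  qed
  have "\<bar>cov M A B\<bar> \<le> \<bar>LINT w|M. A w * B w\<bar> + \<bar>LINT w|M. A w\<bar> * \<bar>LINT w|M. B w\<bar>"
    unfolding cov_eq[OF iA(2) iB(2) iAB] by (simp add: abs_mult[symmetric] abs_triangle_ineq4)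
  also have "\<dots> \<le> T powr (- \<delta>) * (m2 + m2) + (T powr (- \<delta>) * m2) * (1 + m2)"
  proof (intro add_mono mult_mono)
    show "\<bar>LINT w|M. A w * B w\<bar> \<le> T powr (- \<delta>) * (m2 + m2)" using EAB integral_abs_bound by (rule order_trans[rotated])
    show "\<bar>LINT w|M. A w\<bar> \<le> T powr (- \<delta>) * m2" using EA integral_abs_bound by (rule order_trans[rotated])
    show "\<bar>LINT w|M. B w\<bar> \<le> 1 + m2"
      using expectation_abs_le[OF assms(3) B] integral_abs_bound by (rule order_trans[rotated])
  qed (use m2_nonneg in auto)
  also have "\<dots> = m3 * T powr (- \<delta>)" by (simp add: m3_def algebra_simps)
  finally show ?thesis .
qed

lemma cov_split:
  assumes [measurable]: "A \<in> borel_measurable M" "A' \<in> borel_measurable M" "B \<in> borel_measurable M"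
    and "integrable M (\<lambda>w. (A w)\<^sup>2)" "integrable M (\<lambda>w. (A' w)\<^sup>2)" "integrable M (\<lambda>w. (B w)\<^sup>2)"
  shows "cov M A B = cov M A' B + cov M (\<lambda>w. A w - A' w) B"
proof -
  have i: "integrable M A" "integrable M A'" "integrable M B"
    using square_integrable_imp_integrable assms by blast+
  have p: "integrable M (\<lambda>w. A w * B w)" "integrable M (\<lambda>w. A' w * B w)"
    using assms by (auto intro: integrable_prod_of_squares)
  have p': "integrable M (\<lambda>w. (A w - A' w) * B w)" using p by (simp add: left_diff_distrib)
  show ?thesis
    unfolding cov_eq[OF i(1,3) p(1)] cov_eq[OF i(2,3) p(2)] cov_eq[OF Bochner_Integration.integrable_diff[OF i(1,2)] i(3) p']
    using i p by (simp add: left_diff_distrib)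
qed

text \<open>Truncating at the level \<open>T = (1 + h) powr (\<beta> / (1 + \<delta>))\<close> balances the covariance of
  the truncated variables, of order \<open>T * (1 + h) powr (- \<beta>)\<close>, and the contribution of the tails, of
  order \<open>T powr (- \<delta>)\<close>.\<close>

lemma cov_lipschitz_le:
  assumes \<phi>: "\<And>x y. \<bar>\<phi> x - \<phi> y\<bar> \<le> \<bar>x - y\<bar>" "\<phi> 0 = 0" and [measurable]: "\<phi> \<in> borel_measurable borel"
    and \<psi>: "\<And>x y. \<bar>\<psi> x - \<psi> y\<bar> \<le> \<bar>x - y\<bar>" "\<psi> 0 = 0" and [measurable]: "\<psi> \<in> borel_measurable borel"
  shows "\<bar>cov M (\<lambda>w. \<phi> (Z u w)) (\<lambda>w. \<psi> (Z v w))\<bar> \<le> C * (1 + real (norm_inf (u - v))) powr (- g)"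
proof -
  define h where "h = 1 + real (norm_inf (u - v))"
  have h: "h \<ge> 1" by (simp add: h_def)
  define T where "T = h powr (\<beta> / (1 + \<delta>))"
  have T: "T \<ge> 1" unfolding T_def using h \<beta>_pos \<delta>_pos by (intro ge_one_powr_ge_zero) auto
  have ph: "\<bar>\<phi> x\<bar> \<le> \<bar>x\<bar>" "\<bar>\<psi> x\<bar> \<le> \<bar>x\<bar>" for x using \<phi>(1)[of x 0] \<psi>(1)[of x 0] \<phi>(2) \<psi>(2) by auto
  have cl: "\<bar>clip T x\<bar> \<le> \<bar>x\<bar>" "\<bar>x - clip T x\<bar> \<le> \<bar>x\<bar>" "\<bar>x\<bar> \<le> T \<Longrightarrow> x - clip T x = 0" for x
    using T by (auto simp: clip_def)
  let ?A = "\<lambda>w. \<phi> (Z u w)" and ?B = "\<lambda>w. \<psi> (Z v w)"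
  let ?A' = "\<lambda>w. clip T (\<phi> (Z u w))" and ?B' = "\<lambda>w. clip T (\<psi> (Z v w))"
  have dom: "\<bar>?A w\<bar> \<le> \<bar>Z u w\<bar>" "\<bar>?A' w\<bar> \<le> \<bar>Z u w\<bar>" "\<bar>?B w\<bar> \<le> \<bar>Z v w\<bar>" "\<bar>?B' w\<bar> \<le> \<bar>Z v w\<bar>"
    "\<bar>?A w - ?A' w\<bar> \<le> \<bar>Z u w\<bar>" "\<bar>?B w - ?B' w\<bar> \<le> \<bar>Z v w\<bar>" for w
    using ph cl order_trans by blast+
  have m: "?A \<in> borel_measurable M" "?A' \<in> borel_measurable M" "?B \<in> borel_measurable M" "?B' \<in> borel_measurable M"
    "(\<lambda>w. ?A w - ?A' w) \<in> borel_measurable M" "(\<lambda>w. ?B w - ?B' w) \<in> borel_measurable M" by measurable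
  note sq = dominated_sq(1)[OF m(1) dom(1)] dominated_sq(1)[OF m(2) dom(2)] dominated_sq(1)[OF m(3) dom(3)] dominated_sq(1)[OF m(4) dom(4)]
  have e: "cov M ?A ?B = cov M ?A' ?B' + cov M (\<lambda>w. ?A w - ?A' w) ?B' + cov M (\<lambda>w. ?B w - ?B' w) ?A"
  proof -
    have "cov M ?A ?B = cov M ?B' ?A + cov M (\<lambda>w. ?B w - ?B' w) ?A"
      using cov_split[OF m(3,4,1) sq(3,4,1)] by (simp add: cov_commute[of M ?A])
    also have "cov M ?B' ?A = cov M ?A' ?B' + cov M (\<lambda>w. ?A w - ?A' w) ?B'"
      using cov_split[OF m(1,2,4) sq(1,2,4)] by (simp add: cov_commute[of M ?B'])
    finally show ?thesis .
  qed
  have 1: "\<bar>cov M ?A' ?B'\<bar> \<le> 2 * K * h powr (- g)"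
  proof -
    have "\<bar>cov M ?A' ?B'\<bar> \<le> K * (1 + real (norm_inf (u - v))) powr (- \<beta>) * (real (card {u}) * T * 1 + real (card {v}) * T * 1)"
    proof (rule weakly_dependentD[OF wd, where F = "\<lambda>x. clip T (\<phi> (x u))" and G = "\<lambda>x. clip T (\<psi> (x v))"])
      show "lipschitz_in {u} 1 (\<lambda>x. clip T (\<phi> (x u)))" "lipschitz_in {v} 1 (\<lambda>x. clip T (\<psi> (x v)))"
        unfolding lipschitz_in_def using order_trans[OF clip_lipschitz \<phi>(1)] order_trans[OF clip_lipschitz \<psi>(1)] by auto
    qed (use T in \<open>auto simp: clip_le\<close>)
    also have "\<dots> = 2 * K * (h powr (- \<beta>) * T)" by (simp add: h_def)
    also have "h powr (- \<beta>) * T = h powr (- g)"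
    proof -
      have "- \<beta> + \<beta> / (1 + \<delta>) = - g" using \<delta>_pos by (simp add: g_def field_simps)
      thus ?thesis unfolding T_def by (simp add: powr_add[symmetric])
    qed
    finally show ?thesis .
  qed
  have Tg: "T powr (- \<delta>) = h powr (- g)" by (simp add: T_def powr_powr g_def)
  have 2: "\<bar>cov M (\<lambda>w. ?A w - ?A' w) ?B'\<bar> \<le> m3 * h powr (- g)"
  proof (rule tail_cov_le[OF T m(5,4) dom(5) _ dom(4), unfolded Tg])
    fix w assume "\<bar>Z u w\<bar> \<le> T" thus "?A w - ?A' w = 0" using cl(3)[of "?A w"] dom(1)[of w] by linarith
  qed
  have 3: "\<bar>cov M (\<lambda>w. ?B w - ?B' w) ?A\<bar> \<le> m3 * h powr (- g)"
  proof (rule tail_cov_le[OF T m(6,1) dom(6) _ dom(1), unfolded Tg])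
    fix w assume "\<bar>Z v w\<bar> \<le> T" thus "?B w - ?B' w = 0" using cl(3)[of "?B w"] dom(3)[of w] by linarith
  qed
  have "C * h powr (- g) = 2 * K * h powr (- g) + m3 * h powr (- g) + m3 * h powr (- g)"
    by (simp add: C_def algebra_simps)
  thus ?thesis unfolding e h_def[symmetric] using 1 2 3 by linarith
qed

text \<open>The weight \<open>\<theta>\<close> is chosen so that the exponent \<open>g * (1 - \<theta>)\<close> is halfway between \<open>m\<close> and \<open>g\<close>,
  and hence still summable.\<close>

definition \<theta> :: real where "\<theta> = (g - real CARD('m)) / (2 * g)"

definition trunc_error :: "real \<Rightarrow> real" where
  "trunc_error T = (2 * C) powr (1 - \<theta>) * (2 * m3 * T powr (- \<delta>)) powr \<theta>
     * infsum (\<lambda>h :: int ^ 'm. (1 + real (norm_inf h)) powr (- ((g + real CARD('m)) / 2))) UNIV"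

lemma \<theta>_bounds: "0 < \<theta>" "\<theta> < 1" "g * (1 - \<theta>) = (g + real CARD('m)) / 2"
proof -
  have m: "real CARD('m) > 0" by simp
  have g0: "g > 0" using g_gt m by linarith
  show "0 < \<theta>" using g_gt g0 by (simp add: \<theta>_def)
  show "\<theta> < 1" unfolding \<theta>_def using g0 m by (simp add: divide_less_eq)
  show "g * (1 - \<theta>) = (g + real CARD('m)) / 2" using g0 by (simp add: \<theta>_def field_simps)
qed

text \<open>Interpolating between the two bounds on the covariances keeps some of the summability and
  some of the smallness.\<close>

lemma mean_truncated_cov_le:
  fixes x :: "int ^ 'm \<Rightarrow> int ^ 'm \<Rightarrow> real"
  assumes D: "finite D" "D \<noteq> {}"
    and 1: "\<And>u v. \<bar>x u v\<bar> \<le> 2 * C * (1 + real (norm_inf (u - v))) powr (- g)"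
    and 2: "\<And>u v. \<bar>x u v\<bar> \<le> 2 * m3 * T powr (- \<delta>)"
  shows "\<bar>(\<Sum>u\<in>D. \<Sum>v\<in>D. x u v) / real (card D)\<bar> \<le> trunc_error T"
proof -
  define w where "w h = (1 + real (norm_inf h)) powr (- ((g + real CARD('m)) / 2))" for h :: "int ^ 'm"
  have ws: "w summable_on UNIV" unfolding w_def using g_gt by (intro summable_lattice_weight) auto
  define a where "a = (2 * C) powr (1 - \<theta>) * (2 * m3 * T powr (- \<delta>)) powr \<theta>"
  have pt: "\<bar>x u v\<bar> \<le> a * w (v - u)" for u v
  proof -
    have "\<bar>x u v\<bar> = \<bar>x u v\<bar> powr (1 - \<theta>) * \<bar>x u v\<bar> powr \<theta>"
      by (simp add: powr_add[symmetric])
    also have "\<dots> \<le> (2 * C * (1 + real (norm_inf (u - v))) powr (- g)) powr (1 - \<theta>) * (2 * m3 * T powr (- \<delta>)) powr \<theta>"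
      using 1 2 \<theta>_bounds by (intro mult_mono powr_mono2) auto
    also have "(2 * C * (1 + real (norm_inf (u - v))) powr (- g)) powr (1 - \<theta>) = (2 * C) powr (1 - \<theta>) * w (v - u)"
      unfolding w_def \<theta>_bounds(3)[symmetric] using C_nonneg by (simp add: powr_mult powr_powr norm_inf_minus_commute)
    finally show ?thesis by (simp add: a_def mult_ac)
  qed
  have n: "real (card D) > 0" using D by (simp add: card_gt_0_iff)
  have a0: "a \<ge> 0" by (simp add: a_def)
  have "\<bar>\<Sum>u\<in>D. \<Sum>v\<in>D. x u v\<bar> \<le> (\<Sum>u\<in>D. \<Sum>v\<in>D. a * w (v - u))"
    by (rule order_trans[OF sum_abs], rule sum_mono, rule order_trans[OF sum_abs], rule sum_mono, rule pt)
  also have "\<dots> = a * (\<Sum>u\<in>D. \<Sum>v\<in>D. w (v - u))" by (simp add: sum_distrib_left)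
  also have "\<dots> \<le> a * (real (card D) * infsum w UNIV)"
    using D a0 by (intro mult_left_mono sum_sum_differences_le ws) (auto simp: w_def)
  finally have "\<bar>\<Sum>u\<in>D. \<Sum>v\<in>D. x u v\<bar> / real (card D) \<le> a * infsum w UNIV"
    using n by (simp add: divide_le_eq mult_ac)
  thus ?thesis using n unfolding trunc_error_def a_def w_def[abs_def] by (simp add: abs_divide)
qed

lemma trunc_error_tendsto: "(\<lambda>n. trunc_error (1 + real n)) \<longlonglongrightarrow> 0"
proof -
  have e: "(2 * m3 * (1 + real n) powr (- \<delta>)) powr \<theta> = (2 * m3) powr \<theta> * (1 + real n) powr (- (\<delta> * \<theta>))" for n
    using m3_nonneg by (simp add: powr_mult powr_powr)
  have "\<delta> * \<theta> > 0" using \<delta>_pos \<theta>_bounds by simp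
  hence "(\<lambda>n. (1 + real n) powr (- (\<delta> * \<theta>))) \<longlonglongrightarrow> 0" by real_asymp
  thus ?thesis unfolding trunc_error_def e
    by (intro tendsto_mult_left_zero tendsto_mult_right_zero)
qed


lemma cov_shift:
  assumes "integrable M A" "integrable M B"
  shows "cov M (\<lambda>w. A w - a) (\<lambda>w. B w - b) = cov M A B"
  using assms by (simp add: cov_def prob_space)

definition truncated :: "real \<Rightarrow> int ^ 'm \<Rightarrow> 'a \<Rightarrow> real" where
  "truncated T u w = clip T (Z u w) - (LINT w|M. clip T (Z u w))"

lemma integrable_clip_Z: "T \<ge> 0 \<Longrightarrow> integrable M (\<lambda>w. clip T (Z u w))"
  by (rule integrable_const_bound[of _ T]) (auto simp: clip_le)

lemma truncated_field:
  assumes T: "T \<ge> 0"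
  shows "bounded_weakly_dependent_field M (truncated T) (2 * T) K \<beta>"
proof unfold_locales
  show "truncated T i \<in> borel_measurable M" for i unfolding truncated_def by measurable
  show "\<bar>truncated T i w\<bar> \<le> 2 * T" for i w
  proof -
    have "\<bar>LINT w|M. clip T (Z i w)\<bar> \<le> (LINT w|M. \<bar>clip T (Z i w)\<bar>)" by (rule integral_abs_bound)
    also have "\<dots> \<le> (LINT w|M. T)"
      using integrable_clip_Z[OF T, of i] by (intro integral_mono) (auto simp: clip_le T)
    finally show ?thesis unfolding truncated_def using clip_le[OF T, of "Z i w"] by (simp add: prob_space)
  qed
  show "(LINT w|M. truncated T i w) = 0" for i
    unfolding truncated_def using integrable_clip_Z[OF T, of i] by (simp add: prob_space)
  show "K \<ge> 0" by (rule K_nonneg)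
  show "real CARD('m) < \<beta>" using \<beta>_gt2 by simp
  have "weakly_dependent M (\<lambda>i w. clip T (Z i w) - (LINT w|M. clip T (Z i w))) (\<lambda>h. 1 * (K * (1 + real h) powr - \<beta>))"
    by (rule weakly_dependent_compose[OF wd]) (auto simp: clip_lipschitz)
  thus "weakly_dependent M (truncated T) (\<lambda>h. K * (1 + real h) powr - \<beta>)"
    unfolding truncated_def[abs_def] by simp
qed

text \<open>The remainder \<open>Z u - clip T (Z u)\<close> is a 1-Lipschitz image of \<open>Z u\<close> that vanishes where
  \<open>\<bar>Z u\<bar> \<le> T\<close>. Its covariances therefore satisfy both bounds that are to be interpolated.\<close>

lemma
  assumes T: "T \<ge> 1" and D: "finite D" "D \<noteq> {}"
  shows expectation_truncation_error:
      "(LINT w|M. \<bar>(\<Sum>u\<in>D. Z u w) / sqrt (real (card D)) - (\<Sum>u\<in>D. truncated T u w) / sqrt (real (card D))\<bar>)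
         \<le> sqrt (trunc_error T)"
    and variance_truncation_error:
      "\<bar>(\<Sum>u\<in>D. \<Sum>v\<in>D. LINT w|M. truncated T u w * truncated T v w) / real (card D)
        - (\<Sum>u\<in>D. \<Sum>v\<in>D. LINT w|M. Z u w * Z v w) / real (card D)\<bar> \<le> trunc_error T"
proof -
  have n: "real (card D) > 0" using D by (simp add: card_gt_0_iff)
  have T0: "T \<ge> 0" using T by simp
  interpret Y: bounded_weakly_dependent_field M "truncated T" "2 * T" K \<beta> by (rule truncated_field[OF T0])
  define R where "R u w = Z u w - clip T (Z u w)" for u w
  have Rm[measurable]: "R u \<in> borel_measurable M" for u unfolding R_def by measurable
  have Z1: "\<bar>Z u w\<bar> \<le> \<bar>Z u w\<bar>" for u w by simp
  have Rd: "\<bar>R u w\<bar> \<le> \<bar>Z u w\<bar>" "\<bar>Z u w\<bar> \<le> T \<Longrightarrow> R u w = 0" for u w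
    using T0 by (auto simp: R_def clip_def)
  have cm: "(\<lambda>w. clip T (Z u w)) \<in> borel_measurable M" for u by measurable
  have cd: "\<bar>clip T (Z u w)\<bar> \<le> \<bar>Z u w\<bar>" for u w using T0 by (auto simp: clip_def)
  note sqR = dominated_sq[OF Rm Rd(1)] and sqZ = dominated_sq[OF Z_measurable Z1] and sqc = dominated_sq[OF cm cd]
  have lipR: "\<bar>(x - clip T x) - (y - clip T y)\<bar> \<le> \<bar>x - y\<bar>" for x y using T0 by (auto simp: clip_def)
  have cg: "C * (1 + real (norm_inf (u - v))) powr (- g) \<le> 2 * C * (1 + real (norm_inf (u - v))) powr (- g)"
    for u v :: "int ^ 'm" using C_nonneg by (simp add: mult_right_mono)
  have dg: "m3 * T powr (- \<delta>) \<le> 2 * m3 * T powr (- \<delta>)" using m3_nonneg by (simp add: mult_right_mono)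
  show "(LINT w|M. \<bar>(\<Sum>u\<in>D. Z u w) / sqrt (real (card D)) - (\<Sum>u\<in>D. truncated T u w) / sqrt (real (card D))\<bar>)
         \<le> sqrt (trunc_error T)"
  proof -
    define Q where "Q u w = R u w - (LINT w|M. R u w)" for u w
    have Qm[measurable]: "Q u \<in> borel_measurable M" for u unfolding Q_def by measurable
    have Q_eq: "Z u w - truncated T u w = Q u w" for u w
      unfolding Q_def R_def truncated_def using sqZ(2)[of u] sqc(2)[of u] by (simp add: Z_mean)
    have Q0: "(LINT w|M. Q u w) = 0" for u unfolding Q_def using sqR(2)[of u] by (simp add: prob_space)
    have sqQ: "integrable M (\<lambda>w. (Q u w)\<^sup>2)" for u
    proof -
      have "integrable M (\<lambda>w. (R u w)\<^sup>2 - 2 * R u w * (LINT w|M. R u w) + (LINT w|M. R u w)\<^sup>2)"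
        using sqR[of u] by simp
      thus ?thesis unfolding Q_def by (simp add: power2_diff algebra_simps)
    qed
    have iQ: "integrable M (Q u)" for u by (rule square_integrable_imp_integrable[OF _ sqQ]) simp
    have cQ: "cov M (Q u) (Q v) = cov M (R u) (R v)" for u v
      unfolding Q_def[abs_def] by (rule cov_shift[OF sqR(2) sqR(2)])
    note var = variance_sum_eq[of Q D, OF Qm sqQ]
    have s0: "(LINT w|M. (\<Sum>u\<in>D. Q u w)) = 0" using iQ by (simp add: Q0)
    define W where "W w = (\<Sum>u\<in>D. Q u w) / sqrt (real (card D))" for w
    have [measurable]: "W \<in> borel_measurable M" unfolding W_def by measurable
    have W2: "(W w)\<^sup>2 = ((\<Sum>u\<in>D. Q u w) - (LINT w|M. (\<Sum>u\<in>D. Q u w)))\<^sup>2 / real (card D)" for w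
      unfolding W_def s0 by (simp add: power_divide)
    have "(LINT w|M. (W w)\<^sup>2) = (\<Sum>u\<in>D. \<Sum>v\<in>D. cov M (R u) (R v)) / real (card D)"
      unfolding W2 using var(2) by (simp add: cQ)
    also have "\<dots> \<le> trunc_error T"
    proof (rule order_trans[OF abs_ge_self mean_truncated_cov_le[OF D]])
      show "\<bar>cov M (R u) (R v)\<bar> \<le> 2 * C * (1 + real (norm_inf (u - v))) powr (- g)" for u v
        unfolding R_def[abs_def] using T0
        by (intro order_trans[OF cov_lipschitz_le cg] lipR) auto
      show "\<bar>cov M (R u) (R v)\<bar> \<le> 2 * m3 * T powr (- \<delta>)" for u v
        by (rule order_trans[OF tail_cov_le[OF T Rm Rm Rd Rd(1)] dg])
    qed
    finally have le: "(LINT w|M. (W w)\<^sup>2) \<le> trunc_error T" .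
    have iW: "integrable M (\<lambda>w. (W w)\<^sup>2)" unfolding W2 using var(1) by simp
    have "(\<Sum>u\<in>D. Z u w) / sqrt (real (card D)) - (\<Sum>u\<in>D. truncated T u w) / sqrt (real (card D)) = W w" for w
      unfolding W_def Q_eq[symmetric] by (simp add: sum_subtractf diff_divide_distrib)
    hence "(LINT w|M. \<bar>(\<Sum>u\<in>D. Z u w) / sqrt (real (card D)) - (\<Sum>u\<in>D. truncated T u w) / sqrt (real (card D))\<bar>)
       = (LINT w|M. \<bar>W w\<bar>)" by simp
    also have "\<dots> \<le> sqrt (LINT w|M. (W w)\<^sup>2)" by (rule expectation_abs_le_sqrt[OF _ iW]) simp
    also have "\<dots> \<le> sqrt (trunc_error T)" using le by simp
    finally show ?thesis .
  qed
  have YZ: "(LINT w|M. truncated T u w * truncated T v w) - (LINT w|M. Z u w * Z v w)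
      = - (cov M (R u) (Z v) + cov M (R v) (\<lambda>w. clip T (Z u w)))" for u v
  proof -
    have "(LINT w|M. truncated T u w * truncated T v w) = cov M (truncated T u) (truncated T v)"
      by (simp add: cov_def Y.Y_mean)
    also have "\<dots> = cov M (\<lambda>w. clip T (Z u w)) (\<lambda>w. clip T (Z v w))"
      unfolding truncated_def[abs_def] by (rule cov_shift[OF sqc(2) sqc(2)])
    finally have 1: "(LINT w|M. truncated T u w * truncated T v w) = cov M (\<lambda>w. clip T (Z u w)) (\<lambda>w. clip T (Z v w))" .
    have 2: "(LINT w|M. Z u w * Z v w) = cov M (Z u) (Z v)" by (simp add: cov_def Z_mean)
    have 3: "cov M (Z u) (Z v) = cov M (\<lambda>w. clip T (Z u w)) (Z v) + cov M (R u) (Z v)"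
      unfolding R_def[abs_def] by (rule cov_split) (use sqZ sqc in auto)
    have 4: "cov M (Z v) (\<lambda>w. clip T (Z u w)) = cov M (\<lambda>w. clip T (Z v w)) (\<lambda>w. clip T (Z u w)) + cov M (R v) (\<lambda>w. clip T (Z u w))"
      unfolding R_def[abs_def] by (rule cov_split) (use sqZ sqc in auto)
    show ?thesis unfolding 1 2 3
      using 4 by (simp add: cov_commute[of M "\<lambda>w. clip T (Z u w)"])
  qed
  show "\<bar>(\<Sum>u\<in>D. \<Sum>v\<in>D. LINT w|M. truncated T u w * truncated T v w) / real (card D)
        - (\<Sum>u\<in>D. \<Sum>v\<in>D. LINT w|M. Z u w * Z v w) / real (card D)\<bar> \<le> trunc_error T"
  proof -
    let ?x = "\<lambda>u v. (LINT w|M. truncated T u w * truncated T v w) - (LINT w|M. Z u w * Z v w)"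
    have "\<bar>(\<Sum>u\<in>D. \<Sum>v\<in>D. ?x u v) / real (card D)\<bar> \<le> trunc_error T"
    proof (rule mean_truncated_cov_le[OF D])
      fix u v
      have a: "\<bar>cov M (R u) (Z v)\<bar> \<le> C * (1 + real (norm_inf (u - v))) powr (- g)"
        unfolding R_def[abs_def]
        by (rule cov_lipschitz_le[where \<phi> = "\<lambda>x. x - clip T x" and \<psi> = "\<lambda>x. x"])
          (rule lipR, simp_all add: T0)
      have b: "\<bar>cov M (R v) (\<lambda>w. clip T (Z u w))\<bar> \<le> C * (1 + real (norm_inf (u - v))) powr (- g)"
        unfolding R_def[abs_def] norm_inf_minus_commute[of u v]
        by (rule cov_lipschitz_le[where \<phi> = "\<lambda>x. x - clip T x" and \<psi> = "clip T"])
          (rule lipR, simp_all add: T0 clip_lipschitz)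
      show "\<bar>?x u v\<bar> \<le> 2 * C * (1 + real (norm_inf (u - v))) powr (- g)"
        unfolding YZ using a b by linarith
      have a: "\<bar>cov M (R u) (Z v)\<bar> \<le> m3 * T powr (- \<delta>)" by (rule tail_cov_le[OF T Rm Z_measurable Rd Z1])
      have b: "\<bar>cov M (R v) (\<lambda>w. clip T (Z u w))\<bar> \<le> m3 * T powr (- \<delta>)" by (rule tail_cov_le[OF T Rm cm Rd cd])
      show "\<bar>?x u v\<bar> \<le> 2 * m3 * T powr (- \<delta>)" unfolding YZ using a b by linarith
    qed
    thus ?thesis by (simp add: sum_subtractf diff_divide_distrib)
  qed
qed

lemma exp_minus_lipschitz:
  assumes "a \<ge> 0" "b \<ge> (0::real)"
  shows "\<bar>exp (- a) - exp (- b)\<bar> \<le> \<bar>a - b\<bar>"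
proof -
  have "exp (- a) - exp (- b) \<le> b - a" if "a \<le> b" "a \<ge> 0" for a b :: real
  proof -
    have 1: "1 - exp (a - b) \<le> b - a" using exp_ge_add_one_self[of "a - b"] by linarith
    have "exp (- a) - exp (- b) = exp (- a) * (1 - exp (a - b))"
      by (simp add: right_diff_distrib exp_add[symmetric])
    also have "\<dots> \<le> 1 * (b - a)"
      using that 1 by (intro mult_mono) auto
    finally show ?thesis by simp
  qed
  from this[of a b] this[of b a] assms show ?thesis by (cases "a \<le> b") auto
qed

text \<open>The level \<open>T\<close> is fixed first, with a truncation error that is small for all \<open>N\<close> at once; then
  \<open>N\<close> tends to infinity, since the error for the bounded field depends on \<open>T\<close>. The limiting variance is
  nonnegative as a limit of variances.\<close>

theorem char_clt:
  fixes D :: "nat \<Rightarrow> (int ^ 'm) set"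
  assumes stat: "\<And>u v. (LINT w|M. Z u w * Z v w) = c (v - u)"
    and D: "\<And>N. finite (D N)" "filterlim (\<lambda>N. card (D N)) at_top sequentially"
    and bd: "(\<lambda>N. real (card (lattice_boundary (D N))) / real (card (D N))) \<longlonglongrightarrow> 0"
  shows "(\<lambda>h. \<bar>c h\<bar>) summable_on UNIV" "infsum c UNIV \<ge> 0"
    "(\<lambda>N. CLINT w|M. iexp ((\<Sum>u\<in>D N. Z u w) / sqrt (real (card (D N))))) \<longlonglongrightarrow> exp (- (infsum c UNIV / 2))"
proof -
  have Z1: "\<bar>Z u w\<bar> \<le> \<bar>Z u w\<bar>" for u w by simp
  note sqZ = dominated_sq[OF Z_measurable Z1]
  have cb: "\<bar>c h\<bar> \<le> C * (1 + real (norm_inf h)) powr (- g)" for h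
  proof -
    have "c h = cov M (Z 0) (Z h)" using stat[of 0 h] by (simp add: cov_def Z_mean)
    thus ?thesis using cov_lipschitz_le[of "\<lambda>x. x" "\<lambda>x. x" 0 h] by simp
  qed
  show cs: "(\<lambda>h. \<bar>c h\<bar>) summable_on UNIV"
    by (rule summable_on_comparison_test[where f = "\<lambda>h. C * (1 + real (norm_inf h)) powr (- g)"])
       (auto intro!: summable_on_cmult_right summable_lattice_weight g_gt cb)
  define s where "s = infsum c UNIV"
  define v where "v N = (\<Sum>u\<in>D N. \<Sum>v\<in>D N. c (v - u)) / real (card (D N))" for N
  have v_lim: "v \<longlonglongrightarrow> s" unfolding v_def[abs_def] s_def by (rule mean_of_difference_sums_tendsto[OF cs D bd])
  have v_alt: "v N = (\<Sum>u\<in>D N. \<Sum>v\<in>D N. LINT w|M. Z u w * Z v w) / real (card (D N))" for N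
    by (simp add: v_def stat)
  define S where "S N w = (\<Sum>u\<in>D N. Z u w) / sqrt (real (card (D N)))" for N w
  have [measurable]: "S N \<in> borel_measurable M" for N unfolding S_def by measurable
  have v_nonneg: "v N \<ge> 0" for N
  proof -
    have ip: "integrable M (\<lambda>w. Z u w * Z v w)" for u v using sqZ by (intro integrable_prod_of_squares) auto
    have "(S N w)\<^sup>2 = (\<Sum>u\<in>D N. \<Sum>v\<in>D N. Z u w * Z v w) / real (card (D N))" for w
      by (simp add: S_def power_divide power2_eq_square sum_product)
    hence "v N = (LINT w|M. (S N w)\<^sup>2)" using ip by (simp add: v_alt Bochner_Integration.integral_sum)
    thus ?thesis by (simp add: Bochner_Integration.integral_nonneg)
  qed
  show s0: "infsum c UNIV \<ge> 0"
    using v_lim v_nonneg unfolding s_def by (intro LIMSEQ_le_const[of v]) auto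
  show "(\<lambda>N. CLINT w|M. iexp ((\<Sum>u\<in>D N. Z u w) / sqrt (real (card (D N))))) \<longlonglongrightarrow> exp (- (infsum c UNIV / 2))"
  proof (rule LIMSEQ_I)
    fix r :: real assume r: "r > 0"
    have "(\<lambda>n. sqrt (trunc_error (1 + real n)) + trunc_error (1 + real n) / 2) \<longlonglongrightarrow> sqrt 0 + 0 / 2"
      by (intro tendsto_intros trunc_error_tendsto) auto
    hence "(\<lambda>n. sqrt (trunc_error (1 + real n)) + trunc_error (1 + real n) / 2) \<longlonglongrightarrow> 0" by simp
    hence "\<forall>\<^sub>F n in sequentially. sqrt (trunc_error (1 + real n)) + trunc_error (1 + real n) / 2 < r / 2"
      using r by (intro order_tendstoD(2)) auto
    then obtain n where te: "sqrt (trunc_error (1 + real n)) + trunc_error (1 + real n) / 2 < r / 2"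
      by (auto simp: eventually_sequentially)
    define T where "T = 1 + real n"
    have T: "T \<ge> 1" "T \<ge> 0" by (auto simp: T_def)
    interpret Y: bounded_weakly_dependent_field M "truncated T" "2 * T" K \<beta> by (rule truncated_field[OF T(2)])
    define y where "y N = (CLINT w|M. iexp (Y.normsum (D N) w)) - exp (- (Y.normvar (D N) / 2))" for N
    have "y \<longlonglongrightarrow> 0" unfolding y_def[abs_def] by (rule Y.char_normsum_tendsto[OF \<beta>_gt2 D])
    hence "(\<lambda>N. cmod (y N) + \<bar>v N - s\<bar> / 2) \<longlonglongrightarrow> cmod 0 + \<bar>s - s\<bar> / 2"
      by (intro tendsto_intros v_lim) auto
    hence "(\<lambda>N. cmod (y N) + \<bar>v N - s\<bar> / 2) \<longlonglongrightarrow> 0" by simp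
    hence "\<forall>\<^sub>F N in sequentially. cmod (y N) + \<bar>v N - s\<bar> / 2 < r / 2"
      using r by (intro order_tendstoD(2)) auto
    moreover have "\<forall>\<^sub>F N in sequentially. card (D N) \<ge> 1" using D(2) by (auto simp: filterlim_at_top)
    ultimately have "\<forall>\<^sub>F N in sequentially. norm ((CLINT w|M. iexp (S N w)) - exp (- (s / 2))) < r"
    proof eventually_elim
      case (elim N)
      hence ne: "D N \<noteq> {}" by auto
      have Ym[measurable]: "Y.normsum (D N) \<in> borel_measurable M" unfolding Y.normsum_def by measurable
      have i1: "integrable M (\<lambda>w. iexp (S N w))" "integrable M (\<lambda>w. iexp (Y.normsum (D N) w))"
        by (rule integrable_const_bound[of _ 1], auto)+
      have iS: "integrable M (S N)" unfolding S_def[abs_def] using sqZ(2) by simp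
      have iY: "integrable M (Y.normsum (D N))" unfolding Y.normsum_def[abs_def] using Y.integrable_Y by simp
      have 1: "cmod ((CLINT w|M. iexp (S N w)) - (CLINT w|M. iexp (Y.normsum (D N) w))) \<le> sqrt (trunc_error T)"
      proof -
        have "cmod ((CLINT w|M. iexp (S N w)) - (CLINT w|M. iexp (Y.normsum (D N) w)))
           = cmod (CLINT w|M. iexp (S N w) - iexp (Y.normsum (D N) w))" using i1 by simp
        also have "\<dots> \<le> (LINT w|M. cmod (iexp (S N w) - iexp (Y.normsum (D N) w)))" by (rule integral_norm_bound)
        also have "\<dots> \<le> (LINT w|M. \<bar>S N w - Y.normsum (D N) w\<bar>)"
        proof (rule integral_mono)
          show "integrable M (\<lambda>w. cmod (iexp (S N w) - iexp (Y.normsum (D N) w)))"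
            by (rule integrable_norm[OF Bochner_Integration.integrable_diff[OF i1]])
          show "integrable M (\<lambda>w. \<bar>S N w - Y.normsum (D N) w\<bar>)" using iS iY by simp
          show "cmod (iexp (S N w) - iexp (Y.normsum (D N) w)) \<le> \<bar>S N w - Y.normsum (D N) w\<bar>" for w
            by (rule cmod_iexp_diff_le)
        qed
        also have "\<dots> \<le> sqrt (trunc_error T)"
          unfolding S_def Y.normsum_def by (rule expectation_truncation_error[OF T(1) D(1) ne])
        finally show ?thesis .
      qed
      have 2: "\<bar>Y.normvar (D N) - v N\<bar> \<le> trunc_error T"
        unfolding Y.normvar_def v_alt by (rule variance_truncation_error[OF T(1) D(1) ne])
      have nv: "Y.normvar (D N) \<ge> 0" unfolding Y.normvar_eq by (rule Bochner_Integration.integral_nonneg) simp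
      have 3: "cmod (complex_of_real (exp (- (Y.normvar (D N) / 2))) - complex_of_real (exp (- (s / 2)))) \<le> \<bar>Y.normvar (D N) - s\<bar> / 2"
        unfolding of_real_diff[symmetric] norm_of_real
      proof -
        have "\<bar>exp (- (Y.normvar (D N) / 2)) - exp (- (s / 2))\<bar> \<le> \<bar>Y.normvar (D N) / 2 - s / 2\<bar>"
          using nv s0 by (intro exp_minus_lipschitz) (auto simp: s_def)
        also have "\<dots> = \<bar>Y.normvar (D N) - s\<bar> / 2" by (simp add: diff_divide_distrib[symmetric])
        finally show "\<bar>exp (- (Y.normvar (D N) / 2)) - exp (- (s / 2))\<bar> \<le> \<bar>Y.normvar (D N) - s\<bar> / 2" .
      qed
      define p q where "p = (CLINT w|M. iexp (S N w)) - (CLINT w|M. iexp (Y.normsum (D N) w))"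
        and "q = complex_of_real (exp (- (Y.normvar (D N) / 2))) - complex_of_real (exp (- (s / 2)))"
      have pq: "(CLINT w|M. iexp (S N w)) - exp (- (s / 2)) = (p + y N) + q"
        by (simp add: y_def p_def q_def)
      have "norm ((CLINT w|M. iexp (S N w)) - exp (- (s / 2))) \<le> sqrt (trunc_error T) + cmod (y N) + \<bar>Y.normvar (D N) - s\<bar> / 2"
        using 1 3 norm_triangle_ineq[of "p + y N" q] norm_triangle_ineq[of p "y N"]
        unfolding pq p_def[symmetric] q_def[symmetric] by linarith
      also have "\<dots> \<le> sqrt (trunc_error T) + cmod (y N) + (trunc_error T + \<bar>v N - s\<bar>) / 2" using 2 by auto
      also have "\<dots> < r" using te elim(1) unfolding T_def by (simp add: add_divide_distrib)
      finally show ?case .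
    qed
    thus "\<exists>no. \<forall>N\<ge>no. norm ((CLINT w|M. iexp ((\<Sum>u\<in>D N. Z u w) / sqrt (real (card (D N))))) - exp (- (infsum c UNIV / 2))) < r"
      unfolding S_def s_def by (simp add: eventually_sequentially)
  qed
qed

end


section \<open>Normal laws\<close>

lemma inner_matrix_vector_sum:
  "x \<bullet> (A *v y) = (\<Sum>i\<in>UNIV. \<Sum>j\<in>UNIV. x $ i * A $ i $ j * y $ j)" for A :: "real ^ 'k::finite ^ 'l::finite"
  by (simp add: inner_vec_def matrix_vector_mult_def sum_distrib_left mult.assoc)

lemma inner_symmetric_matrix:
  fixes A :: "real ^ 'k::finite ^ 'k"
  assumes "transpose A = A"
  shows "x \<bullet> (A *v y) = y \<bullet> (A *v x)"
proof -
  have "x \<bullet> (A *v y) = (x v* A) \<bullet> y" by (simp add: dot_lmul_matrix)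
  also have "x v* A = transpose A *v x" by simp
  finally show ?thesis using assms by (simp add: inner_commute)
qed

lemma outer_mult: "outer v v *v t = (v \<bullet> t) *\<^sub>R v"
  by (simp add: vec_eq_iff outer_def matrix_vector_mult_def inner_vec_def sum_distrib_left mult_ac)

lemma normal_law_zero: "normal_law 0 (0 :: real ^ 'k::finite ^ 'k) (return borel 0)"
  unfolding normal_law_def by (auto intro!: prob_space_return simp: integral_return)

lemma normal_law_rank_one:
  fixes v :: "real ^ 'k::finite"
  shows "normal_law 0 (outer v v) (distr std_normal_distribution borel (\<lambda>s. s *\<^sub>R v))"
proof -
  have [measurable]: "(\<lambda>s. s *\<^sub>R v) \<in> borel_measurable std_normal_distribution" by simp
  interpret N: prob_space std_normal_distribution by (rule prob_space_normal_density) simp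
  show ?thesis unfolding normal_law_def
  proof (intro conjI allI)
    show "prob_space (distr std_normal_distribution borel (\<lambda>s. s *\<^sub>R v))" by (rule N.prob_space_distr) simp
    fix t
    have "(CLINT x|distr std_normal_distribution borel (\<lambda>s. s *\<^sub>R v). iexp (t \<bullet> x))
        = (CLINT s|std_normal_distribution. iexp ((t \<bullet> v) * s))"
      by (subst integral_distr) (auto simp: mult.commute)
    also have "\<dots> = exp (- ((t \<bullet> v)\<^sup>2) / 2)"
      using fun_cong[OF char_std_normal_distribution, of "t \<bullet> v"] by (simp add: char_def)
    finally show "(CLINT x|distr std_normal_distribution borel (\<lambda>s. s *\<^sub>R v). iexp (t \<bullet> x)) =
          exp (\<i> * complex_of_real (t \<bullet> 0) - complex_of_real (t \<bullet> (outer v v *v t)) / 2)"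
      by (simp add: outer_mult power2_eq_square inner_commute exp_of_real[symmetric])
  qed simp
qed

lemma normal_law_add:
  fixes A B :: "real ^ 'k::finite ^ 'k"
  assumes "normal_law 0 A \<mu>" "normal_law 0 B \<nu>"
  shows "\<exists>\<rho>. normal_law 0 (A + B) \<rho>"
proof -
  have s[measurable_cong]: "sets \<mu> = sets borel" "sets \<nu> = sets borel" using assms by (auto simp: normal_law_def)
  interpret \<mu>: prob_space \<mu> using assms by (simp add: normal_law_def)
  interpret \<nu>: prob_space \<nu> using assms by (simp add: normal_law_def)
  interpret P: pair_prob_space \<mu> \<nu> ..
  let ?\<rho> = "distr (\<mu> \<Otimes>\<^sub>M \<nu>) borel (\<lambda>z. fst z + snd z)"
  have "normal_law 0 (A + B) ?\<rho>" unfolding normal_law_def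
  proof (intro conjI allI)
    show "prob_space ?\<rho>" by (rule P.prob_space_distr) simp
    fix t :: "real ^ 'k"
    define f where "f = (\<lambda>z. iexp (t \<bullet> (fst z + snd z)) :: complex)"
    have [measurable]: "f \<in> borel_measurable (\<mu> \<Otimes>\<^sub>M \<nu>)" unfolding f_def by measurable
    have i: "integrable (\<mu> \<Otimes>\<^sub>M \<nu>) f" by (rule P.integrable_const_bound[of _ 1]) (auto simp: f_def)
    have "(CLINT x|?\<rho>. iexp (t \<bullet> x)) = integral\<^sup>L (\<mu> \<Otimes>\<^sub>M \<nu>) f"
      unfolding f_def by (subst integral_distr) auto
    also have "\<dots> = (CLINT x|\<mu>. CLINT y|\<nu>. f (x, y))" using P.integral_fst'[OF i] by simp
    also have "\<dots> = (CLINT x|\<mu>. CLINT y|\<nu>. iexp (t \<bullet> x) * iexp (t \<bullet> y))"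
      by (simp add: f_def inner_add_right exp_add[symmetric] distrib_left)
    also have "\<dots> = (CLINT x|\<mu>. iexp (t \<bullet> x)) * (CLINT y|\<nu>. iexp (t \<bullet> y))" by simp
    also have "\<dots> = exp (\<i> * complex_of_real (t \<bullet> 0) - complex_of_real (t \<bullet> ((A + B) *v t)) / 2)"
      using assms by (simp add: normal_law_def exp_add[symmetric] matrix_vector_mult_add_rdistrib inner_add_right
          add_divide_distrib)
    finally show "(CLINT x|?\<rho>. iexp (t \<bullet> x)) = exp (\<i> * complex_of_real (t \<bullet> 0) - complex_of_real (t \<bullet> ((A + B) *v t)) / 2)" .
  qed simp
  thus ?thesis by blast
qed

text \<open>A step of the Cholesky decomposition: a positive diagonal entry is eliminated by subtracting
  a rank-one matrix, a vanishing one has a vanishing row.\<close>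

lemma normal_law_exists:
  fixes A :: "real ^ 'k::finite ^ 'k"
  assumes "pos_semidef A"
  shows "\<exists>\<mu>. normal_law 0 A \<mu>"
proof -
  have "\<exists>\<mu>. normal_law 0 A \<mu>" if "finite I" "pos_semidef A" "\<And>i j. i \<notin> I \<Longrightarrow> A $ i $ j = 0"
    for I and A :: "real ^ 'k ^ 'k"
    using that
  proof (induction I arbitrary: A rule: finite_induct)
    case empty
    hence "A = 0" by (simp add: vec_eq_iff)
    thus ?case using normal_law_zero by blast
  next
    case (insert i I)
    have sym: "transpose A = A" and psd: "0 \<le> x \<bullet> (A *v x)" for x
      using insert.prems(1) by (auto simp: pos_semidef_def)
    have sym': "A $ a $ b = A $ b $ a" for a b
      using arg_cong[OF sym, of "\<lambda>B. B $ b $ a"] by (simp add: transpose_def)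
    define e where "e = (axis i 1 :: real ^ 'k)"
    have Ae: "(A *v e) $ a = A $ a $ i" for a
      by (simp add: e_def matrix_vector_mult_def axis_def if_distrib cong: if_cong)
    have eA: "e \<bullet> (A *v x) = (A *v x) $ i" for x by (simp add: e_def inner_axis')
    define d where "d = A $ i $ i"
    have q: "(x + s *\<^sub>R e) \<bullet> (A *v (x + s *\<^sub>R e)) = x \<bullet> (A *v x) + 2 * s * (x \<bullet> (A *v e)) + s\<^sup>2 * d" for x s
    proof -
      have "e \<bullet> (A *v x) = x \<bullet> (A *v e)" by (rule inner_symmetric_matrix[OF sym])
      thus ?thesis
        by (simp add: matrix_vector_right_distrib matrix_vector_mult_scaleR inner_add_left inner_add_right
            eA[of e] Ae d_def power2_eq_square algebra_simps)
    qed
    have d0: "d \<ge> 0" using psd[of e] by (simp add: eA Ae d_def)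
    show ?case
    proof (cases "d = 0")
      case True
      have "x \<bullet> (A *v e) = 0" for x
      proof (rule ccontr)
        define b where "b = x \<bullet> (A *v e)"
        assume "x \<bullet> (A *v e) \<noteq> 0"
        hence b: "b \<noteq> 0" by (simp add: b_def)
        \<comment> \<open>Along \<open>e\<close> the quadratic form is affine in \<open>s\<close>; this \<open>s\<close> gives it the value \<open>- 1\<close>.\<close>
        define s where "s = - (x \<bullet> (A *v x) + 1) / (2 * b)"
        have "0 \<le> x \<bullet> (A *v x) + 2 * s * b" using psd[of "x + s *\<^sub>R e"] unfolding q b_def True by simp
        also have "\<dots> = - 1" using b by (simp add: s_def field_simps)
        finally show False by simp
      qed
      from this[of "axis _ 1"] have "A $ a $ i = 0" for a by (simp add: inner_axis' Ae)
      hence "A $ i $ j = 0" for j using sym'[of i j] by simp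
      hence "A $ a $ j = 0" if "a \<notin> I" for a j using insert.prems(2)[of a j] that by (cases "a = i") auto
      thus ?thesis by (intro insert.IH insert.prems(1))
    next
      case False
      hence d: "d > 0" using d0 by simp
      define v where "v = (1 / sqrt d) *\<^sub>R (A *v e)"
      define B where "B = A - outer v v"
      have vv: "outer v v $ a $ b = A $ a $ i * A $ b $ i / d" for a b
        using d by (simp add: outer_def v_def Ae field_simps)
      have "pos_semidef B" unfolding pos_semidef_def
      proof (intro conjI allI)
        show "transpose B = B"
          using sym' by (simp add: vec_eq_iff transpose_def B_def vv mult.commute)
        fix x
        define b where "b = x \<bullet> (A *v e)"
        have "0 \<le> x \<bullet> (A *v x) + 2 * (- (b / d)) * b + (- (b / d))\<^sup>2 * d"
          using psd[of "x + (- (b / d)) *\<^sub>R e"] unfolding q b_def by simp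
        also have "\<dots> = x \<bullet> (A *v x) - b * b / d" using d by (simp add: field_simps power2_eq_square)
        also have "\<dots> = x \<bullet> (B *v x)"
        proof -
          have "v \<bullet> x = b / sqrt d" by (simp add: v_def b_def inner_commute)
          hence "x \<bullet> (outer v v *v x) = (b / sqrt d) * (b / sqrt d)" by (simp add: outer_mult inner_commute)
          also have "\<dots> = b * b / d" using d by simp
          finally show ?thesis by (simp add: B_def matrix_vector_mult_diff_rdistrib inner_diff_right)
        qed
        finally show "0 \<le> x \<bullet> (B *v x)" .
      qed
      moreover have "B $ a $ j = 0" if "a \<notin> I" for a j
      proof (cases "a = i")
        case True
        thus ?thesis using d sym'[of i j] by (simp add: B_def vv d_def)
      next
        case False
        hence "A $ a $ j = 0" "A $ a $ i = 0" using that insert.prems(2) by auto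
        thus ?thesis by (simp add: B_def vv)
      qed
      ultimately obtain \<mu> where "normal_law 0 B \<mu>" using insert.IH[of B] by blast
      from normal_law_add[OF this normal_law_rank_one[of v]] show ?thesis by (simp add: B_def)
    qed
  qed
  from this[of UNIV A] assms show ?thesis by simp
qed

section \<open>Levy's continuity theorem in several dimensions\<close>

definition gauss_kernel :: "real \<Rightarrow> real ^ 'k::finite \<Rightarrow> real" where
  "gauss_kernel \<sigma> x = (\<Prod>b\<in>Basis. normal_density 0 \<sigma> (x \<bullet> b))"

lemma gauss_kernel_measurable [measurable]: "gauss_kernel \<sigma> \<in> borel_measurable borel"
  unfolding gauss_kernel_def by measurable

lemma gauss_kernel_nonneg: "gauss_kernel \<sigma> x \<ge> 0"
  unfolding gauss_kernel_def by (intro prod_nonneg) auto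

lemma gauss_kernel_eq:
  "gauss_kernel \<sigma> (x :: real ^ 'k::finite) = (1 / sqrt (2 * pi * \<sigma>\<^sup>2)) ^ CARD('k) * exp (- ((norm x)\<^sup>2 / (2 * \<sigma>\<^sup>2)))"
proof -
  have "gauss_kernel \<sigma> x = (1 / sqrt (2 * pi * \<sigma>\<^sup>2)) ^ CARD('k) * exp (\<Sum>b\<in>Basis. - (x \<bullet> b)\<^sup>2 / (2 * \<sigma>\<^sup>2))"
  proof -
    have nd: "normal_density 0 \<sigma> y = (1 / sqrt (2 * pi * \<sigma>\<^sup>2)) * exp (- y\<^sup>2 / (2 * \<sigma>\<^sup>2))" for y
      by (simp add: normal_density_def)
    show ?thesis unfolding gauss_kernel_def nd prod.distrib by (simp add: exp_sum)
  qed
  also have "(\<Sum>b\<in>Basis. - (x \<bullet> b)\<^sup>2 / (2 * \<sigma>\<^sup>2)) = - ((norm x)\<^sup>2 / (2 * \<sigma>\<^sup>2))"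
  proof -
    have "(norm x)\<^sup>2 = (\<Sum>b\<in>Basis. (x \<bullet> b)\<^sup>2)"
      unfolding power2_norm_eq_inner by (subst euclidean_inner) (simp add: power2_eq_square)
    thus ?thesis by (simp add: sum_divide_distrib sum_negf)
  qed
  finally show ?thesis .
qed

lemma gauss_kernel_le: "gauss_kernel \<sigma> (x :: real ^ 'k::finite) \<le> (1 / sqrt (2 * pi * \<sigma>\<^sup>2)) ^ CARD('k)"
  unfolding gauss_kernel_eq by (intro mult_left_le) auto

lemma gauss_kernel_even: "gauss_kernel \<sigma> (- x) = gauss_kernel \<sigma> x"
  unfolding gauss_kernel_eq by simp

lemma nn_integral_product_density:
  fixes h :: "real ^ 'k::finite \<Rightarrow> real \<Rightarrow> real"
  assumes "\<And>b. b \<in> Basis \<Longrightarrow> integrable lborel (h b)" "\<And>b x. b \<in> Basis \<Longrightarrow> h b x \<ge> 0"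
  shows "(\<integral>\<^sup>+x. ennreal (\<Prod>b\<in>Basis. h b (x \<bullet> b)) \<partial>lborel) = ennreal (\<Prod>b\<in>Basis. LINT x|lborel. h b x)"
proof -
  have [measurable]: "h b \<in> borel_measurable borel" if "b \<in> Basis" for b
    using borel_measurable_integrable[OF assms(1)[OF that]] by simp
  have "(\<integral>\<^sup>+x. ennreal (\<Prod>b\<in>Basis. h b (x \<bullet> b)) \<partial>lborel)
      = (\<integral>\<^sup>+x. (\<Prod>b\<in>Basis. ennreal (h b (x \<bullet> b))) \<partial>(lborel :: (real ^ 'k) measure))"
    using assms(2) by (intro nn_integral_cong) (simp add: prod_ennreal)
  also have "\<dots> = (\<Prod>b\<in>(Basis :: (real ^ 'k) set). \<integral>\<^sup>+x. ennreal (h b x) \<partial>lborel)"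
    by (rule nn_integral_lborel_prod) auto
  also have "\<dots> = (\<Prod>b\<in>(Basis :: (real ^ 'k) set). ennreal (LINT x|lborel. h b x))"
    using assms by (intro prod.cong refl nn_integral_eq_integral) auto
  also have "\<dots> = ennreal (\<Prod>b\<in>Basis. LINT x|lborel. h b x)"
    using assms by (intro prod_ennreal Bochner_Integration.integral_nonneg) auto
  finally show ?thesis .
qed

lemma gauss_kernel_integral:
  assumes "\<sigma> > 0"
  shows "integrable lborel (gauss_kernel \<sigma> :: real ^ 'k::finite \<Rightarrow> real)"
    "(LINT x|lborel. gauss_kernel \<sigma> (x :: real ^ 'k)) = 1"
proof -
  have nn: "(\<integral>\<^sup>+x. ennreal (gauss_kernel \<sigma> (x :: real ^ 'k)) \<partial>lborel) = 1"
    unfolding gauss_kernel_def using assms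
    by (subst nn_integral_product_density) auto
  show i: "integrable lborel (gauss_kernel \<sigma> :: real ^ 'k \<Rightarrow> real)"
    by (intro integrableI_nonneg) (auto simp: nn gauss_kernel_nonneg)
  show "(LINT x|lborel. gauss_kernel \<sigma> (x :: real ^ 'k)) = 1"
    using nn by (subst integral_eq_nn_integral) (auto simp: gauss_kernel_nonneg)
qed

lemma gauss_kernel_second_moment:
  assumes "\<sigma> > 0"
  shows "integrable lborel (\<lambda>x :: real ^ 'k::finite. gauss_kernel \<sigma> x * (norm x)\<^sup>2)"
    "(LINT x|lborel. gauss_kernel \<sigma> (x :: real ^ 'k) * (norm x)\<^sup>2) = real CARD('k) * \<sigma>\<^sup>2"
proof -
  define h where "h a b x = normal_density 0 \<sigma> x * (if b = a then x\<^sup>2 else 1)" for a b :: "real ^ 'k" and x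
  have v: "integrable lborel (\<lambda>x. normal_density 0 \<sigma> x * x\<^sup>2)" "(LINT x|lborel. normal_density 0 \<sigma> x * x\<^sup>2) = \<sigma>\<^sup>2"
    using integrable_normal_moment[OF assms, of 0 2] integral_normal_moment_even[OF assms, of 0 1] by simp_all
  have hi: "integrable lborel (h a b)" "(LINT x|lborel. h a b x) = (if b = a then \<sigma>\<^sup>2 else 1)" for a b
    using v assms by (cases "b = a"; simp add: h_def[abs_def])+
  have hnn: "h a b x \<ge> 0" for a b x by (simp add: h_def)
  have hp: "(\<Prod>b\<in>Basis. h a b (x \<bullet> b)) = gauss_kernel \<sigma> x * (x \<bullet> a)\<^sup>2" if "a \<in> Basis" for a x
    using that by (simp add: h_def prod.distrib gauss_kernel_def prod.delta)
  have nn: "(\<integral>\<^sup>+x. ennreal (gauss_kernel \<sigma> x * (x \<bullet> a)\<^sup>2) \<partial>lborel) = ennreal (\<sigma>\<^sup>2)" if "a \<in> Basis" for a :: "real ^ 'k"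
    unfolding hp[OF that, symmetric]
    by (subst nn_integral_product_density) (use that in \<open>auto simp: hi hnn prod.delta\<close>)
  have ia: "integrable lborel (\<lambda>x. gauss_kernel \<sigma> x * (x \<bullet> a)\<^sup>2)" if "a \<in> Basis" for a :: "real ^ 'k"
    by (intro integrableI_nonneg) (auto simp: nn[OF that] gauss_kernel_nonneg)
  have va: "(LINT x|lborel. gauss_kernel \<sigma> x * (x \<bullet> a)\<^sup>2) = \<sigma>\<^sup>2" if "a \<in> Basis" for a :: "real ^ 'k"
    using nn[OF that] by (subst integral_eq_nn_integral) (auto simp: gauss_kernel_nonneg)
  have e: "gauss_kernel \<sigma> x * (norm x)\<^sup>2 = (\<Sum>a\<in>Basis. gauss_kernel \<sigma> x * (x \<bullet> a)\<^sup>2)" for x :: "real ^ 'k"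
  proof -
    have "(norm x)\<^sup>2 = (\<Sum>b\<in>Basis. (x \<bullet> b)\<^sup>2)"
      unfolding power2_norm_eq_inner by (subst euclidean_inner) (simp add: power2_eq_square)
    thus ?thesis by (simp add: sum_distrib_left)
  qed
  show "integrable lborel (\<lambda>x :: real ^ 'k. gauss_kernel \<sigma> x * (norm x)\<^sup>2)" unfolding e using ia by simp
  show "(LINT x|lborel. gauss_kernel \<sigma> (x :: real ^ 'k) * (norm x)\<^sup>2) = real CARD('k) * \<sigma>\<^sup>2"
    unfolding e using ia va by (simp add: Bochner_Integration.integral_sum)
qed

definition smoothed :: "real \<Rightarrow> (real ^ 'k::finite \<Rightarrow> real) \<Rightarrow> real ^ 'k \<Rightarrow> real" where
  "smoothed \<sigma> g x = (LINT y|lborel. g y * gauss_kernel \<sigma> (x - y))"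

text \<open>Chebyshev's inequality: outside the ball of radius \<open>d\<close> the kernel has mass at most
  \<open>CARD('k) * \<sigma>\<^sup>2 / d\<^sup>2\<close>.\<close>

lemma smoothed_close:
  fixes g :: "real ^ 'k::finite \<Rightarrow> real"
  assumes [measurable]: "g \<in> borel_measurable borel" and G: "\<And>x. \<bar>g x\<bar> \<le> G"
    and uc: "\<And>x y. norm (x - y) < d \<Longrightarrow> \<bar>g x - g y\<bar> \<le> \<epsilon>" and d: "d > 0" and \<sigma>: "\<sigma> > 0" and \<epsilon>: "\<epsilon> \<ge> 0"
  shows "\<bar>smoothed \<sigma> g x - g x\<bar> \<le> \<epsilon> + 2 * G * (real CARD('k) * \<sigma>\<^sup>2 / d\<^sup>2)"
proof -
  note gi = gauss_kernel_integral[OF \<sigma>, where 'k = 'k] and gm = gauss_kernel_second_moment[OF \<sigma>, where 'k = 'k]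
  have G0: "G \<ge> 0" using G[of 0] by linarith
  have e: "smoothed \<sigma> g x = (LINT z|lborel. g (x + z) * gauss_kernel \<sigma> z)"
  proof -
    have "smoothed \<sigma> g x = (LINT y|distr lborel borel ((+) x). g y * gauss_kernel \<sigma> (x - y))"
      by (simp add: lborel_distr_plus smoothed_def)
    also have "\<dots> = (LINT z|lborel. g (x + z) * gauss_kernel \<sigma> (x - (x + z)))"
      by (subst integral_distr) auto
    finally show ?thesis by (simp add: gauss_kernel_even)
  qed
  have i1: "integrable lborel (\<lambda>z. g (x + z) * gauss_kernel \<sigma> z)"
  proof (rule Bochner_Integration.integrable_bound)
    show "integrable lborel (\<lambda>z :: real ^ 'k. G * gauss_kernel \<sigma> z)" using gi by simp
    show "AE z in lborel. norm (g (x + z) * gauss_kernel \<sigma> z) \<le> norm (G * gauss_kernel \<sigma> z)"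
      using G0 by (auto simp: abs_mult gauss_kernel_nonneg intro!: mult_right_mono G)
  qed simp
  have "smoothed \<sigma> g x - g x = (LINT z|lborel. g (x + z) * gauss_kernel \<sigma> z) - g x * (LINT z|lborel. gauss_kernel \<sigma> (z :: real ^ 'k))"
    using gi by (simp add: e)
  also have "\<dots> = (LINT z|lborel. (g (x + z) - g x) * gauss_kernel \<sigma> z)"
    using i1 gi by (simp add: left_diff_distrib)
  also have "\<bar>\<dots>\<bar> \<le> (LINT z|lborel. \<bar>(g (x + z) - g x) * gauss_kernel \<sigma> z\<bar>)" by (rule integral_abs_bound)
  also have "\<dots> \<le> (LINT z|lborel. \<epsilon> * gauss_kernel \<sigma> z + (2 * G / d\<^sup>2) * (gauss_kernel \<sigma> (z :: real ^ 'k) * (norm z)\<^sup>2))"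
  proof (rule integral_mono)
    show "integrable lborel (\<lambda>z. \<bar>(g (x + z) - g x) * gauss_kernel \<sigma> z\<bar>)"
      unfolding left_diff_distrib using i1 gi by simp
    show "integrable lborel (\<lambda>z :: real ^ 'k. \<epsilon> * gauss_kernel \<sigma> z + (2 * G / d\<^sup>2) * (gauss_kernel \<sigma> z * (norm z)\<^sup>2))"
      using gi gm by simp
    fix z :: "real ^ 'k"
    have "\<bar>g (x + z) - g x\<bar> \<le> \<epsilon> + (2 * G / d\<^sup>2) * (norm z)\<^sup>2"
    proof (cases "norm z < d")
      case True
      hence "\<bar>g (x + z) - g x\<bar> \<le> \<epsilon>" by (intro uc) simp
      thus ?thesis using G0 by (simp add: add_increasing2)
    next
      case False
      hence "1 \<le> (norm z)\<^sup>2 / d\<^sup>2" using d by (simp add: power_mono)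
      hence "2 * G \<le> 2 * G * ((norm z)\<^sup>2 / d\<^sup>2)" using G0 by (metis mult.right_neutral mult_left_mono mult_nonneg_nonneg zero_le_numeral)
      moreover have "\<bar>g (x + z) - g x\<bar> \<le> 2 * G" using G[of "x + z"] G[of x] by linarith
      ultimately show ?thesis using \<epsilon> by simp
    qed
    hence "\<bar>g (x + z) - g x\<bar> * gauss_kernel \<sigma> z \<le> (\<epsilon> + (2 * G / d\<^sup>2) * (norm z)\<^sup>2) * gauss_kernel \<sigma> z"
      by (rule mult_right_mono) (rule gauss_kernel_nonneg)
    also have "\<dots> = \<epsilon> * gauss_kernel \<sigma> z + (2 * G / d\<^sup>2) * (gauss_kernel \<sigma> z * (norm z)\<^sup>2)"
      by (simp add: algebra_simps)
    finally show "\<bar>(g (x + z) - g x) * gauss_kernel \<sigma> z\<bar> \<le> \<epsilon> * gauss_kernel \<sigma> z + (2 * G / d\<^sup>2) * (gauss_kernel \<sigma> z * (norm z)\<^sup>2)"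
      unfolding abs_mult abs_of_nonneg[OF gauss_kernel_nonneg] .
  qed
  also have "\<dots> = \<epsilon> + 2 * G * (real CARD('k) * \<sigma>\<^sup>2 / d\<^sup>2)" using gi gm by simp
  finally show ?thesis .
qed

text \<open>Parseval's identity: the Gaussian kernel is itself a characteristic function, so its
  convolution with a law is an average of the characteristic function of that law.\<close>

lemma integral_gauss_kernel_eq_char:
  fixes \<mu> \<gamma> :: "(real ^ 'k::finite) measure"
  assumes \<mu>: "prob_space \<mu>" "sets \<mu> = sets borel" and \<gamma>: "normal_law 0 (mat 1) \<gamma>"
  shows "complex_of_real (LINT x|\<mu>. gauss_kernel \<sigma> (x - y)) = (1 / sqrt (2 * pi * \<sigma>\<^sup>2)) ^ CARD('k) *
     (CLINT t|\<gamma>. (CLINT x|\<mu>. iexp (((1 / \<sigma>) *\<^sub>R t) \<bullet> x)) * iexp (- ((1 / \<sigma>) *\<^sub>R t) \<bullet> y))"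
proof -
  have s[measurable_cong]: "sets \<mu> = sets borel" "sets \<gamma> = sets borel" using assms by (auto simp: normal_law_def)
  interpret \<mu>: prob_space \<mu> by fact
  interpret \<gamma>: prob_space \<gamma> using \<gamma> by (simp add: normal_law_def)
  interpret P: pair_prob_space \<mu> \<gamma> ..
  define f where "f x t = (iexp (((1 / \<sigma>) *\<^sub>R t) \<bullet> (x - y)) :: complex)" for x t :: "real ^ 'k"
  have [measurable]: "(\<lambda>(x, t). f x t) \<in> borel_measurable (\<mu> \<Otimes>\<^sub>M \<gamma>)" unfolding f_def by measurable
  have i: "integrable (\<mu> \<Otimes>\<^sub>M \<gamma>) (\<lambda>(x, t). f x t)"
    by (rule P.integrable_const_bound[of _ 1]) (auto simp: f_def)
  have inner: "(CLINT t|\<gamma>. f x t) = complex_of_real (exp (- ((norm (x - y))\<^sup>2 / (2 * \<sigma>\<^sup>2))))" for x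
  proof -
    let ?z = "(1 / \<sigma>) *\<^sub>R (x - y)"
    have "(CLINT t|\<gamma>. f x t) = (CLINT t|\<gamma>. iexp (?z \<bullet> t))" unfolding f_def by (simp add: inner_commute)
    also have "\<dots> = exp (\<i> * complex_of_real (?z \<bullet> 0) - complex_of_real (?z \<bullet> (mat 1 *v ?z)) / 2)"
      using \<gamma> unfolding normal_law_def by blast
    also have "\<dots> = exp (complex_of_real (- ((norm (x - y))\<^sup>2 / (2 * \<sigma>\<^sup>2))))"
    proof -
      have "?z \<bullet> (mat 1 *v ?z) / 2 = (norm (x - y))\<^sup>2 / (2 * \<sigma>\<^sup>2)"
        unfolding power2_norm_eq_inner by (simp add: power2_eq_square)
      hence "complex_of_real (?z \<bullet> (mat 1 *v ?z)) / 2 = complex_of_real ((norm (x - y))\<^sup>2 / (2 * \<sigma>\<^sup>2))"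
        by (metis of_real_divide of_real_numeral)
      thus ?thesis by simp
    qed
    finally show ?thesis unfolding exp_of_real .
  qed
  have "(CLINT t|\<gamma>. (CLINT x|\<mu>. iexp (((1 / \<sigma>) *\<^sub>R t) \<bullet> x)) * iexp (- ((1 / \<sigma>) *\<^sub>R t) \<bullet> y))
      = (CLINT t|\<gamma>. CLINT x|\<mu>. f x t)"
  proof (rule Bochner_Integration.integral_cong[OF refl])
    fix t
    have "f x t = iexp (((1 / \<sigma>) *\<^sub>R t) \<bullet> x) * iexp (- ((1 / \<sigma>) *\<^sub>R t) \<bullet> y)" for x
      unfolding f_def exp_add[symmetric] by (intro arg_cong[where f = exp]) (simp add: inner_diff_right algebra_simps)
    thus "(CLINT x|\<mu>. iexp (((1 / \<sigma>) *\<^sub>R t) \<bullet> x)) * iexp (- ((1 / \<sigma>) *\<^sub>R t) \<bullet> y) = (CLINT x|\<mu>. f x t)"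
      by simp
  qed
  also have "\<dots> = (CLINT x|\<mu>. CLINT t|\<gamma>. f x t)" by (rule P.Fubini_integral[OF i])
  also have "\<dots> = complex_of_real (LINT x|\<mu>. exp (- ((norm (x - y))\<^sup>2 / (2 * \<sigma>\<^sup>2))))"
    unfolding inner by simp
  finally show ?thesis unfolding gauss_kernel_eq by simp
qed

lemma smoothed_fubini:
  fixes \<mu> :: "(real ^ 'k::finite) measure"
  assumes \<mu>: "prob_space \<mu>" "sets \<mu> = sets borel" and g: "integrable lborel g"
  shows "(LINT x|\<mu>. smoothed \<sigma> g x) = (LINT y|lborel. g y * (LINT x|\<mu>. gauss_kernel \<sigma> (x - y)))"
proof -
  note [measurable_cong] = \<mu>(2)
  interpret \<mu>: prob_space \<mu> by fact
  interpret P: pair_sigma_finite \<mu> "lborel :: (real ^ 'k) measure" ..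
  have [measurable]: "g \<in> borel_measurable borel" using borel_measurable_integrable[OF g] by simp
  define c where "c = (1 / sqrt (2 * pi * \<sigma>\<^sup>2)) ^ CARD('k)"
  have i: "integrable (\<mu> \<Otimes>\<^sub>M lborel) (\<lambda>(x, y). g y * gauss_kernel \<sigma> (x - y))"
  proof (rule Bochner_Integration.integrable_bound)
    show "integrable (\<mu> \<Otimes>\<^sub>M lborel) (\<lambda>(x, y). c * g y)"
      using g by (intro P.Fubini_integrable) auto
    show "AE z in \<mu> \<Otimes>\<^sub>M lborel. norm (case z of (x, y) \<Rightarrow> g y * gauss_kernel \<sigma> (x - y)) \<le> norm (case z of (x, y) \<Rightarrow> c * g y)"
    proof (rule AE_I2, clarsimp)
      fix x y :: "real ^ 'k"
      have "\<bar>gauss_kernel \<sigma> (x - y)\<bar> \<le> \<bar>c\<bar>" using gauss_kernel_le[of \<sigma> "x - y"] gauss_kernel_nonneg[of \<sigma> "x - y"] by (simp add: c_def)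
      thus "\<bar>g y * gauss_kernel \<sigma> (x - y)\<bar> \<le> \<bar>c * g y\<bar>"
        by (simp add: abs_mult mult.commute[of "\<bar>c\<bar>"] mult_left_mono)
    qed
  qed simp
  show ?thesis unfolding smoothed_def using P.Fubini_integral[OF i] by simp
qed

lemma compact_support_uniformly_continuous:
  fixes g :: "'a::euclidean_space \<Rightarrow> real"
  assumes c: "continuous_on UNIV g" and supp: "\<And>x. norm x > R \<Longrightarrow> g x = 0" and \<epsilon>: "\<epsilon> > 0"
  shows "\<exists>d>0. \<forall>x y. norm (x - y) < d \<longrightarrow> \<bar>g x - g y\<bar> \<le> \<epsilon>"
proof -
  have "uniformly_continuous_on (cball 0 (R + 1)) g"
    by (intro compact_uniformly_continuous continuous_on_subset[OF c]) auto
  then obtain d where d: "d > 0" "\<And>x y. x \<in> cball 0 (R + 1) \<Longrightarrow> y \<in> cball 0 (R + 1) \<Longrightarrow> dist y x < d \<Longrightarrow> dist (g y) (g x) < \<epsilon>"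
    unfolding uniformly_continuous_on_def using \<epsilon> by metis
  have "\<bar>g x - g y\<bar> \<le> \<epsilon>" if "norm (x - y) < min d 1" for x y
  proof (cases "x \<in> cball 0 (R + 1) \<and> y \<in> cball 0 (R + 1)")
    case True
    thus ?thesis using d(2)[of y x] that by (auto simp: dist_norm)
  next
    case False
    have "norm x \<le> norm y + norm (x - y)" "norm y \<le> norm x + norm (x - y)"
      using norm_triangle_sub[of x y] norm_triangle_sub[of y x] by (auto simp: norm_minus_commute)
    hence "norm x > R" "norm y > R" using False that by auto
    thus ?thesis using supp \<epsilon> by simp
  qed
  thus ?thesis using d(1) by (intro exI[of _ "min d 1"]) auto
qed

locale char_convergence =
  fixes \<mu> :: "nat \<Rightarrow> (real ^ 'k::finite) measure" and \<mu>' :: "(real ^ 'k) measure"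
  assumes prob: "\<And>N. prob_space (\<mu> N)" "prob_space \<mu>'"
    and sets_eq: "\<And>N. sets (\<mu> N) = sets borel" "sets \<mu>' = sets borel"
    and char_lim: "\<And>t. (\<lambda>N. CLINT x|\<mu> N. iexp (t \<bullet> x)) \<longlonglongrightarrow> (CLINT x|\<mu>'. iexp (t \<bullet> x))"
begin

text \<open>On the right-hand side of Parseval's identity only the characteristic function depends on \<open>N\<close>,
  and it is bounded by one.\<close>

lemma kernel_integral_tendsto:
  "(\<lambda>N. LINT x|\<mu> N. gauss_kernel \<sigma> (x - y)) \<longlonglongrightarrow> (LINT x|\<mu>'. gauss_kernel \<sigma> (x - y))"
proof -
  have "pos_semidef (mat 1 :: real ^ 'k ^ 'k)" by (simp add: pos_semidef_def)
  then obtain \<gamma> :: "(real ^ 'k) measure" where \<gamma>: "normal_law 0 (mat 1) \<gamma>" using normal_law_exists by blast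
  interpret \<gamma>: prob_space \<gamma> using \<gamma> by (simp add: normal_law_def)
  have s[measurable_cong]: "sets \<gamma> = sets borel" using \<gamma> by (simp add: normal_law_def)
  have sN[measurable_cong]: "sets (\<mu> N) = sets borel" "sets \<mu>' = sets borel" for N by (rule sets_eq)+
  have bnd: "cmod (CLINT x|m. iexp (s \<bullet> x)) \<le> 1" if "prob_space m" "sets m = sets borel" for m :: "(real ^ 'k) measure" and s
  proof -
    interpret m: prob_space m by fact
    have "cmod (CLINT x|m. iexp (s \<bullet> x)) \<le> (LINT x|m. cmod (iexp (s \<bullet> x)))" by (rule integral_norm_bound)
    thus ?thesis by (simp add: m.prob_space)
  qed
  have meas: "(\<lambda>t. CLINT x|m. iexp (((1 / \<sigma>) *\<^sub>R t) \<bullet> x)) \<in> borel_measurable borel"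
    if "prob_space m" and [measurable_cong]: "sets m = sets borel" for m :: "(real ^ 'k) measure"
  proof -
    interpret m: prob_space m by fact
    show ?thesis by measurable
  qed
  have "(\<lambda>N. CLINT t|\<gamma>. (CLINT x|\<mu> N. iexp (((1 / \<sigma>) *\<^sub>R t) \<bullet> x)) * iexp (- ((1 / \<sigma>) *\<^sub>R t) \<bullet> y))
      \<longlonglongrightarrow> (CLINT t|\<gamma>. (CLINT x|\<mu>'. iexp (((1 / \<sigma>) *\<^sub>R t) \<bullet> x)) * iexp (- ((1 / \<sigma>) *\<^sub>R t) \<bullet> y))"
  proof (rule integral_dominated_convergence[where w = "\<lambda>_. 1"])
    show "AE t in \<gamma>. (\<lambda>N. (CLINT x|\<mu> N. iexp (((1 / \<sigma>) *\<^sub>R t) \<bullet> x)) * iexp (- ((1 / \<sigma>) *\<^sub>R t) \<bullet> y))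
        \<longlonglongrightarrow> (CLINT x|\<mu>'. iexp (((1 / \<sigma>) *\<^sub>R t) \<bullet> x)) * iexp (- ((1 / \<sigma>) *\<^sub>R t) \<bullet> y)"
      by (intro AE_I2 tendsto_mult char_lim tendsto_const)
    show "AE t in \<gamma>. norm ((CLINT x|\<mu> N. iexp (((1 / \<sigma>) *\<^sub>R t) \<bullet> x)) * iexp (- ((1 / \<sigma>) *\<^sub>R t) \<bullet> y)) \<le> 1" for N
    proof (rule AE_I2)
      fix t
      have 1: "cmod (CLINT x|\<mu> N. iexp (((1 / \<sigma>) *\<^sub>R t) \<bullet> x)) \<le> 1" by (rule bnd[OF prob(1) sets_eq(1)])
      have 2: "cmod (iexp (- ((1 / \<sigma>) *\<^sub>R t) \<bullet> y)) = 1" by (rule norm_exp_i_times)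
      show "norm ((CLINT x|\<mu> N. iexp (((1 / \<sigma>) *\<^sub>R t) \<bullet> x)) * iexp (- ((1 / \<sigma>) *\<^sub>R t) \<bullet> y)) \<le> 1"
        unfolding norm_mult 2 mult_1_right by (rule 1)
    qed
  qed (use meas[OF prob(1) sets_eq(1)] meas[OF prob(2) sets_eq(2)] in \<open>auto\<close>)
  hence "(\<lambda>N. complex_of_real (LINT x|\<mu> N. gauss_kernel \<sigma> (x - y))) \<longlonglongrightarrow> complex_of_real (LINT x|\<mu>'. gauss_kernel \<sigma> (x - y))"
    unfolding integral_gauss_kernel_eq_char[OF prob(1) sets_eq(1) \<gamma>] integral_gauss_kernel_eq_char[OF prob(2) sets_eq(2) \<gamma>]
    by (intro tendsto_intros)
  thus ?thesis by (simp add: tendsto_of_real_iff)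
qed

text \<open>Smoothing changes a continuous function of compact support uniformly little, and the integral of
  the smoothed function is an average of integrals of kernels.\<close>

lemma compact_support_tendsto:
  fixes g :: "real ^ 'k \<Rightarrow> real"
  assumes c: "continuous_on UNIV g" and supp: "\<And>x. norm x > R \<Longrightarrow> g x = 0" and G: "\<And>x. \<bar>g x\<bar> \<le> G"
  shows "(\<lambda>N. LINT x|\<mu> N. g x) \<longlonglongrightarrow> (LINT x|\<mu>'. g x)"
proof (rule LIMSEQ_I)
  fix r :: real assume r: "r > 0"
  have [measurable]: "g \<in> borel_measurable borel" using c by (rule borel_measurable_continuous_onI)
  have G0: "G \<ge> 0" using G[of 0] by linarith
  have gi: "integrable lborel g"
  proof (rule Bochner_Integration.integrable_bound)
    show "integrable lborel (\<lambda>x :: real ^ 'k. G * indicator (cball 0 R) x)"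
      using emeasure_bounded_finite[OF bounded_cball[of "0 :: real ^ 'k" R]]
      by (intro integrable_mult_right integrable_real_indicator) simp_all
    show "AE x in lborel. norm (g x) \<le> norm (G * indicator (cball 0 R) x)"
      using G supp G0 by (auto simp: indicator_def abs_le_iff)
  qed simp
  have "\<exists>d>0. \<forall>x y. norm (x - y) < d \<longrightarrow> \<bar>g x - g y\<bar> \<le> r / 8"
    by (rule compact_support_uniformly_continuous[where R = R, OF c]) (use supp r in auto)
  then obtain d where d: "d > 0" "\<And>x y. norm (x - y) < d \<Longrightarrow> \<bar>g x - g y\<bar> \<le> r / 8" by blast
  have "((\<lambda>\<sigma>. 2 * G * (real CARD('k) * \<sigma>\<^sup>2 / d\<^sup>2)) \<longlongrightarrow> 2 * G * (real CARD('k) * 0\<^sup>2 / d\<^sup>2)) (at_right 0)"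
    using d by (intro tendsto_intros) auto
  hence "\<forall>\<^sub>F \<sigma> in at_right 0. 2 * G * (real CARD('k) * \<sigma>\<^sup>2 / d\<^sup>2) < r / 8"
    using r by (intro order_tendstoD(2)) auto
  then obtain s where s: "s > 0" "\<And>\<sigma>. 0 < \<sigma> \<Longrightarrow> \<sigma> < s \<Longrightarrow> 2 * G * (real CARD('k) * \<sigma>\<^sup>2 / d\<^sup>2) < r / 8"
    unfolding eventually_at_right_field by blast
  define \<sigma> where "\<sigma> = s / 2"
  have \<sigma>s: "0 < \<sigma>" "\<sigma> < s" using s(1) by (simp_all add: \<sigma>_def)
  note \<sigma> = \<sigma>s(1) s(2)[OF \<sigma>s]
  have close: "\<bar>smoothed \<sigma> g x - g x\<bar> \<le> r / 4" for x
    using smoothed_close[of g G d "r / 8" \<sigma> x] G d \<sigma> r by auto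
  have diff: "\<bar>(LINT x|m. smoothed \<sigma> g x) - (LINT x|m. g x)\<bar> \<le> r / 4" if "prob_space m" and [measurable_cong]: "sets m = sets borel" for m
  proof -
    interpret m: prob_space m by fact
    have [measurable]: "smoothed \<sigma> g \<in> borel_measurable borel" unfolding smoothed_def[abs_def] by measurable
    have i1: "integrable m g" by (rule m.integrable_const_bound[of _ G]) (auto simp: G)
    have i2: "integrable m (smoothed \<sigma> g)"
    proof (rule m.integrable_const_bound[of _ "G + r / 4"])
      have "\<bar>smoothed \<sigma> g x\<bar> \<le> G + r / 4" for x using close[of x] G[of x] by linarith
      thus "AE x in m. norm (smoothed \<sigma> g x) \<le> G + r / 4" by simp
    qed simp
    have "(LINT x|m. smoothed \<sigma> g x) - (LINT x|m. g x) = (LINT x|m. smoothed \<sigma> g x - g x)" using i1 i2 by simp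
    also have "\<bar>\<dots>\<bar> \<le> (LINT x|m. \<bar>smoothed \<sigma> g x - g x\<bar>)" by (rule integral_abs_bound)
    also have "\<dots> \<le> (LINT x|m. r / 4)"
    proof (rule integral_mono)
      show "integrable m (\<lambda>x. \<bar>smoothed \<sigma> g x - g x\<bar>)" using i1 i2 by simp
      show "\<bar>smoothed \<sigma> g x - g x\<bar> \<le> r / 4" for x by (rule close)
    qed simp
    finally show ?thesis by (simp add: m.prob_space)
  qed
  have "(\<lambda>N. LINT x|\<mu> N. smoothed \<sigma> g x) \<longlonglongrightarrow> (LINT x|\<mu>'. smoothed \<sigma> g x)"
    unfolding smoothed_fubini[OF prob(1) sets_eq(1) gi] smoothed_fubini[OF prob(2) sets_eq(2) gi]
  proof (rule integral_dominated_convergence[where w = "\<lambda>y. \<bar>g y\<bar> * (1 / sqrt (2 * pi * \<sigma>\<^sup>2)) ^ CARD('k)"])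
    have bd: "\<bar>LINT x|m. gauss_kernel \<sigma> (x - y)\<bar> \<le> (1 / sqrt (2 * pi * \<sigma>\<^sup>2)) ^ CARD('k)"
      if "prob_space m" and [measurable_cong]: "sets m = sets borel" for m :: "(real ^ 'k) measure" and y
    proof -
      interpret m: prob_space m by fact
      have k: "\<bar>gauss_kernel \<sigma> (x - y)\<bar> \<le> (1 / sqrt (2 * pi * \<sigma>\<^sup>2)) ^ CARD('k)" for x :: "real ^ 'k"
        using gauss_kernel_le[of \<sigma> "x - y"] gauss_kernel_nonneg[of \<sigma> "x - y"] by simp
      have "integrable m (\<lambda>x. gauss_kernel \<sigma> (x - y))"
        by (rule m.integrable_const_bound[of _ "(1 / sqrt (2 * pi * \<sigma>\<^sup>2)) ^ CARD('k)"]) (use k in auto)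
      hence "(LINT x|m. \<bar>gauss_kernel \<sigma> (x - y)\<bar>) \<le> (LINT x|m. (1 / sqrt (2 * pi * \<sigma>\<^sup>2)) ^ CARD('k))"
        using k by (intro integral_mono integrable_abs) auto
      also have "(LINT x|m. (1 / sqrt (2 * pi * \<sigma>\<^sup>2)) ^ CARD('k)) = (1 / sqrt (2 * pi * \<sigma>\<^sup>2)) ^ CARD('k)"
        by (simp add: m.prob_space)
      finally show ?thesis by (rule order_trans[OF integral_abs_bound])
    qed
    show "AE y in lborel. norm (g y * (LINT x|\<mu> N. gauss_kernel \<sigma> (x - y))) \<le> \<bar>g y\<bar> * (1 / sqrt (2 * pi * \<sigma>\<^sup>2)) ^ CARD('k)" for N
      using bd[OF prob(1) sets_eq(1)] by (auto simp: abs_mult intro!: mult_left_mono)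
    show "AE y in lborel. (\<lambda>N. g y * (LINT x|\<mu> N. gauss_kernel \<sigma> (x - y))) \<longlonglongrightarrow> g y * (LINT x|\<mu>'. gauss_kernel \<sigma> (x - y))"
      by (rule AE_I2, rule tendsto_mult[OF tendsto_const kernel_integral_tendsto])
    have m: "(\<lambda>y. LINT x|m. gauss_kernel \<sigma> (x - y)) \<in> borel_measurable borel"
      if "prob_space m" and [measurable_cong]: "sets m = sets borel" for m :: "(real ^ 'k) measure"
    proof -
      interpret m: prob_space m by fact
      show ?thesis by measurable
    qed
    show "(\<lambda>y. g y * (LINT x|\<mu> N. gauss_kernel \<sigma> (x - y))) \<in> borel_measurable lborel" for N
      using m[OF prob(1) sets_eq(1)] by simp
    show "(\<lambda>y. g y * (LINT x|\<mu>'. gauss_kernel \<sigma> (x - y))) \<in> borel_measurable lborel"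
      using m[OF prob(2) sets_eq(2)] by simp
  qed (use gi in simp)
  from LIMSEQ_D[OF this, of "r / 4"] r obtain no where
    no: "\<And>N. N \<ge> no \<Longrightarrow> \<bar>(LINT x|\<mu> N. smoothed \<sigma> g x) - (LINT x|\<mu>'. smoothed \<sigma> g x)\<bar> < r / 4" by auto
  have "norm ((LINT x|\<mu> N. g x) - (LINT x|\<mu>'. g x)) < r" if "N \<ge> no" for N
    using no[OF that] diff[OF prob(1)[of N] sets_eq(1)] diff[OF prob(2) sets_eq(2)] r unfolding real_norm_def by linarith
  thus "\<exists>no. \<forall>N\<ge>no. norm ((LINT x|\<mu> N. g x) - (LINT x|\<mu>'. g x)) < r" by blast
qed

text \<open>A continuous cutoff that carries almost all the mass of the limit carries almost all the mass
  of the laws far along the sequence, which replaces tightness.\<close>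

theorem weak_convergence: "weak_conv_euclidean \<mu> \<mu>'"
  unfolding weak_conv_euclidean_def
proof (intro allI impI)
  fix g :: "real ^ 'k \<Rightarrow> real" assume c: "continuous_on UNIV g" and b: "bounded (range g)"
  obtain G where G: "\<And>x. \<bar>g x\<bar> \<le> G" using b unfolding bounded_iff by auto
  have G0: "G \<ge> 0" using G[of 0] by linarith
  have [measurable]: "g \<in> borel_measurable borel" using c by (rule borel_measurable_continuous_onI)
  define cf where "cf R x = max 0 (min 1 (R + 1 - norm x))" for R :: real and x :: "real ^ 'k"
  have cf01: "0 \<le> cf R x" "cf R x \<le> 1" for R x by (auto simp: cf_def)
  have cfc: "continuous_on UNIV (cf R)" for R unfolding cf_def by (intro continuous_intros)
  have [measurable]: "cf R \<in> borel_measurable borel" for R using cfc by (rule borel_measurable_continuous_onI)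
  have cfs: "cf R x = 0" if "norm x > R + 1" for R x using that by (simp add: cf_def)
  interpret \<mu>': prob_space \<mu>' by (rule prob)
  note [measurable_cong] = sets_eq
  have limcf: "(\<lambda>n. LINT x|\<mu>'. cf (real n) x) \<longlonglongrightarrow> (LINT x|\<mu>'. 1)"
  proof (rule integral_dominated_convergence[where w = "\<lambda>_. 1"])
    show "AE x in \<mu>'. (\<lambda>n. cf (real n) x) \<longlonglongrightarrow> 1"
    proof (rule AE_I2, rule tendsto_eventually)
      fix x :: "real ^ 'k"
      obtain n0 where "norm x \<le> real n0" using real_arch_simple by blast
      thus "\<forall>\<^sub>F n in sequentially. cf (real n) x = 1"
        by (intro eventually_sequentiallyI[of n0]) (auto simp: cf_def)
    qed
  qed (use cf01 in auto)
  show "(\<lambda>N. LINT x|\<mu> N. g x) \<longlonglongrightarrow> (LINT x|\<mu>'. g x)"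
  proof (rule LIMSEQ_I)
    fix r :: real assume r: "r > 0"
    define e where "e = r / (4 * (G + 1))"
    have e: "e > 0" "G * e \<le> r / 4" using r G0 by (auto simp: e_def field_simps)
    have "\<forall>\<^sub>F n in sequentially. (LINT x|\<mu>'. cf (real n) x) > 1 - e"
      using limcf e by (intro order_tendstoD(1)) (auto simp: \<mu>'.prob_space)
    then obtain n where n: "(LINT x|\<mu>'. cf (real n) x) > 1 - e" by (auto simp: eventually_sequentially)
    define \<psi> where "\<psi> = cf (real n)"
    have \<psi>: "0 \<le> \<psi> x" "\<psi> x \<le> 1" for x using cf01 by (auto simp: \<psi>_def)
    have [measurable]: "\<psi> \<in> borel_measurable borel" unfolding \<psi>_def by measurable
    have 1: "(\<lambda>N. LINT x|\<mu> N. \<psi> x) \<longlonglongrightarrow> (LINT x|\<mu>'. \<psi> x)"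
      unfolding \<psi>_def using cfc cfs cf01 by (intro compact_support_tendsto[where R = "real n + 1" and G = 1]) auto
    have 2: "(\<lambda>N. LINT x|\<mu> N. g x * \<psi> x) \<longlonglongrightarrow> (LINT x|\<mu>'. g x * \<psi> x)"
    proof (rule compact_support_tendsto[where R = "real n + 1" and G = G])
      show "continuous_on UNIV (\<lambda>x. g x * \<psi> x)" unfolding \<psi>_def by (intro continuous_intros c cfc)
      show "\<bar>g x * \<psi> x\<bar> \<le> G" for x
        using mult_mono[OF G[of x] \<psi>(2)[of x] G0 \<psi>(1)] \<psi>(1)[of x] by (simp add: abs_mult)
    qed (simp add: \<psi>_def cfs)
    have cut: "\<bar>(LINT x|m. g x) - (LINT x|m. g x * \<psi> x)\<bar> \<le> G * (1 - (LINT x|m. \<psi> x))"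
      if "prob_space m" and [measurable_cong]: "sets m = sets borel" for m
    proof -
      interpret m: prob_space m by fact
      have i: "integrable m g" by (rule m.integrable_const_bound[of _ G]) (auto simp: G)
      have ip: "integrable m \<psi>" by (rule m.integrable_const_bound[of _ 1]) (use \<psi> in auto)
      have igp: "integrable m (\<lambda>x. g x * \<psi> x)"
        by (rule Bochner_Integration.integrable_bound[OF i]) (use \<psi> in \<open>auto simp: abs_mult mult_left_le\<close>)
      have "(LINT x|m. g x) - (LINT x|m. g x * \<psi> x) = (LINT x|m. g x * (1 - \<psi> x))"
        using i igp by (simp add: right_diff_distrib)
      also have "\<bar>\<dots>\<bar> \<le> (LINT x|m. \<bar>g x * (1 - \<psi> x)\<bar>)" by (rule integral_abs_bound)
      also have "\<dots> \<le> (LINT x|m. G * (1 - \<psi> x))"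
      proof (rule integral_mono)
        show "integrable m (\<lambda>x. \<bar>g x * (1 - \<psi> x)\<bar>)" using i igp by (simp add: right_diff_distrib)
        show "\<bar>g x * (1 - \<psi> x)\<bar> \<le> G * (1 - \<psi> x)" for x
        proof -
          have "\<bar>1 - \<psi> x\<bar> = 1 - \<psi> x" using \<psi>(2)[of x] by simp
          thus ?thesis unfolding abs_mult using \<psi>(2)[of x] by (simp only:) (rule mult_right_mono[OF G], simp)
        qed
        show "integrable m (\<lambda>x. G * (1 - \<psi> x))" using ip by simp
      qed
      also have "\<dots> = G * (1 - (LINT x|m. \<psi> x))" using ip by (simp add: m.prob_space)
      finally show ?thesis .
    qed
    have "\<forall>\<^sub>F N in sequentially. (LINT x|\<mu> N. \<psi> x) > 1 - e"
      using 1 n by (intro order_tendstoD(1)) (auto simp: \<psi>_def)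
    moreover have "\<forall>\<^sub>F N in sequentially. dist (LINT x|\<mu> N. g x * \<psi> x) (LINT x|\<mu>'. g x * \<psi> x) < r / 4"
      using 2 r by (intro tendstoD) auto
    ultimately have "\<forall>\<^sub>F N in sequentially. norm ((LINT x|\<mu> N. g x) - (LINT x|\<mu>'. g x)) < r"
    proof eventually_elim
      case (elim N)
      have "G * (1 - (LINT x|\<mu> N. \<psi> x)) \<le> G * e" using elim(1) G0 by (intro mult_left_mono) auto
      moreover have "G * (1 - (LINT x|\<mu>'. \<psi> x)) \<le> G * e" using n G0 by (intro mult_left_mono) (auto simp: \<psi>_def)
      ultimately show ?case
        using cut[OF prob(1)[of N] sets_eq(1)] cut[OF prob(2) sets_eq(2)] elim(2) e(2) r
        unfolding real_norm_def dist_real_def by linarith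
    qed
    thus "\<exists>no. \<forall>N\<ge>no. norm ((LINT x|\<mu> N. g x) - (LINT x|\<mu>'. g x)) < r" by (simp add: eventually_sequentially)
  qed
qed

end


section \<open>Convergence in probability\<close>

text \<open>Convergence in probability of real random variables is convergence in this pseudometric, whose
  values depend on the law only.\<close>

definition (in prob_space) ky_fan :: "('a \<Rightarrow> real) \<Rightarrow> real" where
  "ky_fan Y = expectation (\<lambda>w. min 1 \<bar>Y w\<bar>)"

context prob_space
begin

lemma ky_fan_integrable [simp]:
  fixes Y :: "'a \<Rightarrow> real"
  assumes [measurable]: "Y \<in> borel_measurable M"
  shows "integrable M (\<lambda>w. min 1 \<bar>Y w\<bar>)"
  by (rule integrable_const_bound[of _ 1]) auto

lemma ky_fan_nonneg: "ky_fan Y \<ge> 0"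
  unfolding ky_fan_def by (rule Bochner_Integration.integral_nonneg) auto

lemma ky_fan_cong_AE:
  assumes "Y \<in> borel_measurable M" "Z \<in> borel_measurable M" "AE w in M. Y w = Z w"
  shows "ky_fan Y = ky_fan Z"
  unfolding ky_fan_def using assms by (intro integral_cong_AE) auto

lemma ky_fan_triangle:
  assumes "Y \<in> borel_measurable M" "Z \<in> borel_measurable M" "W \<in> borel_measurable M"
    and le: "AE w in M. \<bar>W w\<bar> \<le> \<bar>Y w\<bar> + \<bar>Z w\<bar>"
  shows "ky_fan W \<le> ky_fan Y + ky_fan Z"
proof -
  have "ky_fan W \<le> expectation (\<lambda>w. min 1 \<bar>Y w\<bar> + min 1 \<bar>Z w\<bar>)"
    unfolding ky_fan_def
  proof (rule integral_mono_AE)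
    show "AE w in M. min 1 \<bar>W w\<bar> \<le> min 1 \<bar>Y w\<bar> + min 1 \<bar>Z w\<bar>"
      using le by eventually_elim (auto simp: min_def)
  qed (use assms in auto)
  thus ?thesis using assms by (simp add: ky_fan_def)
qed

lemma ky_fan_tendsto_of_char:
  assumes [measurable]: "\<And>n. Y n \<in> borel_measurable M"
    and ch: "\<And>s. (\<lambda>n. CLINT w|M. iexp (s * Y n w)) \<longlonglongrightarrow> 1"
  shows "(\<lambda>n. ky_fan (Y n)) \<longlonglongrightarrow> 0"
proof -
  have rd: "real_distribution (distr M borel (Y n))" for n
    by (intro real_distribution_distr) simp
  have r0: "real_distribution (return borel (0::real))"
    unfolding real_distribution_def real_distribution_axioms_def by (auto intro: prob_space_return)
  have "weak_conv_m (\<lambda>n. distr M borel (Y n)) (return borel 0)"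
  proof (rule levy_continuity[OF rd r0])
    fix t
    have "char (distr M borel (Y n)) t = (CLINT w|M. iexp (t * Y n w))" for n
      unfolding char_def by (subst integral_distr) auto
    moreover have "char (return borel 0) t = 1" unfolding char_def by (subst integral_return) auto
    ultimately show "(\<lambda>n. char (distr M borel (Y n)) t) \<longlonglongrightarrow> char (return borel 0) t" using ch by simp
  qed
  hence "(\<lambda>n. LINT x|distr M borel (Y n). min 1 \<bar>x\<bar>) \<longlonglongrightarrow> (LINT x|return borel 0. min 1 \<bar>x\<bar>)"
    by (intro weak_conv_imp_integral_bdd_continuous_conv[OF rd r0, where B = 1]) (auto intro!: continuous_intros)
  moreover have "(LINT x|distr M borel (Y n). min 1 \<bar>x\<bar>) = ky_fan (Y n)" for n
    unfolding ky_fan_def by (subst integral_distr) auto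
  moreover have "(LINT x|return borel 0. min 1 \<bar>x :: real\<bar>) = 0" by (subst integral_return) auto
  ultimately show ?thesis by simp
qed

lemma cmod_char_diff_le:
  assumes [measurable]: "Y \<in> borel_measurable M" "Z \<in> borel_measurable M"
  shows "cmod ((CLINT w|M. iexp (s * Y w)) - (CLINT w|M. iexp (s * Z w))) \<le> (2 + \<bar>s\<bar>) * ky_fan (\<lambda>w. Y w - Z w)"
proof -
  have i: "integrable M (\<lambda>w. iexp (s * Y w))" "integrable M (\<lambda>w. iexp (s * Z w))"
    by (rule integrable_const_bound[of _ 1], auto)+
  have "cmod ((CLINT w|M. iexp (s * Y w)) - (CLINT w|M. iexp (s * Z w)))
      = cmod (CLINT w|M. iexp (s * Y w) - iexp (s * Z w))" using i by simp
  also have "\<dots> \<le> (LINT w|M. cmod (iexp (s * Y w) - iexp (s * Z w)))" by (rule integral_norm_bound)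
  also have "\<dots> \<le> (LINT w|M. (2 + \<bar>s\<bar>) * min 1 \<bar>Y w - Z w\<bar>)"
  proof (rule integral_mono)
    show "integrable M (\<lambda>w. cmod (iexp (s * Y w) - iexp (s * Z w)))"
      by (rule integrable_norm[OF Bochner_Integration.integrable_diff[OF i]])
    show "integrable M (\<lambda>w. (2 + \<bar>s\<bar>) * min 1 \<bar>Y w - Z w\<bar>)" by simp
    fix w
    have 1: "cmod (iexp (s * Y w) - iexp (s * Z w)) \<le> \<bar>s\<bar> * \<bar>Y w - Z w\<bar>"
      using cmod_iexp_diff_le[of "s * Y w" "s * Z w"] by (simp add: abs_mult[symmetric] right_diff_distrib)
    have 2: "cmod (iexp (s * Y w) - iexp (s * Z w)) \<le> 2"
      using norm_triangle_ineq4[of "iexp (s * Y w)" "iexp (s * Z w)"] by simp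
    show "cmod (iexp (s * Y w) - iexp (s * Z w)) \<le> (2 + \<bar>s\<bar>) * min 1 \<bar>Y w - Z w\<bar>"
    proof (cases "\<bar>Y w - Z w\<bar> \<le> 1")
      case True
      have "\<bar>s\<bar> * \<bar>Y w - Z w\<bar> \<le> (2 + \<bar>s\<bar>) * \<bar>Y w - Z w\<bar>" by (intro mult_right_mono) auto
      thus ?thesis using 1 True by (simp add: min_def)
    next
      case False
      thus ?thesis using 2 by (simp add: min_def)
    qed
  qed
  finally show ?thesis by (simp add: ky_fan_def)
qed

lemma char_tendsto_of_ky_fan:
  assumes "\<And>n. Y n \<in> borel_measurable M" "Z \<in> borel_measurable M"
    and k: "(\<lambda>n. ky_fan (\<lambda>w. Y n w - Z w)) \<longlonglongrightarrow> 0"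
  shows "(\<lambda>n. CLINT w|M. iexp (s * Y n w)) \<longlonglongrightarrow> (CLINT w|M. iexp (s * Z w))"
proof -
  have "(\<lambda>n. (2 + \<bar>s\<bar>) * ky_fan (\<lambda>w. Y n w - Z w)) \<longlonglongrightarrow> (2 + \<bar>s\<bar>) * 0" by (intro tendsto_intros k)
  hence "(\<lambda>n. (2 + \<bar>s\<bar>) * ky_fan (\<lambda>w. Y n w - Z w)) \<longlonglongrightarrow> 0" by simp
  hence "(\<lambda>n. (CLINT w|M. iexp (s * Y n w)) - (CLINT w|M. iexp (s * Z w))) \<longlonglongrightarrow> 0"
    by (rule Lim_null_comparison[rotated]) (use cmod_char_diff_le[OF assms(1,2)] in simp)
  thus ?thesis by (rule LIM_zero_cancel)
qed

lemma ky_fan_tendsto_of_prob: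
  fixes Y :: "nat \<Rightarrow> 'a \<Rightarrow> 'b::euclidean_space"
  assumes [measurable]: "\<And>n. Y n \<in> borel_measurable M" "Z \<in> borel_measurable M"
    and p: "tendsto_in_prob M Y Z"
  shows "(\<lambda>n. ky_fan (\<lambda>w. a \<bullet> Y n w - a \<bullet> Z w)) \<longlonglongrightarrow> 0"
proof (rule LIMSEQ_I)
  fix r :: real assume r: "r > 0"
  define e where "e = (r / 2) / (norm a + 1)"
  have e: "e > 0" using r by (simp add: e_def add_nonneg_pos)
  have na: "norm a * e \<le> r / 2"
  proof -
    have "norm a * e \<le> (norm a + 1) * e" using e by (intro mult_right_mono) auto
    also have "\<dots> = r / 2"
    proof -
      have "norm a + 1 \<noteq> 0" using norm_ge_zero[of a] by linarith
      thus ?thesis unfolding e_def times_divide_eq_right[of "norm a + 1" "r / 2" "norm a + 1"]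
        by (rule nonzero_mult_div_cancel_left)
    qed
    finally show ?thesis .
  qed
  have "\<forall>\<^sub>F n in sequentially. measure M {w \<in> space M. dist (Y n w) (Z w) > e} < r / 2"
    using p e r unfolding tendsto_in_prob_def by (intro order_tendstoD(2)) auto
  hence "\<forall>\<^sub>F n in sequentially. norm (ky_fan (\<lambda>w. a \<bullet> Y n w - a \<bullet> Z w) - 0) < r"
  proof eventually_elim
    case (elim n)
    define A where "A = {w \<in> space M. dist (Y n w) (Z w) > e}"
    have [measurable]: "A \<in> sets M" unfolding A_def by measurable
    have iI: "integrable M (indicat_real A)" by (rule integrable_const_bound[of _ 1]) auto
    have "ky_fan (\<lambda>w. a \<bullet> Y n w - a \<bullet> Z w) \<le> expectation (\<lambda>w. r / 2 + indicator A w)"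
      unfolding ky_fan_def
    proof (rule integral_mono)
      fix w assume w: "w \<in> space M"
      show "min 1 \<bar>a \<bullet> Y n w - a \<bullet> Z w\<bar> \<le> r / 2 + indicator A w"
      proof (cases "w \<in> A")
        case False
        hence "norm (Y n w - Z w) \<le> e" using w by (simp add: A_def dist_norm)
        hence "\<bar>a \<bullet> (Y n w - Z w)\<bar> \<le> norm a * e"
          by (intro order_trans[OF Cauchy_Schwarz_ineq2] mult_left_mono) auto
        hence "\<bar>a \<bullet> Y n w - a \<bullet> Z w\<bar> \<le> r / 2" using na by (simp only: inner_diff_right)
        moreover have "min 1 \<bar>a \<bullet> Y n w - a \<bullet> Z w\<bar> \<le> \<bar>a \<bullet> Y n w - a \<bullet> Z w\<bar>" by (rule min.cobounded2)
        moreover have "indicator A w = (0 :: real)" using False by simp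
        ultimately show ?thesis by linarith
      qed (use r in simp)
    next
      show "integrable M (\<lambda>w. r / 2 + indicator A w)"
        using iI by simp
    qed auto
    also have "\<dots> = r / 2 + prob A" using iI by (simp add: prob_space)
    also have "\<dots> < r" using elim by (simp add: A_def)
    finally show ?case using ky_fan_nonneg by simp
  qed
  thus "\<exists>no. \<forall>n\<ge>no. norm (ky_fan (\<lambda>w. a \<bullet> Y n w - a \<bullet> Z w) - 0) < r" by (simp add: eventually_sequentially)
qed

lemma same_law_of_char:
  assumes [measurable]: "Y \<in> borel_measurable M" "Z \<in> borel_measurable M"
    and "\<And>s. (CLINT w|M. iexp (s * Y w)) = (CLINT w|M. iexp (s * Z w))"
  shows "distr M borel Y = distr M borel (Z :: 'a \<Rightarrow> real)"
proof (rule Levy_uniqueness)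
  show "real_distribution (distr M borel Y)" "real_distribution (distr M borel Z)"
    by (intro real_distribution_distr, simp)+
  show "char (distr M borel Y) = char (distr M borel Z)"
    unfolding char_def using assms(3) by (auto simp: integral_distr)
qed

lemma ky_fan_eq_of_law:
  assumes [measurable]: "Y \<in> borel_measurable M" "Z \<in> borel_measurable M"
    and "distr M borel Y = distr M borel Z"
  shows "ky_fan Y = ky_fan Z"
proof -
  have "ky_fan W = (LINT x|distr M borel W. min 1 \<bar>x\<bar>)" if [measurable]: "W \<in> borel_measurable M" for W
    unfolding ky_fan_def by (subst integral_distr) auto
  thus ?thesis using assms by simp
qed

end

section \<open>A Vitali-Hahn-Saks theorem\<close>

text \<open>The set functions \<open>d k l\<close> stand for the distance between the members \<open>k\<close> and \<open>l\<close> of a sequence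
  of additive set functions with values in a pseudometric group; subadditivity is what remains of
  additivity. The argument is Baire's, carried out in the complete pseudometric space of measurable sets with
  distance \<open>P (A \<triangle> B)\<close>. If absolute continuity were not uniform, any set could be changed by a
  set of small measure so that \<open>d\<close> becomes large for some late indices, and this persists under
  smaller changes; the upper limit of the sets so constructed contradicts convergence on it.\<close>

lemma (in finite_measure) vitali_hahn_saks:
  fixes d :: "nat \<Rightarrow> nat \<Rightarrow> 'a set \<Rightarrow> real"
  assumes sub: "\<And>k l A B. A \<in> sets M \<Longrightarrow> B \<in> sets M \<Longrightarrow> A \<inter> B = {} \<Longrightarrow> d k l (A \<union> B) \<le> d k l A + d k l B"
    and sub': "\<And>k l A B. A \<in> sets M \<Longrightarrow> B \<in> sets M \<Longrightarrow> A \<inter> B = {} \<Longrightarrow> d k l A \<le> d k l (A \<union> B) + d k l B"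
    and ac: "\<And>k l e. e > 0 \<Longrightarrow> \<exists>r>0. \<forall>B\<in>sets M. measure M B < r \<longrightarrow> d k l B < e"
    and cauchy: "\<And>A e. A \<in> sets M \<Longrightarrow> e > 0 \<Longrightarrow> \<exists>n. \<forall>k\<ge>n. \<forall>l\<ge>n. d k l A < e"
    and \<epsilon>: "\<epsilon> > 0"
  shows "\<exists>n r. r > 0 \<and> (\<forall>k\<ge>n. \<forall>l\<ge>n. \<forall>B\<in>sets M. measure M B < r \<longrightarrow> d k l B \<le> \<epsilon>)"
proof (rule ccontr)
  assume neg: "\<not> ?thesis"
  define sd where "sd A B = (A - B) \<union> (B - A)" for A B :: "'a set"
  have sd[measurable]: "sd A B \<in> sets M" if "A \<in> sets M" "B \<in> sets M" for A B
    using that by (auto simp: sd_def)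
  \<comment> \<open>Some \<open>d k l\<close> with late indices is large on every set that is \<open>r\<close>-close to \<open>C\<close>.\<close>
  define bad where "bad n C r \<longleftrightarrow> (\<exists>k\<ge>n. \<exists>l\<ge>n. \<forall>D\<in>sets M. measure M (sd D C) \<le> r \<longrightarrow> d k l D > \<epsilon> / 4)" for n C r
  have step: "\<exists>C' r'. C' \<in> sets M \<and> r' > 0 \<and> bad n C' r' \<and> measure M (sd C C') < r / 2 \<and> r' \<le> r / 2"
    if C: "C \<in> sets M" and r: "r > 0" for n C r
  proof -
    obtain k l B where kl: "k \<ge> n" "l \<ge> n" and B: "B \<in> sets M" "measure M B < r / 2" "d k l B > \<epsilon>"
      using neg r by (metis half_gt_zero not_le_imp_less)
    have "d k l B \<le> d k l (B \<union> (C - B)) + d k l (C - B)" using B C by (intro sub') auto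
    hence "d k l (C \<union> B) > \<epsilon> / 2 \<or> d k l (C - B) > \<epsilon> / 2"
      using B(3) by (simp add: Un_commute) linarith
    then obtain C' where C': "d k l C' > \<epsilon> / 2" "C' = C \<union> B \<or> C' = C - B" by blast
    have C'm: "C' \<in> sets M" using C'(2) B C by auto
    have "sd C C' \<subseteq> B" using C'(2) by (auto simp: sd_def)
    hence m: "measure M (sd C C') < r / 2" using B finite_measure_mono[of "sd C C'" B] by linarith
    obtain q where q: "q > 0" "\<And>B. B \<in> sets M \<Longrightarrow> measure M B < q \<Longrightarrow> d k l B < \<epsilon> / 8"
      using ac[of "\<epsilon> / 8" k l] \<epsilon> by auto
    define r' where "r' = min (q / 2) (r / 2)"
    have "bad n C' r'" unfolding bad_def
    proof (rule exI[of _ k], rule conjI[OF kl(1)], rule exI[of _ l], rule conjI[OF kl(2)], intro ballI impI)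
      fix D assume D: "D \<in> sets M" "measure M (sd D C') \<le> r'"
      have s: "measure M (D - C') < q" "measure M (C' - D) < q"
        using finite_measure_mono[of "D - C'" "sd D C'"] finite_measure_mono[of "C' - D" "sd D C'"] D C'm q
        by (auto simp: sd_def r'_def)
      have "d k l ((C' \<inter> D) \<union> (C' - D)) \<le> d k l (C' \<inter> D) + d k l (C' - D)" using D C'm by (intro sub) auto
      moreover have "(C' \<inter> D) \<union> (C' - D) = C'" by auto
      moreover have "d k l (C' \<inter> D) \<le> d k l ((C' \<inter> D) \<union> (D - C')) + d k l (D - C')" using D C'm by (intro sub') auto
      moreover have "(C' \<inter> D) \<union> (D - C') = D" by auto
      moreover have "d k l (D - C') < \<epsilon> / 8" "d k l (C' - D) < \<epsilon> / 8" using s q(2) D C'm by auto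
      ultimately show "d k l D > \<epsilon> / 4" using C'(1) by simp
    qed
    thus ?thesis using C'm m q(1) r by (intro exI[of _ C'] exI[of _ r']) (auto simp: r'_def)
  qed
  have "\<exists>f. \<forall>n. (fst (f n) \<in> sets M \<and> snd (f n) > 0 \<and> bad n (fst (f n)) (snd (f n))) \<and>
      (measure M (sd (fst (f n)) (fst (f (Suc n)))) < snd (f n) / 2 \<and> snd (f (Suc n)) \<le> snd (f n) / 2)"
  proof (rule dependent_nat_choice)
    show "\<exists>x. fst x \<in> sets M \<and> snd x > 0 \<and> bad 0 (fst x) (snd x)"
      using step[of "{}" 1 0] by (auto)
    fix x :: "'a set \<times> real" and n assume "fst x \<in> sets M \<and> snd x > 0 \<and> bad n (fst x) (snd x)"
    with step[of "fst x" "snd x" "Suc n"]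
    show "\<exists>y. (fst y \<in> sets M \<and> snd y > 0 \<and> bad (Suc n) (fst y) (snd y)) \<and>
       (measure M (sd (fst x) (fst y)) < snd x / 2 \<and> snd y \<le> snd x / 2)" by auto
  qed
  then obtain f where f: "\<And>n. fst (f n) \<in> sets M" "\<And>n. snd (f n) > 0" "\<And>n. bad n (fst (f n)) (snd (f n))"
      "\<And>n. measure M (sd (fst (f n)) (fst (f (Suc n)))) < snd (f n) / 2" "\<And>n. snd (f (Suc n)) \<le> snd (f n) / 2"
    by blast
  define C r where "C n = fst (f n)" and "r n = snd (f n)" for n
  have Cm[measurable]: "C n \<in> sets M" for n using f by (simp add: C_def)
  define L where "L = (\<Inter>n. \<Union>m\<in>{n..}. C m)"
  have Lm[measurable]: "L \<in> sets M" unfolding L_def by measurable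
  have rdec: "r (n + i) \<le> r n * (1 / 2) ^ i" for n i
  proof (induction i)
    case (Suc i)
    have "r (n + Suc i) \<le> r (n + i) / 2" using f(5)[of "n + i"] by (simp add: r_def)
    also have "\<dots> \<le> r n * (1 / 2) ^ i / 2" using Suc by simp
    finally show ?case by simp
  qed simp
  have close: "measure M (sd L (C n)) \<le> r n" for n
  proof -
    define A where "A i = sd (C (n + i)) (C (Suc (n + i)))" for i
    have Am: "A i \<in> sets M" for i unfolding A_def by (intro sd Cm)
    have sub: "sd L (C n) \<subseteq> (\<Union>i. A i)"
    proof (rule subsetI, rule ccontr)
      fix x assume x: "x \<in> sd L (C n)" "x \<notin> (\<Union>i. A i)"
      have "x \<in> C (n + i) \<longleftrightarrow> x \<in> C n" for i
        by (induction i) (use x(2) in \<open>auto simp: A_def sd_def\<close>)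
      hence c: "x \<in> C m \<longleftrightarrow> x \<in> C n" if "m \<ge> n" for m using le_Suc_ex[OF that] by auto
      have "x \<in> L \<longleftrightarrow> x \<in> C n"
      proof
        assume "x \<in> L"
        then obtain m where "m \<ge> n" "x \<in> C m" by (auto simp: L_def)
        thus "x \<in> C n" using c by blast
      next
        assume "x \<in> C n"
        hence "x \<in> C (max n k)" for k using c[of "max n k"] by simp
        hence "\<exists>m\<ge>k. x \<in> C m" for k by (intro exI[of _ "max n k"]) auto
        thus "x \<in> L" by (auto simp: L_def)
      qed
      thus False using x(1) by (auto simp: sd_def)
    qed
    have Ai: "measure M (A i) \<le> r n / 2 * (1 / 2) ^ i" for i
      using f(4)[of "n + i"] rdec[of n i] by (simp add: A_def C_def r_def)
    have geo: "(\<lambda>i. r n / 2 * (1 / 2) ^ i) sums (r n / 2 * (1 / (1 - 1 / 2)))"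
      by (intro sums_mult geometric_sums) auto
    have sA: "summable (\<lambda>i. measure M (A i))"
      by (rule summable_comparison_test'[OF sums_summable[OF geo], of 0]) (use Ai in simp)
    have "measure M (sd L (C n)) \<le> measure M (\<Union>i. A i)" using Am sub by (intro finite_measure_mono) auto
    also have "\<dots> \<le> (\<Sum>i. measure M (A i))" using Am sA by (intro finite_measure_subadditive_countably) auto
    also have "\<dots> \<le> (\<Sum>i. r n / 2 * (1 / 2) ^ i)" by (intro suminf_le Ai sA sums_summable[OF geo])
    also have "\<dots> = r n" using sums_unique[OF geo] by simp
    finally show ?thesis .
  qed
  obtain n where n: "\<And>k l. k \<ge> n \<Longrightarrow> l \<ge> n \<Longrightarrow> d k l L < \<epsilon> / 4" using cauchy[OF Lm, of "\<epsilon> / 4"] \<epsilon> by auto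
  obtain k l where "k \<ge> n" "l \<ge> n" "d k l L > \<epsilon> / 4"
    using f(3)[of n] close[of n] Lm unfolding bad_def C_def r_def by blast
  thus False using n[of k l] by simp
qed


section \<open>Scalar integrals of simple functions against a Levy basis\<close>

lemma bounded_borel_subset: "B \<in> bounded_borel \<Longrightarrow> A \<in> sets borel \<Longrightarrow> A \<subseteq> B \<Longrightarrow> A \<in> bounded_borel"
  unfolding bounded_borel_def by (auto intro: bounded_subset)

lemma bounded_borel_Int: "B \<in> bounded_borel \<Longrightarrow> A \<in> sets borel \<Longrightarrow> A \<inter> B \<in> bounded_borel"
  by (rule bounded_borel_subset) (auto simp: bounded_borel_def)

lemma bounded_borel_UN: "finite I \<Longrightarrow> (\<And>i. i \<in> I \<Longrightarrow> B i \<in> bounded_borel) \<Longrightarrow> (\<Union>i\<in>I. B i) \<in> bounded_borel"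
  unfolding bounded_borel_def by (auto intro!: bounded_UN)

lemma bounded_borel_empty [simp]: "{} \<in> bounded_borel"
  by (simp add: bounded_borel_def)

text \<open>Simple functions are described by a labelling \<open>q\<close> with finitely many labels, of which only
  \<open>i0\<close> may be taken on an unbounded set. Sums and linear images of simple functions then are simple
  functions of one common labelling.\<close>

definition simple_labelling :: "('s::polish_space \<times> (real ^ 'm::finite) \<Rightarrow> 'i) \<Rightarrow> 'i \<Rightarrow> bool" where
  "simple_labelling q i0 \<longleftrightarrow> finite (range q) \<and> (\<forall>i. i \<noteq> i0 \<longrightarrow> q -` {i} \<in> bounded_borel)"

lemma simple_labelling_vimage:
  assumes "simple_labelling q i0"
  shows "q -` {i} \<in> sets borel"
proof (cases "i = i0")
  case True
  have "q -` {i} = UNIV - (\<Union>j\<in>range q - {i0}. q -` {j})" using True by auto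
  also have "\<dots> \<in> sets borel"
  proof -
    have "q -` {j} \<in> sets borel" if "j \<in> range q - {i0}" for j
      using assms that by (auto simp: simple_labelling_def bounded_borel_def)
    moreover have "finite (range q - {i0})" using assms by (simp add: simple_labelling_def)
    ultimately have "(\<Union>j\<in>range q - {i0}. q -` {j}) \<in> sets borel" by (intro sets.finite_UN) auto
    thus ?thesis by (intro borel_comp[unfolded Compl_eq_Diff_UNIV])
  qed
  finally show ?thesis .
next
  case False
  thus ?thesis using assms by (auto simp: simple_labelling_def bounded_borel_def)
qed

lemma simple_labelling_image:
  assumes q: "simple_labelling q i0" and K: "K i0 = k0"
  shows "simple_labelling (\<lambda>x. K (q x)) k0"
  unfolding simple_labelling_def
proof (intro conjI allI impI)
  have fin: "finite (range q)" using q by (simp add: simple_labelling_def)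
  have "range (\<lambda>x. K (q x)) = K ` range q" by auto
  thus "finite (range (\<lambda>x. K (q x)))" using fin by simp
  fix k assume k: "k \<noteq> k0"
  have "(\<lambda>x. K (q x)) -` {k} = (\<Union>i\<in>{i \<in> range q. K i = k}. q -` {i})" by auto
  also have "\<dots> \<in> bounded_borel"
    using q k K fin by (intro bounded_borel_UN) (auto simp: simple_labelling_def)
  finally show "(\<lambda>x. K (q x)) -` {k} \<in> bounded_borel" .
qed

lemma simple_labelling_Pair:
  assumes p: "simple_labelling p i0" and q: "simple_labelling q j0"
  shows "simple_labelling (\<lambda>x. (p x, q x)) (i0, j0)"
  unfolding simple_labelling_def
proof (intro conjI allI impI)
  have "range (\<lambda>x. (p x, q x)) \<subseteq> range p \<times> range q" by auto
  thus "finite (range (\<lambda>x. (p x, q x)))"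
    using p q unfolding simple_labelling_def by (meson finite_SigmaI finite_subset)
  fix i assume i: "i \<noteq> (i0, j0)"
  have e: "(\<lambda>x. (p x, q x)) -` {i} = p -` {fst i} \<inter> q -` {snd i}" by (cases i) auto
  show "(\<lambda>x. (p x, q x)) -` {i} \<in> bounded_borel"
  proof (cases "fst i = i0")
    case True
    hence "q -` {snd i} \<in> bounded_borel" using i q by (cases i) (auto simp: simple_labelling_def)
    thus ?thesis unfolding e using simple_labelling_vimage[OF p] by (intro bounded_borel_Int)
  next
    case False
    hence "p -` {fst i} \<in> bounded_borel" using p by (auto simp: simple_labelling_def)
    thus ?thesis unfolding e Int_commute[of "p -` _"] using simple_labelling_vimage[OF q] by (intro bounded_borel_Int)
  qed
qed

lemma simple_labelling_finite: "simple_labelling q i0 \<Longrightarrow> finite (range q)"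
  by (simp add: simple_labelling_def)

lemma simple_labelling_bounded: "simple_labelling q i0 \<Longrightarrow> i \<noteq> i0 \<Longrightarrow> q -` {i} \<in> bounded_borel"
  by (simp add: simple_labelling_def)

lemma simple_labelling_measurable:
  assumes "simple_labelling q i0"
  shows "{x. Q (q x)} \<in> sets borel"
proof -
  have "{x. Q (q x)} = (\<Union>i\<in>{i \<in> range q. Q i}. q -` {i})" by auto
  also have "\<dots> \<in> sets borel"
    using simple_labelling_finite[OF assms] simple_labelling_vimage[OF assms] by (intro sets.finite_UN) auto
  finally show ?thesis .
qed

text \<open>Linear functionals of integrals of matrix-valued simple functions have this form, up to null
  sets, with a vector-valued integrand.\<close>

definition scalar_integral ::
    "(('s::polish_space \<times> (real ^ 'm::finite)) set \<Rightarrow> 'w \<Rightarrow> real ^ 'd::finite)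
     \<Rightarrow> ('s \<times> (real ^ 'm)) set \<Rightarrow> ('s \<times> (real ^ 'm) \<Rightarrow> real ^ 'd) \<Rightarrow> 'w \<Rightarrow> real" where
  "scalar_integral \<Lambda> A \<phi> w = (\<Sum>c\<in>range \<phi> - {0}. c \<bullet> \<Lambda> (A \<inter> \<phi> -` {c}) w)"

text \<open>For \<open>norm u \<le> 1\<close> the integrand of the exponent is dominated by \<open>2 * min 1 ((norm x)\<^sup>2)\<close>, which is
  integrable with respect to a Levy measure.\<close>

lemma levy_exponent_tendsto_0:
  fixes \<nu> :: "(real ^ 'd::finite) measure"
  assumes \<nu>: "levy_measure \<nu>" and u: "u \<longlonglongrightarrow> 0"
  shows "(\<lambda>n. levy_exponent \<gamma> C \<nu> (u n)) \<longlonglongrightarrow> 0"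
proof -
  have [measurable_cong]: "sets \<nu> = sets borel" using \<nu> by (simp add: levy_measure_def)
  define F where "F u x = iexp (u \<bullet> x) - 1 - \<i> * complex_of_real (u \<bullet> x) * indicator {0..1} (norm x)" for u x :: "real ^ 'd"
  have bnd: "cmod (F u x) \<le> 2 * min 1 ((norm x)\<^sup>2)" if u: "norm u \<le> 1" for u x
  proof (cases "norm x \<le> 1")
    case True
    have ux: "\<bar>u \<bullet> x\<bar> \<le> norm x"
      using Cauchy_Schwarz_ineq2[of u x] mult_right_mono[OF u, of "norm x"] by simp
    have "F u x = iexp (u \<bullet> x) - (\<Sum>k\<le>1. (\<i> * (u \<bullet> x)) ^ k / fact k)" using True by (simp add: F_def)
    hence "cmod (F u x) \<le> \<bar>u \<bullet> x\<bar> ^ Suc 1 / fact (Suc 1)" using iexp_approx1[of "u \<bullet> x" 1] by simp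
    also have "\<dots> = \<bar>u \<bullet> x\<bar>\<^sup>2 / 2" by (simp add: power2_eq_square)
    also have "\<dots> \<le> (norm x)\<^sup>2 / 2" using power_mono[OF ux, of 2] by simp
    also have "\<dots> \<le> 2 * min 1 ((norm x)\<^sup>2)"
    proof -
      have "(norm x)\<^sup>2 \<le> 1" using True by (simp add: power_le_one)
      thus ?thesis by (simp add: min_def)
    qed
    finally show ?thesis .
  next
    case False
    have "cmod (F u x) \<le> 2" using False norm_triangle_ineq4[of "iexp (u \<bullet> x)" 1] by (simp add: F_def)
    moreover have "1 \<le> (norm x)\<^sup>2" using False by (simp add: one_le_power)
    ultimately show ?thesis by (simp add: min_def)
  qed
  obtain n0 where n0: "\<And>n. n \<ge> n0 \<Longrightarrow> norm (u n) \<le> 1"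
  proof -
    have "\<forall>\<^sub>F n in sequentially. norm (u n) < 1" using tendsto_norm[OF u] by (intro order_tendstoD(2)) auto
    thus ?thesis using that unfolding eventually_sequentially by (metis less_imp_le)
  qed
  have ui: "(\<lambda>n. u n \<bullet> x) \<longlonglongrightarrow> 0" for x using tendsto_inner[OF u tendsto_const[of x]] by simp
  have "(\<lambda>n. CLINT x|\<nu>. F (u (n + n0)) x) \<longlonglongrightarrow> (CLINT x|\<nu>. 0)"
  proof (rule integral_dominated_convergence[where w = "\<lambda>x. 2 * min 1 ((norm x)\<^sup>2)"])
    show "integrable \<nu> (\<lambda>x. 2 * min 1 ((norm x)\<^sup>2))"
      using \<nu> by (intro integrable_mult_right integrableI_nonneg) (auto simp: levy_measure_def)
    show "AE x in \<nu>. norm (F (u (n + n0)) x) \<le> 2 * min 1 ((norm x)\<^sup>2)" for n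
      using bnd[OF n0] by simp
    show "AE x in \<nu>. (\<lambda>n. F (u (n + n0)) x) \<longlonglongrightarrow> 0"
    proof (rule AE_I2)
      fix x
      have "(\<lambda>n. F (u n) x) \<longlonglongrightarrow> iexp 0 - 1 - \<i> * complex_of_real 0 * indicator {0..1} (norm x)"
        unfolding F_def by (intro tendsto_diff tendsto_exp tendsto_mult tendsto_of_real tendsto_const ui)
      hence "(\<lambda>n. F (u n) x) \<longlonglongrightarrow> 0" by simp
      thus "(\<lambda>n. F (u (n + n0)) x) \<longlonglongrightarrow> 0" by (rule LIMSEQ_ignore_initial_segment)
    qed
    show "F (u (n + n0)) \<in> borel_measurable \<nu>" for n unfolding F_def[abs_def] by measurable
  qed simp
  hence 1: "(\<lambda>n. CLINT x|\<nu>. F (u n) x) \<longlonglongrightarrow> 0" by (simp add: LIMSEQ_offset)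
  have 2: "(\<lambda>n. u n \<bullet> (C *v u n)) \<longlonglongrightarrow> 0"
  proof -
    have "(\<lambda>n. C *v u n) \<longlonglongrightarrow> C *v 0"
      using u by (intro isCont_tendsto_compose[OF linear_continuous_at[OF matrix_vector_mul_bounded_linear[of C]]])
    from tendsto_inner[OF u this] show ?thesis by simp
  qed
  have 3: "(\<lambda>n. \<gamma> \<bullet> u n) \<longlonglongrightarrow> 0" using tendsto_inner[OF tendsto_const[of \<gamma>] u] by simp
  have "(\<lambda>n. levy_exponent \<gamma> C \<nu> (u n)) \<longlonglongrightarrow> \<i> * complex_of_real 0 - complex_of_real 0 / 2 + 0"
    unfolding levy_exponent_def F_def[symmetric]
    by (intro tendsto_add tendsto_diff tendsto_mult tendsto_divide tendsto_of_real tendsto_const 1 2 3) auto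
  thus ?thesis by simp
qed

locale levy_basis_space =
  fixes M :: "'w measure"
    and \<Lambda> :: "('s::polish_space \<times> (real ^ 'm::finite)) set \<Rightarrow> 'w \<Rightarrow> real ^ 'd::finite"
    and \<gamma> :: "real ^ 'd" and C :: "real ^ 'd ^ 'd" and \<nu> :: "(real ^ 'd) measure" and \<pi> :: "'s measure"
  assumes basis: "levy_basis M \<Lambda> \<gamma> C \<nu> \<pi>"
begin

sublocale prob_space M using basis by (simp add: levy_basis_def)

sublocale \<pi>: prob_space \<pi> using basis by (simp add: levy_basis_def)

lemma sets_\<pi> [measurable_cong]: "sets \<pi> = sets borel" using basis by (simp add: levy_basis_def)

sublocale control: pair_sigma_finite \<pi> "lborel :: (real ^ 'm) measure" ..

abbreviation \<mu> :: "('s \<times> (real ^ 'm)) measure" where "\<mu> \<equiv> \<pi> \<Otimes>\<^sub>M lborel"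

abbreviation \<Phi> :: "real ^ 'd \<Rightarrow> complex" where "\<Phi> \<equiv> levy_exponent \<gamma> C \<nu>"

lemma sets_\<mu> [measurable_cong]: "sets \<mu> = sets borel"
proof -
  have "sets \<mu> = sets (borel \<Otimes>\<^sub>M borel)" by (rule sets_pair_measure_cong[OF sets_\<pi> sets_lborel])
  thus ?thesis by (simp only: borel_prod)
qed

lemma space_\<mu>: "space \<mu> = UNIV" using sets_eq_imp_space_eq[OF sets_\<mu>] by simp

lemma \<Lambda>_measurable: "B \<in> bounded_borel \<Longrightarrow> \<Lambda> B \<in> borel_measurable M"
  using basis by (simp add: levy_basis_def)

lemma \<Lambda>_sums:
  assumes "range S \<subseteq> bounded_borel" "disjoint_family S" "(\<Union>i. S i) \<in> bounded_borel"
  shows "AE w in M. (\<lambda>i::nat. \<Lambda> (S i) w) sums \<Lambda> (\<Union>i. S i) w"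
proof -
  have "\<forall>B :: nat \<Rightarrow> _. range B \<subseteq> bounded_borel \<and> disjoint_family B \<and> (\<Union>i. B i) \<in> bounded_borel \<longrightarrow>
        (AE w in M. (\<lambda>i. \<Lambda> (B i) w) sums \<Lambda> (\<Union>i. B i) w)"
    using basis unfolding levy_basis_def by (elim conjE) assumption
  thus ?thesis using assms by blast
qed

text \<open>A constant series converges only if its terms vanish.\<close>

lemma \<Lambda>_empty: "AE w in M. \<Lambda> {} w = 0"
proof -
  have "AE w in M. (\<lambda>i::nat. \<Lambda> ({} :: ('s \<times> (real ^ 'm)) set) w) sums \<Lambda> (\<Union>i::nat. {}) w"
    by (rule \<Lambda>_sums) (auto simp: disjoint_family_on_def)
  thus ?thesis
  proof eventually_elim
    case (elim w)
    hence "(\<lambda>i::nat. \<Lambda> {} w) \<longlonglongrightarrow> 0" using sums_summable summable_LIMSEQ_zero by blast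
    thus ?case using LIMSEQ_const_iff by blast
  qed
qed

lemma \<Lambda>_Un:
  assumes A: "A \<in> bounded_borel" "B \<in> bounded_borel" "A \<inter> B = {}"
  shows "AE w in M. \<Lambda> (A \<union> B) w = \<Lambda> A w + \<Lambda> B w"
proof -
  define S where "S i = (if i = 0 then A else if i = Suc 0 then B else {})" for i
  have U: "(\<Union>i. S i) = A \<union> B"
  proof
    show "A \<union> B \<subseteq> (\<Union>i. S i)" using S_def by (auto intro: exI[of _ 0] exI[of _ "Suc 0"])
  qed (auto simp: S_def split: if_splits)
  have AB: "A \<union> B \<in> bounded_borel" using A by (auto simp: bounded_borel_def)
  have "range S \<subseteq> bounded_borel" using A by (auto simp: S_def)
  moreover have "disjoint_family S" using A(3) by (auto simp: disjoint_family_on_def S_def)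
  ultimately have "AE w in M. (\<lambda>i. \<Lambda> (S i) w) sums \<Lambda> (\<Union>i. S i) w"
    using AB by (intro \<Lambda>_sums) (simp_all only: U)
  thus ?thesis using \<Lambda>_empty
  proof eventually_elim
    case (elim w)
    have "(\<lambda>i. \<Lambda> (S i) w) sums (\<Sum>i\<in>{0, Suc 0}. \<Lambda> (S i) w)"
      by (rule sums_finite) (auto simp: S_def elim(2))
    hence "(\<Sum>i\<in>{0, Suc 0}. \<Lambda> (S i) w) = \<Lambda> (A \<union> B) w" using elim(1) unfolding U by (rule sums_unique2)
    thus ?case by (simp add: S_def)
  qed
qed

lemma \<Lambda>_UN:
  assumes "finite I" "\<And>i. i \<in> I \<Longrightarrow> B i \<in> bounded_borel" "disjoint_family_on B I"
  shows "AE w in M. \<Lambda> (\<Union>i\<in>I. B i) w = (\<Sum>i\<in>I. \<Lambda> (B i) w)"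
  using assms
proof (induction I rule: finite_induct)
  case empty
  thus ?case using \<Lambda>_empty by simp
next
  case (insert i I)
  have IH: "AE w in M. \<Lambda> (\<Union>i\<in>I. B i) w = (\<Sum>i\<in>I. \<Lambda> (B i) w)"
    using insert.prems by (intro insert.IH) (auto simp: disjoint_family_on_def)
  have "B i \<inter> (\<Union>i\<in>I. B i) = {}" using insert.prems(2) insert.hyps(2) by (force simp: disjoint_family_on_def)
  hence "AE w in M. \<Lambda> (B i \<union> (\<Union>i\<in>I. B i)) w = \<Lambda> (B i) w + \<Lambda> (\<Union>i\<in>I. B i) w"
    using insert.prems insert.hyps by (intro \<Lambda>_Un bounded_borel_UN) auto
  thus ?case using IH by eventually_elim (use insert.hyps in simp)
qed

lemma char_\<Lambda>_family:
  assumes I: "finite I" and B: "\<And>i. i \<in> I \<Longrightarrow> B i \<in> bounded_borel" and disj: "disjoint_family_on B I"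
  shows "(CLINT w|M. iexp (\<Sum>i\<in>I. t i \<bullet> \<Lambda> (B i) w)) = exp (\<Sum>i\<in>I. \<Phi> (t i) * complex_of_real (measure \<mu> (B i)))"
proof -
  \<comment> \<open>Independence is available for families indexed by an initial segment of the naturals.\<close>
  obtain e where e: "bij_betw e {..<card I} I"
    using ex_bij_betw_nat_finite[OF I] by (auto simp: atLeast0LessThan)
  let ?k = "card I"
  have eI: "e j \<in> I" if "j < ?k" for j using e that by (auto simp: bij_betw_def)
  have inj: "inj_on e {..<?k}" using e by (simp add: bij_betw_def)
  have "indep_vars (\<lambda>_. borel) (\<lambda>j. \<Lambda> (B (e j))) {..<?k}"
  proof -
    have "disjoint_family_on (\<lambda>j. B (e j)) {..<?k}"
      unfolding disjoint_family_on_def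
    proof (intro ballI impI)
      fix m n assume mn: "m \<in> {..<?k}" "n \<in> {..<?k}" "m \<noteq> n"
      hence "e m \<noteq> e n" using inj by (auto simp: inj_on_def)
      thus "B (e m) \<inter> B (e n) = {}" using disj eI mn by (auto simp: disjoint_family_on_def)
    qed
    thus ?thesis using basis B eI unfolding levy_basis_def by simp
  qed
  hence ind: "indep_vars (\<lambda>_. borel) (\<lambda>j w. (\<lambda>x. iexp (t (e j) \<bullet> x)) (\<Lambda> (B (e j)) w)) {..<?k}"
    by (rule indep_vars_compose2) measurable
  have int: "integrable M (\<lambda>w. iexp (t (e j) \<bullet> \<Lambda> (B (e j)) w))" if "j < ?k" for j
    using \<Lambda>_measurable[OF B[OF eI[OF that]]] by (intro integrable_const_bound[of _ 1]) auto
  have "(CLINT w|M. iexp (\<Sum>i\<in>I. t i \<bullet> \<Lambda> (B i) w)) = (CLINT w|M. (\<Prod>j<?k. iexp (t (e j) \<bullet> \<Lambda> (B (e j)) w)))"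
  proof (rule Bochner_Integration.integral_cong[OF refl])
    fix w
    have "(\<Sum>i\<in>I. t i \<bullet> \<Lambda> (B i) w) = (\<Sum>j<?k. t (e j) \<bullet> \<Lambda> (B (e j)) w)"
      by (rule sum.reindex_bij_betw[OF e, symmetric])
    thus "iexp (\<Sum>i\<in>I. t i \<bullet> \<Lambda> (B i) w) = (\<Prod>j<?k. iexp (t (e j) \<bullet> \<Lambda> (B (e j)) w))"
      by (simp add: sum_distrib_left exp_sum)
  qed
  also have "\<dots> = (\<Prod>j<?k. CLINT w|M. iexp (t (e j) \<bullet> \<Lambda> (B (e j)) w))"
    by (rule indep_vars_lebesgue_integral[OF _ ind]) (use int in auto)
  also have "\<dots> = (\<Prod>j<?k. exp (\<Phi> (t (e j)) * complex_of_real (measure \<mu> (B (e j)))))"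
    using basis B eI unfolding levy_basis_def by (intro prod.cong) auto
  also have "\<dots> = (\<Prod>i\<in>I. exp (\<Phi> (t i) * complex_of_real (measure \<mu> (B i))))"
    by (rule prod.reindex_bij_betw[OF e])
  finally show ?thesis using I by (simp add: exp_sum)
qed

abbreviation "J \<equiv> scalar_integral \<Lambda>"

abbreviation "vsimple \<phi> \<equiv> simple_labelling \<phi> (0 :: real ^ 'd)"

lemma fibre_bounded:
  assumes "simple_labelling q i0" "i \<noteq> i0" "A \<in> sets borel"
  shows "A \<inter> q -` {i} \<in> bounded_borel"
  using assms by (intro bounded_borel_Int simple_labelling_bounded)

lemma J_measurable [measurable]:
  assumes "vsimple \<phi>" "A \<in> sets borel"
  shows "J A \<phi> \<in> borel_measurable M"
proof -
  have "(\<lambda>w. c \<bullet> \<Lambda> (A \<inter> \<phi> -` {c}) w) \<in> borel_measurable M" if "c \<in> range \<phi> - {0}" for c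
    using \<Lambda>_measurable[OF fibre_bounded[OF assms(1) _ assms(2), of c]] that by simp
  thus ?thesis unfolding scalar_integral_def[abs_def] by (rule borel_measurable_sum)
qed

text \<open>Additivity of \<open>\<Lambda>\<close> holds almost surely for each choice of sets, hence almost surely for the finitely
  many sets of a labelling at once. The integral may thus be computed from any labelling that
  determines the integrand, and two integrands may be compared on a common one.\<close>

lemma J_regroup:
  assumes q: "simple_labelling q i0" and K: "K i0 = 0" and A: "A \<in> sets borel"
  shows "AE w in M. J A (\<lambda>x. K (q x)) w = (\<Sum>i\<in>range q - {i0}. K i \<bullet> \<Lambda> (A \<inter> q -` {i}) w)"
proof -
  let ?R = "range (\<lambda>x. K (q x)) - {0}"
  have fin: "finite (range q)" by (rule simple_labelling_finite[OF q])
  have finR: "finite ?R" by (rule finite_Diff[OF simple_labelling_finite[OF simple_labelling_image[of q i0 K 0, OF q K]]])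
  define S where "S = {i \<in> range q. K i \<noteq> 0}"
  have S: "finite S" "S \<subseteq> range q - {i0}" using fin K by (auto simp: S_def)
  have "AE w in M. \<Lambda> (A \<inter> (\<lambda>x. K (q x)) -` {c}) w = (\<Sum>i\<in>{i \<in> S. K i = c}. \<Lambda> (A \<inter> q -` {i}) w)" if c: "c \<in> ?R" for c
  proof -
    have e: "A \<inter> (\<lambda>x. K (q x)) -` {c} = (\<Union>i\<in>{i \<in> S. K i = c}. A \<inter> q -` {i})"
      using c by (auto simp: S_def)
    show ?thesis unfolding e
    proof (rule \<Lambda>_UN)
      show "A \<inter> q -` {i} \<in> bounded_borel" if "i \<in> {i \<in> S. K i = c}" for i
        using that S(2) by (intro fibre_bounded[OF q _ A]) auto
    qed (use S(1) in \<open>auto simp: disjoint_family_on_def\<close>)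
  qed
  hence "AE w in M. \<forall>c\<in>?R. \<Lambda> (A \<inter> (\<lambda>x. K (q x)) -` {c}) w = (\<Sum>i\<in>{i \<in> S. K i = c}. \<Lambda> (A \<inter> q -` {i}) w)"
    using finR by (intro AE_finite_allI) auto
  thus ?thesis
  proof eventually_elim
    case (elim w)
    have "J A (\<lambda>x. K (q x)) w = (\<Sum>c\<in>?R. c \<bullet> (\<Sum>i\<in>{i \<in> S. K i = c}. \<Lambda> (A \<inter> q -` {i}) w))"
      unfolding scalar_integral_def using elim by (intro sum.cong) auto
    also have "\<dots> = (\<Sum>c\<in>?R. \<Sum>i\<in>{i \<in> S. K i = c}. K i \<bullet> \<Lambda> (A \<inter> q -` {i}) w)"
      by (simp add: inner_sum_right)
    also have "\<dots> = (\<Sum>i\<in>S. K i \<bullet> \<Lambda> (A \<inter> q -` {i}) w)"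
      using S finR by (intro sum.group) (auto simp: S_def)
    also have "\<dots> = (\<Sum>i\<in>range q - {i0}. K i \<bullet> \<Lambda> (A \<inter> q -` {i}) w)"
      using fin S by (intro sum.mono_neutral_left) (auto simp: S_def)
    finally show ?case .
  qed
qed

lemma J_add:
  assumes p: "vsimple \<phi>" and q: "vsimple \<psi>" and A: "A \<in> sets borel"
  shows "vsimple (\<lambda>x. \<phi> x + \<psi> x)" "AE w in M. J A (\<lambda>x. \<phi> x + \<psi> x) w = J A \<phi> w + J A \<psi> w"
proof -
  note pq = simple_labelling_Pair[OF p q]
  show "vsimple (\<lambda>x. \<phi> x + \<psi> x)" using simple_labelling_image[OF pq, of "\<lambda>z. fst z + snd z"] by simp
  have 1: "AE w in M. J A (\<lambda>x. \<phi> x + \<psi> x) w = (\<Sum>i\<in>range (\<lambda>x. (\<phi> x, \<psi> x)) - {(0, 0)}. (fst i + snd i) \<bullet> \<Lambda> (A \<inter> (\<lambda>x. (\<phi> x, \<psi> x)) -` {i}) w)"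
    using J_regroup[OF pq, of "\<lambda>z. fst z + snd z"] A by simp
  have 2: "AE w in M. J A \<phi> w = (\<Sum>i\<in>range (\<lambda>x. (\<phi> x, \<psi> x)) - {(0, 0)}. fst i \<bullet> \<Lambda> (A \<inter> (\<lambda>x. (\<phi> x, \<psi> x)) -` {i}) w)"
    using J_regroup[OF pq, of fst] A by simp
  have 3: "AE w in M. J A \<psi> w = (\<Sum>i\<in>range (\<lambda>x. (\<phi> x, \<psi> x)) - {(0, 0)}. snd i \<bullet> \<Lambda> (A \<inter> (\<lambda>x. (\<phi> x, \<psi> x)) -` {i}) w)"
    using J_regroup[OF pq, of snd] A by simp
  show "AE w in M. J A (\<lambda>x. \<phi> x + \<psi> x) w = J A \<phi> w + J A \<psi> w"
    using 1 2 3 by eventually_elim (simp add: inner_add_left sum.distrib)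
qed

lemma J_diff:
  assumes p: "vsimple \<phi>" and q: "vsimple \<psi>" and A: "A \<in> sets borel"
  shows "vsimple (\<lambda>x. \<phi> x - \<psi> x)" "AE w in M. J A (\<lambda>x. \<phi> x - \<psi> x) w = J A \<phi> w - J A \<psi> w"
proof -
  show v: "vsimple (\<lambda>x. \<phi> x - \<psi> x)"
    using simple_labelling_image[OF simple_labelling_Pair[OF p q], of "\<lambda>z. fst z - snd z"] by simp
  from J_add(2)[OF v q A] show "AE w in M. J A (\<lambda>x. \<phi> x - \<psi> x) w = J A \<phi> w - J A \<psi> w"
    by eventually_elim simp
qed

lemma J_Un:
  assumes p: "vsimple \<phi>" and A: "A \<in> sets borel" "B \<in> sets borel" "A \<inter> B = {}"
  shows "AE w in M. J (A \<union> B) \<phi> w = J A \<phi> w + J B \<phi> w"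
proof -
  have "AE w in M. \<Lambda> ((A \<union> B) \<inter> \<phi> -` {c}) w = \<Lambda> (A \<inter> \<phi> -` {c}) w + \<Lambda> (B \<inter> \<phi> -` {c}) w" if "c \<in> range \<phi> - {0}" for c
    using that A fibre_bounded[OF p] \<Lambda>_Un[of "A \<inter> \<phi> -` {c}" "B \<inter> \<phi> -` {c}"]
    by (auto simp: Int_Un_distrib2)
  hence "AE w in M. \<forall>c\<in>range \<phi> - {0}. \<Lambda> ((A \<union> B) \<inter> \<phi> -` {c}) w = \<Lambda> (A \<inter> \<phi> -` {c}) w + \<Lambda> (B \<inter> \<phi> -` {c}) w"
    using simple_labelling_finite[OF p] by (intro AE_finite_allI) auto
  thus ?thesis
    by eventually_elim (simp add: scalar_integral_def inner_add_right sum.distrib)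
qed

lemma char_J:
  assumes p: "vsimple \<phi>" and A: "A \<in> sets borel"
  shows "(CLINT w|M. iexp (s * J A \<phi> w)) = exp (\<Sum>c\<in>range \<phi> - {0}. \<Phi> (s *\<^sub>R c) * complex_of_real (measure \<mu> (A \<inter> \<phi> -` {c})))"
proof -
  have "(CLINT w|M. iexp (\<Sum>c\<in>range \<phi> - {0}. (s *\<^sub>R c) \<bullet> \<Lambda> (A \<inter> \<phi> -` {c}) w))
    = exp (\<Sum>c\<in>range \<phi> - {0}. \<Phi> (s *\<^sub>R c) * complex_of_real (measure \<mu> (A \<inter> \<phi> -` {c})))"
    by (rule char_\<Lambda>_family)
      (use simple_labelling_finite[OF p] fibre_bounded[OF p _ A] in \<open>auto simp: disjoint_family_on_def\<close>)
  thus ?thesis by (simp add: scalar_integral_def sum_distrib_left)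
qed

end


section \<open>The integral does not depend on the approximating simple functions\<close>

context levy_basis_space
begin

text \<open>The control measure is infinite. Weighting it with a Gaussian density in the space variable
  makes it finite and keeps it comparable on sets that are bounded in space.\<close>

definition weight :: "'s \<times> (real ^ 'm) \<Rightarrow> real" where
  "weight x = gauss_kernel 1 (snd x)"

definition P :: "('s \<times> (real ^ 'm)) measure" where
  "P = density \<mu> (\<lambda>x. ennreal (weight x))"

lemma snd_borel: "(snd :: 's \<times> (real ^ 'm) \<Rightarrow> _) \<in> borel_measurable borel"
  by (intro borel_measurable_continuous_onI continuous_intros)

lemma weight_measurable [measurable]: "weight \<in> borel_measurable \<mu>"
proof -
  have "weight \<in> borel_measurable borel"
    unfolding weight_def[abs_def] by (rule measurable_compose[OF snd_borel gauss_kernel_measurable])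
  thus ?thesis unfolding measurable_cong_sets[OF sets_\<mu> refl] .
qed

lemma in_sets_\<mu>: "B \<in> sets borel \<Longrightarrow> B \<in> sets \<mu>"
  unfolding sets_\<mu> .

lemma sets_P [measurable_cong]: "sets P = sets borel"
  unfolding P_def sets_density by (rule sets_\<mu>)

lemma finite_P: "finite_measure P"
proof
  have "emeasure P (space P) = (\<integral>\<^sup>+x. ennreal (weight x) \<partial>\<mu>)"
  proof -
    have "emeasure P (space P) = (\<integral>\<^sup>+x. ennreal (weight x) * indicator (space \<mu>) x \<partial>\<mu>)"
      unfolding P_def space_density by (rule emeasure_density[OF _ sets.top]) measurable
    also have "\<dots> = (\<integral>\<^sup>+x. ennreal (weight x) \<partial>\<mu>)" by (intro nn_integral_cong) (simp add: indicator_def)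
    finally show ?thesis .
  qed
  also have "\<dots> = (\<integral>\<^sup>+z. \<integral>\<^sup>+s. ennreal (weight (z, s)) \<partial>lborel \<partial>\<pi>)"
    by (rule lborel.nn_integral_fst[symmetric]) measurable
  also have "\<dots> = (\<integral>\<^sup>+z. 1 \<partial>\<pi>)"
  proof (rule nn_integral_cong)
    fix z
    have "(\<integral>\<^sup>+s. ennreal (gauss_kernel 1 (s :: real ^ 'm)) \<partial>lborel) = ennreal (LINT s|lborel. gauss_kernel 1 (s :: real ^ 'm))"
      by (rule nn_integral_eq_integral) (auto simp: gauss_kernel_integral gauss_kernel_nonneg)
    thus "(\<integral>\<^sup>+s. ennreal (weight (z, s)) \<partial>lborel) = 1" by (simp add: weight_def gauss_kernel_integral)
  qed
  also have "\<dots> = 1" by (simp add: \<pi>.emeasure_space_1)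
  finally show "emeasure P (space P) \<noteq> \<infinity>" by simp
qed

sublocale P: finite_measure P by (rule finite_P)

definition slab :: "real \<Rightarrow> ('s \<times> (real ^ 'm)) set" where
  "slab R = {x. norm (snd x) \<le> R}"

lemma slab_measurable [measurable]: "slab R \<in> sets borel"
  unfolding slab_def by (intro borel_closed closed_Collect_le continuous_intros)

lemma slab_finite: "emeasure \<mu> (slab R) < \<infinity>"
proof -
  have "slab R = UNIV \<times> cball 0 R" by (auto simp: slab_def)
  hence "emeasure \<mu> (slab R) = emeasure \<pi> UNIV * emeasure lborel (cball 0 R :: (real ^ 'm) set)"
    by (simp add: lborel.emeasure_pair_measure_Times sets_\<pi>)
  also have "emeasure \<pi> UNIV = 1" using \<pi>.emeasure_space_1 sets_eq_imp_space_eq[OF sets_\<pi>] by simp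
  finally show ?thesis using emeasure_bounded_finite[OF bounded_cball[of "0 :: real ^ 'm" R]] by simp
qed

lemma slab_fmeasurable:
  assumes "B \<in> sets borel" "B \<subseteq> slab R"
  shows "B \<in> fmeasurable \<mu>"
proof (rule fmeasurableI)
  show "B \<in> sets \<mu>" using assms by (intro in_sets_\<mu>)
  have "emeasure \<mu> B \<le> emeasure \<mu> (slab R)" using assms by (intro emeasure_mono in_sets_\<mu> slab_measurable)
  thus "emeasure \<mu> B < \<infinity>" using slab_finite by (rule le_less_trans)
qed

lemma bounded_borel_slab:
  assumes "B \<in> bounded_borel"
  shows "\<exists>R. B \<subseteq> slab R"
proof -
  have "bounded (snd ` B)" using assms by (intro bounded_snd) (simp add: bounded_borel_def)
  then obtain R where "\<forall>y\<in>snd ` B. norm y \<le> R" unfolding bounded_iff by auto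
  thus ?thesis by (intro exI[of _ R]) (auto simp: slab_def)
qed

lemma measure_slab_le_P:
  "\<exists>c>0. \<forall>B\<in>sets borel. B \<subseteq> slab R \<longrightarrow> c * measure \<mu> B \<le> measure P B"
proof -
  define c where "c = (1 / sqrt (2 * pi * 1\<^sup>2)) ^ CARD('m) * exp (- (R\<^sup>2 / (2 * 1\<^sup>2)))"
  have c: "c > 0" by (simp add: c_def)
  have "c * measure \<mu> B \<le> measure P B" if B: "B \<in> sets borel" "B \<subseteq> slab R" for B
  proof -
    have Bm[measurable]: "B \<in> sets \<mu>" using B by (intro in_sets_\<mu>)
    have w: "c \<le> weight x" if "x \<in> B" for x
    proof -
      have "norm (snd x) \<le> R" using B that by (auto simp: slab_def)
      hence "(norm (snd x))\<^sup>2 \<le> R\<^sup>2" by (intro power_mono) auto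
      thus ?thesis unfolding weight_def gauss_kernel_eq c_def by (intro mult_left_mono) auto
    qed
    have "ennreal c * emeasure \<mu> B = (\<integral>\<^sup>+x. ennreal c * indicator B x \<partial>\<mu>)"
      by (rule nn_integral_cmult_indicator[OF Bm, symmetric])
    also have "\<dots> \<le> (\<integral>\<^sup>+x. ennreal (weight x) * indicator B x \<partial>\<mu>)"
      using w by (intro nn_integral_mono) (auto simp: indicator_def intro!: ennreal_leI)
    also have "\<dots> = emeasure P B" unfolding P_def
      by (rule emeasure_density[OF _ Bm, symmetric]) measurable
    finally have "ennreal (c * measure \<mu> B) \<le> ennreal (measure P B)"
      using slab_fmeasurable[OF B] c
      by (simp add: P.emeasure_eq_measure emeasure_eq_measure2 ennreal_mult')
    thus ?thesis by (simp add: ennreal_le_iff)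
  qed
  thus ?thesis using c by blast
qed

lemma AE_P: "(AE x in \<mu>. Q x) \<Longrightarrow> (AE x in P. Q x)"
  unfolding P_def by (subst AE_density) (auto elim: AE_mp)

text \<open>The sum is the exponent of the characteristic function of an integral over \<open>A\<close>.\<close>

lemma sum_fibres_le:
  assumes p: "vsimple \<phi>" and A: "A \<in> sets borel" "A \<subseteq> slab R" and b0: "b \<ge> 0"
    and b: "\<And>c. A \<inter> \<phi> -` {c} \<noteq> {} \<Longrightarrow> cmod (\<Phi> (s *\<^sub>R c)) \<le> b"
  shows "cmod (\<Sum>c\<in>range \<phi> - {0}. \<Phi> (s *\<^sub>R c) * complex_of_real (measure \<mu> (A \<inter> \<phi> -` {c}))) \<le> b * measure \<mu> (slab R)"
proof -
  have fin: "finite (range \<phi> - {0})" using simple_labelling_finite[OF p] by simp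
  have Ac: "A \<inter> \<phi> -` {c} \<in> sets borel" for c using A(1) simple_labelling_vimage[OF p, of c] by simp
  have fm: "A \<inter> \<phi> -` {c} \<in> fmeasurable \<mu>" for c
    using A(2) by (intro slab_fmeasurable[OF Ac, of _ R]) auto
  have "cmod (\<Sum>c\<in>range \<phi> - {0}. \<Phi> (s *\<^sub>R c) * complex_of_real (measure \<mu> (A \<inter> \<phi> -` {c})))
      \<le> (\<Sum>c\<in>range \<phi> - {0}. b * measure \<mu> (A \<inter> \<phi> -` {c}))"
  proof (rule sum_norm_le)
    fix c
    show "cmod (\<Phi> (s *\<^sub>R c) * complex_of_real (measure \<mu> (A \<inter> \<phi> -` {c}))) \<le> b * measure \<mu> (A \<inter> \<phi> -` {c})"
    proof (cases "A \<inter> \<phi> -` {c} = {}")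
      case False
      show ?thesis using b[OF False] by (simp add: norm_mult mult_right_mono)
    qed simp
  qed
  also have "\<dots> = b * measure \<mu> (\<Union>c\<in>range \<phi> - {0}. A \<inter> \<phi> -` {c})"
  proof -
    have "measure \<mu> (\<Union>c\<in>range \<phi> - {0}. A \<inter> \<phi> -` {c}) = (\<Sum>c\<in>range \<phi> - {0}. measure \<mu> (A \<inter> \<phi> -` {c}))"
    proof (rule measure_finite_Union[OF fin])
      show "(\<lambda>c. A \<inter> \<phi> -` {c}) ` (range \<phi> - {0}) \<subseteq> sets \<mu>" using in_sets_\<mu>[OF Ac] by blast
    qed (use fmeasurableD2[OF fm] in \<open>auto simp: disjoint_family_on_def\<close>)
    thus ?thesis by (simp add: sum_distrib_left)
  qed
  also have "\<dots> \<le> b * measure \<mu> (slab R)"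
  proof (rule mult_left_mono[OF measure_mono_fmeasurable b0])
    show "(\<Union>c\<in>range \<phi> - {0}. A \<inter> \<phi> -` {c}) \<subseteq> slab R" using A(2) by auto
    have "(\<Union>c\<in>range \<phi> - {0}. A \<inter> \<phi> -` {c}) \<in> sets borel" using fin Ac by (intro sets.finite_UN) auto
    thus "(\<Union>c\<in>range \<phi> - {0}. A \<inter> \<phi> -` {c}) \<in> sets \<mu>" by (rule in_sets_\<mu>)
    show "slab R \<in> fmeasurable \<mu>" by (rule slab_fmeasurable) auto
  qed
  finally show ?thesis .
qed

text \<open>A simple function has finitely many nonzero values, each of them on a set that is bounded in
  space, where \<open>P\<close> controls \<open>\<mu>\<close>. If \<open>P\<close> of the domain tends to zero, so does every summand in the
  exponent of the characteristic function of the integral.\<close>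

lemma ky_fan_J_absolutely_continuous:
  assumes p: "vsimple \<phi>" and e: "e > 0"
  shows "\<exists>r>0. \<forall>B\<in>sets borel. measure P B < r \<longrightarrow> ky_fan (J B \<phi>) < e"
proof (rule ccontr)
  assume neg: "\<not> ?thesis"
  have "\<forall>n. \<exists>B. B \<in> sets borel \<and> measure P B < 1 / real (Suc n) \<and> ky_fan (J B \<phi>) \<ge> e"
  proof
    fix n
    have "1 / real (Suc n) > 0" by simp
    with neg show "\<exists>B. B \<in> sets borel \<and> measure P B < 1 / real (Suc n) \<and> ky_fan (J B \<phi>) \<ge> e"
      by (meson not_le_imp_less)
  qed
  from choice[OF this] obtain B where B: "\<And>n. B n \<in> sets borel" "\<And>n. measure P (B n) < 1 / real (Suc n)" "\<And>n. ky_fan (J (B n) \<phi>) \<ge> e"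
    by blast
  have m0: "(\<lambda>n. measure \<mu> (B n \<inter> \<phi> -` {c})) \<longlonglongrightarrow> 0" if c: "c \<noteq> 0" for c
  proof -
    obtain R where R: "\<phi> -` {c} \<subseteq> slab R"
      using bounded_borel_slab[OF simple_labelling_bounded[OF p c]] by blast
    obtain a where a: "a > 0" "\<And>B. B \<in> sets borel \<Longrightarrow> B \<subseteq> slab R \<Longrightarrow> a * measure \<mu> B \<le> measure P B"
      using measure_slab_le_P[of R] by blast
    have Bc: "B n \<inter> \<phi> -` {c} \<in> sets borel" for n using B(1) simple_labelling_vimage[OF p, of c] by simp
    have "measure \<mu> (B n \<inter> \<phi> -` {c}) \<le> (1 / a) * (1 / real (Suc n))" for n
    proof -
      have "a * measure \<mu> (B n \<inter> \<phi> -` {c}) \<le> measure P (B n \<inter> \<phi> -` {c})" using R by (intro a(2) Bc) auto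
      also have "\<dots> \<le> measure P (B n)" using B(1) by (intro P.finite_measure_mono) (auto simp: sets_P)
      also have "\<dots> \<le> 1 / real (Suc n)" using B(2) by (rule less_imp_le)
      finally have "(1 / a) * (a * measure \<mu> (B n \<inter> \<phi> -` {c})) \<le> (1 / a) * (1 / real (Suc n))"
        using a(1) by (intro mult_left_mono) auto
      thus ?thesis using a(1) by simp
    qed
    hence "\<forall>\<^sub>F n in sequentially. norm (measure \<mu> (B n \<inter> \<phi> -` {c})) \<le> (1 / a) * (1 / real (Suc n))"
      by (intro always_eventually allI) (simp only: real_norm_def abs_of_nonneg[OF measure_nonneg])
    moreover have "(\<lambda>n. (1 / a) * (1 / real (Suc n))) \<longlonglongrightarrow> 0"
      using tendsto_mult_right_zero[OF LIMSEQ_inverse_real_of_nat, of "1 / a"] by (simp add: inverse_eq_divide)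
    ultimately show ?thesis by (rule Lim_null_comparison)
  qed
  have "(\<lambda>n. ky_fan (J (B n) \<phi>)) \<longlonglongrightarrow> 0"
  proof (rule ky_fan_tendsto_of_char)
    show "J (B n) \<phi> \<in> borel_measurable M" for n using p B(1) by (rule J_measurable)
    fix s
    have "(\<lambda>n. exp (\<Sum>c\<in>range \<phi> - {0}. \<Phi> (s *\<^sub>R c) * complex_of_real (measure \<mu> (B n \<inter> \<phi> -` {c}))))
        \<longlonglongrightarrow> exp (\<Sum>c\<in>range \<phi> - {0}. \<Phi> (s *\<^sub>R c) * complex_of_real 0)"
      by (intro tendsto_exp tendsto_sum tendsto_mult tendsto_const tendsto_of_real m0) auto
    thus "(\<lambda>n. CLINT w|M. iexp (s * J (B n) \<phi> w)) \<longlonglongrightarrow> 1" unfolding char_J[OF p B(1)] by simp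
  qed
  hence "\<forall>\<^sub>F n in sequentially. ky_fan (J (B n) \<phi>) < e" using e by (intro order_tendstoD(2)) auto
  then obtain n where "ky_fan (J (B n) \<phi>) < e" by (auto simp: eventually_sequentially)
  thus False using B(3)[of n] by simp
qed

lemma levy_exponent_small:
  assumes "e > 0"
  shows "\<exists>d>0. \<forall>u. norm u < d \<longrightarrow> cmod (\<Phi> u) < e"
proof (rule ccontr)
  assume neg: "\<not> ?thesis"
  have "\<forall>n. \<exists>u. norm u < 1 / real (Suc n) \<and> cmod (\<Phi> u) \<ge> e"
  proof
    fix n
    have "1 / real (Suc n) > 0" by simp
    with neg show "\<exists>u. norm u < 1 / real (Suc n) \<and> cmod (\<Phi> u) \<ge> e" by (meson not_le_imp_less)
  qed
  from choice[OF this] obtain u where u: "\<And>n. norm (u n) < 1 / real (Suc n)" "\<And>n. cmod (\<Phi> (u n)) \<ge> e" by blast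
  have "u \<longlonglongrightarrow> 0"
  proof (rule Lim_null_comparison)
    show "(\<lambda>n. 1 / real (Suc n)) \<longlonglongrightarrow> 0" using LIMSEQ_inverse_real_of_nat by (simp add: inverse_eq_divide)
    show "\<forall>\<^sub>F n in sequentially. norm (u n) \<le> 1 / real (Suc n)"
      by (intro always_eventually allI less_imp_le u(1))
  qed
  moreover have "levy_measure \<nu>" using basis by (simp add: levy_basis_def)
  ultimately have "(\<lambda>n. cmod (\<Phi> (u n))) \<longlonglongrightarrow> cmod 0" by (intro tendsto_norm levy_exponent_tendsto_0)
  hence "\<forall>\<^sub>F n in sequentially. cmod (\<Phi> (u n)) < e" using assms by (intro order_tendstoD(2)) auto
  then obtain n where "cmod (\<Phi> (u n)) < e" by (auto simp: eventually_sequentially)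
  thus False using u(2)[of n] by simp
qed

text \<open>The Levy exponent vanishes continuously at zero, and a slab has finite control measure, so the
  exponent of the characteristic function of the integral is small.\<close>

lemma ky_fan_J_small:
  assumes e: "e > 0"
  shows "\<exists>d>0. \<forall>\<phi> A. vsimple \<phi> \<longrightarrow> A \<in> sets borel \<longrightarrow> A \<subseteq> slab R \<longrightarrow> (\<forall>x\<in>A. norm (\<phi> x) \<le> d) \<longrightarrow> ky_fan (J A \<phi>) < e"
proof (rule ccontr)
  assume neg: "\<not> ?thesis"
  have "\<forall>n. \<exists>z. vsimple (fst z) \<and> snd z \<in> sets borel \<and> snd z \<subseteq> slab R \<and> (\<forall>x\<in>snd z. norm (fst z x) \<le> 1 / real (Suc n)) \<and> ky_fan (J (snd z) (fst z)) \<ge> e"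
  proof
    fix n
    have "1 / real (Suc n) > 0" by simp
    with neg obtain \<phi> A where "vsimple \<phi>" "A \<in> sets borel" "A \<subseteq> slab R" "\<forall>x\<in>A. norm (\<phi> x) \<le> 1 / real (Suc n)" "\<not> ky_fan (J A \<phi>) < e"
      by blast
    thus "\<exists>z. vsimple (fst z) \<and> snd z \<in> sets borel \<and> snd z \<subseteq> slab R \<and> (\<forall>x\<in>snd z. norm (fst z x) \<le> 1 / real (Suc n)) \<and> ky_fan (J (snd z) (fst z)) \<ge> e"
      by (intro exI[of _ "(\<phi>, A)"]) simp
  qed
  from choice[OF this] obtain z where z: "\<And>n. vsimple (fst (z n))" "\<And>n. snd (z n) \<in> sets borel" "\<And>n. snd (z n) \<subseteq> slab R"
    "\<And>n x. x \<in> snd (z n) \<Longrightarrow> norm (fst (z n) x) \<le> 1 / real (Suc n)" "\<And>n. ky_fan (J (snd (z n)) (fst (z n))) \<ge> e"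
    by blast
  define \<phi> A where "\<phi> n = fst (z n)" and "A n = snd (z n)" for n
  note z = z[folded \<phi>_def A_def]
  have "(\<lambda>n. ky_fan (J (A n) (\<phi> n))) \<longlonglongrightarrow> 0"
  proof (rule ky_fan_tendsto_of_char)
    show "J (A n) (\<phi> n) \<in> borel_measurable M" for n using z(1,2) by (rule J_measurable)
    fix s
    define S where "S n = (\<Sum>c\<in>range (\<phi> n) - {0}. \<Phi> (s *\<^sub>R c) * complex_of_real (measure \<mu> (A n \<inter> \<phi> n -` {c})))" for n
    have "S \<longlonglongrightarrow> 0"
    proof (rule LIMSEQ_I)
      fix r :: real assume r: "r > 0"
      define b where "b = r / (2 * (measure \<mu> (slab R) + 1))"
      have mp: "measure \<mu> (slab R) + 1 > 0" by (simp add: add_nonneg_pos)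
      have b: "b > 0" using r mp by (simp add: b_def)
      have bm: "b * measure \<mu> (slab R) < r"
      proof -
        have "b * measure \<mu> (slab R) \<le> b * (measure \<mu> (slab R) + 1)" using b by (intro mult_left_mono) auto
        also have "\<dots> = r / 2" using mp unfolding b_def by (simp add: field_simps)
        finally show ?thesis using r by simp
      qed
      obtain d where d: "d > 0" "\<And>u. norm u < d \<Longrightarrow> cmod (\<Phi> u) < b" using levy_exponent_small[OF b] by blast
      obtain n0 where n0: "\<bar>s\<bar> / d < real n0" using reals_Archimedean2 by blast
      have "norm (S n - 0) < r" if n: "n \<ge> n0" for n
      proof -
        have "cmod (S n) \<le> b * measure \<mu> (slab R)" unfolding S_def
        proof (rule sum_fibres_le[OF z(1,2,3)])
          fix c assume "A n \<inter> \<phi> n -` {c} \<noteq> {}"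
          then obtain x where "x \<in> A n" "\<phi> n x = c" by auto
          hence c: "norm c \<le> 1 / real (Suc n)" using z(4) by blast
          have "\<bar>s\<bar> < d * real n0" using n0 d(1) by (simp add: field_simps)
          also have "\<dots> \<le> d * real (Suc n)" using n d(1) by (intro mult_left_mono) auto
          finally have sd: "\<bar>s\<bar> / real (Suc n) < d" by (simp add: divide_less_eq del: of_nat_Suc)
          have "norm (s *\<^sub>R c) \<le> \<bar>s\<bar> * (1 / real (Suc n))" unfolding norm_scaleR using c by (intro mult_left_mono) auto
          also have "\<dots> < d" using sd by simp
          finally show "cmod (\<Phi> (s *\<^sub>R c)) \<le> b" using d(2) by (meson less_imp_le)
        qed (use b in simp)
        thus ?thesis using bm by simp
      qed
      thus "\<exists>no. \<forall>n\<ge>no. norm (S n - 0) < r" by blast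
    qed
    from tendsto_exp[OF this] show "(\<lambda>n. CLINT w|M. iexp (s * J (A n) (\<phi> n) w)) \<longlonglongrightarrow> 1"
      unfolding char_J[OF z(1,2)] S_def by simp
  qed
  hence "\<forall>\<^sub>F n in sequentially. ky_fan (J (A n) (\<phi> n)) < e" using e by (intro order_tendstoD(2)) auto
  then obtain n where "ky_fan (J (A n) (\<phi> n)) < e" by (auto simp: eventually_sequentially)
  thus False using z(5)[of n] by simp
qed

text \<open>Convergence of the integrals over every set forces them to be uniformly absolutely continuous
  by the Vitali-Hahn-Saks theorem. Outside a small set the integrands are uniformly small and live on
  a set of finite control measure.\<close>

lemma ky_fan_integral_of_null_sequence:
  assumes h: "\<And>k. vsimple (h k)" and ae: "AE x in \<mu>. (\<lambda>k. h k x) \<longlonglongrightarrow> 0"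
    and cauchy: "\<And>A e. A \<in> sets borel \<Longrightarrow> e > 0 \<Longrightarrow> \<exists>n. \<forall>k\<ge>n. \<forall>l\<ge>n. ky_fan (\<lambda>w. J A (h k) w - J A (h l) w) < e"
  shows "(\<lambda>k. ky_fan (J UNIV (h k))) \<longlonglongrightarrow> 0"
proof (rule LIMSEQ_I)
  fix e :: real assume e: "e > 0"
  have Jm[measurable]: "J A (h k) \<in> borel_measurable M" if "A \<in> sets borel" for A k using h that by (rule J_measurable)
  define d where "d k l A = ky_fan (\<lambda>w. J A (h k) w - J A (h l) w)" for k l A
  have d_le: "d k l B \<le> ky_fan (J B (h k)) + ky_fan (J B (h l))" if "B \<in> sets borel" for k l B
    unfolding d_def using that by (intro ky_fan_triangle) (auto intro!: borel_measurable_diff Jm)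
  have Un: "AE w in M. J (A \<union> B) (h k) w - J (A \<union> B) (h l) w = (J A (h k) w - J A (h l) w) + (J B (h k) w - J B (h l) w)"
    if "A \<in> sets borel" "B \<in> sets borel" "A \<inter> B = {}" for A B k l
    using J_Un[OF h[of k] that] J_Un[OF h[of l] that] by eventually_elim simp
  have "\<exists>n r. r > 0 \<and> (\<forall>k\<ge>n. \<forall>l\<ge>n. \<forall>B\<in>sets P. measure P B < r \<longrightarrow> d k l B \<le> e / 4)"
  proof (rule P.vitali_hahn_saks)
    fix k l and A B assume "A \<in> sets P" "B \<in> sets P" and disj: "A \<inter> B = {}"
    hence AB: "A \<in> sets borel" "B \<in> sets borel" by (simp_all add: sets_P)
    show "d k l (A \<union> B) \<le> d k l A + d k l B" unfolding d_def
    proof (rule ky_fan_triangle)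
      show "AE w in M. \<bar>J (A \<union> B) (h k) w - J (A \<union> B) (h l) w\<bar> \<le> \<bar>J A (h k) w - J A (h l) w\<bar> + \<bar>J B (h k) w - J B (h l) w\<bar>"
        using Un[OF AB disj, of k l] by eventually_elim simp
    qed (use AB in \<open>auto intro!: borel_measurable_diff Jm\<close>)
    show "d k l A \<le> d k l (A \<union> B) + d k l B" unfolding d_def
    proof (rule ky_fan_triangle)
      show "AE w in M. \<bar>J A (h k) w - J A (h l) w\<bar> \<le> \<bar>J (A \<union> B) (h k) w - J (A \<union> B) (h l) w\<bar> + \<bar>J B (h k) w - J B (h l) w\<bar>"
        using Un[OF AB disj, of k l] by eventually_elim simp
    qed (use AB in \<open>auto intro!: borel_measurable_diff Jm\<close>)
  next
    fix k l and e' :: real assume e': "e' > 0"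
    obtain r1 where r1: "r1 > 0" "\<And>B. B \<in> sets borel \<Longrightarrow> measure P B < r1 \<Longrightarrow> ky_fan (J B (h k)) < e' / 2"
      using ky_fan_J_absolutely_continuous[OF h, of "e' / 2" k] e' by auto
    obtain r2 where r2: "r2 > 0" "\<And>B. B \<in> sets borel \<Longrightarrow> measure P B < r2 \<Longrightarrow> ky_fan (J B (h l)) < e' / 2"
      using ky_fan_J_absolutely_continuous[OF h, of "e' / 2" l] e' by auto
    have "d k l B < e'" if "B \<in> sets borel" "measure P B < min r1 r2" for B
      using d_le[of B k l] r1(2)[of B] r2(2)[of B] that by simp
    thus "\<exists>r>0. \<forall>B\<in>sets P. measure P B < r \<longrightarrow> d k l B < e'"
      using r1(1) r2(1) by (intro exI[of _ "min r1 r2"]) (auto simp: sets_P)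
  next
    show "\<exists>n. \<forall>k\<ge>n. \<forall>l\<ge>n. d k l A < e'" if "A \<in> sets P" "e' > 0" for A e'
      unfolding d_def using cauchy that by (simp add: sets_P)
  qed (use e in simp)
  then obtain n r where r: "r > 0" "\<And>k l B. k \<ge> n \<Longrightarrow> l \<ge> n \<Longrightarrow> B \<in> sets borel \<Longrightarrow> measure P B < r \<Longrightarrow> d k l B \<le> e / 4"
    unfolding sets_P by blast
  obtain r' where r': "r' > 0" "\<And>B. B \<in> sets borel \<Longrightarrow> measure P B < r' \<Longrightarrow> ky_fan (J B (h n)) < e / 4"
    using ky_fan_J_absolutely_continuous[OF h, of "e / 4" n] e by auto
  define \<rho> where "\<rho> = min r r'"
  have \<rho>: "\<rho> > 0" using r r' by (simp add: \<rho>_def)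
  have small: "ky_fan (J B (h k)) \<le> e / 2" if "k \<ge> n" "B \<in> sets borel" "measure P B < \<rho>" for k B
  proof -
    have "ky_fan (J B (h k)) \<le> d k n B + ky_fan (J B (h n))"
      unfolding d_def using that(2) by (intro ky_fan_triangle) (auto intro!: borel_measurable_diff Jm)
    thus ?thesis using r(2)[of k n B] r'(2)[of B] that by (simp add: \<rho>_def)
  qed
  have "(\<lambda>j. measure P (- slab (real j))) \<longlonglongrightarrow> measure P (\<Inter>j. - slab (real j))"
  proof (rule P.finite_Lim_measure_decseq)
    show "range (\<lambda>j. - slab (real j)) \<subseteq> sets P" by (auto simp: sets_P intro!: borel_comp)
    show "decseq (\<lambda>j. - slab (real j))" by (auto simp: decseq_def slab_def)
  qed
  moreover have "(\<Inter>j. - slab (real j)) = {}"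
  proof -
    have "\<exists>j. norm (snd x) \<le> real j" for x :: "'s \<times> (real ^ 'm)" by (rule real_arch_simple)
    thus ?thesis by (auto simp: slab_def not_le)
  qed
  ultimately have "(\<lambda>j. measure P (- slab (real j))) \<longlonglongrightarrow> 0" by simp
  hence "\<forall>\<^sub>F j in sequentially. measure P (- slab (real j)) < \<rho> / 2" using \<rho> by (intro order_tendstoD(2)) auto
  then obtain j where j: "measure P (- slab (real j)) < \<rho> / 2" by (auto simp: eventually_sequentially)
  obtain \<delta> where \<delta>: "\<delta> > 0" "\<And>\<phi> A. vsimple \<phi> \<Longrightarrow> A \<in> sets borel \<Longrightarrow> A \<subseteq> slab (real j) \<Longrightarrow> (\<forall>x\<in>A. norm (\<phi> x) \<le> \<delta>) \<Longrightarrow> ky_fan (J A \<phi>) < e / 4"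
  proof -
    have "e / 4 > 0" using e by simp
    from ky_fan_J_small[OF this, of "real j"] that show ?thesis by blast
  qed
  define L where "L k = {x. norm (h k x) > \<delta>}" for k
  have Lm[measurable]: "L k \<in> sets borel" for k unfolding L_def by (rule simple_labelling_measurable[OF h])
  have LP: "L k \<in> sets P" for k by (simp add: sets_P)
  have "(\<lambda>k. LINT x|P. indicator (L k) x) \<longlonglongrightarrow> (LINT x|P. (0 :: real))"
  proof (rule integral_dominated_convergence[where w = "\<lambda>_. 1"])
    show "AE x in P. (\<lambda>k. indicator (L k) x) \<longlonglongrightarrow> (0 :: real)"
      using AE_P[OF ae]
    proof eventually_elim
      case (elim x)
      have "\<forall>\<^sub>F k in sequentially. norm (h k x) < \<delta>"
        using tendsto_norm[OF elim] \<delta>(1) by (intro order_tendstoD(2)) auto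
      hence "\<forall>\<^sub>F k in sequentially. indicator (L k) x = (0 :: real)"
        by eventually_elim (simp add: L_def)
      thus ?case by (rule tendsto_eventually)
    qed
    show "(\<lambda>x. indicator (L k) x :: real) \<in> borel_measurable P" for k using LP by (rule borel_measurable_indicator)
    show "AE x in P. norm (indicator (L k) x :: real) \<le> 1" for k by (rule AE_I2) (simp add: indicator_def)
  qed simp_all
  hence "(\<lambda>k. measure P (L k)) \<longlonglongrightarrow> 0"
    by (simp add: Int_absorb2[OF sets.sets_into_space[OF LP]] Bochner_Integration.integral_indicator)
  hence "\<forall>\<^sub>F k in sequentially. measure P (L k) < \<rho> / 2" using \<rho> by (intro order_tendstoD(2)) auto
  then obtain n1 where n1: "\<And>k. k \<ge> n1 \<Longrightarrow> measure P (L k) < \<rho> / 2" by (auto simp: eventually_sequentially)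
  have "norm (ky_fan (J UNIV (h k)) - 0) < e" if k: "k \<ge> max n n1" for k
  proof -
    define B where "B = - slab (real j) \<union> L k"
    have Bm: "B \<in> sets borel" "- B \<in> sets borel" unfolding B_def by (auto intro!: borel_comp)
    have "measure P B \<le> measure P (- slab (real j)) + measure P (L k)"
      unfolding B_def by (rule measure_Un_le) (auto simp: sets_P intro!: borel_comp)
    hence "measure P B < \<rho>" using j n1[of k] k by simp
    hence 1: "ky_fan (J B (h k)) \<le> e / 2" using k Bm by (intro small) auto
    have 2: "ky_fan (J (- B) (h k)) < e / 4"
      by (rule \<delta>(2)[OF h Bm(2)]) (auto simp: B_def L_def)
    have "AE w in M. J UNIV (h k) w = J B (h k) w + J (- B) (h k) w"
      using J_Un[OF h Bm, of k] by simp
    hence "ky_fan (J UNIV (h k)) \<le> ky_fan (J B (h k)) + ky_fan (J (- B) (h k))"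
      using Bm by (intro ky_fan_triangle Jm) auto
    thus ?thesis using 1 2 e ky_fan_nonneg[of "J UNIV (h k)"] by simp
  qed
  thus "\<exists>no. \<forall>k\<ge>no. norm (ky_fan (J UNIV (h k)) - 0) < e" by blast
qed

end


section \<open>Stationarity of moving averages\<close>

definition translate :: "real ^ 'm \<Rightarrow> 's \<times> (real ^ 'm::finite) \<Rightarrow> 's \<times> (real ^ 'm)" where
  "translate a x = (fst x, snd x - a)"

lemma translate_translate: "translate a (translate b x) = translate (a + b) x"
  by (simp add: translate_def algebra_simps)

lemma translate_0 [simp]: "translate 0 x = x" by (simp add: translate_def)

lemma translate_minus [simp]: "translate a (translate (- a) x) = x" "translate (- a) (translate a x) = x"
  by (simp_all add: translate_translate)

lemma translate_borel: "translate a \<in> borel_measurable (borel :: ('s::polish_space \<times> (real ^ 'm::finite)) measure)"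
  unfolding translate_def by (intro borel_measurable_continuous_onI continuous_intros)

lemma translate_vimage_borel:
  "A \<in> sets borel \<Longrightarrow> translate a -` A \<in> sets (borel :: ('s::polish_space \<times> (real ^ 'm::finite)) measure)"
  using measurable_sets_borel[OF translate_borel] .

lemma translate_vimage_bounded:
  assumes "B \<in> bounded_borel"
  shows "translate a -` B \<in> bounded_borel"
proof -
  obtain x r where r: "B \<subseteq> cball x r"
    using assms unfolding bounded_borel_def bounded_subset_cball by blast
  have "translate a -` B \<subseteq> cball x (r + norm a)"
  proof
    fix y assume "y \<in> translate a -` B"
    hence "dist x (translate a y) \<le> r" using r by auto
    moreover have "dist (translate a y) y = norm a"
      by (cases y) (simp add: translate_def dist_Pair_Pair dist_norm)
    ultimately show "y \<in> cball x (r + norm a)"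
      using dist_triangle[of x y "translate a y"] by simp
  qed
  thus ?thesis using assms translate_vimage_borel[of B a] unfolding bounded_borel_def
    by (auto intro: bounded_subset[OF bounded_cball])
qed

lemma simple_labelling_translate:
  assumes "simple_labelling q i0"
  shows "simple_labelling (\<lambda>x. q (translate a x)) i0"
  unfolding simple_labelling_def
proof (intro conjI allI impI)
  have "range (\<lambda>x. q (translate a x)) \<subseteq> range q" by auto
  thus "finite (range (\<lambda>x. q (translate a x)))" using simple_labelling_finite[OF assms] by (rule finite_subset)
  fix i assume "i \<noteq> i0"
  moreover have "(\<lambda>x. q (translate a x)) -` {i} = translate a -` (q -` {i})" by auto
  ultimately show "(\<lambda>x. q (translate a x)) -` {i} \<in> bounded_borel"
    using simple_labelling_bounded[OF assms] by (simp add: translate_vimage_bounded)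
qed

lemma of_int_vec_add: "of_int_vec (u + v) = of_int_vec u + of_int_vec v"
  by (simp add: of_int_vec_def vec_eq_iff)

lemma matrix_vector_measurable:
  fixes c :: "real ^ 'd::finite ^ 'n::finite"
  assumes "Y \<in> borel_measurable M"
  shows "(\<lambda>w. c *v Y w) \<in> borel_measurable M"
proof (rule measurable_compose[OF assms])
  show "(\<lambda>y. c *v y) \<in> borel_measurable borel"
    by (intro borel_measurable_continuous_onI linear_continuous_on matrix_vector_mul_bounded_linear)
qed

context levy_basis_space
begin

lemma distr_translate: "distr \<mu> borel (translate a) = \<mu>"
proof (rule measure_eqI)
  show "sets (distr \<mu> borel (translate a)) = sets \<mu>" unfolding sets_\<mu> by simp
  fix A assume "A \<in> sets (distr \<mu> borel (translate a))"
  hence A: "A \<in> sets borel" by simp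
  have tm: "translate a \<in> measurable \<mu> borel"
    unfolding measurable_cong_sets[OF sets_\<mu> refl] by (rule translate_borel)
  have "emeasure (distr \<mu> borel (translate a)) A = emeasure \<mu> (translate a -` A)"
    using emeasure_distr[OF tm A] by (simp add: space_\<mu>)
  also have "\<dots> = (\<integral>\<^sup>+z. emeasure lborel (Pair z -` (translate a -` A)) \<partial>\<pi>)"
    by (rule lborel.emeasure_pair_measure_alt[OF in_sets_\<mu>[OF translate_vimage_borel[OF A]]])
  also have "\<dots> = (\<integral>\<^sup>+z. emeasure lborel (Pair z -` A) \<partial>\<pi>)"
  proof (rule nn_integral_cong)
    fix z
    have Az: "Pair z -` A \<in> sets lborel" using sets_Pair1[OF in_sets_\<mu>[OF A]] .
    have "emeasure lborel (Pair z -` A) = emeasure (distr lborel borel ((+) (- a))) (Pair z -` A)"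
      by (simp only: lborel_distr_plus)
    also have "\<dots> = emeasure lborel ((+) (- a) -` (Pair z -` A))"
      using Az by (subst emeasure_distr) auto
    also have "(+) (- a) -` (Pair z -` A) = Pair z -` (translate a -` A)"
      by (auto simp: translate_def)
    finally show "emeasure lborel (Pair z -` (translate a -` A)) = emeasure lborel (Pair z -` A)" by simp
  qed
  also have "\<dots> = emeasure \<mu> A" by (rule lborel.emeasure_pair_measure_alt[OF in_sets_\<mu>[OF A], symmetric])
  finally show "emeasure (distr \<mu> borel (translate a)) A = emeasure \<mu> A" .
qed

lemma measure_translate: "A \<in> sets borel \<Longrightarrow> measure \<mu> (translate a -` A) = measure \<mu> A"
proof -
  assume A: "A \<in> sets borel"
  have tm: "translate a \<in> measurable \<mu> borel"
    unfolding measurable_cong_sets[OF sets_\<mu> refl] by (rule translate_borel)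
  have "measure \<mu> A = measure (distr \<mu> borel (translate a)) A" by (simp only: distr_translate)
  also have "\<dots> = measure \<mu> (translate a -` A)" using measure_distr[OF tm A] by (simp add: space_\<mu>)
  finally show ?thesis by simp
qed

lemma AE_translate:
  assumes "AE x in \<mu>. Q x"
  shows "AE x in \<mu>. Q (translate a x)"
proof -
  have tm: "translate a \<in> measurable \<mu> borel"
    unfolding measurable_cong_sets[OF sets_\<mu> refl] by (rule translate_borel)
  have "AE x in distr \<mu> borel (translate a). Q x" using assms by (simp only: distr_translate)
  thus ?thesis by (rule AE_distrD[OF tm])
qed

text \<open>The law of the integral of a simple function is determined by the measures of the level sets, and
  the control measure is invariant under translations of the space variable.\<close>

lemma char_J_translate:
  assumes p: "vsimple \<phi>" and A: "A \<in> sets borel"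
  shows "(CLINT w|M. iexp (s * J (translate a -` A) (\<lambda>x. \<phi> (translate a x)) w)) = (CLINT w|M. iexp (s * J A \<phi> w))"
proof -
  have "range (\<lambda>x. \<phi> (translate a x)) = range \<phi>"
  proof
    show "range \<phi> \<subseteq> range (\<lambda>x. \<phi> (translate a x))"
    proof
      fix y assume "y \<in> range \<phi>"
      then obtain x where "y = \<phi> x" by blast
      hence "y = \<phi> (translate a (translate (- a) x))" by simp
      thus "y \<in> range (\<lambda>x. \<phi> (translate a x))" by blast
    qed
  qed auto
  moreover have "measure \<mu> (translate a -` A \<inter> (\<lambda>x. \<phi> (translate a x)) -` {c}) = measure \<mu> (A \<inter> \<phi> -` {c})" for c
  proof -
    have "translate a -` A \<inter> (\<lambda>x. \<phi> (translate a x)) -` {c} = translate a -` (A \<inter> \<phi> -` {c})" by auto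
    moreover have "A \<inter> \<phi> -` {c} \<in> sets borel" using A simple_labelling_vimage[OF p, of c] by simp
    ultimately show ?thesis by (simp only: measure_translate)
  qed
  ultimately show ?thesis
    unfolding char_J[OF p A] char_J[OF simple_labelling_translate[OF p] translate_vimage_borel[OF A]] by simp
qed

lemma ky_fan_J_translate:
  assumes p: "vsimple \<phi>" and A: "A \<in> sets borel"
  shows "ky_fan (J (translate a -` A) (\<lambda>x. \<phi> (translate a x))) = ky_fan (J A \<phi>)"
  using J_measurable[OF p A] J_measurable[OF simple_labelling_translate[OF p] translate_vimage_borel[OF A]]
  by (intro ky_fan_eq_of_law same_law_of_char char_J_translate[OF p A]) auto

lemma basis_simple_labelling: "basis_simple g \<Longrightarrow> simple_labelling g 0"
  unfolding basis_simple_def simple_labelling_def by auto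

lemma simple_basis_integral_measurable:
  fixes g :: "'s \<times> (real ^ 'm) \<Rightarrow> real ^ 'd ^ 'n::finite"
  assumes g: "basis_simple g" and A: "A \<in> sets borel"
  shows "simple_basis_integral \<Lambda> A g \<in> borel_measurable M"
proof -
  have "(\<lambda>w. c *v \<Lambda> (A \<inter> g -` {c}) w) \<in> borel_measurable M" if "c \<in> range g - {0}" for c
    using \<Lambda>_measurable[OF fibre_bounded[OF basis_simple_labelling[OF g] _ A, of c]] that
    by (intro matrix_vector_measurable) auto
  thus ?thesis unfolding simple_basis_integral_def[abs_def] by (rule borel_measurable_sum)
qed

lemma inner_simple_basis_integral:
  fixes g :: "'s \<times> (real ^ 'm) \<Rightarrow> real ^ 'd ^ 'n::finite"
  assumes g: "basis_simple g" and A: "A \<in> sets borel"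
  shows "vsimple (\<lambda>x. transpose (g x) *v b)"
    "AE w in M. b \<bullet> simple_basis_integral \<Lambda> A g w = J A (\<lambda>x. transpose (g x) *v b) w"
proof -
  note l = basis_simple_labelling[OF g]
  have t0: "transpose (0 :: real ^ 'd ^ 'n) *v b = 0"
    by (simp add: vec_eq_iff matrix_vector_mult_def transpose_def)
  show "vsimple (\<lambda>x. transpose (g x) *v b)"
    by (rule simple_labelling_image[OF l, of "\<lambda>c. transpose c *v b", OF t0])
  have e: "b \<bullet> (c *v y) = (transpose c *v b) \<bullet> y" for c :: "real ^ 'd ^ 'n" and y
    by (simp add: dot_lmul_matrix[symmetric])
  show "AE w in M. b \<bullet> simple_basis_integral \<Lambda> A g w = J A (\<lambda>x. transpose (g x) *v b) w"
    using J_regroup[OF l, of "\<lambda>c. transpose c *v b", OF t0 A]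
    by eventually_elim (simp add: simple_basis_integral_def inner_sum_right e)
qed

lemma cauchy_scalar_integrals:
  fixes g :: "nat \<Rightarrow> 's \<times> (real ^ 'm) \<Rightarrow> real ^ 'd ^ 'n::finite"
  assumes g: "\<And>k. basis_simple (g k)" and A: "A \<in> sets borel" and e: "e > 0"
    and Z: "Z \<in> borel_measurable M" "tendsto_in_prob M (\<lambda>k. simple_basis_integral \<Lambda> A (g k)) Z"
  shows "\<exists>n. \<forall>k\<ge>n. \<forall>l\<ge>n. ky_fan (\<lambda>w. J A (\<lambda>x. transpose (g k x) *v b) w - J A (\<lambda>x. transpose (g l x) *v b) w) < e"
proof -
  let ?I = "\<lambda>k w. b \<bullet> simple_basis_integral \<Lambda> A (g k) w"
  have Im: "simple_basis_integral \<Lambda> A (g k) \<in> borel_measurable M" for k by (rule simple_basis_integral_measurable[OF g A])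
  have Jm: "J A (\<lambda>x. transpose (g k x) *v b) \<in> borel_measurable M" for k
    by (rule J_measurable[OF inner_simple_basis_integral(1)[OF g A] A])
  have "(\<lambda>k. ky_fan (\<lambda>w. ?I k w - b \<bullet> Z w)) \<longlonglongrightarrow> 0"
    by (rule ky_fan_tendsto_of_prob[OF Im Z])
  hence "\<forall>\<^sub>F k in sequentially. ky_fan (\<lambda>w. ?I k w - b \<bullet> Z w) < e / 2" using e by (intro order_tendstoD(2)) auto
  then obtain n where n: "\<And>k. k \<ge> n \<Longrightarrow> ky_fan (\<lambda>w. ?I k w - b \<bullet> Z w) < e / 2"
    by (auto simp: eventually_sequentially)
  have "ky_fan (\<lambda>w. J A (\<lambda>x. transpose (g k x) *v b) w - J A (\<lambda>x. transpose (g l x) *v b) w) < e" if "k \<ge> n" "l \<ge> n" for k l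
  proof -
    have "ky_fan (\<lambda>w. J A (\<lambda>x. transpose (g k x) *v b) w - J A (\<lambda>x. transpose (g l x) *v b) w)
        \<le> ky_fan (\<lambda>w. ?I k w - b \<bullet> Z w) + ky_fan (\<lambda>w. ?I l w - b \<bullet> Z w)"
    proof (rule ky_fan_triangle)
      show "AE w in M. \<bar>J A (\<lambda>x. transpose (g k x) *v b) w - J A (\<lambda>x. transpose (g l x) *v b) w\<bar>
          \<le> \<bar>?I k w - b \<bullet> Z w\<bar> + \<bar>?I l w - b \<bullet> Z w\<bar>"
        using inner_simple_basis_integral(2)[OF g[of k] A, of b] inner_simple_basis_integral(2)[OF g[of l] A, of b]
        by eventually_elim linarith
    qed (use Im Jm Z(1) in \<open>auto intro!: borel_measurable_diff borel_measurable_inner\<close>)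
    thus ?thesis using n[OF that(1)] n[OF that(2)] by linarith
  qed
  thus ?thesis by blast
qed

text \<open>The translates of simple functions that approximate \<open>F\<close> approximate the translate of \<open>F\<close>, and
  by translation invariance their integrals behave alike. The difference to any other
  approximating sequence of the translate tends to zero almost everywhere.\<close>

lemma integral_of_translated_approximation:
  fixes g g' :: "nat \<Rightarrow> 's \<times> (real ^ 'm) \<Rightarrow> real ^ 'd ^ 'n::finite"
  assumes g: "\<And>k. basis_simple (g k)" "AE x in \<mu>. (\<lambda>k. g k x) \<longlonglongrightarrow> F x"
      "\<forall>A\<in>sets borel. \<exists>Z\<in>borel_measurable M. tendsto_in_prob M (\<lambda>k. simple_basis_integral \<Lambda> A (g k)) Z"
    and g': "\<And>k. basis_simple (g' k)" "AE x in \<mu>. (\<lambda>k. g' k x) \<longlonglongrightarrow> F (translate a x)"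
      "\<forall>A\<in>sets borel. \<exists>Z\<in>borel_measurable M. tendsto_in_prob M (\<lambda>k. simple_basis_integral \<Lambda> A (g' k)) Z"
    and Y: "Y \<in> borel_measurable M" "tendsto_in_prob M (\<lambda>k. simple_basis_integral \<Lambda> UNIV (g' k)) Y"
  shows "(\<lambda>k. ky_fan (\<lambda>w. J UNIV (\<lambda>x. transpose (g k (translate a x)) *v b) w - b \<bullet> Y w)) \<longlonglongrightarrow> 0"
proof -
  define \<phi> where "\<phi> k x = transpose (g k x) *v b" for k x
  define \<psi> where "\<psi> k x = \<phi> k (translate a x)" for k x
  define \<chi>' where "\<chi>' k x = transpose (g' k x) *v b" for k x
  have p: "vsimple (\<phi> k)" for k unfolding \<phi>_def[abs_def] by (rule inner_simple_basis_integral(1)[OF g(1) sets.top[of borel, unfolded space_borel]])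
  have q: "vsimple (\<psi> k)" for k unfolding \<psi>_def[abs_def] by (rule simple_labelling_translate[OF p])
  have c: "vsimple (\<chi>' k)" for k unfolding \<chi>'_def[abs_def] by (rule inner_simple_basis_integral(1)[OF g'(1) sets.top[of borel, unfolded space_borel]])
  define h where "h k x = \<chi>' k x - \<psi> k x" for k x
  have h: "vsimple (h k)" for k unfolding h_def[abs_def] by (rule J_diff(1)[OF c q sets.top[of borel, unfolded space_borel]])
  have Jh: "AE w in M. J A (h k) w = J A (\<chi>' k) w - J A (\<psi> k) w" if "A \<in> sets borel" for A k
    unfolding h_def[abs_def] by (rule J_diff(2)[OF c q that])
  note Jm = J_measurable[OF p] J_measurable[OF q] J_measurable[OF c] J_measurable[OF h]
  have lin: "(\<lambda>k. transpose (m k) *v b) \<longlonglongrightarrow> transpose l *v b" if "m \<longlonglongrightarrow> l" for m :: "nat \<Rightarrow> real ^ 'd ^ 'n" and l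
  proof (rule vec_tendstoI)
    fix i
    have "(\<lambda>k. m k $ j $ i) \<longlonglongrightarrow> l $ j $ i" for j using tendsto_vec_nth[OF tendsto_vec_nth[OF that]] .
    thus "(\<lambda>k. (transpose (m k) *v b) $ i) \<longlonglongrightarrow> (transpose l *v b) $ i"
      by (simp add: matrix_vector_mult_def transpose_def tendsto_intros)
  qed
  have ae: "AE x in \<mu>. (\<lambda>k. h k x) \<longlonglongrightarrow> 0"
    using g'(2) AE_translate[OF g(2), of a]
  proof eventually_elim
    case (elim x)
    from tendsto_diff[OF lin[OF elim(1)] lin[OF elim(2)]] show ?case by (simp add: h_def \<chi>'_def \<psi>_def \<phi>_def)
  qed
  have cauchy: "\<exists>n. \<forall>k\<ge>n. \<forall>l\<ge>n. ky_fan (\<lambda>w. J A (h k) w - J A (h l) w) < e" if A: "A \<in> sets borel" and e: "e > 0" for A e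
  proof -
    define A' where "A' = translate (- a) -` A"
    have A': "A' \<in> sets borel" "translate a -` A' = A"
      unfolding A'_def using translate_vimage_borel[OF A] by (auto simp: vimage_def)
    obtain Z where "Z \<in> borel_measurable M" "tendsto_in_prob M (\<lambda>k. simple_basis_integral \<Lambda> A (g' k)) Z"
      using g'(3) A by blast
    from cauchy_scalar_integrals[OF g'(1) A _ this, of "e / 2" b] e
    obtain n1 where n1: "\<And>k l. k \<ge> n1 \<Longrightarrow> l \<ge> n1 \<Longrightarrow> ky_fan (\<lambda>w. J A (\<chi>' k) w - J A (\<chi>' l) w) < e / 2"
      unfolding \<chi>'_def[abs_def] by auto
    obtain Z where "Z \<in> borel_measurable M" "tendsto_in_prob M (\<lambda>k. simple_basis_integral \<Lambda> A' (g k)) Z"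
      using g(3) A' by blast
    from cauchy_scalar_integrals[OF g(1) A'(1) _ this, of "e / 2" b] e
    obtain n2 where n2: "\<And>k l. k \<ge> n2 \<Longrightarrow> l \<ge> n2 \<Longrightarrow> ky_fan (\<lambda>w. J A' (\<phi> k) w - J A' (\<phi> l) w) < e / 2"
      unfolding \<phi>_def[abs_def] by auto
    have tr: "ky_fan (\<lambda>w. J A (\<psi> k) w - J A (\<psi> l) w) = ky_fan (\<lambda>w. J A' (\<phi> k) w - J A' (\<phi> l) w)" for k l
    proof -
      have v: "vsimple (\<lambda>x. \<phi> k x - \<phi> l x)" by (rule J_diff(1)[OF p p A])
      have "ky_fan (\<lambda>w. J A (\<psi> k) w - J A (\<psi> l) w) = ky_fan (J A (\<lambda>x. \<psi> k x - \<psi> l x))"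
        using J_diff(2)[OF q[of k] q[of l] A] J_measurable[OF J_diff(1)[OF q[of k] q[of l] A] A] Jm(2)[OF A]
        by (intro ky_fan_cong_AE) auto
      also have "\<dots> = ky_fan (J A' (\<lambda>x. \<phi> k x - \<phi> l x))"
        using ky_fan_J_translate[OF v A'(1), of a] by (simp add: A'(2) \<psi>_def)
      also have "\<dots> = ky_fan (\<lambda>w. J A' (\<phi> k) w - J A' (\<phi> l) w)"
        using J_diff(2)[OF p[of k] p[of l] A'(1)] J_measurable[OF v A'(1)] Jm(1)[OF A'(1)]
        by (intro ky_fan_cong_AE) auto
      finally show ?thesis .
    qed
    have "ky_fan (\<lambda>w. J A (h k) w - J A (h l) w) < e" if "k \<ge> max n1 n2" "l \<ge> max n1 n2" for k l
    proof -
      have "ky_fan (\<lambda>w. J A (h k) w - J A (h l) w)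
         \<le> ky_fan (\<lambda>w. J A (\<chi>' k) w - J A (\<chi>' l) w) + ky_fan (\<lambda>w. J A (\<psi> k) w - J A (\<psi> l) w)"
      proof (rule ky_fan_triangle)
        show "AE w in M. \<bar>J A (h k) w - J A (h l) w\<bar> \<le> \<bar>J A (\<chi>' k) w - J A (\<chi>' l) w\<bar> + \<bar>J A (\<psi> k) w - J A (\<psi> l) w\<bar>"
          using Jh[OF A, of k] Jh[OF A, of l] by eventually_elim linarith
      qed (use Jm A in auto)
      thus ?thesis using n1[of k l] n2[of k l] that unfolding tr by simp
    qed
    thus ?thesis by blast
  qed
  have U: "(UNIV :: ('s \<times> (real ^ 'm)) set) \<in> sets borel" by simp
  have 1: "(\<lambda>k. ky_fan (J UNIV (h k))) \<longlonglongrightarrow> 0" by (rule ky_fan_integral_of_null_sequence[OF h ae cauchy])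
  have Im: "simple_basis_integral \<Lambda> UNIV (g' k) \<in> borel_measurable M" for k
    by (rule simple_basis_integral_measurable[OF g'(1) U])
  have 2: "(\<lambda>k. ky_fan (\<lambda>w. b \<bullet> simple_basis_integral \<Lambda> UNIV (g' k) w - b \<bullet> Y w)) \<longlonglongrightarrow> 0"
    by (rule ky_fan_tendsto_of_prob[OF Im Y])
  have le: "ky_fan (\<lambda>w. J UNIV (\<psi> k) w - b \<bullet> Y w)
     \<le> ky_fan (J UNIV (h k)) + ky_fan (\<lambda>w. b \<bullet> simple_basis_integral \<Lambda> UNIV (g' k) w - b \<bullet> Y w)" for k
  proof (rule ky_fan_triangle)
    show "AE w in M. \<bar>J UNIV (\<psi> k) w - b \<bullet> Y w\<bar> \<le> \<bar>J UNIV (h k) w\<bar> + \<bar>b \<bullet> simple_basis_integral \<Lambda> UNIV (g' k) w - b \<bullet> Y w\<bar>"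
    proof -
      have "AE w in M. b \<bullet> simple_basis_integral \<Lambda> UNIV (g' k) w = J UNIV (\<chi>' k) w"
        unfolding \<chi>'_def[abs_def] by (rule inner_simple_basis_integral(2)[OF g'(1) U])
      thus ?thesis using Jh[OF U, of k] by eventually_elim linarith
    qed
  qed (use Jm[OF U] Im Y(1) in \<open>auto intro!: borel_measurable_diff borel_measurable_inner\<close>)
  have "(\<lambda>k. ky_fan (\<lambda>w. J UNIV (\<psi> k) w - b \<bullet> Y w)) \<longlonglongrightarrow> 0"
  proof (rule tendsto_sandwich[OF _ _ tendsto_const])
    show "(\<lambda>k. ky_fan (J UNIV (h k)) + ky_fan (\<lambda>w. b \<bullet> simple_basis_integral \<Lambda> UNIV (g' k) w - b \<bullet> Y w)) \<longlonglongrightarrow> 0"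
      using tendsto_add[OF 1 2] by simp
  qed (use le ky_fan_nonneg in auto)
  thus ?thesis by (simp add: \<psi>_def[abs_def] \<phi>_def)
qed

text \<open>The values of the field at all sites are approximated by translates of one sequence of simple
  functions, namely one that approximates the kernel at the origin. For these the shift by \<open>h\<close> does not
  change the laws of linear combinations, and the characteristic functions converge.\<close>

theorem mma_field_stationary:
  fixes f :: "'s \<times> (real ^ 'm) \<Rightarrow> real ^ 'd ^ 'n::finite" and X :: "int ^ 'm \<Rightarrow> 'w \<Rightarrow> real ^ 'n"
  assumes X: "mma_field M \<Lambda> \<pi> f X"
  shows "X u \<in> borel_measurable M"
    "distr M borel (\<lambda>w. a \<bullet> X u w + b \<bullet> X v w) = distr M borel (\<lambda>w. a \<bullet> X (u + h) w + b \<bullet> X (v + h) w)"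
proof -
  have X': "has_basis_integral M \<Lambda> \<pi> (\<lambda>(z, s). f (z, of_int_vec u - s)) (X u)" for u
    using X by (simp add: mma_field_def)
  show Xm: "X u \<in> borel_measurable M" for u using X'[of u] by (simp add: has_basis_integral_def)
  define F where "F = (\<lambda>x :: 's \<times> (real ^ 'm). f (fst x, - snd x))"
  have Fu: "(\<lambda>(z, s). f (z, of_int_vec u - s)) = (\<lambda>x. F (translate (of_int_vec u) x))" for u
    by (auto simp: F_def translate_def)
  have "\<forall>u. \<exists>g. (\<forall>k. basis_simple (g k)) \<and> (AE x in \<mu>. (\<lambda>k. g k x) \<longlonglongrightarrow> F (translate (of_int_vec u) x)) \<and>
      (\<forall>A\<in>sets borel. \<exists>Z\<in>borel_measurable M. tendsto_in_prob M (\<lambda>k. simple_basis_integral \<Lambda> A (g k)) Z) \<and>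
      tendsto_in_prob M (\<lambda>k. simple_basis_integral \<Lambda> UNIV (g k)) (X u)"
    using X' unfolding has_basis_integral_def Fu by blast
  from choice[OF this] obtain G where G: "\<And>u k. basis_simple (G u k)"
    "\<And>u. AE x in \<mu>. (\<lambda>k. G u k x) \<longlonglongrightarrow> F (translate (of_int_vec u) x)"
    "\<And>u. \<forall>A\<in>sets borel. \<exists>Z\<in>borel_measurable M. tendsto_in_prob M (\<lambda>k. simple_basis_integral \<Lambda> A (G u k)) Z"
    "\<And>u. tendsto_in_prob M (\<lambda>k. simple_basis_integral \<Lambda> UNIV (G u k)) (X u)"
    by blast
  have z0: "of_int_vec (0 :: int ^ 'm) = 0" by (simp add: of_int_vec_def vec_eq_iff)
  have G0: "AE x in \<mu>. (\<lambda>k. G 0 k x) \<longlonglongrightarrow> F x" using G(2)[of 0] by (simp add: z0)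
  have lim: "(\<lambda>k. ky_fan (\<lambda>w. J UNIV (\<lambda>x. transpose (G 0 k (translate (of_int_vec u) x)) *v b) w - b \<bullet> X u w)) \<longlonglongrightarrow> 0" for u b
    by (rule integral_of_translated_approximation[OF G(1) G0 G(3) G(1,2,3) Xm G(4)])
  have U: "(UNIV :: ('s \<times> (real ^ 'm)) set) \<in> sets borel" by simp
  define \<psi> where "\<psi> b u k x = transpose (G 0 k (translate (of_int_vec u) x)) *v b" for b and u :: "int ^ 'm" and k x
  have ps: "vsimple (\<psi> b u k)" for b u k
    unfolding \<psi>_def[abs_def]
    using simple_labelling_translate[OF inner_simple_basis_integral(1)[OF G(1)[of 0 k] U, where b = b], of "of_int_vec u"] by simp
  define \<sigma> where "\<sigma> u v k x = \<psi> a u k x + \<psi> b v k x" for u v k x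
  have ss: "vsimple (\<sigma> u v k)" for u v k unfolding \<sigma>_def[abs_def] by (rule J_add(1)[OF ps ps U])
  have lims: "(\<lambda>k. CLINT w|M. iexp (s * J UNIV (\<sigma> u v k) w)) \<longlonglongrightarrow> (CLINT w|M. iexp (s * (a \<bullet> X u w + b \<bullet> X v w)))" for s u v
  proof (rule char_tendsto_of_ky_fan)
    show "J UNIV (\<sigma> u v k) \<in> borel_measurable M" for k by (rule J_measurable[OF ss U])
    show m: "(\<lambda>w. a \<bullet> X u w + b \<bullet> X v w) \<in> borel_measurable M" using Xm by simp
    have le: "ky_fan (\<lambda>w. J UNIV (\<sigma> u v k) w - (a \<bullet> X u w + b \<bullet> X v w))
       \<le> ky_fan (\<lambda>w. J UNIV (\<psi> a u k) w - a \<bullet> X u w) + ky_fan (\<lambda>w. J UNIV (\<psi> b v k) w - b \<bullet> X v w)" for k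
    proof (rule ky_fan_triangle)
      show "AE w in M. \<bar>J UNIV (\<sigma> u v k) w - (a \<bullet> X u w + b \<bullet> X v w)\<bar>
         \<le> \<bar>J UNIV (\<psi> a u k) w - a \<bullet> X u w\<bar> + \<bar>J UNIV (\<psi> b v k) w - b \<bullet> X v w\<bar>"
      proof -
        have "AE w in M. J UNIV (\<sigma> u v k) w = J UNIV (\<psi> a u k) w + J UNIV (\<psi> b v k) w"
          unfolding \<sigma>_def[abs_def] by (rule J_add(2)[OF ps ps U])
        thus ?thesis by eventually_elim linarith
      qed
    qed (use J_measurable[OF ss U] J_measurable[OF ps U] Xm in auto)
    show "(\<lambda>k. ky_fan (\<lambda>w. J UNIV (\<sigma> u v k) w - (a \<bullet> X u w + b \<bullet> X v w))) \<longlonglongrightarrow> 0"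
    proof (rule tendsto_sandwich[OF _ _ tendsto_const])
      show "(\<lambda>k. ky_fan (\<lambda>w. J UNIV (\<psi> a u k) w - a \<bullet> X u w) + ky_fan (\<lambda>w. J UNIV (\<psi> b v k) w - b \<bullet> X v w)) \<longlonglongrightarrow> 0"
        using tendsto_add[OF lim[of u a] lim[of v b]] by (simp add: \<psi>_def[abs_def])
    qed (use le ky_fan_nonneg in auto)
  qed
  have "\<sigma> (u + h) (v + h) k = (\<lambda>x. \<sigma> u v k (translate (of_int_vec h) x))" for k
    by (simp add: \<sigma>_def \<psi>_def translate_translate of_int_vec_add fun_eq_iff)
  hence "(CLINT w|M. iexp (s * J UNIV (\<sigma> (u + h) (v + h) k) w)) = (CLINT w|M. iexp (s * J UNIV (\<sigma> u v k) w))" for s k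
    using char_J_translate[OF ss U, of s "of_int_vec h" u v k] by simp
  hence "(CLINT w|M. iexp (s * (a \<bullet> X u w + b \<bullet> X v w))) = (CLINT w|M. iexp (s * (a \<bullet> X (u + h) w + b \<bullet> X (v + h) w)))" for s
    using lims[of s "u + h" "v + h"] lims[of s u v] by (simp add: LIMSEQ_unique)
  thus "distr M borel (\<lambda>w. a \<bullet> X u w + b \<bullet> X v w) = distr M borel (\<lambda>w. a \<bullet> X (u + h) w + b \<bullet> X (v + h) w)"
    using Xm by (intro same_law_of_char) auto
qed

end


section \<open>The central limit theorem for stationary vector fields\<close>

lemma has_sum_matrixI:
  fixes f :: "'i \<Rightarrow> real ^ 'k::finite ^ 'l::finite"
  assumes "\<And>i j. ((\<lambda>u. f u $ i $ j) has_sum S $ i $ j) A"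
  shows "(f has_sum S) A"
  unfolding has_sum_def
proof (intro vec_tendstoI)
  fix i j
  have "(\<lambda>F. sum f F $ i $ j) = (\<lambda>F. \<Sum>u\<in>F. f u $ i $ j)" by (simp add: fun_eq_iff)
  thus "((\<lambda>F. sum f F $ i $ j) \<longlongrightarrow> S $ i $ j) (finite_subsets_at_top A)"
    using assms[of i j] by (simp add: has_sum_def)
qed

text \<open>Stationarity takes the form of invariance of the laws of two-point linear combinations, which
  determine means, covariances and the moments of linear functionals.\<close>

locale stationary_field = prob_space M for M :: "'a measure" +
  fixes X :: "int ^ 'm::finite \<Rightarrow> 'a \<Rightarrow> real ^ 'n::finite" and K \<beta> \<delta> :: real
  assumes X_measurable [measurable]: "\<And>u. X u \<in> borel_measurable M"
    and stationary: "\<And>a b u v h. distr M borel (\<lambda>w. a \<bullet> X u w + b \<bullet> X v w) = distr M borel (\<lambda>w. a \<bullet> X (u + h) w + b \<bullet> X (v + h) w)"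
    and X_mean: "(LINT w|M. X 0 w) = 0"
    and \<delta>_pos: "\<delta> > 0"
    and X_moment: "integrable M (\<lambda>w. norm (X 0 w) powr (2 + \<delta>))"
    and eta: "\<forall>\<^sub>F h in sequentially. eta_coeff M X h \<le> ennreal (K * real h powr (- \<beta>))"
    and \<beta>_gt: "\<beta> > real CARD('m) * max 2 (1 + 1 / \<delta>)"
begin

lemma law_eq: "distr M borel (\<lambda>w. a \<bullet> X u w) = distr M borel (\<lambda>w. a \<bullet> X 0 w)"
  using stationary[of a u 0 0 "- u"] by simp

lemma transfer_integral:
  fixes f :: "real \<Rightarrow> real"
  assumes [measurable]: "f \<in> borel_measurable borel" "Y \<in> borel_measurable M" "Z \<in> borel_measurable M"
    and eq: "distr M borel Y = distr M borel Z"
  shows "integrable M (\<lambda>w. f (Y w)) \<longleftrightarrow> integrable M (\<lambda>w. f (Z w))" "(LINT w|M. f (Y w)) = (LINT w|M. f (Z w))"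
proof -
  have "integrable M (\<lambda>w. f (W w)) \<longleftrightarrow> integrable (distr M borel W) f" "(LINT w|M. f (W w)) = (LINT x|distr M borel W. f x)"
    if [measurable]: "W \<in> borel_measurable M" for W
    by (simp_all add: integrable_distr_eq integral_distr)
  thus "integrable M (\<lambda>w. f (Y w)) \<longleftrightarrow> integrable M (\<lambda>w. f (Z w))" "(LINT w|M. f (Y w)) = (LINT w|M. f (Z w))"
    using eq by simp_all
qed

lemma inner_moment:
  "integrable M (\<lambda>w. \<bar>a \<bullet> X u w\<bar> powr (2 + \<delta>))"
  "(LINT w|M. \<bar>a \<bullet> X u w\<bar> powr (2 + \<delta>)) \<le> norm a powr (2 + \<delta>) * (LINT w|M. norm (X 0 w) powr (2 + \<delta>))"
proof -
  have le: "\<bar>a \<bullet> X 0 w\<bar> powr (2 + \<delta>) \<le> norm a powr (2 + \<delta>) * norm (X 0 w) powr (2 + \<delta>)" for w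
    unfolding powr_mult[symmetric]
    using \<delta>_pos by (intro powr_mono2 Cauchy_Schwarz_ineq2) auto
  have i0: "integrable M (\<lambda>w. \<bar>a \<bullet> X 0 w\<bar> powr (2 + \<delta>))"
    by (rule Bochner_Integration.integrable_bound[OF integrable_mult_right[OF X_moment, of "norm a powr (2 + \<delta>)"]])
      (use le in \<open>auto intro!: AE_I2\<close>)
  note tr = transfer_integral[of "\<lambda>x. \<bar>x\<bar> powr (2 + \<delta>)", OF _ _ _ law_eq[of a u]]
  show "integrable M (\<lambda>w. \<bar>a \<bullet> X u w\<bar> powr (2 + \<delta>))" using tr(1) i0 by simp
  have "(LINT w|M. \<bar>a \<bullet> X u w\<bar> powr (2 + \<delta>)) = (LINT w|M. \<bar>a \<bullet> X 0 w\<bar> powr (2 + \<delta>))" using tr(2) by simp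
  also have "\<dots> \<le> (LINT w|M. norm a powr (2 + \<delta>) * norm (X 0 w) powr (2 + \<delta>))"
    using i0 X_moment le by (intro integral_mono) auto
  finally show "(LINT w|M. \<bar>a \<bullet> X u w\<bar> powr (2 + \<delta>)) \<le> norm a powr (2 + \<delta>) * (LINT w|M. norm (X 0 w) powr (2 + \<delta>))"
    by simp
qed

lemma X0_integrable: "integrable M (X 0)"
proof (rule Bochner_Integration.integrable_bound)
  show "integrable M (\<lambda>w. 1 + norm (X 0 w) powr (2 + \<delta>))" using X_moment by simp
  show "AE w in M. norm (X 0 w) \<le> norm (1 + norm (X 0 w) powr (2 + \<delta>))"
  proof (rule AE_I2)
    fix w
    have "norm (X 0 w) \<le> 1 + norm (X 0 w) powr (2 + \<delta>)"
    proof (cases "norm (X 0 w) \<le> 1")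
      case False
      hence "norm (X 0 w) powr 1 \<le> norm (X 0 w) powr (2 + \<delta>)" using \<delta>_pos by (intro powr_mono) auto
      thus ?thesis by simp
    qed (simp add: add_increasing2)
    thus "norm (X 0 w) \<le> norm (1 + norm (X 0 w) powr (2 + \<delta>))" by simp
  qed
qed simp

lemma inner_integrable: "integrable M (\<lambda>w. a \<bullet> X u w)"
  and inner_mean: "(LINT w|M. a \<bullet> X u w) = 0"
  and inner_abs: "(LINT w|M. \<bar>a \<bullet> X u w\<bar>) = (LINT w|M. \<bar>a \<bullet> X 0 w\<bar>)"
proof -
  note tr = transfer_integral[of "\<lambda>x. x", OF _ _ _ law_eq[of a u]]
  have i0: "integrable M (\<lambda>w. a \<bullet> X 0 w)" using X0_integrable by simp
  show "integrable M (\<lambda>w. a \<bullet> X u w)" using tr(1) i0 by simp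
  have "(LINT w|M. a \<bullet> X u w) = (LINT w|M. a \<bullet> X 0 w)" using tr(2) by simp
  also have "\<dots> = a \<bullet> (LINT w|M. X 0 w)" using X0_integrable by (simp add: integral_inner_right)
  finally show "(LINT w|M. a \<bullet> X u w) = 0" by (simp add: X_mean)
  show "(LINT w|M. \<bar>a \<bullet> X u w\<bar>) = (LINT w|M. \<bar>a \<bullet> X 0 w\<bar>)"
    using transfer_integral(2)[of "\<lambda>x. \<bar>x\<bar>", OF _ _ _ law_eq[of a u]] by simp
qed

lemma X_integrable: "integrable M (X u)"
proof -
  have "integrable M (\<lambda>w. \<Sum>i\<in>UNIV. (X u w $ i) *\<^sub>R axis i (1::real))"
    using inner_integrable[of "axis _ 1" u] by (intro Bochner_Integration.integrable_sum integrable_scaleR_left) (simp add: inner_axis')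
  moreover have "X u w = (\<Sum>i\<in>UNIV. (X u w $ i) *\<^sub>R axis i (1::real))" for w
    by (simp add: basis_expansion[of "X u w", unfolded scalar_mult_eq_scaleR])
  ultimately show ?thesis by simp
qed

definition m1 :: real where "m1 = (\<Sum>i\<in>UNIV. LINT w|M. \<bar>axis i 1 \<bullet> X 0 w\<bar>)"

lemma X_norm_le: "(LINT w|M. norm (X u w)) \<le> m1"
proof -
  have "(LINT w|M. norm (X u w)) \<le> (LINT w|M. (\<Sum>i\<in>UNIV. \<bar>axis i 1 \<bullet> X u w\<bar>))"
  proof (rule integral_mono)
    show "integrable M (\<lambda>w. norm (X u w))" using X_integrable by (rule integrable_norm)
    show "integrable M (\<lambda>w. \<Sum>i\<in>UNIV. \<bar>axis i 1 \<bullet> X u w\<bar>)"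
      using inner_integrable by (intro Bochner_Integration.integrable_sum integrable_abs)
    show "norm (X u w) \<le> (\<Sum>i\<in>UNIV. \<bar>axis i 1 \<bullet> X u w\<bar>)" for w
      using norm_le_l1_cart[of "X u w"] by (simp add: inner_axis')
  qed
  also have "\<dots> = (\<Sum>i\<in>UNIV. LINT w|M. \<bar>axis i 1 \<bullet> X u w\<bar>)"
    using inner_integrable by (intro Bochner_Integration.integral_sum integrable_abs)
  also have "\<dots> = m1" unfolding m1_def by (intro sum.cong refl inner_abs)
  finally show ?thesis .
qed

lemma \<beta>_pos: "\<beta> > 0"
proof -
  have "0 < real CARD('m) * max 2 (1 + 1 / \<delta>)" by (intro mult_pos_pos) auto
  thus ?thesis using \<beta>_gt by linarith
qed

text \<open>The direction may depend on the site. With one direction at the origin and another one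
  elsewhere, the covariance bound for real fields covers cross-covariances.\<close>

lemma moment_field_inner:
  assumes A: "\<And>u. norm (A u) \<le> c"
  shows "\<exists>K'. moment_field M (\<lambda>u w. A u \<bullet> X u w) K' \<beta> \<delta> (c powr (2 + \<delta>) * (LINT w|M. norm (X 0 w) powr (2 + \<delta>)))"
proof -
  obtain K' where K': "K' \<ge> 0" "weakly_dependent M X (\<lambda>h. K' * (1 + real h) powr (- \<beta>))"
    using weakly_dependent_of_eta[OF X_measurable X_integrable X_norm_le eta \<beta>_pos] by blast
  have c: "c \<ge> 0" using A[of 0] norm_ge_zero order_trans by blast
  have "weakly_dependent M (\<lambda>u w. A u \<bullet> X u w) (\<lambda>h. c * (K' * (1 + real h) powr (- \<beta>)))"
  proof (rule weakly_dependent_compose[OF K'(2) c])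
    fix u and x y :: "real ^ 'n"
    have "norm (A u \<bullet> x - A u \<bullet> y) = \<bar>A u \<bullet> (x - y)\<bar>" by (simp add: inner_diff_right)
    also have "\<dots> \<le> norm (A u) * norm (x - y)" by (rule Cauchy_Schwarz_ineq2)
    also have "\<dots> \<le> c * norm (x - y)" using A by (intro mult_right_mono) auto
    finally show "norm (A u \<bullet> x - A u \<bullet> y) \<le> c * norm (x - y)" .
  qed
  hence wd: "weakly_dependent M (\<lambda>u w. A u \<bullet> X u w) (\<lambda>h. (c * K') * (1 + real h) powr (- \<beta>))"
    by (simp add: mult.assoc)
  have "moment_field M (\<lambda>u w. A u \<bullet> X u w) (c * K') \<beta> \<delta> (c powr (2 + \<delta>) * (LINT w|M. norm (X 0 w) powr (2 + \<delta>)))"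
  proof unfold_locales
    show "(\<lambda>w. A i \<bullet> X i w) \<in> borel_measurable M" for i by measurable
    show "(LINT w|M. A i \<bullet> X i w) = 0" for i by (rule inner_mean)
    show "integrable M (\<lambda>w. \<bar>A i \<bullet> X i w\<bar> powr (2 + \<delta>))" for i by (rule inner_moment)
    show "(LINT w|M. \<bar>A i \<bullet> X i w\<bar> powr (2 + \<delta>)) \<le> c powr (2 + \<delta>) * (LINT w|M. norm (X 0 w) powr (2 + \<delta>))" for i
    proof (rule order_trans[OF inner_moment(2)], rule mult_right_mono)
      show "norm (A i) powr (2 + \<delta>) \<le> c powr (2 + \<delta>)" using A \<delta>_pos by (intro powr_mono2) auto
    qed (rule Bochner_Integration.integral_nonneg, simp)
    show "0 \<le> c * K'" using c K'(1) by simp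
  qed (use \<delta>_pos \<beta>_gt wd in auto)
  thus ?thesis by blast
qed

definition cross_cov :: "real ^ 'n \<Rightarrow> real ^ 'n \<Rightarrow> int ^ 'm \<Rightarrow> real" where
  "cross_cov a b h = (LINT w|M. (a \<bullet> X 0 w) * (b \<bullet> X h w))"

lemma square_integrable: "integrable M (\<lambda>w. (a \<bullet> X u w)\<^sup>2)"
proof -
  obtain K' where "moment_field M (\<lambda>u w. a \<bullet> X u w) K' \<beta> \<delta> (norm a powr (2 + \<delta>) * (LINT w|M. norm (X 0 w) powr (2 + \<delta>)))"
    using moment_field_inner[of "\<lambda>_. a" "norm a"] by auto
  then interpret Z: moment_field M "\<lambda>u w. a \<bullet> X u w" K' \<beta> \<delta> "norm a powr (2 + \<delta>) * (LINT w|M. norm (X 0 w) powr (2 + \<delta>))" .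
  show ?thesis by (rule Z.Z_sq)
qed

lemma product_integrable: "integrable M (\<lambda>w. (a \<bullet> X u w) * (b \<bullet> X v w))"
  by (rule integrable_prod_of_squares) (auto intro: square_integrable)

text \<open>By polarisation the second moments of two-point linear combinations determine the covariances.\<close>

lemma covariance_eq: "(LINT w|M. (a \<bullet> X u w) * (b \<bullet> X v w)) = cross_cov a b (v - u)"
proof -
  have e: "2 * (LINT w|M. (a \<bullet> X u w) * (b \<bullet> X v w))
     = (LINT w|M. (a \<bullet> X u w + b \<bullet> X v w)\<^sup>2) - (LINT w|M. (a \<bullet> X 0 w)\<^sup>2) - (LINT w|M. (b \<bullet> X 0 w)\<^sup>2)" for u v
  proof -
    have "(LINT w|M. (a \<bullet> X u w + b \<bullet> X v w)\<^sup>2)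
       = (LINT w|M. (a \<bullet> X u w)\<^sup>2) + (LINT w|M. (b \<bullet> X v w)\<^sup>2) + 2 * (LINT w|M. (a \<bullet> X u w) * (b \<bullet> X v w))"
      using square_integrable product_integrable[of a u b v] by (simp add: power2_sum mult.assoc)
    moreover have sq: "(LINT w|M. (c \<bullet> X u w)\<^sup>2) = (LINT w|M. (c \<bullet> X 0 w)\<^sup>2)" for c u
      using transfer_integral(2)[of "\<lambda>x. x\<^sup>2", OF _ _ _ law_eq[of c u]] by simp
    ultimately show ?thesis using sq[of a u] sq[of b v] by linarith
  qed
  have "(LINT w|M. (a \<bullet> X u w + b \<bullet> X v w)\<^sup>2) = (LINT w|M. (a \<bullet> X 0 w + b \<bullet> X (v - u) w)\<^sup>2)"
    using transfer_integral(2)[of "\<lambda>x. x\<^sup>2", OF _ _ _ stationary[of a u b v "- u"]] by simp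
  thus ?thesis using e[of u v] e[of 0 "v - u"] by (simp add: cross_cov_def)
qed

lemma cross_cov_minus: "cross_cov a b (- h) = cross_cov b a h"
  using covariance_eq[of a h b 0] by (simp add: cross_cov_def mult.commute)

text \<open>The direction \<open>a\<close> is used at the origin and \<open>b\<close> at all other sites; the origin itself contributes
  one term.\<close>

lemma cross_cov_summable: "(\<lambda>h. \<bar>cross_cov a b h\<bar>) summable_on UNIV"
proof -
  define A where "A u = (if u = 0 then a else b)" for u :: "int ^ 'm"
  have "norm (A u) \<le> max (norm a) (norm b)" for u by (auto simp: A_def)
  from moment_field_inner[of A, OF this] obtain K' where
    "moment_field M (\<lambda>u w. A u \<bullet> X u w) K' \<beta> \<delta> (max (norm a) (norm b) powr (2 + \<delta>) * (LINT w|M. norm (X 0 w) powr (2 + \<delta>)))"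
    by blast
  then interpret Z: moment_field M "\<lambda>u w. A u \<bullet> X u w" K' \<beta> \<delta> "max (norm a) (norm b) powr (2 + \<delta>) * (LINT w|M. norm (X 0 w) powr (2 + \<delta>))" .
  define D where "D h = Z.C * (1 + real (norm_inf h)) powr (- Z.g)" for h :: "int ^ 'm"
  have D: "D summable_on UNIV"
    unfolding D_def by (intro summable_on_cmult_right summable_lattice_weight Z.g_gt)
  have le: "\<bar>cross_cov a b h\<bar> \<le> D h" if "h \<noteq> 0" for h
  proof -
    have "cross_cov a b h = cov M (\<lambda>w. A 0 \<bullet> X 0 w) (\<lambda>w. A h \<bullet> X h w)"
      using that by (simp add: cross_cov_def cov_def inner_mean A_def)
    thus ?thesis using Z.cov_lipschitz_le[of "\<lambda>x. x" "\<lambda>x. x" 0 h] by (simp add: D_def)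
  qed
  have "(\<lambda>h. \<bar>cross_cov a b h\<bar>) summable_on (UNIV - {0})"
    using le by (intro summable_on_comparison_test[OF summable_on_subset_banach[OF D]]) auto
  moreover have "(\<lambda>h. \<bar>cross_cov a b h\<bar>) summable_on {0}" by (rule summable_on_finite) simp
  ultimately have "(\<lambda>h. \<bar>cross_cov a b h\<bar>) summable_on ((UNIV - {0}) \<union> {0})" by (rule summable_on_union)
  thus ?thesis by simp
qed

definition limit_cov :: "real ^ 'n ^ 'n" where
  "limit_cov = (\<chi> i j. infsum (cross_cov (axis i 1) (axis j 1)) UNIV)"

lemma cov_matrix_entry: "cov_matrix M (X 0) (X u) $ i $ j = cross_cov (axis i 1) (axis j 1) u"
  using inner_mean[of "axis i 1" 0] inner_mean[of "axis j 1" u]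
  by (simp add: cov_matrix_def cov_def cross_cov_def inner_axis')

lemma cov_matrix_has_sum: "((\<lambda>u. cov_matrix M (X 0) (X u)) has_sum limit_cov) UNIV"
proof (rule has_sum_matrixI)
  fix i j
  have "cross_cov (axis i 1) (axis j 1) summable_on UNIV"
    by (rule abs_summable_summable) (use cross_cov_summable in simp)
  thus "((\<lambda>u. cov_matrix M (X 0) (X u) $ i $ j) has_sum limit_cov $ i $ j) UNIV"
    unfolding cov_matrix_entry limit_cov_def by (simp add: has_sum_infsum)
qed

lemma integral_outer_eq: "(LINT w|M. outer (X 0 w) (X u w)) = cov_matrix M (X 0) (X u)"
proof -
  have p: "integrable M (\<lambda>w. X 0 w $ i * X u w $ j)" for i j
    using product_integrable[of "axis i 1" 0 "axis j 1" u] by (simp add: inner_axis')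
  have "outer (X 0 w) (X u w) = (\<Sum>i\<in>UNIV. \<Sum>j\<in>UNIV. (X 0 w $ i * X u w $ j) *\<^sub>R axis i (axis j (1::real)))" for w
  proof -
    define c where "c i j = X 0 w $ i * X u w $ j" for i j
    have e: "(c i j *\<^sub>R axis i (axis j (1::real))) $ a $ b = (if i = a then if j = b then c i j else 0 else 0)" for i j a b
      by (simp add: axis_def)
    have "(\<Sum>i\<in>UNIV. \<Sum>j\<in>UNIV. c i j *\<^sub>R axis i (axis j (1::real))) $ a $ b = c a b" for a b
    proof -
      have "(\<Sum>j\<in>UNIV. if i = a then if j = b then c i j else 0 else 0) = (if i = a then c i b else 0)" for i
        by (cases "i = a") simp_all
      thus ?thesis unfolding sum_component e by simp
    qed
    thus ?thesis by (simp add: vec_eq_iff outer_def c_def)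
  qed
  hence i: "integrable M (\<lambda>w. outer (X 0 w) (X u w))"
    using p by (simp add: Bochner_Integration.integrable_sum)
  have "(LINT w|M. outer (X 0 w) (X u w)) $ i $ j = cov_matrix M (X 0) (X u) $ i $ j" for i j
  proof -
    have bl: "bounded_linear (\<lambda>A :: real ^ 'n ^ 'n. A $ i $ j)"
      by (intro bounded_linear_compose[OF bounded_linear_vec_nth bounded_linear_vec_nth])
    have "(LINT w|M. outer (X 0 w) (X u w)) $ i $ j = (LINT w|M. outer (X 0 w) (X u w) $ i $ j)"
      by (rule integral_bounded_linear[OF bl i, symmetric])
    thus ?thesis unfolding cov_matrix_entry by (simp add: outer_def cross_cov_def inner_axis')
  qed
  thus ?thesis by (simp add: vec_eq_iff)
qed

lemma quadratic_form_limit_cov: "a \<bullet> (limit_cov *v a) = infsum (cross_cov a a) UNIV"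
proof -
  have "linear (\<lambda>A :: real ^ 'n ^ 'n. a \<bullet> (A *v a))"
    by (rule linearI) (simp_all add: matrix_vector_mult_add_rdistrib inner_add_right scaleR_matrix_vector_assoc[symmetric])
  hence bl: "bounded_linear (\<lambda>A :: real ^ 'n ^ 'n. a \<bullet> (A *v a))" by (simp add: linear_conv_bounded_linear)
  have "a \<bullet> (cov_matrix M (X 0) (X u) *v a) = cross_cov a a u" for u
  proof -
    have p: "integrable M (\<lambda>w. X 0 w $ i * X u w $ j)" for i j
      using product_integrable[of "axis i 1" 0 "axis j 1" u] by (simp add: inner_axis')
    have "a \<bullet> (cov_matrix M (X 0) (X u) *v a) = (\<Sum>i\<in>UNIV. \<Sum>j\<in>UNIV. a $ i * (LINT w|M. X 0 w $ i * X u w $ j) * a $ j)"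
      unfolding inner_matrix_vector_sum cov_matrix_entry by (simp add: cross_cov_def inner_axis')
    also have "\<dots> = (LINT w|M. (\<Sum>i\<in>UNIV. \<Sum>j\<in>UNIV. a $ i * (X 0 w $ i * X u w $ j) * a $ j))"
      using p by (simp add: Bochner_Integration.integral_sum)
    also have "\<dots> = cross_cov a a u"
      unfolding cross_cov_def inner_vec_def sum_product by (simp add: mult_ac)
    finally show ?thesis .
  qed
  hence "(cross_cov a a has_sum a \<bullet> (limit_cov *v a)) UNIV"
    using has_sum_bounded_linear[OF bl cov_matrix_has_sum] by (simp add: o_def)
  thus ?thesis by (simp add: infsumI)
qed

text \<open>The Cramer-Wold device: the central limit theorem for the real fields \<open>a \<bullet> X u\<close> gives the
  pointwise limit of the characteristic functions of the normalised sums.\<close>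

theorem central_limit_theorem:
  fixes D :: "nat \<Rightarrow> (int ^ 'm) set"
  assumes D: "\<And>N. finite (D N)" "filterlim (\<lambda>N. card (D N)) at_top sequentially"
    and bd: "(\<lambda>N. real (card (lattice_boundary (D N))) / real (card (D N))) \<longlonglongrightarrow> 0"
  shows "pos_semidef limit_cov"
    "\<exists>\<mu>. normal_law 0 limit_cov \<mu> \<and>
       weak_conv_euclidean (\<lambda>N. distr M borel (\<lambda>w. (1 / sqrt (real (card (D N)))) *\<^sub>R (\<Sum>u\<in>D N. X u w))) \<mu>"
proof -
  have clt: "infsum (cross_cov a a) UNIV \<ge> 0"
    "(\<lambda>N. CLINT w|M. iexp ((\<Sum>u\<in>D N. a \<bullet> X u w) / sqrt (real (card (D N))))) \<longlonglongrightarrow> exp (- (infsum (cross_cov a a) UNIV / 2))" for a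
  proof -
    obtain K' where "moment_field M (\<lambda>u w. a \<bullet> X u w) K' \<beta> \<delta> (norm a powr (2 + \<delta>) * (LINT w|M. norm (X 0 w) powr (2 + \<delta>)))"
      using moment_field_inner[of "\<lambda>_. a" "norm a"] by auto
    then interpret Z: moment_field M "\<lambda>u w. a \<bullet> X u w" K' \<beta> \<delta> "norm a powr (2 + \<delta>) * (LINT w|M. norm (X 0 w) powr (2 + \<delta>))" .
    show "infsum (cross_cov a a) UNIV \<ge> 0"
      "(\<lambda>N. CLINT w|M. iexp ((\<Sum>u\<in>D N. a \<bullet> X u w) / sqrt (real (card (D N))))) \<longlonglongrightarrow> exp (- (infsum (cross_cov a a) UNIV / 2))"
      by (rule Z.char_clt[OF covariance_eq D bd])+
  qed
  show psd: "pos_semidef limit_cov" unfolding pos_semidef_def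
  proof (intro conjI allI)
    show "transpose limit_cov = limit_cov"
    proof -
      have "infsum (cross_cov (axis j 1) (axis i 1)) UNIV = infsum (cross_cov (axis i 1) (axis j 1)) UNIV" for i j
      proof -
        have "infsum (cross_cov (axis i 1) (axis j 1)) UNIV = infsum (\<lambda>h. cross_cov (axis i 1) (axis j 1) (- h)) UNIV"
        by (rule infsum_reindex_bij_witness[of _ uminus uminus]) auto
        thus ?thesis unfolding cross_cov_minus by simp
      qed
      thus ?thesis by (simp add: vec_eq_iff transpose_def limit_cov_def)
    qed
    show "0 \<le> x \<bullet> (limit_cov *v x)" for x unfolding quadratic_form_limit_cov by (rule clt(1))
  qed
  then obtain \<mu> where \<mu>: "normal_law 0 limit_cov \<mu>" using normal_law_exists by blast
  define S where "S N w = (1 / sqrt (real (card (D N)))) *\<^sub>R (\<Sum>u\<in>D N. X u w)" for N w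
  have [measurable]: "S N \<in> borel_measurable M" for N unfolding S_def by measurable
  have ch: "(\<lambda>N. CLINT x|distr M borel (S N). iexp (t \<bullet> x)) \<longlonglongrightarrow> (CLINT x|\<mu>. iexp (t \<bullet> x))" for t
  proof -
    have "(CLINT x|distr M borel (S N). iexp (t \<bullet> x)) = (CLINT w|M. iexp ((\<Sum>u\<in>D N. t \<bullet> X u w) / sqrt (real (card (D N)))))" for N
      by (subst integral_distr) (auto simp: S_def inner_sum_right)
    moreover have "(CLINT x|\<mu>. iexp (t \<bullet> x)) = exp (- (infsum (cross_cov t t) UNIV / 2))"
      using \<mu> unfolding normal_law_def quadratic_form_limit_cov by (simp add: exp_of_real[symmetric])
    ultimately show ?thesis using clt(2)[of t] by simp
  qed
  have "char_convergence (\<lambda>N. distr M borel (S N)) \<mu>"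
    by (rule char_convergence.intro)
      (use \<mu> ch in \<open>auto simp: normal_law_def intro!: prob_space_distr\<close>)
  from char_convergence.weak_convergence[OF this] \<mu>
  show "\<exists>\<mu>. normal_law 0 limit_cov \<mu> \<and>
       weak_conv_euclidean (\<lambda>N. distr M borel (\<lambda>w. (1 / sqrt (real (card (D N)))) *\<^sub>R (\<Sum>u\<in>D N. X u w))) \<mu>"
    unfolding S_def[abs_def] by blast
qed

end

theorem theorem3p21:
  fixes M :: "'w measure"
    and \<Lambda> :: "('s::polish_space \<times> (real ^ 'm::finite)) set \<Rightarrow> 'w \<Rightarrow> real ^ 'd::finite"
    and \<gamma> :: "real ^ 'd" and C :: "real ^ 'd ^ 'd" and \<nu> :: "(real ^ 'd) measure"
    and \<pi> :: "'s measure"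
    and f :: "'s \<times> (real ^ 'm) \<Rightarrow> real ^ 'd ^ 'n::finite"
    and X :: "int ^ 'm \<Rightarrow> 'w \<Rightarrow> real ^ 'n"
    and D :: "nat \<Rightarrow> (int ^ 'm) set"
    and \<delta> \<beta> :: real
  defines "\<Xi> \<equiv> (\<Sum>\<^sub>\<infinity>u\<in>UNIV. cov_matrix M (X 0) (X u))"
  assumes "levy_basis M \<Lambda> \<gamma> C \<nu> \<pi>"
    and "f \<in> borel_measurable borel"
    and "basis_integrable M \<Lambda> \<pi> f"
    and "mma_field M \<Lambda> \<pi> f X"
    and "(LINT w|M. X 0 w) = 0"
    and "\<delta> > 0"
    and "integrable M (\<lambda>w. norm (X 0 w) powr (2 + \<delta>))"
    and "\<exists>K::real. \<forall>\<^sub>F h in sequentially. eta_coeff M X h \<le> ennreal (K * real h powr (- \<beta>))"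
    and "\<beta> > real CARD('m) * max 2 (1 + 1 / \<delta>)"
    and "\<And>N. finite (D N)"
    and "filterlim (\<lambda>N. card (D N)) at_top sequentially"
    and "(\<lambda>N. real (card (lattice_boundary (D N))) / real (card (D N))) \<longlonglongrightarrow> 0"
  shows "(\<lambda>u. cov_matrix M (X 0) (X u)) summable_on UNIV
    \<and> ((\<lambda>u. LINT w|M. outer (X 0 w) (X u w)) has_sum \<Xi>) UNIV
    \<and> pos_semidef \<Xi>
    \<and> (\<exists>\<mu>. normal_law 0 \<Xi> \<mu> \<and>
          weak_conv_euclidean
            (\<lambda>N. distr M borel (\<lambda>w. (1 / sqrt (real (card (D N)))) *\<^sub>R (\<Sum>u\<in>D N. X u w))) \<mu>)"
proof -
  interpret L: levy_basis_space M \<Lambda> \<gamma> C \<nu> \<pi> by unfold_locales fact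
  obtain K where K: "\<forall>\<^sub>F h in sequentially. eta_coeff M X h \<le> ennreal (K * real h powr (- \<beta>))"
    using assms(9) by blast
  interpret stationary_field M X K \<beta> \<delta>
    by unfold_locales (fact L.mma_field_stationary[OF assms(5)] assms(6-8) K assms(10))+
  have \<Xi>: "\<Xi> = limit_cov" unfolding \<Xi>_def by (rule infsumI[OF cov_matrix_has_sum])
  have "(\<lambda>u. cov_matrix M (X 0) (X u)) summable_on UNIV"
    using cov_matrix_has_sum by (rule has_sum_imp_summable)
  moreover have "((\<lambda>u. LINT w|M. outer (X 0 w) (X u w)) has_sum \<Xi>) UNIV"
    unfolding integral_outer_eq \<Xi> by (rule cov_matrix_has_sum)
  ultimately show ?thesis
    unfolding \<Xi> using central_limit_theorem[OF assms(11-13)] by blast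
qed

end
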